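(* Assume the standing setting below, with $m\ge1$, and assume that hypotheses $(h_1)$, $(h_2)$, $(h_3)$ hold and $\alpha_i>0$ for $i=1,\ldots,m$. Suppose moreover that $$\alpha_i g_0^i<\lambda_0\quad\text{and}\quad \alpha_i g_\infty^i>\lambda_1^i\qquad\text{for all } i=1,\ldots,m.$$ Then there exists $\beta^{*}>0$ such that, if $\beta_j>\beta^{*}$ for all $j=0,\ldots,m+1$, the boundary value problem (SL) has at least $2^{m}-1$ positive solutions.
   Context: Standing setting. Fix $L>0$ and $\alpha,\beta,\gamma,\delta\ge0$ with $\gamma\beta+\alpha\gamma+\alpha\delta>0$. Let $m\ge1$ be an integer, $\alpha_i>0$ ($i=1,\ldots,m$), $\beta_j>0$ ($j=0,\ldots,m+1$), let $a_i,b_j\colon[0,L]\to[0,+\infty)$ be Lebesgue integrable, and $g_i,k_j\colon[0,+\infty)\to[0,+\infty)$ continuous. Define $$f(x,s)=\sum_{i=1}^{m}\alpha_i a_i(x)g_i(s)-\sum_{j=0}^{m+1}\beta_j b_j(x)k_j(s).$$ Problem (SL): $u''+f(x,u)=0$ on $[0,L]$, $\alpha u(0)-\beta u'(0)=0$, $\gamma u(L)+\delta u'(L)=0$. A solution is $u\colon[0,L]\to[0,+\infty)$ with $u,u'$ absolutely continuous, satisfying the equation a.e. and the boundary conditions; it is positive if $u(x)>0$ for all $x\in\,]0,L[$. $(h_1)$: there are points $0=\tau_0\le\sigma_1<\tau_1<\sigma_2<\tau_2<\cdots<\sigma_m<\tau_m\le\sigma_{m+1}=L$; set $I_i=[\sigma_i,\tau_i]$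 ($i=1,\ldots,m$) and $J_j=[\tau_j,\sigma_{j+1}]$ ($j=0,\ldots,m+1$; $J_0$ and $J_{m+1}$ may reduce to a point/be empty). For each $i$, $a_i$ is not a.e. zero on $I_i$ and $a_i=0$ a.e. on $[0,L]\setminus I_i$; for each $j$, $b_j=0$ a.e. on $[0,L]\setminus J_j$, and whenever $\tau_j<\sigma_{j+1}$, $b_j$ is not a.e. zero on $[\tau_j,\tau_j+\varepsilon]$ nor on $[\sigma_{j+1}-\varepsilon,\sigma_{j+1}]$ for any $\varepsilon>0$. $(h_2)$: $g_i(0)=0$, $g_i(s)>0$ for $s>0$ ($i=1,\ldots,m$); $k_j(0)=0$, $k_j(s)>0$ for $s>0$ ($j=0,\ldots,m+1$). Notation: $g_0^i=\limsup_{s\to0^+}g_i(s)/s$, $g_\infty^i=\liminf_{s\to+\infty}g_i(s)/s$, $k_0^j=\limsup_{s\to0^+}k_j(s)/s$. $(h_3)$: $g_0^i<+\infty$, $g_\infty^i>0$ for all $i$, and $k_0^j<+\infty$ for all $j$. $\lambda_0>0$ denotes the first (smallest positive) eigenvalue of $\varphi''+\lambda\bigl[\sum_{i=1}^m a_i(x)\bigr]\varphi=0$, $\alpha\varphi(0)-\beta\varphi'(0)=0$, $\gamma\varphi(L)+\delta\varphi'(L)=0$. For $i=1,\ldots,m$, $\lambda_1^i>0$ denotes the first eigenvalue of $\varphi''+\lambda a_i(x)\varphi=0$ on $I_i$ with $\varphi(\sigma_i)=\varphi(\tau_i)=0$, except that if $\sigma_1=0$ the condition at $\sigma_1$ for $i=1$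 is replaced by $\alpha\varphi(0)-\beta\varphi'(0)=0$, and if $\tau_m=L$ the condition at $\tau_m$ for $i=m$ is replaced by $\gamma\varphi(L)+\delta\varphi'(L)=0$. *)

theory Defs
  imports "HOL-Analysis.Analysis"
begin

definition abs_cont_on :: "real \<Rightarrow> real \<Rightarrow> (real \<Rightarrow> real) \<Rightarrow> bool" where
  "abs_cont_on p q f \<longleftrightarrow>
     (\<forall>e>0. \<exists>d>0. \<forall>(n::nat) (a::nat \<Rightarrow> real) (b::nat \<Rightarrow> real).
        (\<forall>k<n. p \<le> a k \<and> a k \<le> b k \<and> b k \<le> q) \<and>
        (\<forall>k<n. \<forall>l<n. k \<noteq> l \<longrightarrow> b k \<le> a l \<or> b l \<le> a k) \<and>
        (\<Sum>k<n. b k - a k) < d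
        \<longrightarrow> (\<Sum>k<n. \<bar>f (b k) - f (a k)\<bar>) < e)"

definition f_SL :: "nat \<Rightarrow> (nat \<Rightarrow> real) \<Rightarrow> (nat \<Rightarrow> real \<Rightarrow> real) \<Rightarrow> (nat \<Rightarrow> real \<Rightarrow> real)
    \<Rightarrow> (nat \<Rightarrow> real) \<Rightarrow> (nat \<Rightarrow> real \<Rightarrow> real) \<Rightarrow> (nat \<Rightarrow> real \<Rightarrow> real) \<Rightarrow> real \<Rightarrow> real \<Rightarrow> real" where
  "f_SL m alp a g bet b k x s =
     (\<Sum>i=1..m. alp i * a i x * g i s) - (\<Sum>j=0..m+1. bet j * b j x * k j s)"

definition SL_solution :: "real \<Rightarrow> real \<Rightarrow> real \<Rightarrow> real \<Rightarrow> real \<Rightarrow> (real \<Rightarrow> real \<Rightarrow> real)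
    \<Rightarrow> (real \<Rightarrow> real) \<Rightarrow> bool" where
  "SL_solution L al be ga de f u \<longleftrightarrow>
     (\<forall>x\<in>{0..L}. u x \<ge> 0) \<and>
     (\<exists>u'. abs_cont_on 0 L u \<and> abs_cont_on 0 L u' \<and>
        (\<forall>x\<in>{0..L}. (u has_real_derivative u' x) (at x within {0..L})) \<and>
        (AE x in lebesgue. x \<in> {0..L} \<longrightarrow>
            (u' has_real_derivative (- f x (u x))) (at x within {0..L})) \<and>
        al * u 0 - be * u' 0 = 0 \<and> ga * u L + de * u' L = 0)"

definition SL_positive_solution :: "real \<Rightarrow> real \<Rightarrow> real \<Rightarrow> real \<Rightarrow> real \<Rightarrow> (real \<Rightarrow> real \<Rightarrow> real)
    \<Rightarrow> (real \<Rightarrow> real) \<Rightarrow> bool" where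
  "SL_positive_solution L al be ga de f u \<longleftrightarrow>
     SL_solution L al be ga de f u \<and> (\<forall>x\<in>{0<..<L}. u x > 0)"

definition SL_eigenvalue :: "real \<Rightarrow> real \<Rightarrow> (real \<Rightarrow> real) \<Rightarrow> real \<Rightarrow> real \<Rightarrow> real \<Rightarrow> real
    \<Rightarrow> real \<Rightarrow> bool" where
  "SL_eigenvalue p q w c1 c2 c3 c4 lam \<longleftrightarrow>
     (\<exists>\<phi> \<phi>'. abs_cont_on p q \<phi> \<and> abs_cont_on p q \<phi>' \<and>
        (\<forall>x\<in>{p..q}. (\<phi> has_real_derivative \<phi>' x) (at x within {p..q})) \<and>
        (AE x in lebesgue. x \<in> {p..q} \<longrightarrow>
            (\<phi>' has_real_derivative (- lam * w x * \<phi> x)) (at x within {p..q})) \<and>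
        c1 * \<phi> p - c2 * \<phi>' p = 0 \<and> c3 * \<phi> q + c4 * \<phi>' q = 0 \<and>
        (\<exists>x\<in>{p..q}. \<phi> x \<noteq> 0))"

definition first_eigenvalue :: "real \<Rightarrow> real \<Rightarrow> (real \<Rightarrow> real) \<Rightarrow> real \<Rightarrow> real \<Rightarrow> real \<Rightarrow> real
    \<Rightarrow> real" where
  "first_eigenvalue p q w c1 c2 c3 c4 =
     (LEAST lam. lam > 0 \<and> SL_eigenvalue p q w c1 c2 c3 c4 lam)"

end

theory Submission
  imports Defs "HOL-Complex_Analysis.Great_Picard"
begin

text \<open>Shoot from the left boundary condition and extend the nonlinearity by zero to negative values, so
  that a trajectory that becomes negative stays negative and misses the right boundary condition. Two
  facts drive the argument. A trajectory that is too high on a hump \<open>I\<^sub>i\<close> dies there, because the principal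
  eigenvalue of the hump lies below \<open>\<alpha>\<^sub>i g\<^sub>\<infinity>\<^sup>i\<close>. A trajectory whose maximum on \<open>I\<^sub>i\<close> equals a fixed small \<open>r\<close> comes
  out of the following gap arbitrarily high when the \<open>\<beta>\<^sub>j\<close> are large: by comparison with a positive
  supersolution at a level just below \<open>\<lambda>\<^sub>0\<close> its Wronskian gains a definite amount on \<open>I\<^sub>i\<close>, so the
  trajectory cannot decay in the gap, and strong absorption makes it blow up. Hence, for each
  nonempty set of humps, first and last crossing arguments along the shooting parameter, hump by hump,
  produce a solution exceeding \<open>r\<close> exactly on those humps, which yields \<open>2\<^sup>m - 1\<close> solutions using only
  the intermediate value theorem. This works for Lipschitz nonlinearities; continuous ones are
  approximated by inf-convolutions, with Arzela-Ascoli providing the limit, and the solutions stay distinct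
  because no solution has maximum exactly \<open>r\<close> on a hump.\<close>

section \<open>Absolute continuity and indefinite Lebesgue integrals\<close>

text \<open>Two difficulties determine the constants. The comparison on a hump needs a Wronskian of
  known sign on entry, but the trajectory may have passed an earlier large hump, where no comparison
  holds. Absorption is therefore used twice: before the hump it forces arrival almost at rest near
  zero, so that the Wronskian starts above \<open>- e\<close>; after the hump it produces the
  blow-up. For the first hump the left boundary condition takes over the former role. The level
  \<open>lam\<close> lies strictly between the growth bound \<open>c\<close> near zero and the
  eigenvalue \<open>lam0\<close>: \<open>lam - c\<close> pays for the gain, and
  \<open>lam < lam0\<close> allows a comparison function bounded away from zero on the closed
  interval, which an eigenfunction vanishing at an end is not. Secondly, the threshold for the
  \<beta>'s must be fixed before the approximation index. Every constant is thus drawn from data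
  shared by all approximations: growth bounds at zero and infinity, and the envelope
  \<open>inf_conv (k j) 1\<close> lying below all of them. The empty set of humps is left out
  because its path would start at the trivial shot, where the boundary value has no strict
  sign.\<close>

lemma AE_imp_negligible:
  fixes P :: "real \<Rightarrow> bool"
  assumes "AE x in lebesgue. P x"
  shows "negligible {x. \<not> P x}"
  using assms by (auto simp: eventually_ae_filter negligible_iff_null_sets intro: null_sets_completion_subset)

lemma negligible_imp_AE:
  fixes P :: "real \<Rightarrow> bool"
  assumes "negligible N" "\<And>x. x \<notin> N \<Longrightarrow> P x"
  shows "AE x in lebesgue. P x"
  using assms by (intro AE_I'[of N]) (auto simp: negligible_iff_null_sets)

lemma negligible_open_cover:
  fixes N :: "real set"
  assumes "negligible N" "d > 0"
  obtains T where "open T" "N \<subseteq> T" "T \<in> lmeasurable" "measure lebesgue T < d"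
proof -
  have "N \<in> sets lebesgue" by (rule negligible_imp_sets[OF assms(1)])
  then obtain T where T: "open T" "N \<subseteq> T" "T - N \<in> lmeasurable" "emeasure lebesgue (T - N) < ennreal d"
    using sets_lebesgue_outer_open assms(2) by blast
  have "T = (T - N) \<union> N" using T(2) by auto
  then have 1: "T \<in> lmeasurable"
    using fmeasurable.Un[OF T(3) negligible_imp_measurable[OF assms(1)]] by simp
  have "measure lebesgue (T - N) = measure lebesgue T"
    by (rule measure_Diff_null_set) (use assms(1) 1 in \<open>auto simp: negligible_iff_null_sets\<close>)
  moreover have "measure lebesgue (T - N) < d"
    using T(4) emeasure_eq_measure2[OF T(3)] assms(2) by (simp add: ennreal_less_iff)
  ultimately show ?thesis using that T(1,2) 1 by auto
qed

text \<open>Gauge-integral form of the fundamental theorem: the exceptional null set is covered by an open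
  set of small measure, on which absolute continuity controls the increments.\<close>

theorem abs_cont_on_has_integral:
  fixes h f :: "real \<Rightarrow> real"
  assumes pq: "p \<le> q" and ac: "abs_cont_on p q h"
    and der: "AE x in lebesgue. x \<in> {p..q} \<longrightarrow> (h has_real_derivative f x) (at x within {p..q})"
  shows "(f has_integral (h q - h p)) {p..q}"
proof -
  define N where "N = {x. \<not> (x \<in> {p..q} \<longrightarrow> (h has_real_derivative f x) (at x within {p..q}))}"
  have N: "negligible N" unfolding N_def by (rule AE_imp_negligible[OF der])
  \<comment> \<open>Nothing is known of \<open>f\<close> on \<open>N\<close>. With the value 0
    there, a cell tagged in \<open>N\<close> contributes only its increment of \<open>h\<close>,
    which absolute continuity makes small.\<close>
  define f0 where "f0 = (\<lambda>x. if x \<in> N then 0 else f x)"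
  show ?thesis
  proof (cases "p = q")
    case True then show ?thesis using has_integral_refl(2)[of f p] by simp
  next
  case False
  with pq have pq': "p < q" by simp
  have "(f0 has_integral (h q - h p)) (cbox p q)"
    unfolding has_integral_factor_content
  proof (intro allI impI)
    fix e :: real assume e: "0 < e"
    show "\<exists>d. gauge d \<and> (\<forall>D. D tagged_division_of cbox p q \<and> d fine D \<longrightarrow>
        norm ((\<Sum>(x,K)\<in>D. measure lborel K *\<^sub>R f0 x) - (h q - h p)) \<le> e * measure lborel (cbox p q))"
    proof -
      \<comment> \<open>Half of the error is reserved for the cells tagged in \<open>N\<close>; the
        other half comes from the factor \<open>e/2\<close> in the differentiability
        estimate.\<close>
      define e1 where "e1 = e * (q - p) / 2"
      have e1: "e1 > 0" using e pq' by (simp add: e1_def)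
      obtain d where d: "d > 0" "\<forall>(n::nat) (a::nat \<Rightarrow> real) (b::nat \<Rightarrow> real).
        (\<forall>k<n. p \<le> a k \<and> a k \<le> b k \<and> b k \<le> q) \<and>
        (\<forall>k<n. \<forall>l<n. k \<noteq> l \<longrightarrow> b k \<le> a l \<or> b l \<le> a k) \<and>
        (\<Sum>k<n. b k - a k) < d \<longrightarrow> (\<Sum>k<n. \<bar>h (b k) - h (a k)\<bar>) < e1"
        using ac e1 unfolding abs_cont_on_def by blast
      obtain T where T: "open T" "N \<subseteq> T" "T \<in> lmeasurable" "measure lebesgue T < d"
        using negligible_open_cover[OF N d(1)] .
      have "\<exists>r>0. if x \<in> N then ball x r \<subseteq> T else
          (x \<in> {p..q} \<longrightarrow> (\<forall>y\<in>{p..q}. \<bar>y - x\<bar> < r \<longrightarrow> \<bar>h y - h x - f x * (y - x)\<bar> \<le> e/2 * \<bar>y - x\<bar>))" for x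
      proof (cases "x \<in> N")
        case True then show ?thesis using T by (meson openE subsetD)
      next
        case False
        show ?thesis
        proof (cases "x \<in> {p..q}")
          case True
          then have "(h has_derivative (*) (f x)) (at x within {p..q})"
            using False by (simp add: N_def has_field_derivative_def)
          then obtain r where "r > 0" "\<forall>y\<in>{p..q}. norm (y - x) < r \<longrightarrow> norm (h y - h x - f x * (y - x)) \<le> e/2 * norm (y - x)"
            unfolding has_derivative_within_alt using e by (meson half_gt_zero)
          then show ?thesis using False by auto
        qed (auto simp: False intro: exI[of _ 1])
      qed
      then have "\<exists>r. \<forall>x. r x > 0 \<and> (if x \<in> N then ball x (r x) \<subseteq> T else
          (x \<in> {p..q} \<longrightarrow> (\<forall>y\<in>{p..q}. \<bar>y - x\<bar> < r x \<longrightarrow> \<bar>h y - h x - f x * (y - x)\<bar> \<le> e/2 * \<bar>y - x\<bar>)))"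
        by (intro choice allI)
      then obtain r where r0: "\<forall>x. r x > 0 \<and> (if x \<in> N then ball x (r x) \<subseteq> T else
          (x \<in> {p..q} \<longrightarrow> (\<forall>y\<in>{p..q}. \<bar>y - x\<bar> < r x \<longrightarrow> \<bar>h y - h x - f x * (y - x)\<bar> \<le> e/2 * \<bar>y - x\<bar>)))"
        by blast
      have r: "r x > 0" "x \<in> N \<Longrightarrow> ball x (r x) \<subseteq> T"
        "x \<notin> N \<Longrightarrow> x \<in> {p..q} \<Longrightarrow> y \<in> {p..q} \<Longrightarrow> \<bar>y - x\<bar> < r x \<Longrightarrow>
           \<bar>h y - h x - f x * (y - x)\<bar> \<le> e/2 * \<bar>y - x\<bar>" for x y
        using spec[OF r0, of x] by auto
      define g where "g x = ball x (r x)" for x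
      have gg: "gauge g" unfolding g_def using r(1) by (intro gauge_ball_dependent) auto
      have "norm ((\<Sum>(x,K)\<in>D. measure lborel K *\<^sub>R f0 x) - (h q - h p)) \<le> e * measure lborel (cbox p q)"
        if D: "D tagged_division_of cbox p q" and fine: "g fine D" for D
      proof -
        define \<delta> where "\<delta> K = h (Sup K) - h (Inf K)" for K :: "real set"
        have finD: "finite D" using D by blast
        have K: "\<exists>a b. K = {a..b} \<and> p \<le> a \<and> a \<le> x \<and> x \<le> b \<and> b \<le> q \<and> K \<subseteq> g x" if xK: "(x, K) \<in> D" for x K
        proof -
          obtain a b where ab: "K = cbox a b" using tagged_division_ofD(4)[OF D xK] by blast
          have "x \<in> K" "K \<subseteq> cbox p q" using tagged_division_ofD(2,3)[OF D that] by auto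
          moreover have "K \<subseteq> g x" using fine that by blast
          ultimately show ?thesis using ab by auto
        qed
        have tel: "(\<Sum>(x,K)\<in>D. \<delta> K) = h q - h p"
          unfolding \<delta>_def using additive_tagged_division_1[OF pq, of D h] D by simp
        have "(\<Sum>(x,K)\<in>D. measure lborel K *\<^sub>R f0 x) - (h q - h p) = (\<Sum>(x,K)\<in>D. measure lborel K *\<^sub>R f0 x - \<delta> K)"
          by (simp add: tel[symmetric] sum_subtractf split_def)
        also have "norm \<dots> \<le> (\<Sum>(x,K)\<in>D. \<bar>measure lborel K *\<^sub>R f0 x - \<delta> K\<bar>)"
          unfolding split_def real_norm_def by (rule sum_abs)
        also have "\<dots> = (\<Sum>(x,K)\<in>{z\<in>D. fst z \<notin> N}. \<bar>measure lborel K *\<^sub>R f0 x - \<delta> K\<bar>)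
             + (\<Sum>(x,K)\<in>{z\<in>D. fst z \<in> N}. \<bar>measure lborel K *\<^sub>R f0 x - \<delta> K\<bar>)"
        proof -
          have "D = {z\<in>D. fst z \<notin> N} \<union> {z\<in>D. fst z \<in> N}" by auto
          moreover have "finite {z\<in>D. fst z \<notin> N}" "finite {z\<in>D. fst z \<in> N}" using finD by auto
          moreover have "{z\<in>D. fst z \<notin> N} \<inter> {z\<in>D. fst z \<in> N} = {}" by auto
          ultimately show ?thesis by (metis (lifting) sum.union_disjoint)
        qed
        also have "(\<Sum>(x,K)\<in>{z\<in>D. fst z \<notin> N}. \<bar>measure lborel K *\<^sub>R f0 x - \<delta> K\<bar>)
             \<le> (\<Sum>(x,K)\<in>{z\<in>D. fst z \<notin> N}. e/2 * measure lborel K)"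
        proof (rule sum_mono, clarify)
          fix x K assume xK: "(x,K) \<in> D" "fst (x,K) \<notin> N"
          obtain a b where ab: "K = {a..b}" "p \<le> a" "a \<le> x" "x \<le> b" "b \<le> q" "K \<subseteq> g x"
            using K[OF xK(1)] by blast
          have "\<bar>b - x\<bar> < r x" "\<bar>a - x\<bar> < r x"
            using ab(3,4) subsetD[OF ab(6), of a] subsetD[OF ab(6), of b]
            by (auto simp: g_def ab(1) dist_real_def)
          \<comment> \<open>Straddle estimate: the tag lies inside the cell, so the first-order
            errors at the two ends add up to \<open>e/2\<close> times its length.\<close>
          then have "\<bar>h b - h x - f x * (b - x)\<bar> \<le> e/2 * \<bar>b - x\<bar>" "\<bar>h a - h x - f x * (a - x)\<bar> \<le> e/2 * \<bar>a - x\<bar>"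
            using r(3)[of x b] r(3)[of x a] xK ab by auto
          moreover have "(b - a) * f x - (h b - h a) = (h a - h x - f x * (a - x)) - (h b - h x - f x * (b - x))"
            by (simp add: algebra_simps)
          moreover have "e/2 * \<bar>b - x\<bar> + e/2 * \<bar>a - x\<bar> = e/2 * (b - a)"
            using ab by (simp add: field_simps)
          ultimately have "\<bar>(b - a) * f x - (h b - h a)\<bar> \<le> e/2 * (b - a)"
            by linarith
          then show "\<bar>measure lborel K *\<^sub>R f0 x - \<delta> K\<bar> \<le> e/2 * measure lborel K"
            using ab xK by (simp add: \<delta>_def f0_def)
        qed
        also have "(\<Sum>(x,K)\<in>{z\<in>D. fst z \<notin> N}. e/2 * measure lborel K) \<le> (\<Sum>(x,K)\<in>D. e/2 * measure lborel K)"
          by (rule sum_mono2) (use finD e in auto)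
        also have "\<dots> = e/2 * (q - p)"
          using additive_content_tagged_division[OF D] pq
          by (simp add: sum_distrib_left[symmetric] split_def sum_divide_distrib[symmetric] del: times_divide_eq_left)
        also have "(\<Sum>(x,K)\<in>{z\<in>D. fst z \<in> N}. \<bar>measure lborel K *\<^sub>R f0 x - \<delta> K\<bar>) \<le> e1"
        proof -
          define E where "E = {z\<in>D. fst z \<in> N}"
          have finE: "finite E" using finD by (simp add: E_def)
          obtain n and z :: "nat \<Rightarrow> real \<times> real set" where z: "bij_betw z {..<n} E"
            using ex_bij_betw_nat_finite[OF finE] by (metis atLeast0LessThan)
          define a where "a k = Inf (snd (z k))" for k
          define b where "b k = Sup (snd (z k))" for k
          have zE: "z k \<in> D" "fst (z k) \<in> N" if "k < n" for k
            using bij_betwE[OF z] that by (auto simp: E_def)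
          have zk: "snd (z k) = {a k..b k}" "p \<le> a k" "a k \<le> fst (z k)" "fst (z k) \<le> b k" "b k \<le> q" "{a k..b k} \<subseteq> g (fst (z k))"
            if kn: "k < n" for k
          proof -
            obtain a' b' where "snd (z k) = {a'..b'} \<and> p \<le> a' \<and> a' \<le> fst (z k) \<and> fst (z k) \<le> b' \<and> b' \<le> q \<and> snd (z k) \<subseteq> g (fst (z k))"
              using K[of "fst (z k)" "snd (z k)"] zE[OF kn] by auto
            then show "snd (z k) = {a k..b k}" "p \<le> a k" "a k \<le> fst (z k)" "fst (z k) \<le> b k" "b k \<le> q" "{a k..b k} \<subseteq> g (fst (z k))"
              by (auto simp: a_def b_def)
          qed
          have dis: "{a k<..<b k} \<inter> {a l<..<b l} = {}" if "k < n" "l < n" "k \<noteq> l" for k l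
          proof -
            have "z k \<noteq> z l" using z that by (auto simp: bij_betw_def inj_on_def)
            then have "interior (snd (z k)) \<inter> interior (snd (z l)) = {}"
              using tagged_division_ofD(5)[OF D] zE that by (metis prod.collapse)
            then show ?thesis using zk that by (simp add: interior_atLeastAtMost_real)
          qed
          have ord: "b k \<le> a l \<or> b l \<le> a k \<or> a k = b k \<or> a l = b l" if "k < n" "l < n" "k \<noteq> l" for k l
          proof (rule ccontr)
            assume "\<not> ?thesis"
            then have c: "a l < b k" "a k < b l" "a k < b k" "a l < b l"
              using zk[OF that(1)] zk[OF that(2)] by auto
            then have "max (a k) (a l) < min (b k) (b l)" by simp
            then obtain w where "max (a k) (a l) < w" "w < min (b k) (b l)" using dense by blast
            then have "w \<in> {a k<..<b k} \<inter> {a l<..<b l}" by simp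
            then show False using dis[OF that] by blast
          qed
          define b' where "b' k = b k" for k
          define I where "I = {k. k < n \<and> a k < b k}"
          have finI: "finite I" by (simp add: I_def)
          obtain m and s :: "nat \<Rightarrow> nat" where s: "bij_betw s {..<m} I"
            using ex_bij_betw_nat_finite[OF finI] by (metis atLeast0LessThan)
          have sI: "s j < n" "a (s j) < b (s j)" if "j < m" for j
            using bij_betwE[OF s] that by (auto simp: I_def)
          have sinj: "s j \<noteq> s l" if "j < m" "l < m" "j \<noteq> l" for j l
            using s that by (auto simp: bij_betw_def inj_on_def)
          have tot: "(\<Sum>j<m. b (s j) - a (s j)) < d"
          proof -
            have "(\<Sum>j<m. b (s j) - a (s j)) = (\<Sum>j<m. measure lebesgue {a (s j)<..<b (s j)})"
              by (intro sum.cong) (use sI in \<open>auto intro!: measure_lborel_Ioo[symmetric] simp: less_imp_le\<close>)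
            also have "\<dots> = measure lebesgue (\<Union>j<m. {a (s j)<..<b (s j)})"
              by (rule measure_UNION'[symmetric])
                (use dis sI sinj in \<open>auto simp: pairwise_def disjnt_def\<close>)
            also have "\<dots> \<le> measure lebesgue T"
            proof (rule measure_mono_fmeasurable)
              show "(\<Union>j<m. {a (s j)<..<b (s j)}) \<subseteq> T"
              proof clarify
                fix x j assume "j < m" "x \<in> {a (s j)<..<b (s j)}"
                then have "x \<in> g (fst (z (s j)))" using zk(6)[of "s j"] sI[of j] by auto
                then show "x \<in> T" using r(2)[OF zE(2)[OF sI(1)[OF \<open>j < m\<close>]]] by (auto simp: g_def)
              qed
            qed (use T in auto)
            finally show ?thesis using T by simp
          qed
          have key: "(\<Sum>j<m. \<bar>h (b (s j)) - h (a (s j))\<bar>) < e1"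
          proof (rule d(2)[rule_format, of m "\<lambda>j. a (s j)" "\<lambda>j. b (s j)"], intro conjI)
            show "\<forall>k<m. p \<le> a (s k) \<and> a (s k) \<le> b (s k) \<and> b (s k) \<le> q"
              using zk sI by (meson less_imp_le)
            show "\<forall>k<m. \<forall>l<m. k \<noteq> l \<longrightarrow> b (s k) \<le> a (s l) \<or> b (s l) \<le> a (s k)"
            proof (intro allI impI)
              fix k l assume "k < m" "l < m" "k \<noteq> l"
              then show "b (s k) \<le> a (s l) \<or> b (s l) \<le> a (s k)"
                using ord[of "s k" "s l"] sI[of k] sI[of l] sinj[of k l] by auto
            qed
          qed (rule tot)
          have "(\<Sum>(x,K)\<in>E. \<bar>measure lborel K *\<^sub>R f0 x - \<delta> K\<bar>) = (\<Sum>(x,K)\<in>E. \<bar>\<delta> K\<bar>)"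
            by (rule sum.cong) (auto simp: E_def f0_def)
          also have "\<dots> = (\<Sum>k<n. \<bar>\<delta> (snd (z k))\<bar>)"
            by (subst sum.reindex_bij_betw[OF z, symmetric]) (simp add: split_def)
          also have "\<dots> = (\<Sum>k<n. \<bar>h (b k) - h (a k)\<bar>)" by (simp add: \<delta>_def a_def b_def)
          also have "\<dots> = (\<Sum>k\<in>I. \<bar>h (b k) - h (a k)\<bar>)"
          proof (rule sum.mono_neutral_right)
            show "\<forall>i\<in>{..<n} - I. \<bar>h (b i) - h (a i)\<bar> = 0"
            proof
              fix i assume "i \<in> {..<n} - I"
              then have "a i = b i" using zk[of i] by (auto simp: I_def)
              then show "\<bar>h (b i) - h (a i)\<bar> = 0" by simp
            qed
          qed (auto simp: I_def)
          also have "\<dots> = (\<Sum>j<m. \<bar>h (b (s j)) - h (a (s j))\<bar>)"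
            by (subst sum.reindex_bij_betw[OF s, symmetric]) simp
          finally show ?thesis using key by (simp add: E_def)
        qed
        finally show ?thesis using pq by (simp add: e1_def)
      qed
      then show ?thesis using gg by blast
    qed
  qed
  then have "(f0 has_integral (h q - h p)) {p..q}" by simp
  then show ?thesis
    by (rule has_integral_spike[OF N, rotated]) (auto simp: f0_def)
  qed
qed

text \<open>Dominated convergence as \<open>n\<close> grows. It splits an integrable function into a
  part bounded by \<open>n\<close> and an excess of small integral, which is how estimates for
  bounded coefficients are carried over to coefficients that are merely integrable.\<close>

lemma integral_truncation_small:
  fixes f :: "real \<Rightarrow> real"
  assumes f: "f absolutely_integrable_on {p..q}" and e: "e > 0"
  obtains n :: nat where "(\<lambda>x. max 0 (\<bar>f x\<bar> - real n)) integrable_on {p..q}"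
    "integral {p..q} (\<lambda>x. max 0 (\<bar>f x\<bar> - real n)) < e"
proof -
  define F where "F n x = max 0 (\<bar>f x\<bar> - real n)" for n x
  have absf: "(\<lambda>x. \<bar>f x\<bar>) absolutely_integrable_on {p..q}"
    using absolutely_integrable_norm[OF f] by (simp add: o_def)
  have Fint: "F n integrable_on {p..q}" for n
  proof -
    have "F n absolutely_integrable_on {p..q}"
      unfolding F_def
      by (intro absolutely_integrable_max_1 set_integral_diff(1) absf absolutely_integrable_zero)
        (auto intro: absolutely_integrable_on_const)
    then show ?thesis using absolutely_integrable_on_def by blast
  qed
  have absf': "(\<lambda>x. \<bar>f x\<bar>) integrable_on {p..q}" using absf absolutely_integrable_on_def by blast
  have "(\<lambda>n. integral {p..q} (F n)) \<longlonglongrightarrow> integral {p..q} (\<lambda>x. 0)"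
  proof (rule dominated_convergence(2)[OF Fint absf'])
    show "norm (F n x) \<le> \<bar>f x\<bar>" for n x by (auto simp: F_def)
    show "(\<lambda>n. F n x) \<longlonglongrightarrow> 0" for x
    proof (rule tendsto_eventually)
      obtain n0 where "\<bar>f x\<bar> \<le> real n0" using real_arch_simple by blast
      then show "\<forall>\<^sub>F n in sequentially. F n x = 0"
        by (intro eventually_sequentiallyI[of n0]) (auto simp: F_def)
    qed
  qed
  then have "(\<lambda>n. integral {p..q} (F n)) \<longlonglongrightarrow> 0" by simp
  then have "\<forall>\<^sub>F n in sequentially. integral {p..q} (F n) < e"
    using e by (intro order_tendstoD(2)) auto
  then obtain n where n: "integral {p..q} (F n) < e"
    using eventually_sequentially by auto
  show ?thesis using that[of n] Fint[of n] n unfolding F_def by blast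
qed

lemma abs_cont_on_indefinite_integral:
  fixes f :: "real \<Rightarrow> real"
  assumes f: "f absolutely_integrable_on {p..q}"
    and h: "\<And>x. x \<in> {p..q} \<Longrightarrow> h x = c + integral {p..x} f"
  shows "abs_cont_on p q h"
  unfolding abs_cont_on_def
proof (intro allI impI)
  fix e :: real assume e: "e > 0"
  define F where "F n x = max 0 (\<bar>f x\<bar> - real n)" for n x
  obtain n where Fint: "F n integrable_on {p..q}" and n: "integral {p..q} (F n) < e/2"
    using integral_truncation_small[OF f, of "e/2"] e unfolding F_def by auto
  have absf': "(\<lambda>x. \<bar>f x\<bar>) integrable_on {p..q}"
    using absolutely_integrable_norm[OF f] absolutely_integrable_on_def by (auto simp: o_def)
  \<comment> \<open>The part of \<open>f\<close> bounded by \<open>n\<close> contributes at most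
    \<open>n * d\<close>, hence at most \<open>e/2\<close>; the excess over \<open>n\<close> has
    integral below \<open>e/2\<close> over any subset.\<close>
  define d where "d = e / (2 * (real n + 1))"
  have d: "d > 0" using e by (simp add: d_def)
  have Fi: "F n integrable_on {a..b}" "f integrable_on {a..b}" "(\<lambda>x. \<bar>f x\<bar>) integrable_on {a..b}" if "p \<le> a" "b \<le> q" for a b
    using Fint absf' set_lebesgue_integral_eq_integral(1)[OF f] that
    by (auto intro!: integrable_on_subinterval[of _ "{p..q}"])
  have Fge: "\<bar>f x\<bar> \<le> F n x + real n" for x by (simp add: F_def)
  have inc: "\<bar>h b - h a\<bar> \<le> integral {a..b} (F n) + real n * (b - a)" if "p \<le> a" "a \<le> b" "b \<le> q" for a b
  proof -
    have "h b - h a = integral {a..b} f"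
      using h[of a] h[of b] that Henstock_Kurzweil_Integration.integral_combine[of p a b f] Fi(2)[of p b] by auto
    also have "\<bar>\<dots>\<bar> \<le> integral {a..b} (\<lambda>x. F n x + real n)"
    proof -
      have "norm (integral {a..b} f) \<le> integral {a..b} (\<lambda>x. F n x + real n)"
        by (rule integral_norm_bound_integral) (use Fi that in \<open>auto intro!: integrable_add simp: Fge\<close>)
      then show ?thesis by simp
    qed
    also have "\<dots> = integral {a..b} (F n) + real n * (b - a)"
      by (subst integral_add) (use Fi that in auto)
    finally show ?thesis .
  qed
  have "(\<Sum>k<N. \<bar>h (b k) - h (a k)\<bar>) < e"
    if A: "\<forall>k<N. p \<le> a k \<and> a k \<le> b k \<and> b k \<le> q"
      "\<forall>k<N. \<forall>l<N. k \<noteq> l \<longrightarrow> b k \<le> a l \<or> b l \<le> a k" "(\<Sum>k<N. b k - a k) < d" for N :: nat and a b :: "nat \<Rightarrow> real"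
  proof -
    \<comment> \<open>The intervals meet only at endpoints, so the sum is a single integral over
      their union and is bounded by the integral over \<open>{p..q}\<close>, however many intervals
      there are.\<close>
    have S: "(\<Sum>k\<in>K. integral {a k..b k} (F n)) = integral (\<Union>k\<in>K. {a k..b k}) (F n) \<and> F n integrable_on (\<Union>k\<in>K. {a k..b k})"
      if "K \<subseteq> {..<N}" "finite K" for K
      using that(2,1)
    proof (induction K rule: finite_induct)
      case empty then show ?case by (simp add: integrable_on_empty)
    next
      case (insert k K)
      have "negligible ({a k..b k} \<inter> (\<Union>l\<in>K. {a l..b l}))"
      proof (rule negligible_subset[of "{a k, b k}"])
        show "{a k..b k} \<inter> (\<Union>l\<in>K. {a l..b l}) \<subseteq> {a k, b k}"
        proof
          fix x assume "x \<in> {a k..b k} \<inter> (\<Union>l\<in>K. {a l..b l})"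
          then obtain l where "l \<in> K" "x \<in> {a k..b k}" "x \<in> {a l..b l}" by auto
          moreover have "l \<noteq> k" "l < N" "k < N" using insert \<open>l \<in> K\<close> by auto
          ultimately show "x \<in> {a k, b k}" using A(2)[rule_format, of k l] by auto
        qed
      qed auto
      moreover have "F n integrable_on {a k..b k}" using A insert by (intro Fi) auto
      ultimately show ?case using insert by (auto simp: integral_Un integrable_Un)
    qed
    have "(\<Sum>k<N. \<bar>h (b k) - h (a k)\<bar>) \<le> (\<Sum>k<N. integral {a k..b k} (F n) + real n * (b k - a k))"
      by (intro sum_mono inc) (use A in auto)
    also have "\<dots> = integral (\<Union>k<N. {a k..b k}) (F n) + real n * (\<Sum>k<N. b k - a k)"
      using S[of "{..<N}"] by (simp add: sum.distrib sum_distrib_left)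
    also have "integral (\<Union>k<N. {a k..b k}) (F n) \<le> integral {p..q} (F n)"
    proof (rule integral_subset_le)
      show "(\<Union>k<N. {a k..b k}) \<subseteq> {p..q}" using A(1) by fastforce
      show "F n integrable_on (\<Union>k<N. {a k..b k})" using S[of "{..<N}"] by simp
    qed (auto simp: Fint F_def[of n])
    also have "real n * (\<Sum>k<N. b k - a k) \<le> real n * d"
      using A(3) by (intro mult_left_mono) auto
    also have "\<dots> \<le> e/2"
      using e by (simp add: d_def field_simps)
    finally show ?thesis using n by simp
  qed
  then show "\<exists>d>0. \<forall>(N::nat) (a::nat \<Rightarrow> real) (b::nat \<Rightarrow> real).
        (\<forall>k<N. p \<le> a k \<and> a k \<le> b k \<and> b k \<le> q) \<and>
        (\<forall>k<N. \<forall>l<N. k \<noteq> l \<longrightarrow> b k \<le> a l \<or> b l \<le> a k) \<and>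
        (\<Sum>k<N. b k - a k) < d \<longrightarrow> (\<Sum>k<N. \<bar>h (b k) - h (a k)\<bar>) < e"
    using d by blast
qed

lemma abs_cont_on_imp_continuous_on:
  assumes "abs_cont_on p q h"
  shows "continuous_on {p..q} h"
  unfolding continuous_on_iff
proof (intro ballI allI impI)
  fix x e :: real assume x: "x \<in> {p..q}" and e: "e > 0"
  obtain d where d: "d > 0" "\<forall>(n::nat) (a::nat \<Rightarrow> real) (b::nat \<Rightarrow> real).
        (\<forall>k<n. p \<le> a k \<and> a k \<le> b k \<and> b k \<le> q) \<and>
        (\<forall>k<n. \<forall>l<n. k \<noteq> l \<longrightarrow> b k \<le> a l \<or> b l \<le> a k) \<and>
        (\<Sum>k<n. b k - a k) < d \<longrightarrow> (\<Sum>k<n. \<bar>h (b k) - h (a k)\<bar>) < e"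
    using assms e unfolding abs_cont_on_def by blast
  have "dist (h y) (h x) < e" if "y \<in> {p..q}" "dist y x < d" for y
    using d(2)[rule_format, of 1 "\<lambda>_. min x y" "\<lambda>_. max x y"] that x
    by (cases "x \<le> y") (auto simp: dist_real_def)
  then show "\<exists>d>0. \<forall>y\<in>{p..q}. dist y x < d \<longrightarrow> dist (h y) (h x) < e" using d by blast
qed

lemma abs_cont_on_diff:
  assumes "abs_cont_on p q f" "abs_cont_on p q g"
  shows "abs_cont_on p q (\<lambda>x. f x - g x)"
  unfolding abs_cont_on_def
proof (intro allI impI)
  fix e :: real assume "e > 0"
  then have e: "e/2 > 0" by simp
  obtain d1 where d1: "d1 > 0" "\<forall>(n::nat) (a::nat \<Rightarrow> real) (b::nat \<Rightarrow> real).
        (\<forall>k<n. p \<le> a k \<and> a k \<le> b k \<and> b k \<le> q) \<and>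
        (\<forall>k<n. \<forall>l<n. k \<noteq> l \<longrightarrow> b k \<le> a l \<or> b l \<le> a k) \<and>
        (\<Sum>k<n. b k - a k) < d1 \<longrightarrow> (\<Sum>k<n. \<bar>f (b k) - f (a k)\<bar>) < e/2"
    using assms(1) e unfolding abs_cont_on_def by blast
  obtain d2 where d2: "d2 > 0" "\<forall>(n::nat) (a::nat \<Rightarrow> real) (b::nat \<Rightarrow> real).
        (\<forall>k<n. p \<le> a k \<and> a k \<le> b k \<and> b k \<le> q) \<and>
        (\<forall>k<n. \<forall>l<n. k \<noteq> l \<longrightarrow> b k \<le> a l \<or> b l \<le> a k) \<and>
        (\<Sum>k<n. b k - a k) < d2 \<longrightarrow> (\<Sum>k<n. \<bar>g (b k) - g (a k)\<bar>) < e/2"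
    using assms(2) e unfolding abs_cont_on_def by blast
  have "(\<Sum>k<n. \<bar>(f (b k) - g (b k)) - (f (a k) - g (a k))\<bar>) < e"
    if A: "(\<forall>k<n. p \<le> a k \<and> a k \<le> b k \<and> b k \<le> q) \<and>
        (\<forall>k<n. \<forall>l<n. k \<noteq> l \<longrightarrow> b k \<le> a l \<or> b l \<le> a k) \<and>
        (\<Sum>k<n. b k - a k) < min d1 d2" for n :: nat and a b :: "nat \<Rightarrow> real"
  proof -
    have "(\<Sum>k<n. \<bar>(f (b k) - g (b k)) - (f (a k) - g (a k))\<bar>)
        \<le> (\<Sum>k<n. \<bar>f (b k) - f (a k)\<bar> + \<bar>g (b k) - g (a k)\<bar>)"
      by (intro sum_mono) auto
    moreover have "(\<Sum>k<n. \<bar>f (b k) - f (a k)\<bar>) < e/2"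
      by (rule d1(2)[rule_format, of n a b]) (use A in auto)
    moreover have "(\<Sum>k<n. \<bar>g (b k) - g (a k)\<bar>) < e/2"
      by (rule d2(2)[rule_format, of n a b]) (use A in auto)
    ultimately show ?thesis by (simp add: sum.distrib)
  qed
  then show "\<exists>d>0. \<forall>(n::nat) (a::nat \<Rightarrow> real) (b::nat \<Rightarrow> real).
        (\<forall>k<n. p \<le> a k \<and> a k \<le> b k \<and> b k \<le> q) \<and>
        (\<forall>k<n. \<forall>l<n. k \<noteq> l \<longrightarrow> b k \<le> a l \<or> b l \<le> a k) \<and>
        (\<Sum>k<n. b k - a k) < d \<longrightarrow> (\<Sum>k<n. \<bar>(f (b k) - g (b k)) - (f (a k) - g (a k))\<bar>) < e"
    using d1 d2 by (intro exI[of _ "min d1 d2"]) auto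
qed

lemma abs_cont_on_mult:
  assumes "abs_cont_on p q f" "abs_cont_on p q g"
  shows "abs_cont_on p q (\<lambda>x. f x * g x)"
proof (cases "p \<le> q")
  case False
  then have "\<not> (p \<le> a \<and> a \<le> b \<and> b \<le> q)" for a b by auto
  then have "n = 0" if "\<forall>k<n. p \<le> a k \<and> a k \<le> b k \<and> b k \<le> q" for n :: nat and a b :: "nat \<Rightarrow> real"
    using that by blast
  then show ?thesis unfolding abs_cont_on_def
  proof (intro allI impI exI[of _ 1] conjI)
    fix e :: real and n :: nat and a b :: "nat \<Rightarrow> real"
    assume "e > 0" and A: "(\<forall>k<n. p \<le> a k \<and> a k \<le> b k \<and> b k \<le> q) \<and>
        (\<forall>k<n. \<forall>l<n. k \<noteq> l \<longrightarrow> b k \<le> a l \<or> b l \<le> a k) \<and> (\<Sum>k<n. b k - a k) < 1"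
    have "n = 0" using \<open>\<And>n b a. \<forall>k<n. p \<le> a k \<and> a k \<le> b k \<and> b k \<le> q \<Longrightarrow> n = 0\<close>[of n a b] A by blast
    then show "(\<Sum>k<n. \<bar>f (b k) * g (b k) - f (a k) * g (a k)\<bar>) < e" using \<open>e > 0\<close> by simp
  qed simp
next
  case True
  obtain B where B: "B > 0" "\<And>x. x \<in> {p..q} \<Longrightarrow> \<bar>f x\<bar> \<le> B" "\<And>x. x \<in> {p..q} \<Longrightarrow> \<bar>g x\<bar> \<le> B"
  proof -
    have "bounded (f ` {p..q})" "bounded (g ` {p..q})"
      using assms by (auto intro!: compact_imp_bounded compact_continuous_image abs_cont_on_imp_continuous_on)
    then obtain b1 b2 where "b1 > 0" "\<forall>x\<in>{p..q}. norm (f x) \<le> b1" "b2 > 0" "\<forall>x\<in>{p..q}. norm (g x) \<le> b2"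
      unfolding bounded_pos by auto
    then have "\<bar>f x\<bar> \<le> max b1 b2" "\<bar>g x\<bar> \<le> max b1 b2" if "x \<in> {p..q}" for x
      using that by (auto simp: le_max_iff_disj)
    then show ?thesis using \<open>b1 > 0\<close> by (intro that[of "max b1 b2"]) auto
  qed
  show ?thesis
  unfolding abs_cont_on_def
proof (intro allI impI)
  fix e :: real assume "e > 0"
  then have e: "e/(2*B) > 0" using B by simp
  obtain d1 where d1: "d1 > 0" "\<forall>(n::nat) (a::nat \<Rightarrow> real) (b::nat \<Rightarrow> real).
        (\<forall>k<n. p \<le> a k \<and> a k \<le> b k \<and> b k \<le> q) \<and>
        (\<forall>k<n. \<forall>l<n. k \<noteq> l \<longrightarrow> b k \<le> a l \<or> b l \<le> a k) \<and>
        (\<Sum>k<n. b k - a k) < d1 \<longrightarrow> (\<Sum>k<n. \<bar>f (b k) - f (a k)\<bar>) < e/(2*B)"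
    using assms(1) e unfolding abs_cont_on_def by blast
  obtain d2 where d2: "d2 > 0" "\<forall>(n::nat) (a::nat \<Rightarrow> real) (b::nat \<Rightarrow> real).
        (\<forall>k<n. p \<le> a k \<and> a k \<le> b k \<and> b k \<le> q) \<and>
        (\<forall>k<n. \<forall>l<n. k \<noteq> l \<longrightarrow> b k \<le> a l \<or> b l \<le> a k) \<and>
        (\<Sum>k<n. b k - a k) < d2 \<longrightarrow> (\<Sum>k<n. \<bar>g (b k) - g (a k)\<bar>) < e/(2*B)"
    using assms(2) e unfolding abs_cont_on_def by blast
  have "(\<Sum>k<n. \<bar>f (b k) * g (b k) - f (a k) * g (a k)\<bar>) < e"
    if A: "(\<forall>k<n. p \<le> a k \<and> a k \<le> b k \<and> b k \<le> q) \<and>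
        (\<forall>k<n. \<forall>l<n. k \<noteq> l \<longrightarrow> b k \<le> a l \<or> b l \<le> a k) \<and>
        (\<Sum>k<n. b k - a k) < min d1 d2" for n :: nat and a b :: "nat \<Rightarrow> real"
  proof -
    have "\<bar>f (b k) * g (b k) - f (a k) * g (a k)\<bar> \<le> B * (\<bar>f (b k) - f (a k)\<bar> + \<bar>g (b k) - g (a k)\<bar>)" if "k < n" for k
    proof -
      have k: "a k \<in> {p..q}" "b k \<in> {p..q}" using A that by auto
      have "f (b k) * g (b k) - f (a k) * g (a k) = (f (b k) - f (a k)) * g (b k) + f (a k) * (g (b k) - g (a k))"
        by (simp add: algebra_simps)
      also have "\<bar>\<dots>\<bar> \<le> \<bar>f (b k) - f (a k)\<bar> * \<bar>g (b k)\<bar> + \<bar>f (a k)\<bar> * \<bar>g (b k) - g (a k)\<bar>"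
        by (metis abs_mult abs_triangle_ineq)
      also have "\<dots> \<le> \<bar>f (b k) - f (a k)\<bar> * B + B * \<bar>g (b k) - g (a k)\<bar>"
        using B k by (intro add_mono mult_mono) auto
      finally show ?thesis by (simp add: algebra_simps)
    qed
    then have "(\<Sum>k<n. \<bar>f (b k) * g (b k) - f (a k) * g (a k)\<bar>)
        \<le> (\<Sum>k<n. B * (\<bar>f (b k) - f (a k)\<bar> + \<bar>g (b k) - g (a k)\<bar>))"
      by (intro sum_mono) auto
    also have "\<dots> = B * ((\<Sum>k<n. \<bar>f (b k) - f (a k)\<bar>) + (\<Sum>k<n. \<bar>g (b k) - g (a k)\<bar>))"
      by (simp add: sum_distrib_left sum.distrib algebra_simps)
    also have "\<dots> < B * (e/(2*B) + e/(2*B))"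
    proof (intro mult_strict_left_mono add_strict_mono)
      show "(\<Sum>k<n. \<bar>f (b k) - f (a k)\<bar>) < e/(2*B)"
        by (rule d1(2)[rule_format, of n a b]) (use A in auto)
      show "(\<Sum>k<n. \<bar>g (b k) - g (a k)\<bar>) < e/(2*B)"
        by (rule d2(2)[rule_format, of n a b]) (use A in auto)
    qed (use B in auto)
    also have "\<dots> = e" using B by (simp add: field_simps)
    finally show ?thesis .
  qed
  then show "\<exists>d>0. \<forall>(n::nat) (a::nat \<Rightarrow> real) (b::nat \<Rightarrow> real).
        (\<forall>k<n. p \<le> a k \<and> a k \<le> b k \<and> b k \<le> q) \<and>
        (\<forall>k<n. \<forall>l<n. k \<noteq> l \<longrightarrow> b k \<le> a l \<or> b l \<le> a k) \<and>
        (\<Sum>k<n. b k - a k) < d \<longrightarrow> (\<Sum>k<n. \<bar>f (b k) * g (b k) - f (a k) * g (a k)\<bar>) < e"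
    using d1 d2 by (intro exI[of _ "min d1 d2"]) auto
qed
qed

text \<open>By Henstock's lemma, disjoint intervals on which the difference quotient misses \<open>f\<close> by more than
  \<open>e\<close> have small total length; Vitali's theorem selects enough of them to cover the bad points.\<close>

theorem AE_has_real_derivative_indefinite_integral:
  fixes f :: "real \<Rightarrow> real"
  assumes f: "f integrable_on {p..q}"
  shows "AE x in lebesgue. x \<in> {p..q} \<longrightarrow>
    ((\<lambda>x. integral {p..x} f) has_real_derivative f x) (at x within {p..q})"
proof -
  define H where "H x = integral {p..x} f" for x
  define Bad where "Bad e = {x \<in> {p..q}. \<forall>d>0. \<exists>y\<in>{p..q}. \<bar>y - x\<bar> < d \<and> \<bar>H y - H x - f x * (y - x)\<bar> > e * \<bar>y - x\<bar>}" for e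
  have inc: "H y - H x = integral {x..y} f" if "p \<le> x" "x \<le> y" "y \<le> q" for x y
    unfolding H_def using that Henstock_Kurzweil_Integration.integral_combine[of p x y f]
      integrable_on_subinterval[OF f, of p y] by auto
  have neg: "negligible (Bad e)" if e: "e > 0" for e
    unfolding negligible_outer_le
  proof (intro allI impI)
    fix \<eta> :: real assume \<eta>: "\<eta> > 0"
    \<comment> \<open>Henstock's lemma returns \<open>2 * \<epsilon>\<close>, and division by the
      threshold \<open>e\<close> turns this into \<open>\<eta>\<close>.\<close>
    define \<epsilon> where "\<epsilon> = \<eta> * e / 2"
    have \<epsilon>: "\<epsilon> > 0" using \<eta> e by (simp add: \<epsilon>_def)
    have "(f has_integral integral {p..q} f) (cbox p q)" using f by (simp add: integrable_integral)
    then obtain \<gamma> where \<gamma>: "gauge \<gamma>"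
      "\<And>D. D tagged_division_of (cbox p q) \<Longrightarrow> \<gamma> fine D \<Longrightarrow>
         norm ((\<Sum>(x,K)\<in>D. measure lborel K *\<^sub>R f x) - integral {p..q} f) < \<epsilon>"
      by (rule has_integralD[OF _ \<epsilon>]) (rule that)
    \<comment> \<open>A pair codes an interval tagged at its end \<open>x\<close>, with
      \<open>y\<close> on either side of \<open>x\<close>, so that a failure of either one-sided
      difference quotient is captured.\<close>
    define I where "I = {(x, y). x \<in> {p..q} \<and> y \<in> {p..q} \<and> x \<noteq> y \<and> {min x y..max x y} \<subseteq> \<gamma> x \<and>
        \<bar>H y - H x - f x * (y - x)\<bar> > e * \<bar>y - x\<bar>}"
    define cen where "cen z = (fst z + snd z) / 2" for z :: "real \<times> real"
    define rad where "rad z = \<bar>fst z - snd z\<bar> / 2" for z :: "real \<times> real"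
    have cb: "cball (cen z) (rad z) = {min (fst z) (snd z)..max (fst z) (snd z)}" for z
    proof (cases "fst z \<le> snd z")
      case True
      then have "rad z = (snd z - fst z) / 2" by (simp add: rad_def)
      then have "cen z - rad z = fst z" "cen z + rad z = snd z" by (simp_all add: cen_def field_simps)
      then show ?thesis using True by (simp add: cball_eq_atLeastAtMost)
    next
      case False
      then have "rad z = (fst z - snd z) / 2" by (simp add: rad_def)
      then have "cen z - rad z = snd z" "cen z + rad z = fst z" by (simp_all add: cen_def field_simps)
      then show ?thesis using False by (simp add: cball_eq_atLeastAtMost)
    qed
    obtain C where C: "countable C" "C \<subseteq> I"
      "pairwise (\<lambda>i j. disjnt (cball (cen i) (rad i)) (cball (cen j) (rad j))) C"
      "negligible (Bad e - (\<Union>i\<in>C. cball (cen i) (rad i)))"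
    proof (rule Vitali_covering_theorem_cballs[of I rad "Bad e" cen])
      show "0 < rad i" if "i \<in> I" for i using that by (auto simp: I_def rad_def)
      show "\<exists>i. i \<in> I \<and> x \<in> cball (cen i) (rad i) \<and> rad i < d" if x: "x \<in> Bad e" and d: "0 < d" for x d
      proof -
        have "open (\<gamma> x)" "x \<in> \<gamma> x" using \<gamma>(1) by (auto simp: gauge_def)
        then obtain s where s: "s > 0" "ball x s \<subseteq> \<gamma> x" by (meson openE)
        obtain y where y: "y \<in> {p..q}" "\<bar>y - x\<bar> < min s d" "\<bar>H y - H x - f x * (y - x)\<bar> > e * \<bar>y - x\<bar>"
        proof -
          have "min s d > 0" using s(1) d by simp
          then show ?thesis using x that unfolding Bad_def by blast
        qed
        have "x \<noteq> y" using y(3) by auto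
        moreover have "{min x y..max x y} \<subseteq> ball x s"
          using y(2) by (auto simp: dist_real_def)
        ultimately have "(x, y) \<in> I" using x y s unfolding I_def Bad_def by auto
        moreover have "x \<in> cball (cen (x,y)) (rad (x,y))" unfolding cb by auto
        moreover have "rad (x,y) < d" using y(2) d unfolding rad_def by auto
        ultimately show ?thesis by blast
      qed
    qed blast
    define U where "U = (\<Union>i\<in>C. cball (cen i) (rad i))"
    have fin: "measure lebesgue (\<Union>i\<in>F. cball (cen i) (rad i)) \<le> \<eta>" if F: "F \<subseteq> C" "finite F" for F
    proof -
      define K where "K z = cball (cen z) (rad z)" for z
      define D where "D = (\<lambda>z. (fst z, K z)) ` F"
      have FI: "z \<in> I" if "z \<in> F" for z using that F C by auto
      have Kz: "K z = {min (fst z) (snd z)..max (fst z) (snd z)}" for z unfolding K_def cb ..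
      have dj: "K z \<inter> K w = {}" if "z \<in> F" "w \<in> F" "z \<noteq> w" for z w
        using C(3) that F by (auto simp: pairwise_def disjnt_def K_def)
      have inj: "inj_on (\<lambda>z. (fst z, K z)) F"
      proof (rule inj_onI, rule ccontr)
        fix z w assume A: "z \<in> F" "w \<in> F" "(fst z, K z) = (fst w, K w)" "z \<noteq> w"
        have "fst z \<in> K z" by (auto simp: Kz)
        then show False using dj[OF A(1,2,4)] A(3) by auto
      qed
      have tag: "D tagged_partial_division_of (cbox p q)"
        unfolding tagged_partial_division_of_def
      proof (intro conjI allI impI)
        show "finite D" using F by (simp add: D_def)
        fix x L assume "(x, L) \<in> D"
        then obtain z where z: "z \<in> F" "x = fst z" "L = K z" by (auto simp: D_def)
        show "x \<in> L" by (auto simp: z Kz)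
        show "L \<subseteq> cbox p q" using FI[OF z(1)] by (auto simp: z Kz I_def)
        show "\<exists>a b. L = cbox a b" by (auto simp: z Kz)
      next
        fix x1 K1 x2 K2 assume "(x1, K1) \<in> D \<and> (x2, K2) \<in> D \<and> (x1, K1) \<noteq> (x2, K2)"
        then obtain z w where "z \<in> F" "w \<in> F" "z \<noteq> w" "K1 = K z" "K2 = K w" by (auto simp: D_def)
        then have "K1 \<inter> K2 = {}" using dj by auto
        then show "interior K1 \<inter> interior K2 = {}" using interior_subset by blast
      qed
      have fineD: "\<gamma> fine D" 
      proof (rule fineI)
        fix x L assume "(x, L) \<in> D"
        then obtain z where z: "z \<in> F" "x = fst z" "L = K z" by (auto simp: D_def)
        show "L \<subseteq> \<gamma> x" using FI[OF z(1)] unfolding z Kz I_def by (auto simp: case_prod_beta)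
      qed
      have "(\<Sum>(x,L)\<in>D. norm (measure lborel L *\<^sub>R f x - integral L f)) \<le> 2 * real (DIM(real)) * \<epsilon>"
        by (rule Henstock_lemma_part2[OF _ \<epsilon> \<gamma>(1) _ tag fineD]) (use f \<gamma>(2) in auto)
      then have H1: "(\<Sum>z\<in>F. \<bar>measure lborel (K z) * f (fst z) - integral (K z) f\<bar>) \<le> 2 * \<epsilon>"
        unfolding D_def by (subst (asm) sum.reindex[OF inj]) (simp add: o_def)
      \<comment> \<open>Each selected interval is bad, so its Henstock error is at least
        \<open>e\<close> times its length; a bound on the total error is then a bound on the total
        length.\<close>
      have "e * measure lborel (K z) \<le> \<bar>measure lborel (K z) * f (fst z) - integral (K z) f\<bar>" if z: "z \<in> F" for z
      proof -
        obtain x y where xy: "z = (x, y)" by (cases z)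
        have I: "x \<in> {p..q}" "y \<in> {p..q}" "\<bar>H y - H x - f x * (y - x)\<bar> > e * \<bar>y - x\<bar>"
          using FI[OF z] by (auto simp: I_def xy)
        show ?thesis
        proof (cases "x \<le> y")
          case True
          then have "K z = {x..y}" by (auto simp: Kz xy)
          then show ?thesis using I inc[of x y] True by (simp add: xy algebra_simps abs_minus_commute)
        next
          case False
          then have "K z = {y..x}" by (auto simp: Kz xy)
          then show ?thesis using I inc[of y x] False by (simp add: xy algebra_simps abs_minus_commute)
        qed
      qed
      then have "e * (\<Sum>z\<in>F. measure lborel (K z)) \<le> 2 * \<epsilon>"
        unfolding sum_distrib_left by (intro order_trans[OF sum_mono H1])
      then have "(\<Sum>z\<in>F. measure lborel (K z)) \<le> \<eta>"
        using e by (simp add: \<epsilon>_def field_simps)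
      moreover have "measure lebesgue (\<Union>z\<in>F. K z) \<le> (\<Sum>z\<in>F. measure lebesgue (K z))"
        by (rule measure_UNION_le) (use F in \<open>auto simp: K_def\<close>)
      moreover have "measure lebesgue (K z) = measure lborel (K z)" for z by (simp add: K_def)
      ultimately show ?thesis by (simp add: K_def)
    qed
    have U: "U \<in> lmeasurable" "measure lebesgue U \<le> \<eta>"
    proof -
      have "(\<Union>i\<in>C. cball (cen i) (rad i)) \<in> lmeasurable \<and> measure lebesgue (\<Union>i\<in>C. cball (cen i) (rad i)) \<le> \<eta>"
        using fmeasurable_UN_bound[OF C(1) lmeasurable_cball fin] measure_UN_bound[OF C(1) lmeasurable_cball fin]
        by blast
      then show "U \<in> lmeasurable" "measure lebesgue U \<le> \<eta>" by (auto simp: U_def)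
    qed
    have n: "Bad e - U \<in> lmeasurable" "measure lebesgue (Bad e - U) = 0"
      using C(4) by (auto simp: U_def negligible_imp_measurable negligible_imp_measure0)
    have "measure lebesgue (U \<union> (Bad e - U)) \<le> measure lebesgue U + measure lebesgue (Bad e - U)"
      by (rule measure_Un_le) (use U n in auto)
    then show "\<exists>T. Bad e \<subseteq> T \<and> T \<in> lmeasurable \<and> measure lebesgue T \<le> \<eta>"
      using U n fmeasurable.Un[OF U(1) n(1)] by (intro exI[of _ "U \<union> (Bad e - U)"]) auto
  qed
  define N where "N = (\<Union>n. Bad (1 / real (Suc n)))"
  have "negligible N" unfolding N_def by (rule negligible_countable_Union) (auto simp: neg)
  then show ?thesis
  proof (rule negligible_imp_AE, intro impI)
    fix x assume x: "x \<notin> N" "x \<in> {p..q}"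
    show "((\<lambda>x. integral {p..x} f) has_real_derivative f x) (at x within {p..q})"
      unfolding has_field_derivative_def has_derivative_within_alt H_def[symmetric]
    proof (intro conjI allI impI)
      show "bounded_linear ((*) (f x))" by (rule bounded_linear_mult_right)
      fix e :: real assume "e > 0"
      then obtain n where n: "1 / real (Suc n) < e" by (meson nat_approx_posE)
      have "x \<notin> Bad (1 / real (Suc n))" using x(1) unfolding N_def by blast
      then have "\<exists>d>0. \<not> (\<exists>y\<in>{p..q}. \<bar>y - x\<bar> < d \<and> \<bar>H y - H x - f x * (y - x)\<bar> > 1 / real (Suc n) * \<bar>y - x\<bar>)"
        using x(2) unfolding Bad_def by blast
      then obtain d where d: "d > 0" "\<forall>y\<in>{p..q}. \<bar>y - x\<bar> < d \<longrightarrow> \<bar>H y - H x - f x * (y - x)\<bar> \<le> 1 / real (Suc n) * \<bar>y - x\<bar>"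
        unfolding not_less[symmetric] by blast
      have "\<bar>H y - H x - f x * (y - x)\<bar> \<le> e * \<bar>y - x\<bar>" if "y\<in>{p..q}" "\<bar>y - x\<bar> < d" for y
        using d(2) that n mult_right_mono[of "1 / real (Suc n)" e "\<bar>y - x\<bar>"] by fastforce
      then show "\<exists>d>0. \<forall>y\<in>{p..q}. norm (y - x) < d \<longrightarrow> norm (H y - H x - f x * (y - x)) \<le> e * norm (y - x)"
        using d(1) by auto
    qed
  qed
qed

section \<open>Caratheodory trajectories\<close>

text \<open>Integrated form of \<open>u'' = - F\<close> with \<open>v\<close> the derivative of
  \<open>u\<close>. \<open>F\<close> is a function of \<open>x\<close> alone: a nonlinear equation
  is expressed by inserting \<open>u\<close> into it, and restriction to subintervals or changes on
  null sets then concern plain integrals only.\<close>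

definition traj :: "real \<Rightarrow> real \<Rightarrow> (real \<Rightarrow> real) \<Rightarrow> (real \<Rightarrow> real) \<Rightarrow> (real \<Rightarrow> real) \<Rightarrow> bool" where
  "traj p q F u v \<longleftrightarrow> F absolutely_integrable_on {p..q} \<and>
     (\<forall>x\<in>{p..q}. integral {p..x} F = v p - v x) \<and>
     (\<forall>x\<in>{p..q}. (u has_real_derivative v x) (at x within {p..q}))"

lemma abs_int_imp_int: "F absolutely_integrable_on S \<Longrightarrow> F integrable_on S" for F :: "real \<Rightarrow> real"
  by (rule set_lebesgue_integral_eq_integral(1))

lemma abs_int_neg: "F absolutely_integrable_on S \<Longrightarrow> (\<lambda>x. - F x) absolutely_integrable_on S" for F :: "real \<Rightarrow> real"
  using absolutely_integrable_scaleR_left[where f=F and S=S and c="-1"] by simp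

lemma traj_integrable:
  assumes "traj p q F u v" "p \<le> x" "y \<le> q"
  shows "F integrable_on {x..y}"
proof -
  have "F integrable_on {p..q}" using assms(1) by (simp add: traj_def abs_int_imp_int)
  then show ?thesis by (rule integrable_on_subinterval) (use assms in auto)
qed

lemma traj_v_diff:
  assumes "traj p q F u v" "p \<le> x" "x \<le> y" "y \<le> q"
  shows "v y - v x = - integral {x..y} F"
proof -
  have "F integrable_on {p..y}"
    using traj_integrable[OF assms(1), of p y] assms by simp
  then have "integral {p..x} F + integral {x..y} F = integral {p..y} F"
    by (intro Henstock_Kurzweil_Integration.integral_combine) (use assms in auto)
  moreover have "integral {p..x} F = v p - v x" "integral {p..y} F = v p - v y"
    using assms unfolding traj_def by auto
  ultimately show ?thesis by simp
qed

lemma traj_sub: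
  assumes "traj p q F u v" "p \<le> p'" "q' \<le> q"
  shows "traj p' q' F u v"
  unfolding traj_def
proof (intro conjI ballI)
  show "F absolutely_integrable_on {p'..q'}"
    by (rule absolutely_integrable_on_subinterval[where S="{p..q}"]) (use assms in \<open>auto simp: traj_def\<close>)
  show "integral {p'..x} F = v p' - v x" if "x \<in> {p'..q'}" for x
    using traj_v_diff[OF assms(1), of p' x] that assms(2,3) by simp
  show "(u has_real_derivative v x) (at x within {p'..q'})" if "x \<in> {p'..q'}" for x
    by (rule DERIV_subset[of _ _ _ "{p..q}"]) (use assms that in \<open>auto simp: traj_def\<close>)
qed

text \<open>\<open>F\<close> enters \<open>traj\<close> through integrals only. In this way
  coefficients that vanish almost everywhere outside their own hump or gap are removed from the
  equation.\<close>

lemma traj_cong: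
  assumes "traj p q F u v" "negligible N" "\<And>x. x \<in> {p..q} \<Longrightarrow> x \<notin> N \<Longrightarrow> F' x = F x"
  shows "traj p q F' u v"
  unfolding traj_def
proof (intro conjI ballI)
  show "F' absolutely_integrable_on {p..q}"
    by (rule absolutely_integrable_spike[where f=F, OF _ assms(2)]) (use assms(1,3) in \<open>auto simp: traj_def\<close>)
  show "integral {p..x} F' = v p - v x" if "x \<in> {p..q}" for x
  proof -
    have "integral {p..x} F' = integral {p..x} F"
      by (rule integral_spike[OF assms(2)]) (use assms(3) that in auto)
    then show ?thesis using assms(1) that unfolding traj_def by simp
  qed
qed (use assms(1) in \<open>simp add: traj_def\<close>)

lemma traj_cont_u: "traj p q F u v \<Longrightarrow> continuous_on {p..q} u"
  unfolding traj_def by (metis DERIV_continuous continuous_on_eq_continuous_within)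

lemma traj_ac_v:
  assumes "traj p q F u v"
  shows "abs_cont_on p q v"
proof (rule abs_cont_on_indefinite_integral)
  show "(\<lambda>x. - F x) absolutely_integrable_on {p..q}" using assms by (simp add: traj_def abs_int_neg)
  show "v x = v p + integral {p..x} (\<lambda>x. - F x)" if "x \<in> {p..q}" for x
    using assms that by (simp add: traj_def)
qed

lemma traj_cont_v: "traj p q F u v \<Longrightarrow> continuous_on {p..q} v"
  using traj_ac_v abs_cont_on_imp_continuous_on by blast

lemma traj_u_integral:
  assumes "traj p q F u v" "x \<in> {p..q}"
  shows "u x = u p + integral {p..x} v"
proof -
  have "(v has_integral (u x - u p)) {p..x}"
  proof (rule fundamental_theorem_of_calculus)
    show "(u has_vector_derivative v y) (at y within {p..x})" if "y \<in> {p..x}" for y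
    proof -
      have "(u has_real_derivative v y) (at y within {p..q})" using assms that by (simp add: traj_def)
      then have "(u has_real_derivative v y) (at y within {p..x})"
        by (rule DERIV_subset) (use assms in auto)
      then show ?thesis by (simp add: has_real_derivative_iff_has_vector_derivative)
    qed
  qed (use assms in auto)
  then show ?thesis by (simp add: integral_unique)
qed

lemma traj_ac_u:
  assumes "traj p q F u v"
  shows "abs_cont_on p q u"
proof (rule abs_cont_on_indefinite_integral)
  show "v absolutely_integrable_on {p..q}"
    by (rule absolutely_integrable_continuous_real[OF traj_cont_v[OF assms]])
  show "u x = u p + integral {p..x} v" if "x \<in> {p..q}" for x
    by (rule traj_u_integral[OF assms that])
qed

lemma traj_AE:
  assumes "traj p q F u v"
  shows "AE x in lebesgue. x \<in> {p..q} \<longrightarrow> (v has_real_derivative - F x) (at x within {p..q})"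
proof -
  have "F integrable_on {p..q}" using traj_integrable[OF assms] by simp
  from AE_has_real_derivative_indefinite_integral[OF this]
  show ?thesis
  proof (rule AE_mp, intro AE_I2 impI)
    fix x assume d: "x \<in> {p..q} \<longrightarrow> ((\<lambda>x. integral {p..x} F) has_real_derivative F x) (at x within {p..q})"
      and x: "x \<in> {p..q}"
    then have "((\<lambda>x. v p - integral {p..x} F) has_real_derivative - F x) (at x within {p..q})"
      by (auto intro!: derivative_eq_intros)
    then show "(v has_real_derivative - F x) (at x within {p..q})"
      by (rule has_field_derivative_transform_within[where d=1]) (use assms x in \<open>auto simp: traj_def\<close>)
  qed
qed

text \<open>Converse of \<open>traj_ac_v\<close> and \<open>traj_AE\<close>: an eigenfunction in the
  sense of \<open>SL_eigenvalue\<close> becomes a trajectory and can be compared with shooting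
  solutions.\<close>

lemma trajI_ac:
  assumes "p \<le> q" "abs_cont_on p q v" "F absolutely_integrable_on {p..q}"
    and "\<And>x. x \<in> {p..q} \<Longrightarrow> (u has_real_derivative v x) (at x within {p..q})"
    and "AE x in lebesgue. x \<in> {p..q} \<longrightarrow> (v has_real_derivative - F x) (at x within {p..q})"
  shows "traj p q F u v"
  unfolding traj_def
proof (intro conjI ballI)
  show "integral {p..x} F = v p - v x" if x: "x \<in> {p..q}" for x
  proof -
    have ac: "abs_cont_on p x v"
      unfolding abs_cont_on_def
    proof (intro allI impI)
      fix e :: real assume "e > 0"
      then obtain d where d: "d > 0" "\<forall>(n::nat) (a::nat \<Rightarrow> real) (b::nat \<Rightarrow> real).
        (\<forall>k<n. p \<le> a k \<and> a k \<le> b k \<and> b k \<le> q) \<and>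
        (\<forall>k<n. \<forall>l<n. k \<noteq> l \<longrightarrow> b k \<le> a l \<or> b l \<le> a k) \<and>
        (\<Sum>k<n. b k - a k) < d \<longrightarrow> (\<Sum>k<n. \<bar>v (b k) - v (a k)\<bar>) < e"
        using assms(2) unfolding abs_cont_on_def by blast
      show "\<exists>d>0. \<forall>(n::nat) (a::nat \<Rightarrow> real) (b::nat \<Rightarrow> real).
        (\<forall>k<n. p \<le> a k \<and> a k \<le> b k \<and> b k \<le> x) \<and>
        (\<forall>k<n. \<forall>l<n. k \<noteq> l \<longrightarrow> b k \<le> a l \<or> b l \<le> a k) \<and>
        (\<Sum>k<n. b k - a k) < d \<longrightarrow> (\<Sum>k<n. \<bar>v (b k) - v (a k)\<bar>) < e"
      proof (intro exI conjI allI impI)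
        fix n :: nat and a b :: "nat \<Rightarrow> real"
        assume A: "(\<forall>k<n. p \<le> a k \<and> a k \<le> b k \<and> b k \<le> x) \<and>
        (\<forall>k<n. \<forall>l<n. k \<noteq> l \<longrightarrow> b k \<le> a l \<or> b l \<le> a k) \<and>
        (\<Sum>k<n. b k - a k) < d"
        show "(\<Sum>k<n. \<bar>v (b k) - v (a k)\<bar>) < e"
          by (rule d(2)[rule_format]) (use A x in fastforce)
      qed (rule d(1))
    qed
    have "((\<lambda>x. - F x) has_integral (v x - v p)) {p..x}"
    proof (rule abs_cont_on_has_integral[OF _ ac])
      show "AE y in lebesgue. y \<in> {p..x} \<longrightarrow> (v has_real_derivative - F y) (at y within {p..x})"
        using assms(5)
        by (rule AE_mp) (use x in \<open>auto intro!: AE_I2 intro: DERIV_subset\<close>)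
    qed (use x in auto)
    then have "(F has_integral (v p - v x)) {p..x}"
      using has_integral_neg[of "\<lambda>x. - F x" "v x - v p" "{p..x}"] by simp
    then show ?thesis by (simp add: integral_unique)
  qed
qed (use assms in auto)

lemma abs_int_mult_cont:
  fixes f g :: "real \<Rightarrow> real"
  assumes "f absolutely_integrable_on {p..q}" "continuous_on {p..q} g"
  shows "(\<lambda>x. f x * g x) absolutely_integrable_on {p..q}" "(\<lambda>x. g x * f x) absolutely_integrable_on {p..q}"
proof -
  have m: "g \<in> borel_measurable (lebesgue_on {p..q})"
    using assms(2) by (simp add: continuous_imp_measurable_on_sets_lebesgue)
  have b: "bounded (g ` {p..q})"
    using assms(2) by (auto intro!: compact_imp_bounded compact_continuous_image)
  show "(\<lambda>x. g x * f x) absolutely_integrable_on {p..q}"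
    by (rule absolutely_integrable_bounded_measurable_product_real[OF m _ b assms(1)]) auto
  then show "(\<lambda>x. f x * g x) absolutely_integrable_on {p..q}" by (simp add: mult.commute)
qed

text \<open>Lagrange identity: in the derivative of \<open>v x * \<phi> x - u x * \<psi> x\<close>
  the terms \<open>v x * \<psi> x\<close> cancel. It is the common source of the comparisons with
  the parabola, with a principal eigenfunction and with the positive function below
  \<open>lam0\<close>.\<close>

lemma traj_wronskian:
  assumes pq: "p \<le> q" and u: "traj p q F u v" and \<phi>: "traj p q G \<phi> \<psi>"
  shows "((\<lambda>x. u x * G x - \<phi> x * F x) has_integral
    ((v q * \<phi> q - u q * \<psi> q) - (v p * \<phi> p - u p * \<psi> p))) {p..q}"
proof (rule abs_cont_on_has_integral[OF pq, of "\<lambda>x. v x * \<phi> x - u x * \<psi> x"])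
  show "abs_cont_on p q (\<lambda>x. v x * \<phi> x - u x * \<psi> x)"
    by (intro abs_cont_on_diff abs_cont_on_mult traj_ac_v[OF u] traj_ac_u[OF u] traj_ac_v[OF \<phi>] traj_ac_u[OF \<phi>])
  show "AE x in lebesgue. x \<in> {p..q} \<longrightarrow>
     ((\<lambda>x. v x * \<phi> x - u x * \<psi> x) has_real_derivative u x * G x - \<phi> x * F x) (at x within {p..q})"
    using traj_AE[OF u] traj_AE[OF \<phi>]
  proof eventually_elim
    case (elim x)
    show ?case
    proof
      assume x: "x \<in> {p..q}"
      have "(u has_real_derivative v x) (at x within {p..q})" "(\<phi> has_real_derivative \<psi> x) (at x within {p..q})"
        using u \<phi> x unfolding traj_def by auto
      then show "((\<lambda>x. v x * \<phi> x - u x * \<psi> x) has_real_derivative u x * G x - \<phi> x * F x) (at x within {p..q})"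
        using elim x by (auto intro!: derivative_eq_intros)
    qed
  qed
qed

lemma traj_mvt:
  assumes "traj p q F u v" "p \<le> x" "x < y" "y \<le> q"
  obtains z where "x < z" "z < y" "u y - u x = v z * (y - x)"
proof -
  have "continuous_on {x..y} u"
    using traj_cont_u[OF assms(1)] assms by (auto intro: continuous_on_subset)
  moreover have "(u has_derivative (*) (v z)) (at z)" if "x < z" "z < y" for z
  proof -
    have "(u has_real_derivative v z) (at z within {p..q})" using assms that by (auto simp: traj_def)
    then have "(u has_real_derivative v z) (at z)"
      using that assms at_within_Icc_at[of p z q] by simp
    then show ?thesis by (simp add: has_field_derivative_def)
  qed
  ultimately obtain z where "x < z" "z < y" "u y - u x = v z * (y - x)"
    using mvt[of x y u "\<lambda>z. (*) (v z)"] assms(3) by auto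
  then show ?thesis by (rule that)
qed

lemma traj_slope_ge:
  assumes "traj p q F u v" "p \<le> x" "x \<le> y" "y \<le> q" "\<And>z. x \<le> z \<Longrightarrow> z \<le> y \<Longrightarrow> v z \<ge> c"
  shows "u y - u x \<ge> c * (y - x)"
proof (cases "x = y")
  case False
  then have "x < y" using assms(3) by simp
  then obtain z where "x < z" "z < y" "u y - u x = v z * (y - x)"
    using traj_mvt[OF assms(1,2) _ assms(4)] by blast
  then show ?thesis using assms(5)[of z] by (simp add: mult_right_mono)
qed auto

lemma traj_neg:
  assumes "traj p q F u v" shows "traj p q (\<lambda>x. - F x) (\<lambda>x. - u x) (\<lambda>x. - v x)"
  using assms unfolding traj_def by (auto intro: DERIV_minus abs_int_neg)

lemma traj_slope_le:
  assumes "traj p q F u v" "p \<le> x" "x \<le> y" "y \<le> q" "\<And>z. x \<le> z \<Longrightarrow> z \<le> y \<Longrightarrow> v z \<le> c"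
  shows "u y - u x \<le> c * (y - x)"
  using traj_slope_ge[OF traj_neg[OF assms(1)] assms(2-4), of "-c"] assms(5) by auto

lemma traj_v_antimono:
  assumes "traj p q F u v" "p \<le> x" "x \<le> y" "y \<le> q" "\<And>z. x \<le> z \<Longrightarrow> z \<le> y \<Longrightarrow> F z \<ge> 0"
  shows "v y \<le> v x"
proof -
  have "integral {x..y} F \<ge> 0" by (rule integral_nonneg)
    (use assms traj_integrable[OF assms(1)] in auto)
  then show ?thesis using traj_v_diff[OF assms(1-4)] by simp
qed

lemma traj_v_mono:
  assumes "traj p q F u v" "p \<le> x" "x \<le> y" "y \<le> q" "\<And>z. x \<le> z \<Longrightarrow> z \<le> y \<Longrightarrow> F z \<le> 0"
  shows "v x \<le> v y"
  using traj_v_antimono[OF traj_neg[OF assms(1)] assms(2-4)] assms(5) by auto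

text \<open>\<open>v\<close> is nonincreasing, so the slope at the middle point separates the slopes
  of the two chords. The product form avoids division, hence coinciding points need no separate
  treatment.\<close>

lemma traj_concave:
  assumes u: "traj p q F u v" and F: "\<And>z. p \<le> z \<Longrightarrow> z \<le> q \<Longrightarrow> F z \<ge> 0"
    and "p \<le> x" "x \<le> y" "y \<le> z" "z \<le> q"
  shows "(z - y) * u x + (y - x) * u z \<le> (z - x) * u y"
proof -
  have 1: "u y - u x \<ge> v y * (y - x)"
    by (rule traj_slope_ge[OF u]) (use assms in \<open>auto intro!: traj_v_antimono[OF u]\<close>)
  have 2: "u z - u y \<le> v y * (z - y)"
    by (rule traj_slope_le[OF u]) (use assms in \<open>auto intro!: traj_v_antimono[OF u]\<close>)
  have "(z - y) * (u y - u x) \<ge> (z - y) * (v y * (y - x))"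
    using 1 assms by (intro mult_left_mono) auto
  moreover have "(y - x) * (u z - u y) \<le> (y - x) * (v y * (z - y))"
    using 2 assms by (intro mult_left_mono) auto
  ultimately show ?thesis by (simp add: algebra_simps)
qed

lemma traj_convex:
  assumes u: "traj p q F u v" and F: "\<And>z. p \<le> z \<Longrightarrow> z \<le> q \<Longrightarrow> F z \<le> 0"
    and "p \<le> x" "x \<le> y" "y \<le> z" "z \<le> q"
  shows "(z - x) * u y \<le> (z - y) * u x + (y - x) * u z"
  using traj_concave[OF traj_neg[OF u], of x y z] assms by auto

lemma traj_convex_le_max:
  assumes u: "traj p q F u v" and F: "\<And>z. p \<le> z \<Longrightarrow> z \<le> q \<Longrightarrow> F z \<le> 0"
    and "p \<le> x" "x \<le> q" "u p \<le> B" "u q \<le> B"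
  shows "u x \<le> B"
proof (cases "p = q")
  case False
  then have pq: "p < q" using assms by simp
  have "(q - p) * u x \<le> (q - x) * u p + (x - p) * u q"
    using traj_convex[OF u F, of p x q] assms by auto
  also have "\<dots> \<le> (q - x) * B + (x - p) * B"
    using assms by (intro add_mono mult_left_mono) auto
  also have "\<dots> = (q - p) * B" by (simp add: algebra_simps)
  finally show ?thesis using pq by simp
qed (use assms in auto)

text \<open>A hat of height 1/2 that lies below every nonnegative concave function on
  \<open>{p..q}\<close> divided by its value at any point where that value is positive. Lower bounds
  by \<open>tent\<close> thus do not depend on where the maximum sits.\<close>

definition tent :: "real \<Rightarrow> real \<Rightarrow> real \<Rightarrow> real" where
  "tent p q x = min (x - p) (q - x) / (q - p)"

lemma tent_pos: "p < x \<Longrightarrow> x < q \<Longrightarrow> 0 < tent p q x"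
  by (simp add: tent_def)

lemma tent_nonneg: "p \<le> x \<Longrightarrow> x \<le> q \<Longrightarrow> 0 \<le> tent p q x"
  by (simp add: tent_def)

lemma tent_cont: "continuous_on S (tent p q)"
  unfolding tent_def[abs_def] divide_inverse by (intro continuous_intros)

text \<open>By concavity \<open>u\<close> lies above the chord from the endpoint on the side of
  \<open>x\<close> to the point over \<open>\<xi>\<close>; this chord is at least as steep as the
  side of the tent scaled by \<open>u \<xi>\<close>.\<close>

lemma traj_ge_tent:
  assumes u: "traj p q F u v" and F: "\<And>z. p \<le> z \<Longrightarrow> z \<le> q \<Longrightarrow> F z \<ge> 0"
    and "p < q" "0 \<le> u p" "0 \<le> u q" "x \<in> {p..q}" "\<xi> \<in> {p..q}" "0 \<le> u \<xi>"
  shows "u x \<ge> u \<xi> * tent p q x"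
proof (cases "x \<le> \<xi>")
  case True
  have c: "(\<xi> - x) * u p + (x - p) * u \<xi> \<le> (\<xi> - p) * u x"
    by (rule traj_concave[OF u F]) (use assms(6,7) True in auto)
  show ?thesis
  proof (cases "\<xi> = p")
    case True
    then have "x = p" using assms(6) \<open>x \<le> \<xi>\<close> by simp
    then show ?thesis using assms(3,4) by (simp add: tent_def)
  next
    case False
    then have \<xi>: "\<xi> > p" using assms(7) by simp
    have "(\<xi> - p) * (u \<xi> * tent p q x) \<le> (q - p) * (u \<xi> * tent p q x)"
      using assms(3,6,7,8) tent_nonneg[of p x q] by (intro mult_right_mono) auto
    also have "\<dots> = u \<xi> * min (x - p) (q - x)" using assms(3) by (simp add: tent_def)
    also have "\<dots> \<le> u \<xi> * (x - p)" using assms(8) by (intro mult_left_mono) auto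
    also have "\<dots> \<le> (\<xi> - p) * u x"
    proof -
      have "(\<xi> - x) * u p \<ge> 0" using assms(4) \<open>x \<le> \<xi>\<close> by simp
      then show ?thesis using c by (simp add: algebra_simps)
    qed
    finally show ?thesis using \<xi> by simp
  qed
next
  case False
  have c: "(q - x) * u \<xi> + (x - \<xi>) * u q \<le> (q - \<xi>) * u x"
    by (rule traj_concave[OF u F]) (use assms(6,7) False in auto)
  have \<xi>: "\<xi> < q" using assms(6,7) False by auto
  have "(q - \<xi>) * (u \<xi> * tent p q x) \<le> (q - p) * (u \<xi> * tent p q x)"
    using assms(3,6,7,8) tent_nonneg[of p x q] by (intro mult_right_mono) auto
  also have "\<dots> = u \<xi> * min (x - p) (q - x)" using assms(3) by (simp add: tent_def)
  also have "\<dots> \<le> u \<xi> * (q - x)" using assms(8) by (intro mult_left_mono) auto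
  also have "\<dots> \<le> (q - \<xi>) * u x"
  proof -
    have "(x - \<xi>) * u q \<ge> 0" using assms(5) False by simp
    then show ?thesis using c by (simp add: algebra_simps)
  qed
  finally show ?thesis using \<xi> by simp
qed

section \<open>Existence, stability and sign of trajectories\<close>

text \<open>Bielecki weight for an integrable coefficient: against the exponential, integration with
  kernel \<open>w\<close> contracts by 1/2. The excess of \<open>w\<close> over \<open>n\<close> has
  mass below 1/4, and the bounded part gains the factor \<open>n / c\<close>, at most 1/4 for
  \<open>c = 4 * n + 4\<close>.\<close>

lemma exp_weight:
  fixes w :: "real \<Rightarrow> real"
  assumes w: "w absolutely_integrable_on {p..q}" and wn: "\<And>x. x \<in> {p..q} \<Longrightarrow> 0 \<le> w x"
  obtains c where "c > 0" "\<And>x. x \<in> {p..q} \<Longrightarrow> integral {p..x} (\<lambda>\<xi>. w \<xi> * exp (c * (\<xi> - p))) \<le> exp (c * (x - p)) / 2"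
proof -
  define F where "F n x = max 0 (\<bar>w x\<bar> - real n)" for n x
  obtain n where Fint: "F n integrable_on {p..q}" and n: "integral {p..q} (F n) < 1/4"
    using integral_truncation_small[OF w, of "1/4"] unfolding F_def by auto
  define c where "c = 4 * real n + 4"
  have c: "c > 0" "real n / c \<le> 1/4" by (simp_all add: c_def field_simps)
  have "integral {p..x} (\<lambda>\<xi>. w \<xi> * exp (c * (\<xi> - p))) \<le> exp (c * (x - p)) / 2" if x: "x \<in> {p..q}" for x
  proof -
    define E where "E \<xi> = exp (c * (\<xi> - p))" for \<xi>
    have Ei: "(E has_integral (E x / c - E p / c)) {p..x}"
      unfolding E_def using c x
      by (intro fundamental_theorem_of_calculus)
        (auto intro!: derivative_eq_intros simp: has_real_derivative_iff_has_vector_derivative[symmetric])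
    have Fx: "F n integrable_on {p..x}" by (rule integrable_on_subinterval[OF Fint]) (use x in auto)
    have wE: "(\<lambda>\<xi>. w \<xi> * E \<xi>) integrable_on {p..x}"
      by (rule abs_int_imp_int, rule abs_int_mult_cont)
        (use x w in \<open>auto intro!: absolutely_integrable_on_subinterval[OF w] continuous_intros simp: E_def\<close>)
    have R: "((\<lambda>\<xi>. F n \<xi> * E x + real n * E \<xi>) has_integral
        (integral {p..x} (F n) * E x + real n * (E x / c - E p / c))) {p..x}"
      by (intro has_integral_add has_integral_mult_left has_integral_mult_right Ei integrable_integral Fx)
    have "integral {p..x} (\<lambda>\<xi>. w \<xi> * E \<xi>) \<le> integral {p..x} (\<lambda>\<xi>. F n \<xi> * E x + real n * E \<xi>)"
    proof (rule integral_le[OF wE])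
      show "(\<lambda>\<xi>. F n \<xi> * E x + real n * E \<xi>) integrable_on {p..x}" using R by blast
      fix \<xi> assume \<xi>: "\<xi> \<in> {p..x}"
      have "w \<xi> \<le> F n \<xi> + real n" by (simp add: F_def)
      then have "w \<xi> * E \<xi> \<le> (F n \<xi> + real n) * E \<xi>" by (intro mult_right_mono) (auto simp: E_def)
      also have "\<dots> \<le> F n \<xi> * E x + real n * E \<xi>"
      proof -
        have "E \<xi> \<le> E x" using \<xi> c by (simp add: E_def)
        moreover have "F n \<xi> \<ge> 0" by (simp add: F_def)
        ultimately show ?thesis by (simp add: distrib_right mult_left_mono)
      qed
      finally show "w \<xi> * E \<xi> \<le> F n \<xi> * E x + real n * E \<xi>" .
    qed
    also have "\<dots> = integral {p..x} (F n) * E x + real n * (E x / c - E p / c)"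
      using R by (rule integral_unique)
    also have "\<dots> \<le> 1/4 * E x + real n / c * E x"
    proof (rule add_mono)
      have "integral {p..x} (F n) \<le> integral {p..q} (F n)"
        by (rule integral_subset_le[OF _ Fx Fint]) (use x in \<open>auto simp: F_def\<close>)
      then show "integral {p..x} (F n) * E x \<le> 1/4 * E x"
        using n by (intro mult_right_mono) (auto simp: E_def)
      show "real n * (E x / c - E p / c) \<le> real n / c * E x"
        using c by (simp add: E_def algebra_simps)
    qed
    also have "\<dots> \<le> 1/4 * E x + 1/4 * E x"
      using c(2) by (intro add_left_mono mult_right_mono) (auto simp: E_def)
    finally show ?thesis by (simp add: E_def)
  qed
  with c(1) that show ?thesis by blast
qed

text \<open>Evaluate the inequality where \<open>y\<close> divided by the exponential weight is
  largest: there the integral absorbs at most half of \<open>y\<close>. The constant depends on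
  \<open>w\<close> and the interval, not on \<open>y\<close> or \<open>E\<close>.\<close>

lemma gronwall_L1:
  fixes w :: "real \<Rightarrow> real"
  assumes pq: "p \<le> q" and w: "w absolutely_integrable_on {p..q}" and wn: "\<And>x. x \<in> {p..q} \<Longrightarrow> 0 \<le> w x"
  obtains C where "C \<ge> 1" "\<And>y E x. continuous_on {p..q} y \<Longrightarrow>
    (\<And>x. x \<in> {p..q} \<Longrightarrow> 0 \<le> y x) \<Longrightarrow>
    (\<And>x. x \<in> {p..q} \<Longrightarrow> y x \<le> E + integral {p..x} (\<lambda>\<xi>. w \<xi> * y \<xi>)) \<Longrightarrow> x \<in> {p..q} \<Longrightarrow> y x \<le> C * E"
proof -
  obtain c where c: "c > 0" "\<And>x. x \<in> {p..q} \<Longrightarrow> integral {p..x} (\<lambda>\<xi>. w \<xi> * exp (c * (\<xi> - p))) \<le> exp (c * (x - p)) / 2"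
    using exp_weight[OF w wn] by blast
  define X where "X \<xi> = exp (c * (\<xi> - p))" for \<xi>
  have Xpos: "X \<xi> > 0" for \<xi> by (simp add: X_def)
  have "y x \<le> (2 * X q) * E" if y: "continuous_on {p..q} y" "\<And>x. x \<in> {p..q} \<Longrightarrow> 0 \<le> y x"
    "\<And>x. x \<in> {p..q} \<Longrightarrow> y x \<le> E + integral {p..x} (\<lambda>\<xi>. w \<xi> * y \<xi>)" "x \<in> {p..q}" for y E x
  proof -
    have "continuous_on {p..q} (\<lambda>x. y x / X x)"
      using y(1) by (auto intro!: continuous_intros simp: X_def)
    then obtain x0 where x0: "x0 \<in> {p..q}" "\<And>x. x \<in> {p..q} \<Longrightarrow> y x / X x \<le> y x0 / X x0"
      using continuous_attains_sup[of "{p..q}" "\<lambda>x. y x / X x"] pq by auto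
    define M where "M = y x0 / X x0"
    have yM: "y x \<le> M * X x" if "x \<in> {p..q}" for x
      using x0(2)[OF that] Xpos[of x] by (simp add: M_def field_simps)
    have M0: "M \<ge> 0" using y(2)[OF x0(1)] Xpos[of x0] by (simp add: M_def)
    have i1: "(\<lambda>\<xi>. w \<xi> * y \<xi>) integrable_on {p..x0}"
      by (rule abs_int_imp_int, rule abs_int_mult_cont)
        (use x0 in \<open>auto intro!: absolutely_integrable_on_subinterval[OF w] continuous_on_subset[OF y(1)]\<close>)
    have i2: "(\<lambda>\<xi>. w \<xi> * X \<xi>) integrable_on {p..x0}"
      by (rule abs_int_imp_int, rule abs_int_mult_cont)
        (use x0 in \<open>auto intro!: absolutely_integrable_on_subinterval[OF w] continuous_intros simp: X_def\<close>)
    have "integral {p..x0} (\<lambda>\<xi>. w \<xi> * y \<xi>) \<le> integral {p..x0} (\<lambda>\<xi>. M * (w \<xi> * X \<xi>))"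
    proof (rule integral_le[OF i1 integrable_on_cmult_left[OF i2, of M, simplified]])
      fix \<xi> assume "\<xi> \<in> {p..x0}"
      then have "\<xi> \<in> {p..q}" using x0 by auto
      then have "w \<xi> * y \<xi> \<le> w \<xi> * (M * X \<xi>)" by (intro mult_left_mono yM wn)
      then show "w \<xi> * y \<xi> \<le> M * (w \<xi> * X \<xi>)" by (simp add: algebra_simps)
    qed
    also have "\<dots> = M * integral {p..x0} (\<lambda>\<xi>. w \<xi> * X \<xi>)" by simp
    also have "\<dots> \<le> M * (X x0 / 2)"
      using c(2)[OF x0(1)] M0 by (intro mult_left_mono) (auto simp: X_def)
    finally have "y x0 \<le> E + M * X x0 / 2" using y(3)[OF x0(1)] by simp
    moreover have "y x0 = M * X x0" using Xpos[of x0] by (simp add: M_def)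
    ultimately have "M * X x0 \<le> 2 * E" by simp
    moreover have "M * 1 \<le> M * X x0" using x0 c M0 by (intro mult_left_mono) (auto simp: X_def)
    ultimately have ME: "M \<le> 2 * E" by simp
    have "y x \<le> M * X x" using yM y(4) .
    also have "\<dots> \<le> M * X q" using y(4) c M0 by (intro mult_left_mono) (auto simp: X_def)
    also have "\<dots> \<le> 2 * E * X q" using ME Xpos[of q] by (intro mult_right_mono) auto
    finally show ?thesis by (simp add: mult_ac)
  qed
  moreover have "2 * X q \<ge> 1"
  proof -
    have "X q \<ge> 1" using pq c by (simp add: X_def)
    then show ?thesis by simp
  qed
  ultimately show ?thesis using that[of "2 * X q"] by blast
qed

text \<open>The Lipschitz bound holds for all real \<open>s\<close>, so solutions exist on the whole
  interval. The last clause takes the place of Caratheodory measurability: only substitution of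
  continuous functions is ever required.\<close>

definition lip_field :: "real \<Rightarrow> real \<Rightarrow> (real \<Rightarrow> real) \<Rightarrow> (real \<Rightarrow> real \<Rightarrow> real) \<Rightarrow> bool" where
  "lip_field p q w F \<longleftrightarrow> w absolutely_integrable_on {p..q} \<and> (\<forall>x\<in>{p..q}. 0 \<le> w x) \<and>
     (\<forall>x\<in>{p..q}. \<forall>s s'. \<bar>F x s - F x s'\<bar> \<le> w x * \<bar>s - s'\<bar>) \<and>
     (\<forall>u. continuous_on {p..q} u \<longrightarrow> (\<lambda>x. F x (u x)) absolutely_integrable_on {p..q})"

lemma trajI_integral:
  assumes F: "F absolutely_integrable_on {p..q}"
    and v: "\<And>x. x \<in> {p..q} \<Longrightarrow> v x = v0 - integral {p..x} F"
    and u: "\<And>x. x \<in> {p..q} \<Longrightarrow> u x = u0 + integral {p..x} v"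
  shows "traj p q F u v"
  unfolding traj_def
proof (intro conjI ballI)
  have cv: "continuous_on {p..q} v"
  proof (rule continuous_on_eq)
    show "continuous_on {p..q} (\<lambda>x. v0 - integral {p..x} F)"
      by (intro continuous_intros indefinite_integral_continuous_1 abs_int_imp_int F)
  qed (simp add: v)
  fix x assume x: "x \<in> {p..q}"
  have "v p = v0" using v[of p] x by simp
  then show "integral {p..x} F = v p - v x" using v[OF x] by simp
  have "((\<lambda>x. u0 + integral {p..x} v) has_real_derivative v x) (at x within {p..q})"
    using integral_has_real_derivative[OF cv x] by (auto intro!: derivative_eq_intros)
  then show "(u has_real_derivative v x) (at x within {p..q})"
    by (rule has_field_derivative_transform_within[where d=1]) (use u x in auto)
qed (rule F)

lemma lip_field_diff:
  assumes L: "lip_field p q w F" and u: "continuous_on {p..q} u" and z: "continuous_on {p..q} z" and x: "x \<in> {p..q}"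
  shows "\<bar>integral {p..x} (\<lambda>s. F s (u s)) - integral {p..x} (\<lambda>s. F s (z s))\<bar> \<le> integral {p..x} (\<lambda>s. w s * \<bar>u s - z s\<bar>)"
proof -
  have i: "(\<lambda>s. F s (u s)) integrable_on {p..x}" "(\<lambda>s. F s (z s)) integrable_on {p..x}"
    using L u z x unfolding lip_field_def
    by (auto intro!: abs_int_imp_int intro: absolutely_integrable_on_subinterval[where S="{p..q}"])
  have wi: "(\<lambda>s. w s * \<bar>u s - z s\<bar>) integrable_on {p..x}"
  proof (rule abs_int_imp_int, rule abs_int_mult_cont)
    show "w absolutely_integrable_on {p..x}"
      using L x unfolding lip_field_def by (auto intro: absolutely_integrable_on_subinterval[where S="{p..q}"])
    show "continuous_on {p..x} (\<lambda>s. \<bar>u s - z s\<bar>)"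
      using x by (auto intro!: continuous_intros intro: continuous_on_subset[OF u] continuous_on_subset[OF z])
  qed
  have "norm (integral {p..x} (\<lambda>s. F s (u s) - F s (z s))) \<le> integral {p..x} (\<lambda>s. w s * \<bar>u s - z s\<bar>)"
  proof (rule integral_norm_bound_integral[OF integrable_diff[OF i] wi])
    show "norm (F s (u s) - F s (z s)) \<le> w s * \<bar>u s - z s\<bar>" if "s \<in> {p..x}" for s
      using L that x unfolding lip_field_def by auto
  qed
  then show ?thesis using integral_diff[OF i] by simp
qed

text \<open>Picard iteration for the pair of integral equations. In the exponentially weighted norm
  the iteration contracts on all of \<open>{p..q}\<close> at once, so no local solutions have to be
  glued.\<close>

theorem ode_exists:
  assumes pq: "p \<le> q" and L: "lip_field p q w F"
  obtains u v where "traj p q (\<lambda>x. F x (u x)) u v" "u p = u0" "v p = v0"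
proof -
  \<comment> \<open>The factor \<open>K\<close> pays for the second integration, from velocity to
    position; weighting \<open>K * w\<close> makes both integrations together contract by
    1/2.\<close>
  define K where "K = q - p + 1"
  have K: "K > 0" using pq by (simp add: K_def)
  have w: "w absolutely_integrable_on {p..q}" "\<And>x. x \<in> {p..q} \<Longrightarrow> 0 \<le> w x"
    using L by (auto simp: lip_field_def)
  have w2: "(\<lambda>x. K * w x) absolutely_integrable_on {p..q}"
    by (rule abs_int_mult_cont(2)[OF w(1)]) auto
  obtain c where c: "c > 0" "\<And>x. x \<in> {p..q} \<Longrightarrow>
     integral {p..x} (\<lambda>\<xi>. (K * w \<xi>) * exp (c * (\<xi> - p))) \<le> exp (c * (x - p)) / 2"
    using exp_weight[OF w2] w(2) K by (smt (verit, best) mult_nonneg_nonneg)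
  define E where "E \<xi> = exp (c * (\<xi> - p))" for \<xi>
  have Epos: "E \<xi> > 0" for \<xi> by (simp add: E_def)
  have Emono: "E \<xi> \<le> E x" if "\<xi> \<le> x" for \<xi> x using that c by (simp add: E_def)
  have Econt: "continuous_on S E" for S unfolding E_def by (intro continuous_intros)
  have wE: "integral {p..x} (\<lambda>\<xi>. w \<xi> * E \<xi>) \<le> E x / (2 * K)" if "x \<in> {p..q}" for x
  proof -
    have "integral {p..x} (\<lambda>\<xi>. (K * w \<xi>) * E \<xi>) = K * integral {p..x} (\<lambda>\<xi>. w \<xi> * E \<xi>)"
      by (simp add: mult.assoc)
    then show ?thesis using c(2)[OF that] K unfolding E_def[symmetric] by (simp add: field_simps)
  qed
  define V where "V u \<xi> = v0 - integral {p..\<xi>} (\<lambda>s. F s (u s))" for u \<xi>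
  define T where "T u x = u0 + integral {p..x} (V u)" for u x
  have Vc: "continuous_on {p..q} (V u)" if "continuous_on {p..q} u" for u
    unfolding V_def using L that
    by (intro continuous_intros indefinite_integral_continuous_1 abs_int_imp_int) (auto simp: lip_field_def)
  have Tc: "continuous_on {p..q} (T u)" if "continuous_on {p..q} u" for u
    unfolding T_def
    by (intro continuous_intros indefinite_integral_continuous_1 integrable_continuous_real Vc that)
  have Tdiff: "\<bar>T u x - T z x\<bar> \<le> D * E x / 2"
    if uz: "continuous_on {p..q} u" "continuous_on {p..q} z" "\<And>s. s \<in> {p..q} \<Longrightarrow> \<bar>u s - z s\<bar> \<le> D * E s"
      and x: "x \<in> {p..q}" and D: "D \<ge> 0" for u z D x
  proof -
    have VV: "\<bar>V u \<xi> - V z \<xi>\<bar> \<le> D * (E x / (2 * K))" if \<xi>: "\<xi> \<in> {p..x}" for \<xi>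
    proof -
      have \<xi>q: "\<xi> \<in> {p..q}" using \<xi> x by auto
      have wa: "w absolutely_integrable_on {p..\<xi>}"
        using \<xi>q by (auto intro: absolutely_integrable_on_subinterval[OF w(1)])
      have "\<bar>V u \<xi> - V z \<xi>\<bar> \<le> integral {p..\<xi>} (\<lambda>s. w s * \<bar>u s - z s\<bar>)"
        using lip_field_diff[OF L uz(1,2) \<xi>q] by (simp add: V_def)
      also have "\<dots> \<le> integral {p..\<xi>} (\<lambda>s. D * (w s * E s))"
      proof (rule integral_le)
        show "(\<lambda>s. w s * \<bar>u s - z s\<bar>) integrable_on {p..\<xi>}"
          by (rule abs_int_imp_int, rule abs_int_mult_cont[OF wa])
            (use \<xi>q in \<open>auto intro!: continuous_intros intro: continuous_on_subset[OF uz(1)] continuous_on_subset[OF uz(2)]\<close>)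
        have "(\<lambda>s. w s * E s) integrable_on {p..\<xi>}"
          by (rule abs_int_imp_int, rule abs_int_mult_cont[OF wa Econt])
        then show "(\<lambda>s. D * (w s * E s)) integrable_on {p..\<xi>}"
          using integrable_on_cmult_left by fastforce
        fix s assume "s \<in> {p..\<xi>}"
        then have s: "s \<in> {p..q}" using \<xi>q by auto
        have "w s * \<bar>u s - z s\<bar> \<le> w s * (D * E s)" by (intro mult_left_mono uz(3) w(2) s)
        then show "w s * \<bar>u s - z s\<bar> \<le> D * (w s * E s)" by (simp add: algebra_simps)
      qed
      also have "\<dots> = D * integral {p..\<xi>} (\<lambda>s. w s * E s)" by simp
      also have "\<dots> \<le> D * (E \<xi> / (2 * K))" by (intro mult_left_mono wE \<xi>q D)
      also have "\<dots> \<le> D * (E x / (2 * K))"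
        using Emono[of \<xi> x] \<xi> K D by (intro mult_left_mono divide_right_mono) auto
      finally show ?thesis .
    qed
    have iV: "V u integrable_on {p..x}" "V z integrable_on {p..x}"
      using x by (auto intro!: integrable_continuous_real intro: continuous_on_subset[OF Vc[OF uz(1)]] continuous_on_subset[OF Vc[OF uz(2)]])
    have "norm (integral {p..x} (\<lambda>\<xi>. V u \<xi> - V z \<xi>)) \<le> integral {p..x} (\<lambda>\<xi>. D * (E x / (2 * K)))"
      by (rule integral_norm_bound_integral[OF integrable_diff[OF iV]]) (use VV in auto)
    also have "\<dots> = (x - p) * (D * (E x / (2 * K)))" using x by simp
    also have "\<dots> \<le> K * (D * (E x / (2 * K)))"
      using x D K Epos[of x] by (intro mult_right_mono) (auto simp: K_def)
    also have "\<dots> = D * E x / 2" using K by simp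
    finally show ?thesis using integral_diff[OF iV] by (simp add: T_def)
  qed
  define U where "U n = (T ^^ n) (\<lambda>_. 0)" for n
  have U0: "U 0 = (\<lambda>_. 0)" and US: "U (Suc n) = T (U n)" for n by (simp_all add: U_def)
  have Uc: "continuous_on {p..q} (U n)" for n by (induction n) (auto simp: U0 US Tc)
  obtain D0 where D0: "D0 > 0" "\<And>x. x \<in> {p..q} \<Longrightarrow> \<bar>U 1 x\<bar> \<le> D0"
  proof -
    have "bounded (U 1 ` {p..q})" by (intro compact_imp_bounded compact_continuous_image Uc) auto
    then obtain b where "b > 0" "\<forall>x\<in>{p..q}. norm (U 1 x) \<le> b" unfolding bounded_pos by auto
    then show ?thesis using that[of b] by auto
  qed
  have step: "\<bar>U (Suc n) x - U n x\<bar> \<le> (D0 * (1/2)^n) * E x" if "x \<in> {p..q}" for n x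
    using that
  proof (induction n arbitrary: x)
    case 0
    have "D0 * 1 \<le> D0 * E x" using 0 c D0 by (intro mult_left_mono) (auto simp: E_def)
    then show ?case using D0(2)[OF 0] by (simp add: U0)
  next
    case (Suc n)
    have "\<bar>T (U (Suc n)) x - T (U n) x\<bar> \<le> (D0 * (1/2)^n) * E x / 2"
      by (rule Tdiff[OF Uc Uc Suc.IH Suc.prems]) (use D0 in auto)
    then show ?case by (simp add: US)
  qed
  have ul: "uniform_limit {p..q} (\<lambda>n x. \<Sum>i<n. U (Suc i) x - U i x) (\<lambda>x. suminf (\<lambda>i. U (Suc i) x - U i x)) sequentially"
  proof (rule Weierstrass_m_test)
    show "norm (U (Suc n) x - U n x) \<le> (D0 * E q) * (1/2)^n" if "x \<in> {p..q}" for n x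
    proof -
      have "(D0 * (1/2)^n) * E x \<le> (D0 * (1/2)^n) * E q"
        using that D0 Emono[of x q] by (intro mult_left_mono) auto
      then show ?thesis using step[OF that, of n] by (simp add: algebra_simps)
    qed
    show "summable (\<lambda>n. (D0 * E q) * (1/2)^n)" by (intro summable_mult summable_geometric) auto
  qed
  define u where "u x = suminf (\<lambda>i. U (Suc i) x - U i x)" for x
  have "(\<Sum>i<n. U (Suc i) x - U i x) = U n x" for n x
    using sum_lessThan_telescope[of "\<lambda>i. U i x" n] by (simp add: U0)
  then have ul: "uniform_limit {p..q} U u sequentially"
    using ul unfolding u_def by simp
  have uc: "continuous_on {p..q} u"
    by (rule uniform_limit_theorem[OF _ ul]) (auto simp: Uc)
  have fix_u: "u x = T u x" if x: "x \<in> {p..q}" for x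
  proof -
    have "(\<lambda>n. U (Suc n) x) \<longlonglongrightarrow> T u x"
    proof (rule tendstoI)
      fix e :: real assume e: "e > 0"
      define D where "D = e / E q"
      have D: "D > 0" using e Epos[of q] by (simp add: D_def)
      have "\<forall>\<^sub>F n in sequentially. \<forall>s\<in>{p..q}. dist (U n s) (u s) < D"
        using ul D unfolding uniform_limit_iff by blast
      then show "\<forall>\<^sub>F n in sequentially. dist (U (Suc n) x) (T u x) < e"
      proof eventually_elim
        case (elim n)
        have "\<bar>T (U n) x - T u x\<bar> \<le> D * E x / 2"
        proof (rule Tdiff[OF Uc uc _ x])
          fix s assume s: "s \<in> {p..q}"
          have "D * 1 \<le> D * E s" using s D c by (intro mult_left_mono) (auto simp: E_def)
          then show "\<bar>U n s - u s\<bar> \<le> D * E s" using elim s by (force simp: dist_real_def)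
        qed (use D in auto)
        also have "\<dots> \<le> D * E q / 2" using Emono[of x q] x D by (intro divide_right_mono mult_left_mono) auto
        also have "\<dots> < e" using e Epos[of q] by (simp add: D_def)
        finally show ?case by (simp add: US dist_real_def)
      qed
    qed
    moreover have "(\<lambda>n. U (Suc n) x) \<longlonglongrightarrow> u x"
      using tendsto_uniform_limitI[OF ul x] by (rule LIMSEQ_Suc)
    ultimately show ?thesis using LIMSEQ_unique by blast
  qed
  have "traj p q (\<lambda>x. F x (u x)) u (V u)"
  proof (rule trajI_integral)
    show "(\<lambda>x. F x (u x)) absolutely_integrable_on {p..q}" using L uc by (auto simp: lip_field_def)
    show "V u x = v0 - integral {p..x} (\<lambda>x. F x (u x))" for x by (simp add: V_def)
    show "u x = u0 + integral {p..x} (V u)" if "x \<in> {p..q}" for x using fix_u[OF that] by (simp add: T_def)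
  qed
  moreover have "u p = u0" using fix_u[of p] pq by (simp add: T_def)
  moreover have "V u p = v0" by (simp add: V_def)
  ultimately show ?thesis by (rule that)
qed

text \<open>The constant depends only on the Lipschitz weight, so one bound serves a whole family of fields.\<close>

theorem ode_stable:
  assumes pq: "p \<le> q" and w: "w absolutely_integrable_on {p..q}" "\<And>x. x \<in> {p..q} \<Longrightarrow> 0 \<le> w x"
  obtains C where "C \<ge> 0" "\<And>F1 F2 u1 v1 u2 v2 x. lip_field p q w F1 \<Longrightarrow>
    traj p q (\<lambda>x. F1 x (u1 x)) u1 v1 \<Longrightarrow> traj p q (\<lambda>x. F2 x (u2 x)) u2 v2 \<Longrightarrow> x \<in> {p..q} \<Longrightarrow>
    \<bar>u1 x - u2 x\<bar> \<le> C * (\<bar>u1 p - u2 p\<bar> + \<bar>v1 p - v2 p\<bar> + integral {p..q} (\<lambda>s. \<bar>F1 s (u2 s) - F2 s (u2 s)\<bar>)) \<and>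
    \<bar>v1 x - v2 x\<bar> \<le> C * (\<bar>u1 p - u2 p\<bar> + \<bar>v1 p - v2 p\<bar> + integral {p..q} (\<lambda>s. \<bar>F1 s (u2 s) - F2 s (u2 s)\<bar>))"
proof -
  define K where "K = q - p + 1"
  have K: "K \<ge> 1" using pq by (simp add: K_def)
  have Kw: "(\<lambda>x. K * w x) absolutely_integrable_on {p..q}"
    by (rule abs_int_mult_cont(2)[OF w(1)]) auto
  have Kwn: "0 \<le> K * w x" if "x \<in> {p..q}" for x using w(2)[OF that] K by simp
  obtain C0 where C0: "C0 \<ge> 1" "\<And>y E x. continuous_on {p..q} y \<Longrightarrow>
    (\<And>x. x \<in> {p..q} \<Longrightarrow> 0 \<le> y x) \<Longrightarrow>
    (\<And>x. x \<in> {p..q} \<Longrightarrow> y x \<le> E + integral {p..x} (\<lambda>\<xi>. (K * w \<xi>) * y \<xi>)) \<Longrightarrow> x \<in> {p..q} \<Longrightarrow> y x \<le> C0 * E"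
    using gronwall_L1[OF pq Kw Kwn] by blast
  define W where "W = integral {p..q} w"
  have W: "W \<ge> 0" unfolding W_def by (intro integral_nonneg abs_int_imp_int w)
  define C where "C = C0 * K + W * (C0 * K) + 1"
  have C: "C \<ge> 0" "C0 * K \<le> C" "W * (C0 * K) + 1 \<le> C" using C0(1) K W by (auto simp: C_def)
  have "\<bar>u1 x - u2 x\<bar> \<le> C * D \<and> \<bar>v1 x - v2 x\<bar> \<le> C * D"
    if L: "lip_field p q w F1" and t1: "traj p q (\<lambda>x. F1 x (u1 x)) u1 v1" and t2: "traj p q (\<lambda>x. F2 x (u2 x)) u2 v2"
      and x: "x \<in> {p..q}"
      and D: "D = \<bar>u1 p - u2 p\<bar> + \<bar>v1 p - v2 p\<bar> + integral {p..q} (\<lambda>s. \<bar>F1 s (u2 s) - F2 s (u2 s)\<bar>)"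
    for F1 F2 u1 v1 u2 v2 x D
  proof -
    define J where "J = integral {p..q} (\<lambda>s. \<bar>F1 s (u2 s) - F2 s (u2 s)\<bar>)"
    define y where "y s = \<bar>u1 s - u2 s\<bar>" for s
    have cu: "continuous_on {p..q} u1" "continuous_on {p..q} u2" using t1 t2 traj_cont_u by blast+
    have cy: "continuous_on {p..q} y" unfolding y_def by (intro continuous_intros cu)
    have a12: "(\<lambda>s. F1 s (u2 s)) absolutely_integrable_on {p..q}" using L cu by (auto simp: lip_field_def)
    have a22: "(\<lambda>s. F2 s (u2 s)) absolutely_integrable_on {p..q}" using t2 by (simp add: traj_def)
    have a: "(\<lambda>s. F1 s (u2 s) - F2 s (u2 s)) absolutely_integrable_on {p..q}"
      by (rule set_integral_diff(1)[OF a12 a22])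
    have aa: "(\<lambda>s. \<bar>F1 s (u2 s) - F2 s (u2 s)\<bar>) integrable_on {p..q}"
      using abs_int_imp_int[OF absolutely_integrable_norm[OF a]] by (simp add: o_def)
    have J: "J \<ge> 0" unfolding J_def by (intro integral_nonneg aa) auto
    have Dg: "D \<ge> \<bar>v1 p - v2 p\<bar> + J" "D \<ge> 0" using J by (auto simp: D J_def)
    have wyi: "(\<lambda>s. w s * y s) integrable_on {p..\<xi>}" if "\<xi> \<in> {p..q}" for \<xi>
      by (rule abs_int_imp_int, rule abs_int_mult_cont)
        (use that in \<open>auto intro: absolutely_integrable_on_subinterval[OF w(1)] continuous_on_subset[OF cy]\<close>)
    have wyn: "0 \<le> w s * y s" if "s \<in> {p..q}" for s using w(2)[OF that] by (simp add: y_def)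
    have vv: "\<bar>v1 \<xi> - v2 \<xi>\<bar> \<le> \<bar>v1 p - v2 p\<bar> + J + integral {p..\<xi>} (\<lambda>s. w s * y s)" if \<xi>: "\<xi> \<in> {p..q}" for \<xi>
    proof -
      have "v1 \<xi> - v2 \<xi> = (v1 p - v2 p) - (integral {p..\<xi>} (\<lambda>s. F1 s (u1 s)) - integral {p..\<xi>} (\<lambda>s. F2 s (u2 s)))"
        using t1 t2 \<xi> by (simp add: traj_def)
      \<comment> \<open>The first field along the second trajectory is inserted: one difference is
        controlled by the Lipschitz weight, the other is the discrepancy of the two fields, measured
        along the second trajectory only.\<close>
      also have "\<bar>\<dots>\<bar> \<le> \<bar>v1 p - v2 p\<bar> + \<bar>integral {p..\<xi>} (\<lambda>s. F1 s (u1 s)) - integral {p..\<xi>} (\<lambda>s. F1 s (u2 s))\<bar>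
         + \<bar>integral {p..\<xi>} (\<lambda>s. F1 s (u2 s)) - integral {p..\<xi>} (\<lambda>s. F2 s (u2 s))\<bar>" by linarith
      also have "\<bar>integral {p..\<xi>} (\<lambda>s. F1 s (u1 s)) - integral {p..\<xi>} (\<lambda>s. F1 s (u2 s))\<bar> \<le> integral {p..\<xi>} (\<lambda>s. w s * y s)"
        using lip_field_diff[OF L cu \<xi>] by (simp add: y_def)
      also have "\<bar>integral {p..\<xi>} (\<lambda>s. F1 s (u2 s)) - integral {p..\<xi>} (\<lambda>s. F2 s (u2 s))\<bar> \<le> J"
      proof -
        have i: "(\<lambda>s. F1 s (u2 s)) integrable_on {p..\<xi>}" "(\<lambda>s. F2 s (u2 s)) integrable_on {p..\<xi>}"
          "(\<lambda>s. \<bar>F1 s (u2 s) - F2 s (u2 s)\<bar>) integrable_on {p..\<xi>}"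
          using \<xi> by (auto intro: integrable_on_subinterval[OF abs_int_imp_int[OF a12]]
            integrable_on_subinterval[OF abs_int_imp_int[OF a22]] integrable_on_subinterval[OF aa])
        have "norm (integral {p..\<xi>} (\<lambda>s. F1 s (u2 s) - F2 s (u2 s))) \<le> integral {p..\<xi>} (\<lambda>s. \<bar>F1 s (u2 s) - F2 s (u2 s)\<bar>)"
          by (rule integral_norm_bound_integral[OF integrable_diff[OF i(1,2)] i(3)]) auto
        also have "\<dots> \<le> J" unfolding J_def by (rule integral_subset_le[OF _ i(3) aa]) (use \<xi> in auto)
        finally show ?thesis using integral_diff[OF i(1,2)] by simp
      qed
      finally show ?thesis by simp
    qed
    have yb: "y \<xi> \<le> C0 * (K * D)" if "\<xi> \<in> {p..q}" for \<xi>
    proof (rule C0(2)[OF cy _ _ that])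
      show "0 \<le> y x" for x by (simp add: y_def)
      fix x assume x: "x \<in> {p..q}"
      define B where "B = \<bar>v1 p - v2 p\<bar> + J + integral {p..x} (\<lambda>s. w s * y s)"
      have Bx: "\<bar>v1 \<xi> - v2 \<xi>\<bar> \<le> B" if "\<xi> \<in> {p..x}" for \<xi>
      proof -
        have "integral {p..\<xi>} (\<lambda>s. w s * y s) \<le> integral {p..x} (\<lambda>s. w s * y s)"
          by (rule integral_subset_le) (use that x wyi wyn in auto)
        then show ?thesis using vv[of \<xi>] that x unfolding B_def by force
      qed
      have B0: "B \<ge> 0" using Bx[of p] x by auto
      have i: "v1 integrable_on {p..x}" "v2 integrable_on {p..x}"
        using traj_cont_v[OF t1] traj_cont_v[OF t2] x
        by (auto intro!: integrable_continuous_real intro: continuous_on_subset)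
      have "norm (integral {p..x} (\<lambda>s. v1 s - v2 s)) \<le> integral {p..x} (\<lambda>s. B)"
        by (rule integral_norm_bound_integral[OF integrable_diff[OF i]]) (use Bx in auto)
      also have "\<dots> \<le> (K - 1) * B" using x B0 by (simp add: K_def mult_right_mono)
      finally have "\<bar>integral {p..x} v1 - integral {p..x} v2\<bar> \<le> (K - 1) * B" using integral_diff[OF i] by simp
      then have "y x \<le> \<bar>u1 p - u2 p\<bar> + (K - 1) * B"
        using traj_u_integral[OF t1 x] traj_u_integral[OF t2 x] by (simp add: y_def)
      also have "\<dots> \<le> K * D + K * integral {p..x} (\<lambda>s. w s * y s)"
      proof -
        have "(K - 1) * B \<le> K * B" using B0 by (intro mult_right_mono) auto
        moreover have "K * B + \<bar>u1 p - u2 p\<bar> \<le> K * B + K * \<bar>u1 p - u2 p\<bar>"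
          using K mult_right_mono[of 1 K "\<bar>u1 p - u2 p\<bar>"] by simp
        moreover have "K * B + K * \<bar>u1 p - u2 p\<bar> = K * D + K * integral {p..x} (\<lambda>s. w s * y s)"
          by (simp add: B_def D J_def algebra_simps)
        ultimately show ?thesis by linarith
      qed
      finally show "y x \<le> K * D + integral {p..x} (\<lambda>\<xi>. (K * w \<xi>) * y \<xi>)"
        by (simp add: mult.assoc)
    qed
    have "\<bar>v1 x - v2 x\<bar> \<le> D + integral {p..x} (\<lambda>s. w s * y s)" using vv[OF x] Dg by simp
    also have "integral {p..x} (\<lambda>s. w s * y s) \<le> integral {p..q} (\<lambda>s. w s * y s)"
      by (rule integral_subset_le) (use x wyi wyn pq in auto)
    also have "\<dots> \<le> integral {p..q} (\<lambda>s. w s * (C0 * (K * D)))"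
      by (rule integral_le) (use wyi[of q] pq w yb in \<open>auto intro!: mult_left_mono integrable_on_mult_left abs_int_imp_int\<close>)
    also have "\<dots> = W * (C0 * (K * D))" by (simp add: W_def)
    finally have "\<bar>v1 x - v2 x\<bar> \<le> (W * (C0 * K) + 1) * D" by (simp add: algebra_simps)
    also have "\<dots> \<le> C * D" using C Dg by (intro mult_right_mono) auto
    finally have 2: "\<bar>v1 x - v2 x\<bar> \<le> C * D" .
    have "\<bar>u1 x - u2 x\<bar> \<le> (C0 * K) * D" using yb[OF x] by (simp add: y_def algebra_simps)
    also have "\<dots> \<le> C * D" using C Dg by (intro mult_right_mono) auto
    finally show ?thesis using 2 by simp
  qed
  then show ?thesis using that[OF C(1)] by simp
qed

text \<open>A trajectory of a field vanishing for nonpositive values is a straight line below zero,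
  so it can never come back.\<close>

lemma traj_neg_past:
  assumes t: "traj p q F u v" and F: "\<And>x. x \<in> {p..q} \<Longrightarrow> u x \<le> 0 \<Longrightarrow> F x = 0"
    and up: "0 \<le> u p" and z: "z \<in> {p..q}" "u z < 0"
  obtains x0 where "p \<le> x0" "x0 < z" "u x0 = 0" "v x0 = v z" "v z < 0" "\<And>x. x0 < x \<Longrightarrow> x \<le> z \<Longrightarrow> u x < 0"
proof -
  define A where "A = {x \<in> {p..z}. 0 \<le> u x}"
  have cu: "continuous_on {p..z} u" using traj_cont_u[OF t] z by (auto intro: continuous_on_subset)
  have "closed A" unfolding A_def
    using continuous_on_closed_Collect_le[OF continuous_on_const cu] by auto
  then have "compact A"
    using compact_Int_closed[of "{p..z}" A] by (simp add: A_def Int_def conj_ac)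
  moreover have "p \<in> A" using up z by (auto simp: A_def)
  ultimately obtain x0 where x0: "x0 \<in> A" "\<And>x. x \<in> A \<Longrightarrow> x \<le> x0"
    using compact_attains_sup[of A] by blast
  have "x0 \<noteq> z" using x0 z by (auto simp: A_def)
  then have x0z: "p \<le> x0" "x0 < z" using x0 by (auto simp: A_def)
  have neg: "u x < 0" if "x0 < x" "x \<le> z" for x
    using x0(2)[of x] that x0z by (force simp: A_def)
  have u0: "u x0 = 0"
  proof (rule ccontr)
    assume "u x0 \<noteq> 0"
    then have "u x0 > 0" using x0 by (auto simp: A_def)
    then obtain y where "x0 \<le> y" "y \<le> z" "u y = 0"
    proof -
      have "continuous_on {x0..z} u" by (rule continuous_on_subset[OF cu]) (use x0z in auto)
      then show ?thesis using IVT2'[of u z 0 x0] z(2) x0z \<open>u x0 > 0\<close> that by auto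
    qed
    then show False using neg[of y] \<open>u x0 > 0\<close> by (cases "y = x0") auto
  qed
  have vx: "v x = v x0" if "x0 \<le> x" "x \<le> z" for x
  proof -
    have "integral {x0..x} F = integral {x0..x} (\<lambda>_. 0)"
    proof (rule Henstock_Kurzweil_Integration.integral_cong)
      fix y assume "y \<in> {x0..x}"
      then show "F y = 0" using F[of y] neg[of y] u0 that z x0z by (cases "y = x0") auto
    qed
    then show ?thesis using traj_v_diff[OF t, of x0 x] x0z that z by auto
  qed
  obtain y where "x0 < y" "y < z" "u z - u x0 = v y * (z - x0)"
    using traj_mvt[OF t x0z] z by auto
  then have "u z = v z * (z - x0)" using vx[of y] vx[of z] u0 x0z by simp
  then have "v z < 0" using z x0z by (simp add: mult_less_0_iff)
  then show ?thesis using that[OF x0z u0] vx[of z] x0z neg by simp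
qed

text \<open>If \<open>u\<close> returned to a nonnegative value, its minimum on
  \<open>{z..y}\<close> would be negative and attained before \<open>y\<close>. But a negative value
  forces a negative slope by \<open>traj_neg_past\<close>, so \<open>u\<close> would drop still
  further.\<close>

lemma traj_neg_future:
  assumes t: "traj p q F u v" and F: "\<And>x. x \<in> {p..q} \<Longrightarrow> u x \<le> 0 \<Longrightarrow> F x = 0"
    and up: "0 \<le> u p" and z: "p \<le> z" "u z < 0" and y: "z \<le> y" "y \<le> q"
  shows "u y < 0" "v y < 0"
proof -
  have vn: "v x < 0" if "x \<in> {p..q}" "u x < 0" for x
    by (rule traj_neg_past[OF t F up that])
  show uy: "u y < 0"
  proof (rule ccontr)
    assume "\<not> u y < 0"
    have "continuous_on {z..y} u" using traj_cont_u[OF t] z y by (auto intro: continuous_on_subset)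
    then obtain s where s: "s \<in> {z..y}" "\<And>x. x \<in> {z..y} \<Longrightarrow> u s \<le> u x"
      using continuous_attains_inf[of "{z..y}" u] y by auto
    have us: "u s < 0" using s(2)[of z] z y by auto
    then have sy: "s < y" using \<open>\<not> u y < 0\<close> s by (cases "s = y") auto
    have "v s < 0" using vn[of s] us s z y by auto
    moreover have "continuous_on {p..q} v" by (rule traj_cont_v[OF t])
    ultimately obtain d where d: "d > 0" "\<And>x. x \<in> {p..q} \<Longrightarrow> \<bar>x - s\<bar> < d \<Longrightarrow> v x < 0"
    proof -
      assume *: "v s < 0" "continuous_on {p..q} v" and th: "\<And>d. 0 < d \<Longrightarrow> (\<And>x. x \<in> {p..q} \<Longrightarrow> \<bar>x - s\<bar> < d \<Longrightarrow> v x < 0) \<Longrightarrow> thesis"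
      have "s \<in> {p..q}" using s z y by auto
      then obtain d where "d > 0" "\<forall>x\<in>{p..q}. dist x s < d \<longrightarrow> dist (v x) (v s) < - v s"
        using * unfolding continuous_on_iff by (meson neg_0_less_iff_less)
      then show thesis by (intro th[of d]) (auto simp: dist_real_def abs_less_iff)
    qed
    define x where "x = min y (s + d/2)"
    have x: "s < x" "x \<le> y" "x - s < d" using d(1) sy by (auto simp: x_def min_def)
    obtain r where r: "s < r" "r < x" "u x - u s = v r * (x - s)"
      using traj_mvt[OF t, of s x] s z y x by auto
    have "v r < 0" using d(2)[of r] r x s z y by auto
    then have "v r * (x - s) < 0" using x by (intro mult_neg_pos) auto
    then have "u x < u s" using r(3) by simp
    moreover have "u s \<le> u x" by (rule s(2)) (use x s in auto)
    ultimately show False by simp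
  qed
  show "v y < 0" using vn[OF _ uy] z y by auto
qed

text \<open>The last zero before \<open>z\<close> is also the moment of death, since a negative
  value at any earlier time would be permanent. The strict slope at that zero is what contradicts a
  nonnegative Wronskian later on.\<close>

lemma traj_first_death:
  assumes t: "traj p q F u v" and F: "\<And>x. x \<in> {p..q} \<Longrightarrow> u x \<le> 0 \<Longrightarrow> F x = 0"
    and up: "0 \<le> u p" and z: "z \<in> {p..q}" "u z < 0"
  obtains x0 where "p \<le> x0" "x0 < z" "u x0 = 0" "v x0 < 0" "\<And>x. p \<le> x \<Longrightarrow> x \<le> x0 \<Longrightarrow> 0 \<le> u x"
    "\<And>x. x0 < x \<Longrightarrow> x \<le> z \<Longrightarrow> u x < 0"
proof -
  obtain x0 where x0: "p \<le> x0" "x0 < z" "u x0 = 0" "v x0 = v z" "v z < 0"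
    "\<And>x. x0 < x \<Longrightarrow> x \<le> z \<Longrightarrow> u x < 0"
    by (rule traj_neg_past[OF t _ up z]) (erule (1) F, rule that)
  have "0 \<le> u x" if "p \<le> x" "x \<le> x0" for x
  proof (rule ccontr)
    assume "\<not> 0 \<le> u x"
    then have "u x0 < 0" using traj_neg_future(1)[OF t F up, of x x0] that x0 z by auto
    then show False using x0 by simp
  qed
  then show ?thesis using that[of x0] x0 by simp
qed

section \<open>The principal eigenvalue\<close>

lemma integral_pos_if_not_negligible:
  fixes f :: "real \<Rightarrow> real"
  assumes f: "f integrable_on {p..q}" and nn: "\<And>x. x \<in> {p..q} \<Longrightarrow> 0 \<le> f x"
    and nt: "\<not> negligible {x \<in> {p..q}. f x \<noteq> 0}"
  shows "0 < integral {p..q} f"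
proof (rule ccontr)
  assume "\<not> 0 < integral {p..q} f"
  moreover have "0 \<le> integral {p..q} f" by (rule integral_nonneg[OF f nn])
  ultimately have 0: "integral {p..q} f = 0" by simp
  have a: "set_integrable lebesgue {p..q} f"
    by (rule nonnegative_absolutely_integrable_1[OF f nn])
  have "(LINT x|lebesgue. indicator {p..q} x *\<^sub>R f x) = 0"
    using set_lebesgue_integral_eq_integral(2)[OF a] 0 by (simp add: set_lebesgue_integral_def)
  moreover have "integrable lebesgue (\<lambda>x. indicator {p..q} x *\<^sub>R f x)" using a by (simp add: set_integrable_def)
  moreover have "AE x in lebesgue. 0 \<le> indicator {p..q} x *\<^sub>R f x"
    using nn by (intro AE_I2) (auto simp: indicator_def)
  ultimately have "AE x in lebesgue. indicator {p..q} x *\<^sub>R f x = 0"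
    using integral_nonneg_eq_0_iff_AE by blast
  then have "negligible {x. \<not> (indicator {p..q} x *\<^sub>R f x = 0)}" by (rule AE_imp_negligible)
  then have "negligible {x \<in> {p..q}. f x \<noteq> 0}" by (rule negligible_subset) auto
  then show False using nt by simp
qed

lemma traj_end_slope:
  assumes t: "traj p q F u v" and pq: "p < q" and nn: "\<And>x. x \<in> {p..q} \<Longrightarrow> 0 \<le> u x" and uq: "u q = 0"
  shows "v q \<le> 0"
proof (rule ccontr)
  assume "\<not> v q \<le> 0"
  then have vq: "v q > 0" by simp
  have "continuous_on {p..q} v" by (rule traj_cont_v[OF t])
  then obtain d where d: "d > 0" "\<forall>x\<in>{p..q}. dist x q < d \<longrightarrow> dist (v x) (v q) < v q"
    unfolding continuous_on_iff using vq pq by (meson atLeastAtMost_iff less_imp_le order_refl)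
  define x where "x = max p (q - d/2)"
  have x: "p \<le> x" "x < q" "q - x < d" using pq d(1) by (auto simp: x_def max_def)
  obtain z where z: "x < z" "z < q" "u q - u x = v z * (q - x)" using traj_mvt[OF t x(1,2)] by blast
  have "dist (v z) (v q) < v q" using d(2) z x by (auto simp: dist_real_def)
  then have "v z > 0" by (auto simp: dist_real_def abs_less_iff)
  then have "v z * (q - x) > 0" using x by simp
  then show False using z(3) uq nn[of x] x by auto
qed

text \<open>Used with \<open>h\<close> the positive part, for shooting, and with \<open>h\<close>
  the identity, for arbitrary eigenfunctions. The bound \<open>B\<close> provides one weight for a
  whole range of \<open>lam\<close>.\<close>

lemma lip_field_linear:
  assumes w: "w absolutely_integrable_on {p..q}" "\<And>x. x \<in> {p..q} \<Longrightarrow> 0 \<le> w x"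
    and l: "\<bar>lam\<bar> \<le> B" and h: "\<And>s s'. \<bar>h s - h s'\<bar> \<le> \<bar>s - s'\<bar>"
  shows "lip_field p q (\<lambda>x. B * w x) (\<lambda>x s. lam * w x * h s)"
  unfolding lip_field_def
proof (intro conjI ballI allI impI)
  show "(\<lambda>x. B * w x) absolutely_integrable_on {p..q}" by (rule abs_int_mult_cont(2)[OF w(1)]) auto
  show "0 \<le> B * w x" if "x \<in> {p..q}" for x using w(2)[OF that] l by simp
  show "\<bar>lam * w x * h s - lam * w x * h s'\<bar> \<le> B * w x * \<bar>s - s'\<bar>" if "x \<in> {p..q}" for x s s'
  proof -
    have "\<bar>lam * w x * h s - lam * w x * h s'\<bar> = (\<bar>lam\<bar> * w x) * \<bar>h s - h s'\<bar>"
      using w(2)[OF that] by (simp add: abs_mult right_diff_distrib[symmetric] abs_of_nonneg)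
    also have "\<dots> \<le> (B * w x) * \<bar>s - s'\<bar>"
      using w(2)[OF that] l h by (intro mult_mono mult_right_mono) auto
    finally show ?thesis .
  qed
  show "(\<lambda>x. lam * w x * h (u x)) absolutely_integrable_on {p..q}" if u: "continuous_on {p..q} u" for u
  proof -
    have "1-lipschitz_on UNIV h"
      by (rule lipschitz_onI) (use h in \<open>auto simp: dist_real_def\<close>)
    then have "continuous_on UNIV h" by (rule lipschitz_on_continuous_on)
    then have "continuous_on {p..q} (\<lambda>x. lam * h (u x))"
      by (intro continuous_on_mult_left continuous_on_compose2[OF _ u]) auto
    then have "(\<lambda>x. w x * (lam * h (u x))) absolutely_integrable_on {p..q}"
      by (rule abs_int_mult_cont(1)[OF w(1)])
    then show ?thesis by (simp add: mult_ac)
  qed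
qed

lemma max0_lip: "\<bar>max 0 s - max 0 s'\<bar> \<le> \<bar>s - s'\<bar>" for s s' :: real
  by (simp add: max_def)

text \<open>The parabola vanishing at both ends has constant second derivative; it is the test
  function that bounds the spectral parameter from above.\<close>

lemma traj_parabola: "traj p q (\<lambda>_. 2) (\<lambda>x. (x - p) * (q - x)) (\<lambda>x. p + q - 2 * x)"
  unfolding traj_def by (auto intro!: derivative_eq_intros absolutely_integrable_on_const simp: algebra_simps)

text \<open>Shooting in the spectral parameter from the left condition. Truncation by
  \<open>max 0\<close> makes sign changes irreversible, so a nonnegative right boundary form
  \<open>P lam \<eta>\<close> certifies a nonnegative solution. The smallest zero of
  \<open>P lam 0\<close> is the eigenvalue; proving that it is attained also gives meaning to the
  \<open>LEAST\<close> in \<open>first_eigenvalue\<close>. Below it \<open>P lam 0\<close> is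
  positive, which leaves room to lift the initial value by \<open>\<eta>\<close>.\<close>

theorem principal_eigenvalue:
  fixes w :: "real \<Rightarrow> real"
  assumes pq: "p < q" and w: "w absolutely_integrable_on {p..q}" and wn: "\<And>x. x \<in> {p..q} \<Longrightarrow> 0 \<le> w x"
    and nt: "\<not> negligible {x \<in> {p..q}. w x \<noteq> 0}"
    and c: "0 \<le> c1" "0 \<le> c2" "0 \<le> c3" "0 \<le> c4" "c3 * c2 + c1 * c3 + c1 * c4 > 0"
  defines "\<mu> \<equiv> first_eigenvalue p q w c1 c2 c3 c4"
  shows principal_eigenfunction: "\<exists>\<phi> \<psi>. traj p q (\<lambda>x. \<mu> * w x * \<phi> x) \<phi> \<psi> \<and> \<phi> p = c2 \<and> \<psi> p = c1 \<and>
       c3 * \<phi> q + c4 * \<psi> q = 0 \<and> (\<forall>x\<in>{p..q}. 0 \<le> \<phi> x) \<and> (\<forall>x\<in>{p<..<q}. 0 < \<phi> x)"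
    and principal_eigenvalue_pos: "\<mu> > 0"
    and positive_below_principal: "\<And>lam. 0 \<le> lam \<Longrightarrow> lam < \<mu> \<Longrightarrow>
       \<exists>\<phi> \<psi> \<eta> d. \<eta> > 0 \<and> d > 0 \<and> traj p q (\<lambda>x. lam * w x * \<phi> x) \<phi> \<psi> \<and> \<phi> p = c2 + \<eta> \<and> \<psi> p = c1 \<and>
       c3 * \<phi> q + c4 * \<psi> q > 0 \<and> (\<forall>x\<in>{p..q}. d \<le> \<phi> x)"
proof -
  have c12: "c1 \<noteq> 0 \<or> c2 \<noteq> 0" and c34: "c3 > 0 \<or> c4 > 0" using c by (auto simp: less_le)
  define G where "G lam x s = lam * w x * max 0 s" for lam x s
  have LG: "lip_field p q (\<lambda>x. B * w x) (G lam)" if "0 \<le> lam" "lam \<le> B" for lam B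
    unfolding G_def by (rule lip_field_linear[OF w wn _ max0_lip]) (use that in auto)
  have "\<exists>u v. 0 \<le> lam \<longrightarrow> traj p q (\<lambda>x. G lam x (u x)) u v \<and> u p = c2 + \<eta> \<and> v p = c1" for lam \<eta>
    using ode_exists[OF less_imp_le[OF pq] LG[OF _ order_refl], of lam "c2 + \<eta>" c1] by metis
  then obtain U V where UV: "\<And>lam \<eta>. 0 \<le> lam \<Longrightarrow> traj p q (\<lambda>x. G lam x (U lam \<eta> x)) (U lam \<eta>) (V lam \<eta>)"
    "\<And>lam \<eta>. 0 \<le> lam \<Longrightarrow> U lam \<eta> p = c2 + \<eta>" "\<And>lam \<eta>. 0 \<le> lam \<Longrightarrow> V lam \<eta> p = c1"
    by metis
  define P where "P lam \<eta> = c3 * U lam \<eta> q + c4 * V lam \<eta> q" for lam \<eta>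
  have alive: "0 \<le> U lam \<eta> x" if "0 \<le> lam" "0 \<le> \<eta>" "0 \<le> P lam \<eta>" "x \<in> {p..q}" for lam \<eta> x
  proof (rule ccontr)
    assume "\<not> 0 \<le> U lam \<eta> x"
    then have "U lam \<eta> q < 0" "V lam \<eta> q < 0"
      using traj_neg_future[OF UV(1)[OF that(1)], of \<eta> x q] UV(2)[OF that(1)] that c(2) pq
      by (auto simp: G_def)
    then have "P lam \<eta> < 0"
    proof -
      have "c3 * U lam \<eta> q \<le> 0" "c4 * V lam \<eta> q \<le> 0" "c3 > 0 \<Longrightarrow> c3 * U lam \<eta> q < 0" "c4 > 0 \<Longrightarrow> c4 * V lam \<eta> q < 0"
        using \<open>U lam \<eta> q < 0\<close> \<open>V lam \<eta> q < 0\<close> c by (auto intro: mult_pos_neg mult_nonneg_nonpos)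
      then show ?thesis using c34 by (auto simp: P_def)
    qed
    then show False using that by simp
  qed
  have lin: "traj p q (\<lambda>x. lam * w x * U lam \<eta> x) (U lam \<eta>) (V lam \<eta>)" if "0 \<le> lam" "0 \<le> \<eta>" "0 \<le> P lam \<eta>" for lam \<eta>
    by (rule traj_cong[OF UV(1)[OF that(1)], of "{}"]) (use alive[OF that] in \<open>auto simp: G_def\<close>)
  have Fnn: "0 \<le> lam * w x * U lam \<eta> x" if "0 \<le> lam" "0 \<le> \<eta>" "0 \<le> P lam \<eta>" "p \<le> x" "x \<le> q" for lam \<eta> x
    using alive[OF that(1-3)] wn that by auto
  have nontriv: "\<exists>\<xi>\<in>{p..q}. U lam \<eta> \<xi> > 0" if "0 \<le> lam" "0 \<le> \<eta>" "0 \<le> P lam \<eta>" for lam \<eta>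
  proof (rule ccontr)
    assume "\<not> ?thesis"
    then have z: "U lam \<eta> x = 0" if "x \<in> {p..q}" for x
      using alive[OF \<open>0 \<le> lam\<close> \<open>0 \<le> \<eta>\<close> \<open>0 \<le> P lam \<eta>\<close> that] that by force
    then have "c2 + \<eta> = 0" using UV(2)[OF that(1), of \<eta>] z[of p] pq by auto
    then have "c2 = 0" using c that by simp
    then have "c1 > 0" using c c12 by simp
    have "V lam \<eta> x = c1" if "x \<in> {p..q}" for x
    proof -
      have "integral {p..x} (\<lambda>x. G lam x (U lam \<eta> x)) = integral {p..x} (\<lambda>x. 0)"
        by (rule Henstock_Kurzweil_Integration.integral_cong) (use that z in \<open>auto simp: G_def\<close>)
      then show ?thesis using traj_v_diff[OF UV(1)[OF \<open>0 \<le> lam\<close>], of p x \<eta>] UV(3)[OF \<open>0 \<le> lam\<close>, of \<eta>] that by simp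
    qed
    then have "U lam \<eta> q - U lam \<eta> p \<ge> c1 * (q - p)"
      by (intro traj_slope_ge[OF UV(1)[OF that(1)]]) (use pq in auto)
    then show False using z pq \<open>c1 > 0\<close> by (simp add: mult_le_0_iff)
  qed
  have pos: "0 < U lam \<eta> x" if l: "0 \<le> lam" "0 \<le> \<eta>" "0 \<le> P lam \<eta>" and x: "p < x" "x < q" for lam \<eta> x
  proof -
    obtain \<xi> where \<xi>: "\<xi> \<in> {p..q}" "U lam \<eta> \<xi> > 0" using nontriv[OF l] by blast
    have "U lam \<eta> x \<ge> U lam \<eta> \<xi> * tent p q x"
      by (rule traj_ge_tent[OF lin[OF l]]) (use Fnn[OF l] alive[OF l] x \<xi> pq in auto)
    moreover have "U lam \<eta> \<xi> * tent p q x > 0" using \<xi> tent_pos[OF x] by simp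
    ultimately show ?thesis by simp
  qed
  define \<kappa> where "\<kappa> = integral {p..q} (\<lambda>x. w x * ((x - p) * (q - x) * tent p q x))"
  have ct: "continuous_on {p..q} (\<lambda>x. (x - p) * (q - x) * tent p q x)" by (intro continuous_intros tent_cont)
  have \<kappa>: "\<kappa> > 0" unfolding \<kappa>_def
  proof (rule integral_pos_if_not_negligible)
    show "(\<lambda>x. w x * ((x - p) * (q - x) * tent p q x)) integrable_on {p..q}"
      by (rule abs_int_imp_int, rule abs_int_mult_cont(1)[OF w ct])
    show "0 \<le> w x * ((x - p) * (q - x) * tent p q x)" if "x \<in> {p..q}" for x
      using that wn tent_nonneg[of p x q] by simp
    show "\<not> negligible {x \<in> {p..q}. w x * ((x - p) * (q - x) * tent p q x) \<noteq> 0}"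
    proof
      assume "negligible {x \<in> {p..q}. w x * ((x - p) * (q - x) * tent p q x) \<noteq> 0}"
      then have "negligible ({x \<in> {p..q}. w x * ((x - p) * (q - x) * tent p q x) \<noteq> 0} \<union> {p, q})"
        by (intro negligible_Un) auto
      moreover have "{x \<in> {p..q}. w x \<noteq> 0} \<subseteq> {x \<in> {p..q}. w x * ((x - p) * (q - x) * tent p q x) \<noteq> 0} \<union> {p, q}"
      proof
        fix x assume x: "x \<in> {x \<in> {p..q}. w x \<noteq> 0}"
        show "x \<in> {x \<in> {p..q}. w x * ((x - p) * (q - x) * tent p q x) \<noteq> 0} \<union> {p, q}"
        proof (cases "x = p \<or> x = q")
          case False
          then have "p < x" "x < q" using x by auto
          then show ?thesis using x tent_pos[of p x q] by simp
        qed auto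
      qed
      ultimately show False using nt negligible_subset by blast
    qed
  qed
  \<comment> \<open>Testing with the parabola and replacing the solution by its tent minorant gives
    \<open>lam * \<kappa> \<le> 2 * (q - p)\<close> as long as \<open>P lam 0\<close> is
    nonnegative. Beyond \<open>\<Lambda>\<close> the form is therefore negative, which yields a
    zero.\<close>
  define \<Lambda> where "\<Lambda> = 2 * (q - p) / \<kappa>"
  have bound: "lam \<le> \<Lambda>" if l: "0 \<le> lam" "0 \<le> P lam 0" for lam
  proof -
    let ?u = "U lam 0" and ?v = "V lam 0"
    note t = lin[OF l(1) order_refl l(2)]
    have cu: "continuous_on {p..q} ?u" by (rule traj_cont_u[OF t])
    obtain \<xi> where \<xi>: "\<xi> \<in> {p..q}" "\<And>x. x \<in> {p..q} \<Longrightarrow> ?u x \<le> ?u \<xi>"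
      using continuous_attains_sup[OF _ _ cu] pq by auto
    obtain \<xi>' where "\<xi>' \<in> {p..q}" "?u \<xi>' > 0" using nontriv[OF l(1) order_refl l(2)] by blast
    then have M: "?u \<xi> > 0" using \<xi>(2)[of \<xi>'] by simp
    have wr: "((\<lambda>x. ?u x * 2 - (x - p) * (q - x) * (lam * w x * ?u x)) has_integral
       (?u q * (q - p) + ?u p * (q - p))) {p..q}"
      using traj_wronskian[OF less_imp_le[OF pq] t traj_parabola] by (simp add: algebra_simps)
    have i1: "?u integrable_on {p..q}" using cu by (rule integrable_continuous_real)
    have i2: "(\<lambda>x. w x * ((x - p) * (q - x) * ?u x)) integrable_on {p..q}"
      by (rule abs_int_imp_int, rule abs_int_mult_cont(1)[OF w]) (intro continuous_intros cu)
    have "((\<lambda>x. ?u x * 2 - lam * (w x * ((x - p) * (q - x) * ?u x))) has_integral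
        (integral {p..q} ?u * 2 - lam * integral {p..q} (\<lambda>x. w x * ((x - p) * (q - x) * ?u x)))) {p..q}"
      by (intro has_integral_diff has_integral_mult_left has_integral_mult_right integrable_integral i1 i2)
    moreover have "(\<lambda>x. ?u x * 2 - lam * (w x * ((x - p) * (q - x) * ?u x))) = (\<lambda>x. ?u x * 2 - (x - p) * (q - x) * (lam * w x * ?u x))"
      by (auto simp: mult_ac)
    ultimately have "integral {p..q} ?u * 2 - lam * integral {p..q} (\<lambda>x. w x * ((x - p) * (q - x) * ?u x)) = ?u q * (q - p) + ?u p * (q - p)"
      using has_integral_unique[OF _ wr] by simp
    moreover have "?u q * (q - p) + ?u p * (q - p) \<ge> 0" using alive[OF l(1) order_refl l(2)] pq by simp
    ultimately have 1: "lam * integral {p..q} (\<lambda>x. w x * ((x - p) * (q - x) * ?u x)) \<le> 2 * integral {p..q} ?u" by simp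
    have 2: "integral {p..q} ?u \<le> ?u \<xi> * (q - p)"
    proof -
      have "integral {p..q} ?u \<le> integral {p..q} (\<lambda>_. ?u \<xi>)" by (rule integral_le[OF i1]) (use \<xi> in auto)
      then show ?thesis using pq by (simp add: mult.commute)
    qed
    have "integral {p..q} (\<lambda>x. ?u \<xi> * (w x * ((x - p) * (q - x) * tent p q x))) \<le> integral {p..q} (\<lambda>x. w x * ((x - p) * (q - x) * ?u x))"
    proof (rule integral_le[OF _ i2])
      show "(\<lambda>x. ?u \<xi> * (w x * ((x - p) * (q - x) * tent p q x))) integrable_on {p..q}"
        by (rule abs_int_imp_int, rule abs_int_mult_cont(2), rule abs_int_mult_cont(1)[OF w ct]) auto
      fix x assume x: "x \<in> {p..q}"
      have "?u x \<ge> ?u \<xi> * tent p q x"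
        by (rule traj_ge_tent[OF t]) (use Fnn[OF l(1) order_refl l(2)] alive[OF l(1) order_refl l(2)] M x \<xi> pq in auto)
      then have "(w x * ((x - p) * (q - x))) * (?u \<xi> * tent p q x) \<le> (w x * ((x - p) * (q - x))) * ?u x"
        using x wn[OF x] by (intro mult_left_mono) auto
      then show "?u \<xi> * (w x * ((x - p) * (q - x) * tent p q x)) \<le> w x * ((x - p) * (q - x) * ?u x)"
        by (simp add: mult_ac)
    qed
    then have "?u \<xi> * \<kappa> \<le> integral {p..q} (\<lambda>x. w x * ((x - p) * (q - x) * ?u x))" by (simp add: \<kappa>_def)
    then have "lam * (?u \<xi> * \<kappa>) \<le> 2 * (?u \<xi> * (q - p))"
      using 1 2 l(1) mult_left_mono by (smt (verit, best))
    then have "lam * \<kappa> \<le> 2 * (q - p)" using M by (simp add: mult.left_commute)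
    then show ?thesis using \<kappa> by (simp add: \<Lambda>_def pos_le_divide_eq)
  qed
  have \<Lambda>0: "\<Lambda> > 0" using \<kappa> pq by (simp add: \<Lambda>_def)
  \<comment> \<open>At \<open>lam = 0\<close> the velocity stays \<open>c1\<close> and the solution
    is affine; the boundary form is positive exactly because of the nondegeneracy condition on
    \<open>c1\<close> to \<open>c4\<close>.\<close>
  have P0: "P 0 0 > 0"
  proof -
    have v: "V 0 0 x = c1" if "x \<in> {p..q}" for x
      using traj_v_diff[OF UV(1)[OF order_refl], of p x 0] UV(3)[OF order_refl, of 0] that by (simp add: G_def)
    have "U 0 0 q - U 0 0 p \<ge> c1 * (q - p)"
      by (intro traj_slope_ge[OF UV(1)[OF order_refl]]) (use pq v in auto)
    then have u: "U 0 0 q \<ge> c2 + c1 * (q - p)" using UV(2)[OF order_refl, of 0] by simp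
    have "c3 * U 0 0 q \<ge> c3 * (c2 + c1 * (q - p))" using u c by (intro mult_left_mono) auto
    then have "P 0 0 \<ge> c3 * (c2 + c1 * (q - p)) + c4 * c1" using v[of q] pq by (simp add: P_def)
    moreover have "c3 * (c2 + c1 * (q - p)) + c4 * c1 > 0"
    proof -
      have "c3 * c2 > 0 \<or> c1 * c3 > 0 \<or> c1 * c4 > 0" using c by (smt (verit))
      moreover have "c3 * c2 \<ge> 0" "c1 * c3 * (q - p) \<ge> 0" "c4 * c1 \<ge> 0" using c pq by auto
      moreover have "c1 * c3 > 0 \<Longrightarrow> c1 * c3 * (q - p) > 0" using pq mult_pos_pos[of "c1 * c3" "q - p"] by simp
      ultimately show ?thesis by (auto simp: algebra_simps)
    qed
    ultimately show ?thesis by simp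
  qed
  \<comment> \<open>All \<open>lam\<close> in \<open>{0..\<Lambda>+1}\<close> share this Lipschitz
    weight, so one stability constant serves the continuity of \<open>P\<close> in
    \<open>lam\<close>, uniqueness, and the perturbation by \<open>\<eta>\<close>.\<close>
  have Bw: "(\<lambda>x. (\<Lambda> + 1) * w x) absolutely_integrable_on {p..q}" "\<And>x. x \<in> {p..q} \<Longrightarrow> 0 \<le> (\<Lambda> + 1) * w x"
    using abs_int_mult_cont(2)[OF w continuous_on_const] wn \<Lambda>0 by auto
  obtain C where C: "C \<ge> 0" "\<And>F1 F2 u1 v1 u2 v2 x. lip_field p q (\<lambda>x. (\<Lambda> + 1) * w x) F1 \<Longrightarrow>
    traj p q (\<lambda>x. F1 x (u1 x)) u1 v1 \<Longrightarrow> traj p q (\<lambda>x. F2 x (u2 x)) u2 v2 \<Longrightarrow> x \<in> {p..q} \<Longrightarrow>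
    \<bar>u1 x - u2 x\<bar> \<le> C * (\<bar>u1 p - u2 p\<bar> + \<bar>v1 p - v2 p\<bar> + integral {p..q} (\<lambda>s. \<bar>F1 s (u2 s) - F2 s (u2 s)\<bar>)) \<and>
    \<bar>v1 x - v2 x\<bar> \<le> C * (\<bar>u1 p - u2 p\<bar> + \<bar>v1 p - v2 p\<bar> + integral {p..q} (\<lambda>s. \<bar>F1 s (u2 s) - F2 s (u2 s)\<bar>))"
    using ode_stable[OF less_imp_le[OF pq] Bw] by blast
  have CG: "\<bar>U l \<eta> q - U l' \<eta>' q\<bar> \<le> C * (\<bar>\<eta> - \<eta>'\<bar> + integral {p..q} (\<lambda>s. \<bar>G l s (U l' \<eta>' s) - G l' s (U l' \<eta>' s)\<bar>)) \<and>
      \<bar>V l \<eta> q - V l' \<eta>' q\<bar> \<le> C * (\<bar>\<eta> - \<eta>'\<bar> + integral {p..q} (\<lambda>s. \<bar>G l s (U l' \<eta>' s) - G l' s (U l' \<eta>' s)\<bar>))"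
    if l: "l \<in> {0..\<Lambda>+1}" "l' \<in> {0..\<Lambda>+1}" for l l' \<eta> \<eta>'
  proof -
    have "0 \<le> l" "l \<le> \<Lambda> + 1" "0 \<le> l'" using l by auto
    then show ?thesis
      using C(2)[of "G l" "U l \<eta>" "V l \<eta>" "G l'" "U l' \<eta>'" "V l' \<eta>'" q, OF LG UV(1) UV(1)] UV(2,3) pq by simp
  qed
  have Pdiff: "\<bar>P lam \<eta> - P lam' \<eta>'\<bar> \<le> (c3 + c4) * B"
    if "\<bar>U lam \<eta> q - U lam' \<eta>' q\<bar> \<le> B" "\<bar>V lam \<eta> q - V lam' \<eta>' q\<bar> \<le> B" for lam \<eta> lam' \<eta>' B
  proof -
    have "\<bar>P lam \<eta> - P lam' \<eta>'\<bar> = \<bar>c3 * (U lam \<eta> q - U lam' \<eta>' q) + c4 * (V lam \<eta> q - V lam' \<eta>' q)\<bar>"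
      by (simp add: P_def algebra_simps)
    also have "\<dots> \<le> c3 * \<bar>U lam \<eta> q - U lam' \<eta>' q\<bar> + c4 * \<bar>V lam \<eta> q - V lam' \<eta>' q\<bar>"
      using c abs_triangle_ineq[of "c3 * (U lam \<eta> q - U lam' \<eta>' q)" "c4 * (V lam \<eta> q - V lam' \<eta>' q)"]
      by (simp add: abs_mult)
    also have "\<dots> \<le> c3 * B + c4 * B" using that c by (intro add_mono mult_left_mono) auto
    finally show ?thesis by (simp add: algebra_simps)
  qed
  have Pcont: "continuous_on {0..\<Lambda>+1} (\<lambda>lam. P lam 0)"
    unfolding continuous_on_iff
  proof (intro ballI allI impI)
    fix l e :: real assume l: "l \<in> {0..\<Lambda>+1}" and e: "e > 0"
    define I where "I = integral {p..q} (\<lambda>s. w s * max 0 (U l 0 s))"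
    have cU: "continuous_on {p..q} (\<lambda>s. max 0 (U l 0 s))"
      by (intro continuous_intros traj_cont_u[OF UV(1)]) (use l in auto)
    have I0: "I \<ge> 0" unfolding I_def
      by (intro integral_nonneg abs_int_imp_int abs_int_mult_cont(1)[OF w cU]) (use wn in auto)
    define K where "K = (c3 + c4) * (C * I) + 1"
    have K: "K > 0" using c C(1) I0 by (simp add: K_def add_nonneg_pos)
    show "\<exists>d>0. \<forall>l'\<in>{0..\<Lambda>+1}. dist l' l < d \<longrightarrow> dist (P l' 0) (P l 0) < e"
    proof (intro exI conjI ballI impI)
      show "e / K > 0" using e K by simp
      fix l' assume l': "l' \<in> {0..\<Lambda>+1}" "dist l' l < e / K"
      have "integral {p..q} (\<lambda>s. \<bar>G l' s (U l 0 s) - G l s (U l 0 s)\<bar>) = integral {p..q} (\<lambda>s. \<bar>l' - l\<bar> * (w s * max 0 (U l 0 s)))"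
      proof (rule Henstock_Kurzweil_Integration.integral_cong)
        fix s assume s: "s \<in> {p..q}"
        have "G l' s (U l 0 s) - G l s (U l 0 s) = (l' - l) * (w s * max 0 (U l 0 s))" by (simp add: G_def algebra_simps)
        then show "\<bar>G l' s (U l 0 s) - G l s (U l 0 s)\<bar> = \<bar>l' - l\<bar> * (w s * max 0 (U l 0 s))"
          using wn[OF s] by (simp add: abs_mult)
      qed
      also have "\<dots> = \<bar>l' - l\<bar> * I" by (simp add: I_def)
      finally have J: "integral {p..q} (\<lambda>s. \<bar>G l' s (U l 0 s) - G l s (U l 0 s)\<bar>) = \<bar>l' - l\<bar> * I" .
      have "\<bar>P l' 0 - P l 0\<bar> \<le> (c3 + c4) * (C * (\<bar>l' - l\<bar> * I))"
        using CG[OF l'(1) l, of 0 0] unfolding J by (intro Pdiff) auto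
      also have "\<dots> = ((c3 + c4) * (C * I)) * \<bar>l' - l\<bar>" by (simp add: mult_ac)
      also have "\<dots> \<le> K * \<bar>l' - l\<bar>" by (intro mult_right_mono) (auto simp: K_def)
      also have "\<dots> < e" using l'(2) K by (simp add: dist_real_def field_simps)
      finally show "dist (P l' 0) (P l 0) < e" by (simp add: dist_real_def)
    qed
  qed
  define Z where "Z = {lam \<in> {0..\<Lambda>+1}. P lam 0 = 0}"
  have "P (\<Lambda>+1) 0 < 0" using bound[of "\<Lambda>+1"] \<Lambda>0 by force
  then have "\<exists>x\<ge>0. x \<le> \<Lambda>+1 \<and> P x 0 = 0"
    using IVT2'[of "\<lambda>l. P l 0" "\<Lambda>+1" 0 0] P0 \<Lambda>0 Pcont by auto
  then have "Z \<noteq> {}" by (auto simp: Z_def)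
  moreover have "compact Z"
  proof -
    have "closed Z" unfolding Z_def
      by (rule continuous_closed_preimage_constant[OF Pcont closed_atLeastAtMost])
    then show ?thesis using compact_Int_closed[of "{0..\<Lambda>+1}" Z] by (simp add: Z_def Int_def conj_ac)
  qed
  ultimately obtain l0 where l0: "l0 \<in> Z" "\<And>l. l \<in> Z \<Longrightarrow> l0 \<le> l"
    using compact_attains_inf[of Z] by auto
  have l0': "0 \<le> l0" "l0 \<le> \<Lambda> + 1" "P l0 0 = 0" using l0 by (auto simp: Z_def)
  have l0pos: "l0 > 0" using l0' P0 by (cases "l0 = 0") auto
  have Pbelow: "P lam 0 > 0" if lam: "0 \<le> lam" "lam < l0" for lam
  proof (rule ccontr)
    assume "\<not> P lam 0 > 0"
    moreover have "continuous_on {0..lam} (\<lambda>l. P l 0)" by (rule continuous_on_subset[OF Pcont]) (use that l0' in auto)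
    ultimately obtain l where "0 \<le> l" "l \<le> lam" "P l 0 = 0"
      using IVT2'[of "\<lambda>l. P l 0" lam 0 0] P0 lam(1) by auto
    then have "l \<in> Z" using that l0' by (auto simp: Z_def)
    then show False using l0(2)[of l] \<open>l \<le> lam\<close> that by simp
  qed
  have t0: "traj p q (\<lambda>x. l0 * w x * U l0 0 x) (U l0 0) (V l0 0)" using lin[of l0 0] l0' by simp
  have ev: "SL_eigenvalue p q w c1 c2 c3 c4 l0"
    unfolding SL_eigenvalue_def
  proof (intro exI conjI)
    show "abs_cont_on p q (U l0 0)" "abs_cont_on p q (V l0 0)" using t0 traj_ac_u traj_ac_v by blast+
    show "\<forall>x\<in>{p..q}. (U l0 0 has_real_derivative V l0 0 x) (at x within {p..q})" using t0 by (simp add: traj_def)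
    show "AE x in lebesgue. x \<in> {p..q} \<longrightarrow> (V l0 0 has_real_derivative - l0 * w x * U l0 0 x) (at x within {p..q})"
      using traj_AE[OF t0] by simp
    show "c1 * U l0 0 p - c2 * V l0 0 p = 0" using UV(2,3)[OF l0'(1)] by simp
    show "c3 * U l0 0 q + c4 * V l0 0 q = 0" using l0'(3) by (simp add: P_def)
    show "\<exists>x\<in>{p..q}. U l0 0 x \<noteq> 0" using nontriv[of l0 0] l0' by force
  qed
  \<comment> \<open>By uniqueness an eigenfunction for a smaller positive \<open>lam\<close> is a
    multiple of the shooting solution, whose right boundary form does not vanish.\<close>
  have least: "l0 \<le> lam" if lam: "lam > 0" "SL_eigenvalue p q w c1 c2 c3 c4 lam" for lam
  proof (rule ccontr)
    assume "\<not> l0 \<le> lam"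
    then have ll: "lam < l0" by simp
    obtain ef ch1 where ch: "abs_cont_on p q ef" "abs_cont_on p q ch1"
      "\<forall>x\<in>{p..q}. (ef has_real_derivative ch1 x) (at x within {p..q})"
      "AE x in lebesgue. x \<in> {p..q} \<longrightarrow> (ch1 has_real_derivative (- lam * w x * ef x)) (at x within {p..q})"
      "c1 * ef p - c2 * ch1 p = 0" "c3 * ef q + c4 * ch1 q = 0" "\<exists>x\<in>{p..q}. ef x \<noteq> 0"
      using lam(2) unfolding SL_eigenvalue_def by blast
    have Llin: "lip_field p q (\<lambda>x. (\<Lambda> + 1) * w x) (\<lambda>x s. lam * w x * s)"
      by (rule lip_field_linear[OF w wn]) (use lam ll l0' in auto)
    have tch: "traj p q (\<lambda>x. lam * w x * ef x) ef ch1"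
      by (rule trajI_ac) (use pq ch Llin abs_cont_on_imp_continuous_on[OF ch(1)] in \<open>auto simp: lip_field_def\<close>)
    have Ppos: "P lam 0 > 0" using Pbelow lam ll by simp
    \<comment> \<open>The left condition makes the initial data of the eigenfunction parallel to the
      vector with entries \<open>c2\<close>, \<open>c1\<close>; this is the coefficient of the
      orthogonal projection onto it.\<close>
    define \<kappa>' where "\<kappa>' = (ef p * c2 + ch1 p * c1) / (c1\<^sup>2 + c2\<^sup>2)"
    have cc: "c1\<^sup>2 + c2\<^sup>2 > 0" using c12 by (simp add: sum_power2_gt_zero_iff)
    have init: "ef p = \<kappa>' * c2" "ch1 p = \<kappa>' * c1"
    proof -
      have "ef p * (c1\<^sup>2 + c2\<^sup>2) = (ef p * c2 + ch1 p * c1) * c2"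
        using arg_cong[OF ch(5), of "\<lambda>z. z * c1"] by (simp add: algebra_simps power2_eq_square)
      then show "ef p = \<kappa>' * c2" using eq_divide_imp[OF less_imp_neq[OF cc, symmetric], of "ef p" "(ef p * c2 + ch1 p * c1) * c2"] by (simp add: \<kappa>'_def)
      have "ch1 p * (c1\<^sup>2 + c2\<^sup>2) = (ef p * c2 + ch1 p * c1) * c1"
        using arg_cong[OF ch(5), of "\<lambda>z. z * c2"] by (simp add: algebra_simps power2_eq_square) argo
      then show "ch1 p = \<kappa>' * c1" using eq_divide_imp[OF less_imp_neq[OF cc, symmetric], of "ch1 p" "(ef p * c2 + ch1 p * c1) * c1"] by (simp add: \<kappa>'_def)
    qed
    have tl: "traj p q (\<lambda>x. lam * w x * U lam 0 x) (U lam 0) (V lam 0)"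
      using lin[of lam 0] lam Ppos by simp
    have tk: "traj p q (\<lambda>x. lam * w x * (\<kappa>' * U lam 0 x)) (\<lambda>x. \<kappa>' * U lam 0 x) (\<lambda>x. \<kappa>' * V lam 0 x)"
      unfolding traj_def
    proof (intro conjI ballI)
      have "(\<lambda>x. \<kappa>' * (lam * w x * U lam 0 x)) absolutely_integrable_on {p..q}"
        by (rule abs_int_mult_cont(2)[OF _ continuous_on_const]) (use tl in \<open>simp add: traj_def\<close>)
      then show "(\<lambda>x. lam * w x * (\<kappa>' * U lam 0 x)) absolutely_integrable_on {p..q}" by (simp add: mult_ac)
      show "integral {p..x} (\<lambda>x. lam * w x * (\<kappa>' * U lam 0 x)) = \<kappa>' * V lam 0 p - \<kappa>' * V lam 0 x" if x: "x \<in> {p..q}" for x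
      proof -
        have "(\<lambda>x. lam * w x * (\<kappa>' * U lam 0 x)) = (\<lambda>x. \<kappa>' * (lam * w x * U lam 0 x))" by (auto simp: mult_ac)
        then have "integral {p..x} (\<lambda>x. lam * w x * (\<kappa>' * U lam 0 x)) = \<kappa>' * integral {p..x} (\<lambda>x. lam * w x * U lam 0 x)"
          using integral_mult_right by metis
        then show ?thesis using tl x by (simp add: traj_def right_diff_distrib)
      qed
      show "((\<lambda>x. \<kappa>' * U lam 0 x) has_real_derivative \<kappa>' * V lam 0 x) (at x within {p..q})" if "x \<in> {p..q}" for x
        using tl that by (auto simp: traj_def intro!: DERIV_cmult)
    qed
    have eq: "ef x = \<kappa>' * U lam 0 x \<and> ch1 x = \<kappa>' * V lam 0 x" if "x \<in> {p..q}" for x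
      using C(2)[of "\<lambda>x s. lam * w x * s" ef ch1 "\<lambda>x s. lam * w x * s" "\<lambda>x. \<kappa>' * U lam 0 x" "\<lambda>x. \<kappa>' * V lam 0 x" x, OF Llin tch tk that] init UV(2,3)[OF less_imp_le[OF lam(1)], of 0] by simp
    have "\<kappa>' * P lam 0 = 0" using ch(6) eq[of q] pq by (simp add: P_def algebra_simps)
    then have "\<kappa>' = 0" using Ppos by simp
    then show False using eq ch(7) by auto
  qed
  have \<mu>: "\<mu> = l0" unfolding \<mu>_def first_eigenvalue_def
    by (rule Least_equality) (use ev least l0pos in auto)
  show "\<mu> > 0" using \<mu> l0pos by simp
  show "\<exists>\<phi> \<psi>. traj p q (\<lambda>x. \<mu> * w x * \<phi> x) \<phi> \<psi> \<and> \<phi> p = c2 \<and> \<psi> p = c1 \<and>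
       c3 * \<phi> q + c4 * \<psi> q = 0 \<and> (\<forall>x\<in>{p..q}. 0 \<le> \<phi> x) \<and> (\<forall>x\<in>{p<..<q}. 0 < \<phi> x)"
    unfolding \<mu> using t0 UV(2,3)[OF l0'(1), of 0] l0' alive[of l0 0] pos[of l0 0]
    by (intro exI[of _ "U l0 0"] exI[of _ "V l0 0"]) (auto simp: P_def)
  show "\<exists>\<phi> \<psi> \<eta> d. \<eta> > 0 \<and> d > 0 \<and> traj p q (\<lambda>x. lam * w x * \<phi> x) \<phi> \<psi> \<and> \<phi> p = c2 + \<eta> \<and> \<psi> p = c1 \<and>
       c3 * \<phi> q + c4 * \<psi> q > 0 \<and> (\<forall>x\<in>{p..q}. d \<le> \<phi> x)" if lam: "0 \<le> lam" "lam < \<mu>" for lam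
  proof -
    have Pl: "P lam 0 > 0" using Pbelow lam \<mu> by simp
    \<comment> \<open>By stability the lift changes the boundary form by at most
      \<open>(c3 + c4) * C * \<eta>\<close>; this choice spends at most half of
      \<open>P lam 0\<close>.\<close>
    define \<eta> where "\<eta> = P lam 0 / (2 * ((c3 + c4) * C + 1))"
    have K: "(c3 + c4) * C + 1 > 0" using c C(1) by (simp add: add_nonneg_pos)
    have \<eta>: "\<eta> > 0" using Pl K by (simp add: \<eta>_def)
    have "\<bar>P lam \<eta> - P lam 0\<bar> \<le> (c3 + c4) * (C * \<eta>)"
      using CG[of lam lam \<eta> 0] lam \<mu> l0' \<eta> by (intro Pdiff) auto
    also have "\<dots> \<le> ((c3 + c4) * C + 1) * \<eta>" using \<eta> by (simp add: algebra_simps)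
    also have "\<dots> = P lam 0 / 2" using K by (simp add: \<eta>_def field_simps)
    finally have Pe: "P lam \<eta> > 0" using Pl by linarith
    note A = lam(1) less_imp_le[OF \<eta>] less_imp_le[OF Pe]
    have uq: "U lam \<eta> q > 0"
    proof (rule ccontr)
      assume "\<not> U lam \<eta> q > 0"
      then have z: "U lam \<eta> q = 0" using alive[OF A, of q] pq by auto
      have "V lam \<eta> q \<le> 0" by (rule traj_end_slope[OF lin[OF A] pq alive[OF A] z])
      then have "P lam \<eta> \<le> 0" using z c by (simp add: P_def mult_nonneg_nonpos)
      then show False using Pe by simp
    qed
    \<comment> \<open>A concave function is smallest at an end. The left value is positive thanks to
      \<open>\<eta>\<close>; a zero at the right end would make the boundary form
      nonpositive.\<close>
    define d where "d = min (U lam \<eta> p) (U lam \<eta> q)"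
    have d: "d > 0" using uq UV(2)[OF lam(1)] \<eta> c by (simp add: d_def)
    have "d \<le> U lam \<eta> x" if x: "x \<in> {p..q}" for x
    proof -
      have "(q - x) * U lam \<eta> p + (x - p) * U lam \<eta> q \<le> (q - p) * U lam \<eta> x"
        by (rule traj_concave[OF lin[OF A]]) (use Fnn[OF A] x in auto)
      moreover have "(q - x) * d + (x - p) * d \<le> (q - x) * U lam \<eta> p + (x - p) * U lam \<eta> q"
        using x by (intro add_mono mult_left_mono) (auto simp: d_def)
      ultimately have "(q - p) * d \<le> (q - p) * U lam \<eta> x" by (simp add: algebra_simps)
      then show ?thesis using pq by simp
    qed
    then show ?thesis using \<eta> d lin[OF A] UV(2,3)[OF lam(1)] Pe
      by (intro exI[of _ "U lam \<eta>"] exI[of _ "V lam \<eta>"] exI[of _ \<eta>] exI[of _ d]) (auto simp: P_def)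
  qed
qed

section \<open>Inf-convolutions\<close>

text \<open>Pasch-Hausdorff envelope: for \<open>g\<close> nonnegative on the half-line, the largest
  \<open>n\<close>-Lipschitz function lying below \<open>g\<close> there. It increases with
  \<open>n\<close>, so the envelope for \<open>n = 1\<close> is a lower bound common to all later
  ones.\<close>

definition inf_conv :: "(real \<Rightarrow> real) \<Rightarrow> nat \<Rightarrow> real \<Rightarrow> real" where
  "inf_conv g n s = (INF y\<in>{0..}. g y + real n * \<bar>s - y\<bar>)"

context
  fixes g :: "real \<Rightarrow> real"
  assumes nonneg: "\<And>s. 0 \<le> s \<Longrightarrow> 0 \<le> g s"
begin

lemma inf_conv_bdd: "bdd_below ((\<lambda>y. g y + real n * \<bar>s - y\<bar>) ` {0..})"
  by (rule bdd_belowI2[of _ 0]) (use nonneg in auto)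

lemma inf_conv_le: "0 \<le> y \<Longrightarrow> inf_conv g n s \<le> g y + real n * \<bar>s - y\<bar>"
  unfolding inf_conv_def by (rule cINF_lower[OF inf_conv_bdd]) auto

lemma inf_conv_ge: "(\<And>y. 0 \<le> y \<Longrightarrow> B \<le> g y + real n * \<bar>s - y\<bar>) \<Longrightarrow> B \<le> inf_conv g n s"
  unfolding inf_conv_def by (rule cINF_greatest) auto

lemma inf_conv_nonneg: "0 \<le> inf_conv g n s"
  by (rule inf_conv_ge) (use nonneg in auto)

lemma inf_conv_le_self: "0 \<le> s \<Longrightarrow> inf_conv g n s \<le> g s"
  using inf_conv_le[of s n s] by simp

lemma inf_conv_lip: "\<bar>inf_conv g n s - inf_conv g n s'\<bar> \<le> real n * \<bar>s - s'\<bar>"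
proof -
  have *: "inf_conv g n s - real n * \<bar>s - s'\<bar> \<le> inf_conv g n s'" for s s' :: real
  proof (rule inf_conv_ge)
    fix y :: real assume "0 \<le> y"
    have "inf_conv g n s \<le> g y + real n * \<bar>s - y\<bar>" by (rule inf_conv_le) fact
    also have "real n * \<bar>s - y\<bar> \<le> real n * (\<bar>s - s'\<bar> + \<bar>s' - y\<bar>)" by (intro mult_left_mono) auto
    finally show "inf_conv g n s - real n * \<bar>s - s'\<bar> \<le> g y + real n * \<bar>s' - y\<bar>" by (simp add: algebra_simps)
  qed
  show ?thesis using *[of s s'] *[of s' s] by (simp add: abs_minus_commute)
qed

lemma inf_conv_mono: "n \<le> m \<Longrightarrow> inf_conv g n s \<le> inf_conv g m s"
proof (rule inf_conv_ge)
  fix y :: real assume "n \<le> m" "0 \<le> y"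
  then have "real n * \<bar>s - y\<bar> \<le> real m * \<bar>s - y\<bar>" by (intro mult_right_mono) auto
  then show "inf_conv g n s \<le> g y + real m * \<bar>s - y\<bar>" using inf_conv_le[OF \<open>0 \<le> y\<close>, of n s] by linarith
qed

text \<open>Competitors within \<open>s/2\<close> of \<open>s\<close> pay at least the positive
  minimum of \<open>g\<close> over that compact interval, all others a penalty of at least
  \<open>s/2\<close>.\<close>

lemma inf_conv_pos:
  assumes c: "continuous_on {0..} g" and pos: "\<And>s. 0 < s \<Longrightarrow> 0 < g s" and s: "0 < s" and n: "1 \<le> n"
  shows "0 < inf_conv g n s"
proof -
  have "continuous_on {s/2..s + s/2} g" by (rule continuous_on_subset[OF c]) (use s in auto)
  then obtain z where z: "z \<in> {s/2..s + s/2}" "\<And>y. y \<in> {s/2..s + s/2} \<Longrightarrow> g z \<le> g y"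
    using continuous_attains_inf[of "{s/2..s + s/2}" g] s by auto
  have gz: "g z > 0" using pos[of z] z s by auto
  have "min (s/2) (g z) \<le> inf_conv g n s"
  proof (rule inf_conv_ge)
    fix y :: real assume y: "0 \<le> y"
    show "min (s/2) (g z) \<le> g y + real n * \<bar>s - y\<bar>"
    proof (cases "y \<in> {s/2..s + s/2}")
      case True
      have "0 \<le> real n * \<bar>s - y\<bar>" by simp
      then show ?thesis using z(2)[OF True] by linarith
    next
      case False
      then have "s/2 \<le> 1 * \<bar>s - y\<bar>" by (auto simp: abs_if not_le)
      also have "\<dots> \<le> real n * \<bar>s - y\<bar>" using n by (intro mult_right_mono) auto
      finally show ?thesis using nonneg[OF y] by linarith
    qed
  qed
  then show ?thesis using gz s by simp
qed

text \<open>A competitor \<open>y < s1\<close> has distance at least \<open>s/2\<close> from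
  \<open>s\<close>, so the penalty alone reaches \<open>\<rho> * s\<close> once \<open>n\<close> is
  at least \<open>2 * \<rho>\<close>. This is why the threshold doubles.\<close>

lemma inf_conv_superlinear:
  assumes g: "\<And>s. s1 \<le> s \<Longrightarrow> \<rho> * s \<le> g s" and s: "2 * s1 \<le> s" "0 < s1" and n: "2 * \<rho> \<le> real n" "0 \<le> \<rho>"
  shows "\<rho> * s \<le> inf_conv g n s"
proof (rule inf_conv_ge)
  fix y :: real assume y: "0 \<le> y"
  show "\<rho> * s \<le> g y + real n * \<bar>s - y\<bar>"
  proof (cases "s1 \<le> y")
    case True
    have "\<rho> * (s - y) \<le> \<rho> * \<bar>s - y\<bar>" using n by (intro mult_left_mono) auto
    also have "\<dots> \<le> real n * \<bar>s - y\<bar>" using n by (intro mult_right_mono) auto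
    finally show ?thesis using g[OF True] by (simp add: algebra_simps)
  next
    case False
    have "\<rho> * s = (2 * \<rho>) * (s / 2)" by simp
    also have "\<dots> \<le> real n * \<bar>s - y\<bar>" using n s False y by (intro mult_mono) auto
    finally show ?thesis using nonneg[OF y] by linarith
  qed
qed

text \<open>Only competitors closer than \<open>d'\<close> matter, since farther ones pay more than
  \<open>g\<close> can save. The interval is enlarged by 1 because such competitors may lie beyond
  \<open>M\<close>; uniform continuity does the rest.\<close>

lemma inf_conv_converges:
  assumes c: "continuous_on {0..} g" and e: "0 < e" and M: "0 \<le> M"
  obtains n0 where "\<And>n s. n0 \<le> n \<Longrightarrow> s \<in> {0..M} \<Longrightarrow> \<bar>inf_conv g n s - g s\<bar> \<le> e"
proof -
  have c': "continuous_on {0..M+1} g" by (rule continuous_on_subset[OF c]) auto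
  then have "uniformly_continuous_on {0..M+1} g" by (intro compact_uniformly_continuous) auto
  then obtain d where d: "d > 0" "\<And>x y. x \<in> {0..M+1} \<Longrightarrow> y \<in> {0..M+1} \<Longrightarrow> dist y x < d \<Longrightarrow> dist (g y) (g x) < e"
    using e unfolding uniformly_continuous_on_def by metis
  define d' where "d' = min d 1"
  have d': "d' > 0" "d' \<le> d" "d' \<le> 1" using d by (auto simp: d'_def)
  obtain z where z: "\<And>y. y \<in> {0..M+1} \<Longrightarrow> g y \<le> g z"
  proof -
    have "\<exists>z\<in>{0..M+1}. \<forall>y\<in>{0..M+1}. g y \<le> g z" using M by (intro continuous_attains_sup c') auto
    then show ?thesis using that by blast
  qed
  obtain n0 :: nat where n0: "g z / d' \<le> real n0" using real_arch_simple by blast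
  have "\<bar>inf_conv g n s - g s\<bar> \<le> e" if n: "n0 \<le> n" and s: "s \<in> {0..M}" for n s
  proof -
    have "g s - e \<le> inf_conv g n s"
    proof (rule inf_conv_ge)
      fix y :: real assume y: "0 \<le> y"
      show "g s - e \<le> g y + real n * \<bar>s - y\<bar>"
      proof (cases "\<bar>s - y\<bar> < d'")
        case True
        then have "dist (g y) (g s) < e" using d(2)[of s y] d' s y by (auto simp: dist_real_def)
        then have "g s - e \<le> g y" by (simp add: dist_real_def)
        moreover have "0 \<le> real n * \<bar>s - y\<bar>" by simp
        ultimately show ?thesis by linarith
      next
        case False
        have "g s \<le> g z" using z[of s] s by auto
        also have "\<dots> \<le> real n0 * d'" using n0 d' by (simp add: pos_divide_le_eq)
        also have "\<dots> \<le> real n * \<bar>s - y\<bar>" using n False d' by (intro mult_mono) auto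
        finally show ?thesis using nonneg[OF y] e by linarith
      qed
    qed
    then show ?thesis using inf_conv_le_self[of s n] s e by auto
  qed
  then show ?thesis using that by blast
qed

end

section \<open>Crossings along the shooting parameter\<close>

lemma first_crossing:
  fixes h :: "real \<Rightarrow> real"
  assumes h: "continuous_on {0..1} h" and "h 0 < r" "r < h 1"
  obtains t where "0 \<le> t" "t \<le> 1" "h t = r" "\<And>s. 0 \<le> s \<Longrightarrow> s \<le> t \<Longrightarrow> h s \<le> r"
proof -
  define Z where "Z = {s \<in> {0..1}. h s = r}"
  obtain s0 where "0 \<le> s0" "s0 \<le> 1" "h s0 = r" using IVT'[of h 0 r 1] assms by auto
  then have "Z \<noteq> {}" by (auto simp: Z_def)
  moreover have "compact Z"
  proof -
    have "closed Z" unfolding Z_def by (rule continuous_closed_preimage_constant[OF h closed_atLeastAtMost])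
    then show ?thesis using compact_Int_closed[of "{0..1}" Z] by (simp add: Z_def Int_def conj_ac)
  qed
  ultimately obtain t where t: "t \<in> Z" "\<And>s. s \<in> Z \<Longrightarrow> t \<le> s" using compact_attains_inf[of Z] by auto
  have t': "0 \<le> t" "t \<le> 1" "h t = r" using t by (auto simp: Z_def)
  have "h s \<le> r" if s: "0 \<le> s" "s \<le> t" for s
  proof (rule ccontr)
    assume "\<not> h s \<le> r"
    moreover have "continuous_on {0..s} h" by (rule continuous_on_subset[OF h]) (use s t' in auto)
    ultimately obtain y where y: "0 \<le> y" "y \<le> s" "h y = r" using IVT'[of h 0 r s] assms s by auto
    then have "y \<in> Z" using s t' by (auto simp: Z_def)
    then have "t \<le> y" by (rule t(2))
    then show False using y s \<open>\<not> h s \<le> r\<close> t' by (metis order_antisym order_refl order_trans)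
  qed
  then show ?thesis using that t' by blast
qed

lemma last_crossing:
  fixes h :: "real \<Rightarrow> real"
  assumes h: "continuous_on {0..1} h" and "h 0 < r" "r < h 1"
  obtains t where "0 \<le> t" "t \<le> 1" "h t = r" "\<And>s. t \<le> s \<Longrightarrow> s \<le> 1 \<Longrightarrow> r \<le> h s"
proof -
  have "continuous_on {0..1} (\<lambda>s. - h (1 - s))"
    by (intro continuous_intros continuous_on_compose2[OF h]) auto
  then obtain t where t: "0 \<le> t" "t \<le> 1" "- h (1 - t) = - r" "\<And>s. 0 \<le> s \<Longrightarrow> s \<le> t \<Longrightarrow> - h (1 - s) \<le> - r"
    using first_crossing[of "\<lambda>s. - h (1 - s)" "- r"] assms by auto
  have "r \<le> h s" if "1 - t \<le> s" "s \<le> 1" for s using t(4)[of "1 - s"] that by auto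
  then show ?thesis using that[of "1 - t"] t by auto
qed

text \<open>Along a path of shooting parameters that starts
  where the hump \<open>i\<close> is absent and ends where it is too high, the first crossing of level \<open>r\<close> leaves a
  path on which hump \<open>i\<close> is small, the last crossing one on which it is large; both of these new paths have
  the same shape with respect to hump \<open>i + 1\<close>.\<close>

theorem shooting_patterns:
  fixes M :: "nat \<Rightarrow> real \<Rightarrow> real" and \<Phi> :: "real \<Rightarrow> real"
  assumes m: "1 \<le> m" and r: "0 < r" "r < R"
    and Mc: "\<And>i. i \<in> {1..m} \<Longrightarrow> continuous_on {0..} (M i)"
    and \<Phi>c: "continuous_on {0..} \<Phi>"
    and M0: "\<And>i. i \<in> {1..m} \<Longrightarrow> M i 0 \<le> 0"
    and Mr: "\<And>i t. i \<in> {1..m} \<Longrightarrow> 0 \<le> t \<Longrightarrow> M i t = r \<Longrightarrow> i < m \<Longrightarrow> R < M (Suc i) t"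
    and Mr': "\<And>t. 0 \<le> t \<Longrightarrow> M m t = r \<Longrightarrow> 0 < \<Phi> t"
    and MR: "\<And>i l t. i \<in> {1..m} \<Longrightarrow> 0 \<le> t \<Longrightarrow> R < M i t \<Longrightarrow> l \<in> {Suc i..m} \<Longrightarrow> M l t \<le> 0"
    and MR': "\<And>i t. i \<in> {1..m} \<Longrightarrow> 0 \<le> t \<Longrightarrow> R < M i t \<Longrightarrow> \<Phi> t < 0"
    and t1: "0 \<le> t1" "R < M 1 t1"
    and S: "S \<subseteq> {1..m}" "S \<noteq> {}"
  obtains t where "0 \<le> t" "\<Phi> t = 0" "\<And>i. i \<in> {1..m} \<Longrightarrow> if i \<in> S then r \<le> M i t else M i t \<le> r"
proof -
  \<comment> \<open>\<open>S\<close> fixes the humps before \<open>i\<close>. At the start all humps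
    from \<open>i\<close> on are absent, at the end hump \<open>i\<close> is too high. A negative
    boundary value at the start is claimed only for nonempty \<open>S\<close>: for the empty pattern
    the start is the parameter 0, where no sign is available.\<close>
  define path where "path i S \<gamma> \<longleftrightarrow> continuous_on {0..1} \<gamma> \<and> (\<forall>s\<in>{0..1}. 0 \<le> \<gamma> s) \<and>
    (\<forall>s\<in>{0..1}. \<forall>l\<in>{1..<i}. if l \<in> S then r \<le> M l (\<gamma> s) else M l (\<gamma> s) \<le> r) \<and>
    (\<forall>l\<in>{i..m}. M l (\<gamma> 0) \<le> 0) \<and> (S \<noteq> {} \<longrightarrow> \<Phi> (\<gamma> 0) < 0) \<and> R < M i (\<gamma> 1)"
    for i S and \<gamma> :: "real \<Rightarrow> real"
  have comp: "continuous_on {0..1} (\<lambda>s. f (\<gamma> s))" if "continuous_on {0..} f" "path i S \<gamma>" for f :: "real \<Rightarrow> real" and i S \<gamma>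
    by (rule continuous_on_compose2[OF that(1)]) (use that(2) in \<open>auto simp: path_def\<close>)
  have ex: "\<exists>\<gamma>. path i S \<gamma>" if "1 \<le> i" "i \<le> m" "S \<subseteq> {1..<i}" for i S
    using that
  proof (induction i arbitrary: S rule: nat_induct_at_least)
    case base
    have "path 1 S (\<lambda>s. s * t1)"
      using base t1 M0 by (auto simp: path_def intro!: continuous_intros)
    then show ?case by blast
  next
    case (Suc i)
    have i: "i \<in> {1..m}" using Suc by auto
    \<comment> \<open>The path for the same earlier pattern, with hump \<open>i\<close> still
      undecided; it runs from absent to too high on hump \<open>i\<close>.\<close>
    obtain \<gamma> where \<gamma>: "path i (S - {i}) \<gamma>" using Suc.IH[of "S - {i}"] Suc.prems by (auto simp: less_Suc_eq subset_eq)
    define h where "h s = M i (\<gamma> s)" for s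
    have "M i (\<gamma> 0) \<le> 0" "R < M i (\<gamma> 1)" using \<gamma> i by (auto simp: path_def)
    then have h: "continuous_on {0..1} h" "h 0 < r" "r < h 1"
      using comp[OF Mc[OF i] \<gamma>] r by (auto simp: h_def)
    have \<gamma>c: "continuous_on {0..1} \<gamma>" using \<gamma> by (simp add: path_def)
    show ?case
    proof (cases "i \<in> S")
      case False
      obtain t where t: "0 \<le> t" "t \<le> 1" "h t = r" "\<And>s. 0 \<le> s \<Longrightarrow> s \<le> t \<Longrightarrow> h s \<le> r"
        using first_crossing[OF h] by blast
      have st: "0 \<le> s * t" "s * t \<le> t" "s * t \<le> 1" if "s \<in> {0..1}" for s
        using that t mult_left_le_one_le[of t s] by auto
      \<comment> \<open>Hump \<open>i\<close> small: keep the piece from the old start to the first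
        crossing. It ends where the maximum equals \<open>r\<close>, and this makes the next hump
        too high.\<close>
      have "path (Suc i) S (\<lambda>s. \<gamma> (s * t))"
        unfolding path_def
      proof (intro conjI ballI)
        show "continuous_on {0..1} (\<lambda>s. \<gamma> (s * t))"
          by (rule continuous_on_compose2[OF \<gamma>c]) (use st in \<open>auto intro!: continuous_intros\<close>)
        show "0 \<le> \<gamma> (s * t)" if "s \<in> {0..1}" for s using \<gamma> st[OF that] by (auto simp: path_def)
        show "if l \<in> S then r \<le> M l (\<gamma> (s * t)) else M l (\<gamma> (s * t)) \<le> r" if "s \<in> {0..1}" "l \<in> {1..<Suc i}" for s l
        proof (cases "l = i")
          case True then show ?thesis using False t(4)[of "s * t"] st[OF that(1)] by (simp add: h_def)
        next
          case l: False
          then have "l \<in> {1..<i}" "l \<in> S - {i} \<longleftrightarrow> l \<in> S" using that by auto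
          then show ?thesis using \<gamma> st[OF that(1)] unfolding path_def by fastforce
        qed
        show "M l (\<gamma> (0 * t)) \<le> 0" if "l \<in> {Suc i..m}" for l using \<gamma> that by (auto simp: path_def)
        show "S \<noteq> {} \<longrightarrow> \<Phi> (\<gamma> (0 * t)) < 0" using \<gamma> False by (auto simp: path_def)
        show "R < M (Suc i) (\<gamma> (1 * t))"
          using Mr[OF i, of "\<gamma> t"] t \<gamma> Suc.prems by (auto simp: path_def h_def)
      qed
      then show ?thesis by blast
    next
      case True
      obtain t where t: "0 \<le> t" "t \<le> 1" "h t = r" "\<And>s. t \<le> s \<Longrightarrow> s \<le> 1 \<Longrightarrow> r \<le> h s"
        using last_crossing[OF h] by blast
      have st: "0 \<le> 1 - s * (1 - t)" "t \<le> 1 - s * (1 - t)" "1 - s * (1 - t) \<le> 1" if "s \<in> {0..1}" for s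
        using that t mult_left_le_one_le[of "1 - t" s] by auto
      \<comment> \<open>Hump \<open>i\<close> large: traverse the piece after the last crossing
        backwards. The new start is the old end, where hump \<open>i\<close> is too high, so that
        all later humps are absent and the boundary value is negative.\<close>
      have "path (Suc i) S (\<lambda>s. \<gamma> (1 - s * (1 - t)))"
        unfolding path_def
      proof (intro conjI ballI)
        show "continuous_on {0..1} (\<lambda>s. \<gamma> (1 - s * (1 - t)))"
          by (rule continuous_on_compose2[OF \<gamma>c]) (use st in \<open>auto intro!: continuous_intros\<close>)
        show "0 \<le> \<gamma> (1 - s * (1 - t))" if "s \<in> {0..1}" for s using \<gamma> st[OF that] by (auto simp: path_def)
        show "if l \<in> S then r \<le> M l (\<gamma> (1 - s * (1 - t))) else M l (\<gamma> (1 - s * (1 - t))) \<le> r"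
          if "s \<in> {0..1}" "l \<in> {1..<Suc i}" for s l
        proof (cases "l = i")
          case l: True then show ?thesis using True t(4)[of "1 - s * (1 - t)"] st[OF that(1)] by (simp add: h_def)
        next
          case l: False
          then have "l \<in> {1..<i}" "l \<in> S - {i} \<longleftrightarrow> l \<in> S" using that by auto
          then show ?thesis using \<gamma> st[OF that(1)] unfolding path_def by fastforce
        qed
        have g1: "0 \<le> \<gamma> 1" "R < M i (\<gamma> 1)" using \<gamma> by (auto simp: path_def)
        show "M l (\<gamma> (1 - 0 * (1 - t))) \<le> 0" if "l \<in> {Suc i..m}" for l using MR[OF i g1 that] by simp
        show "S \<noteq> {} \<longrightarrow> \<Phi> (\<gamma> (1 - 0 * (1 - t))) < 0" using MR'[OF i g1] by simp
        show "R < M (Suc i) (\<gamma> (1 - 1 * (1 - t)))"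
          using Mr[OF i, of "\<gamma> t"] t \<gamma> Suc.prems by (auto simp: path_def h_def)
      qed
      then show ?thesis by blast
    qed
  qed
  have mm: "m \<in> {1..m}" using m by simp
  have "S - {m} \<subseteq> {1..<m}" using S by (auto simp: subset_eq less_le)
  then obtain \<gamma> where \<gamma>: "path m (S - {m}) \<gamma>" using ex[OF m order_refl] by blast
  define h where "h s = M m (\<gamma> s)" for s
  have "M m (\<gamma> 0) \<le> 0" "R < M m (\<gamma> 1)" using \<gamma> mm by (auto simp: path_def)
  then have h: "continuous_on {0..1} h" "h 0 < r" "r < h 1"
    using comp[OF Mc[OF mm] \<gamma>] r by (auto simp: h_def)
  have pat: "if l \<in> S then r \<le> M l (\<gamma> s) else M l (\<gamma> s) \<le> r" if "s \<in> {0..1}" "l \<in> {1..m}" "l \<noteq> m" for s l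
  proof -
    have "l \<in> {1..<m}" "l \<in> S - {m} \<longleftrightarrow> l \<in> S" using that by auto
    then show ?thesis using \<gamma> that(1) unfolding path_def by fastforce
  qed
  have g0: "0 \<le> \<gamma> s" if "s \<in> {0..1}" for s using \<gamma> that by (auto simp: path_def)
  have \<Phi>\<gamma>: "continuous_on {0..1} (\<lambda>s. \<Phi> (\<gamma> s))" by (rule comp[OF \<Phi>c \<gamma>])
  \<comment> \<open>On the last hump the next-hump condition is replaced by the sign of
    \<open>\<Phi>\<close>: positive at the crossing, negative at the end (large case) or at the
    start (small case, where \<open>S\<close> has an earlier element). A zero lies on the
    corresponding piece.\<close>
  show ?thesis
  proof (cases "m \<in> S")
    case True
    obtain t where t: "0 \<le> t" "t \<le> 1" "h t = r" "\<And>s. t \<le> s \<Longrightarrow> s \<le> 1 \<Longrightarrow> r \<le> h s"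
      using last_crossing[OF h] by blast
    have "\<Phi> (\<gamma> t) > 0" using Mr'[of "\<gamma> t"] t g0[of t] by (simp add: h_def)
    moreover have "\<Phi> (\<gamma> 1) < 0" using MR'[OF mm, of "\<gamma> 1"] \<gamma> by (auto simp: path_def)
    moreover have "continuous_on {t..1} (\<lambda>s. \<Phi> (\<gamma> s))" by (rule continuous_on_subset[OF \<Phi>\<gamma>]) (use t in auto)
    ultimately obtain s where s: "t \<le> s" "s \<le> 1" "\<Phi> (\<gamma> s) = 0"
      using IVT2'[of "\<lambda>s. \<Phi> (\<gamma> s)" 1 0 t] t by auto
    then have "s \<in> {0..1}" using t by auto
    then show ?thesis using that[of "\<gamma> s"] s g0[of s] pat[of s] t(4)[of s] True by (metis h_def)
  next
    case False
    obtain t where t: "0 \<le> t" "t \<le> 1" "h t = r" "\<And>s. 0 \<le> s \<Longrightarrow> s \<le> t \<Longrightarrow> h s \<le> r"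
      using first_crossing[OF h] by blast
    have "\<Phi> (\<gamma> t) > 0" using Mr'[of "\<gamma> t"] t g0[of t] by (simp add: h_def)
    moreover have "\<Phi> (\<gamma> 0) < 0" using \<gamma> S False by (auto simp: path_def)
    moreover have "continuous_on {0..t} (\<lambda>s. \<Phi> (\<gamma> s))" by (rule continuous_on_subset[OF \<Phi>\<gamma>]) (use t in auto)
    ultimately obtain s where s: "0 \<le> s" "s \<le> t" "\<Phi> (\<gamma> s) = 0"
      using IVT'[of "\<lambda>s. \<Phi> (\<gamma> s)" 0 0 t] t by auto
    then have "s \<in> {0..1}" using t by auto
    then show ?thesis using that[of "\<gamma> s"] s g0[of s] pat[of s] t(4)[of s] False by (metis h_def)
  qed
qed

section \<open>Behaviour on a single hump or gap\<close>

lemma integral_weighted_tent_pos: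
  fixes a :: "real \<Rightarrow> real"
  assumes pq: "p < q" and a: "a absolutely_integrable_on {p..q}" and an: "\<And>x. x \<in> {p..q} \<Longrightarrow> 0 \<le> a x"
    and nt: "\<not> negligible {x \<in> {p..q}. a x \<noteq> 0}"
    and f: "continuous_on {p..q} f" "\<And>x. x \<in> {p..q} \<Longrightarrow> 0 \<le> f x" "\<And>x. p < x \<Longrightarrow> x < q \<Longrightarrow> 0 < f x"
  shows "0 < integral {p..q} (\<lambda>x. a x * (f x * tent p q x))"
proof (rule integral_pos_if_not_negligible)
  show "(\<lambda>x. a x * (f x * tent p q x)) integrable_on {p..q}"
    by (rule abs_int_imp_int, rule abs_int_mult_cont(1)[OF a]) (intro continuous_intros f tent_cont)
  show "0 \<le> a x * (f x * tent p q x)" if "x \<in> {p..q}" for x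
    using that an f(2) tent_nonneg[of p x q] by simp
  show "\<not> negligible {x \<in> {p..q}. a x * (f x * tent p q x) \<noteq> 0}"
  proof
    assume "negligible {x \<in> {p..q}. a x * (f x * tent p q x) \<noteq> 0}"
    then have "negligible ({x \<in> {p..q}. a x * (f x * tent p q x) \<noteq> 0} \<union> {p, q})"
      by (intro negligible_Un) auto
    moreover have "{x \<in> {p..q}. a x \<noteq> 0} \<subseteq> {x \<in> {p..q}. a x * (f x * tent p q x) \<noteq> 0} \<union> {p, q}"
    proof
      fix x assume x: "x \<in> {x \<in> {p..q}. a x \<noteq> 0}"
      show "x \<in> {x \<in> {p..q}. a x * (f x * tent p q x) \<noteq> 0} \<union> {p, q}"
      proof (cases "x = p \<or> x = q")
        case False
        then have "p < x" "x < q" using x by auto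
        then show ?thesis using x tent_pos[of p x q] f(3)[of x] by simp
      qed auto
    qed
    ultimately show False using nt negligible_subset by blast
  qed
qed

text \<open>Testing the equation with the principal eigenfunction bounds every nonnegative trajectory over a hump,
  because concavity makes it comparable to its maximum times a tent function.\<close>

theorem hump_bound:
  fixes a :: "real \<Rightarrow> real"
  assumes pq: "p < q" and a: "a absolutely_integrable_on {p..q}" and an: "\<And>x. x \<in> {p..q} \<Longrightarrow> 0 \<le> a x"
    and nt: "\<not> negligible {x \<in> {p..q}. a x \<noteq> 0}"
    and \<phi>: "traj p q (\<lambda>x. \<mu> * a x * \<phi> x) \<phi> \<psi>" "\<And>x. x \<in> {p..q} \<Longrightarrow> 0 \<le> \<phi> x" "\<And>x. p < x \<Longrightarrow> x < q \<Longrightarrow> 0 < \<phi> x"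
    and \<rho>: "0 \<le> \<mu>" "\<mu> < \<rho>" "0 < s1"
  obtains R where "\<And>h u v x. traj p q (\<lambda>x. a x * h (u x)) u v \<Longrightarrow> (\<And>x. x \<in> {p..q} \<Longrightarrow> 0 \<le> u x) \<Longrightarrow>
    (\<And>s. 0 \<le> s \<Longrightarrow> 0 \<le> h s) \<Longrightarrow> (\<And>s. s1 \<le> s \<Longrightarrow> \<rho> * s \<le> h s) \<Longrightarrow>
    u q * \<psi> q - v q * \<phi> q \<le> u p * \<psi> p - v p * \<phi> p \<Longrightarrow> x \<in> {p..q} \<Longrightarrow> u x \<le> R"
proof -
  have c\<phi>: "continuous_on {p..q} \<phi>" by (rule traj_cont_u[OF \<phi>(1)])
  define \<kappa> where "\<kappa> = integral {p..q} (\<lambda>x. a x * (\<phi> x * tent p q x))"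
  have \<kappa>: "\<kappa> > 0" unfolding \<kappa>_def
    by (rule integral_weighted_tent_pos[OF pq a an nt c\<phi> \<phi>(2,3)])
  define A where "A = integral {p..q} (\<lambda>x. a x * \<phi> x)"
  have iA: "(\<lambda>x. a x * \<phi> x) integrable_on {p..q}"
    by (rule abs_int_imp_int, rule abs_int_mult_cont(1)[OF a c\<phi>])
  \<comment> \<open>The constant solves
    \<open>(\<rho> - \<mu>) * u \<xi> * \<kappa> \<le> \<rho> * s1 * A\<close>: the right side is
    the deficit from values below \<open>s1\<close>, where \<open>h\<close> is only known to be
    nonnegative.\<close>
  have "u \<xi> \<le> \<rho> * s1 * A / ((\<rho> - \<mu>) * \<kappa>)"
    if t: "traj p q (\<lambda>x. a x * h (u x)) u v" and un: "\<And>x. x \<in> {p..q} \<Longrightarrow> 0 \<le> u x"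
      and h: "\<And>s. 0 \<le> s \<Longrightarrow> 0 \<le> h s" "\<And>s. s1 \<le> s \<Longrightarrow> \<rho> * s \<le> h s"
      and bc: "u q * \<psi> q - v q * \<phi> q \<le> u p * \<psi> p - v p * \<phi> p" and \<xi>: "\<xi> \<in> {p..q}" for h u v \<xi>
  proof -
    have wr: "((\<lambda>x. u x * (\<mu> * a x * \<phi> x) - \<phi> x * (a x * h (u x))) has_integral
      ((v q * \<phi> q - u q * \<psi> q) - (v p * \<phi> p - u p * \<psi> p))) {p..q}"
      by (rule traj_wronskian[OF less_imp_le[OF pq] t \<phi>(1)])
    have c1: "continuous_on {p..q} (\<lambda>x. \<phi> x * tent p q x)" by (intro continuous_intros c\<phi> tent_cont)
    have R: "((\<lambda>x. \<rho> * s1 * (a x * \<phi> x) - (\<rho> - \<mu>) * u \<xi> * (a x * (\<phi> x * tent p q x))) has_integral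
       (\<rho> * s1 * A - (\<rho> - \<mu>) * u \<xi> * \<kappa>)) {p..q}"
      unfolding A_def \<kappa>_def
      by (intro has_integral_diff has_integral_mult_right integrable_integral iA abs_int_imp_int[OF abs_int_mult_cont(1)[OF a c1]])
    have "(v q * \<phi> q - u q * \<psi> q) - (v p * \<phi> p - u p * \<psi> p) \<le> \<rho> * s1 * A - (\<rho> - \<mu>) * u \<xi> * \<kappa>"
    proof (rule has_integral_le[OF wr R])
      fix x assume x: "x \<in> {p..q}"
      have F: "0 \<le> a z * h (u z)" if "p \<le> z" "z \<le> q" for z using that an un h(1) by auto
      have "u x \<ge> u \<xi> * tent p q x"
        by (rule traj_ge_tent[OF t F pq]) (use x \<xi> un pq in auto)
      then have "(\<rho> - \<mu>) * (u \<xi> * tent p q x) \<le> (\<rho> - \<mu>) * u x" using \<rho> by (intro mult_left_mono) auto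
      moreover have "\<mu> * u x - h (u x) \<le> \<rho> * s1 - (\<rho> - \<mu>) * u x"
      proof (cases "s1 \<le> u x")
        case True
        have "0 \<le> \<rho> * s1" using \<rho> by auto
        then show ?thesis using h(2)[OF True] by (simp add: algebra_simps)
      next
        case False
        then have "\<rho> * u x \<le> \<rho> * s1" using \<rho> by (intro mult_left_mono) auto
        then show ?thesis using h(1)[OF un[OF x]] by (simp add: algebra_simps)
      qed
      ultimately have "\<mu> * u x - h (u x) \<le> \<rho> * s1 - (\<rho> - \<mu>) * (u \<xi> * tent p q x)" by linarith
      then have "(a x * \<phi> x) * (\<mu> * u x - h (u x)) \<le> (a x * \<phi> x) * (\<rho> * s1 - (\<rho> - \<mu>) * (u \<xi> * tent p q x))"
        using an[OF x] \<phi>(2)[OF x] by (intro mult_left_mono) auto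
      then show "u x * (\<mu> * a x * \<phi> x) - \<phi> x * (a x * h (u x)) \<le> \<rho> * s1 * (a x * \<phi> x) - (\<rho> - \<mu>) * u \<xi> * (a x * (\<phi> x * tent p q x))"
        by (simp add: algebra_simps)
    qed
    then have "u \<xi> * ((\<rho> - \<mu>) * \<kappa>) \<le> \<rho> * s1 * A" using bc by (simp add: algebra_simps)
    then show ?thesis using \<rho> \<kappa> by (simp add: pos_le_divide_eq)
  qed
  then show ?thesis using that by blast
qed

text \<open>Continuity of the indefinite integral. Positive mass at a definite distance from the end
  is needed because a trajectory with small end value but steep slope is bounded below only away
  from that end.\<close>

lemma mass_away_from_right_end:
  fixes b :: "real \<Rightarrow> real"
  assumes pq: "p < q" and b: "b integrable_on {p..q}" and bn: "\<And>x. x \<in> {p..q} \<Longrightarrow> 0 \<le> b x"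
    and nt: "\<not> negligible {x \<in> {p..q}. b x \<noteq> 0}"
  obtains d where "0 < d" "d < q - p" "0 < integral {p..q - d} b"
proof -
  have I: "0 < integral {p..q} b" by (rule integral_pos_if_not_negligible[OF b bn nt])
  have "continuous_on {p..q} (\<lambda>x. integral {p..x} b)" by (rule indefinite_integral_continuous_1[OF b])
  then obtain e where e: "e > 0" "\<forall>x\<in>{p..q}. dist x q < e \<longrightarrow> dist (integral {p..x} b) (integral {p..q} b) < integral {p..q} b"
    unfolding continuous_on_iff using I pq by (meson atLeastAtMost_iff less_imp_le order_refl)
  define d where "d = min (e/2) ((q - p)/2)"
  have d: "0 < d" "d < q - p" "d < e" using e(1) pq by (auto simp: d_def min_def field_simps)
  have "dist (integral {p..q - d} b) (integral {p..q} b) < integral {p..q} b"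
    using e(2) d by (auto simp: dist_real_def)
  then have "0 < integral {p..q - d} b" by (simp add: dist_real_def abs_less_iff)
  then show ?thesis using that d by blast
qed

lemma mass_away_from_left_end:
  fixes b :: "real \<Rightarrow> real"
  assumes pq: "p < q" and b: "b integrable_on {p..q}" and bn: "\<And>x. x \<in> {p..q} \<Longrightarrow> 0 \<le> b x"
    and nt: "\<not> negligible {x \<in> {p..q}. b x \<noteq> 0}"
  obtains d where "0 < d" "d < q - p" "0 < integral {p + d..q} b"
proof -
  have I: "0 < integral {p..q} b" by (rule integral_pos_if_not_negligible[OF b bn nt])
  have "continuous_on {p..q} (\<lambda>x. integral {x..q} b)" by (rule indefinite_integral_continuous_1'[OF b])
  then obtain e where e: "e > 0" "\<forall>x\<in>{p..q}. dist x p < e \<longrightarrow> dist (integral {x..q} b) (integral {p..q} b) < integral {p..q} b"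
    unfolding continuous_on_iff using I pq by (meson atLeastAtMost_iff less_imp_le order_refl)
  define d where "d = min (e/2) ((q - p)/2)"
  have d: "0 < d" "d < q - p" "d < e" using e(1) pq by (auto simp: d_def min_def field_simps)
  have "dist (integral {p + d..q} b) (integral {p..q} b) < integral {p..q} b"
    using e(2) d by (auto simp: dist_real_def)
  then have "0 < integral {p + d..q} b" by (simp add: dist_real_def abs_less_iff)
  then show ?thesis using that d by blast
qed

lemma pos_lower_bound:
  fixes kk :: "real \<Rightarrow> real"
  assumes "continuous_on {0..} kk" "\<And>s. 0 < s \<Longrightarrow> 0 < kk s" "0 < s0"
  obtains \<kappa> where "0 < \<kappa>" "\<And>s. s0 \<le> s \<Longrightarrow> s \<le> R \<Longrightarrow> \<kappa> \<le> kk s"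
proof (cases "s0 \<le> R")
  case True
  have "continuous_on {s0..R} kk" by (rule continuous_on_subset[OF assms(1)]) (use assms(3) in auto)
  then have "\<exists>z\<in>{s0..R}. \<forall>s\<in>{s0..R}. kk z \<le> kk s" using True by (intro continuous_attains_inf) auto
  then obtain z where "z \<in> {s0..R}" "\<forall>s\<in>{s0..R}. kk z \<le> kk s" by blast
  then show ?thesis using that[of "kk z"] assms(2)[of z] assms(3) by auto
next
  case False
  then show ?thesis using that[of 1] by auto
qed

text \<open>In a gap with strong absorption a bounded trajectory must arrive at the right end almost at rest at
  zero: otherwise integrating the absorption backwards makes the left end value too large.\<close>

lemma gap_exit:
  fixes b kk :: "real \<Rightarrow> real"
  assumes pq: "p < q" and b: "b absolutely_integrable_on {p..q}" and bn: "\<And>x. x \<in> {p..q} \<Longrightarrow> 0 \<le> b x"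
    and nt: "\<And>e. 0 < e \<Longrightarrow> e \<le> q - p \<Longrightarrow> \<not> negligible {x \<in> {q - e..q}. b x \<noteq> 0}"
    and kk: "continuous_on {0..} kk" "\<And>s. 0 < s \<Longrightarrow> 0 < kk s"
    and pos: "0 < e" "0 < C" "0 < R"
  obtains B where "\<And>\<beta> k u v. B \<le> \<beta> \<Longrightarrow> traj p q (\<lambda>x. - (\<beta> * b x * k (u x))) u v \<Longrightarrow>
    (\<And>x. x \<in> {p..q} \<Longrightarrow> 0 \<le> u x) \<Longrightarrow> (\<And>s. 0 \<le> s \<Longrightarrow> 0 \<le> k s) \<Longrightarrow> (\<And>s. 0 \<le> s \<Longrightarrow> kk s \<le> k s) \<Longrightarrow>
    u p \<le> R \<Longrightarrow> u q \<le> R \<Longrightarrow> v q \<le> C \<Longrightarrow> u q \<le> e \<and> - e \<le> v q"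
proof -
  \<comment> \<open>Over a length \<open>d\<close> a slope of at most \<open>C\<close> costs at most
    \<open>e / 2\<close>, so an end value above \<open>e\<close> keeps \<open>u\<close> above
    \<open>e / 2\<close> on that stretch; the other bound leaves half of the gap to its
    left.\<close>
  define d where "d = min (e / (2 * C)) ((q - p) / 2)"
  have d: "0 < d" "d \<le> q - p" "C * d \<le> e / 2" "q - d - p \<ge> (q - p) / 2"
  proof -
    show "0 < d" using pos pq by (simp add: d_def)
    have "C * d \<le> C * (e / (2 * C))" using pos by (intro mult_left_mono) (auto simp: d_def)
    then show "C * d \<le> e / 2" using pos by simp
    have "d \<le> (q - p) / 2" unfolding d_def by (rule min.cobounded2)
    then show "d \<le> q - p" "q - d - p \<ge> (q - p) / 2" using pq by auto
  qed
  have bi: "b integrable_on {x..y}" if "p \<le> x" "y \<le> q" for x y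
    by (rule integrable_on_subinterval[OF abs_int_imp_int[OF b]]) (use that in auto)
  obtain d' where d': "0 < d'" "d' < d" "0 < integral {q - d..q - d'} b"
    using mass_away_from_right_end[of "q - d" q b] d bi nt[of d] bn by auto
  \<comment> \<open>One lower bound for both ways the claim may fail: \<open>e / 2\<close> when the
    end value exceeds \<open>e\<close>, and \<open>e * d'\<close> when the final slope is below
    \<open>- e\<close>, as \<open>u\<close> then has to descend to a nonnegative end value.\<close>
  define s0 where "s0 = min (e / 2) (e * d')"
  have s0: "0 < s0" "s0 \<le> e / 2" "s0 \<le> e * d'" using pos d' by (auto simp: s0_def)
  obtain \<kappa> where \<kappa>: "0 < \<kappa>" "\<And>s. s0 \<le> s \<Longrightarrow> s \<le> R \<Longrightarrow> \<kappa> \<le> kk s"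
    using pos_lower_bound[OF kk s0(1)] by blast
  define I where "I = integral {q - d..q - d'} b"
  have I: "0 < I" using d' by (simp add: I_def)
  \<comment> \<open>Chosen so that absorption forces a slope below
    \<open>- 2 * (R + 1) / (q - p)\<close> at \<open>q - d\<close>. By convexity this persists to
    the left over at least half of the gap, which puts \<open>u p\<close> above \<open>R\<close>.
    Only the minorant \<open>kk\<close> enters, so \<open>B\<close> is the same for every
    \<open>k\<close> above it.\<close>
  define B where "B = (C + 2 * (R + 1) / (q - p)) / (\<kappa> * I)"
  have Bpos: "0 < B" using pos pq \<kappa> I by (simp add: B_def add_pos_pos)
  have "u q \<le> e \<and> - e \<le> v q"
    if \<beta>: "B \<le> \<beta>" and t: "traj p q (\<lambda>x. - (\<beta> * b x * k (u x))) u v"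
      and un: "\<And>x. x \<in> {p..q} \<Longrightarrow> 0 \<le> u x" and k: "\<And>s. 0 \<le> s \<Longrightarrow> 0 \<le> k s" "\<And>s. 0 \<le> s \<Longrightarrow> kk s \<le> k s"
      and ub: "u p \<le> R" "u q \<le> R" "v q \<le> C" for \<beta> k u v
  proof (rule ccontr)
    assume neg: "\<not> (u q \<le> e \<and> - e \<le> v q)"
    have \<beta>0: "0 < \<beta>" using \<beta> Bpos by simp
    have F: "- (\<beta> * b z * k (u z)) \<le> 0" if "p \<le> z" "z \<le> q" for z
      using that bn un k(1) \<beta>0 by auto
    have vm: "v x \<le> v y" if "p \<le> x" "x \<le> y" "y \<le> q" for x y
      by (rule traj_v_mono[OF t that]) (use F that in auto)
    have uR: "u x \<le> R" if "x \<in> {p..q}" for x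
      by (rule traj_convex_le_max[OF t F]) (use that ub in auto)
    have us0: "s0 \<le> u x" if x: "x \<in> {q - d..q - d'}" for x
    proof (cases "e < u q")
      case True
      have "u q - u x \<le> C * (q - x)"
      proof (rule traj_slope_le[OF t])
        fix z assume "x \<le> z" "z \<le> q"
        then show "v z \<le> C" using vm[of z q] ub(3) x d by auto
      qed (use x d d' in auto)
      also have "\<dots> \<le> C * d" using x pos by (intro mult_left_mono) auto
      finally show ?thesis using True d s0 by linarith
    next
      case False
      then have "v q < - e" using neg by auto
      have "u q - u x \<le> - e * (q - x)"
      proof (rule traj_slope_le[OF t])
        fix z assume "x \<le> z" "z \<le> q"
        then show "v z \<le> - e" using vm[of z q] \<open>v q < - e\<close> x d by auto
      qed (use x d d' in auto)
      moreover have "e * d' \<le> e * (q - x)" using x pos by (intro mult_left_mono) auto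
      moreover have "0 \<le> u q" using un pq by auto
      ultimately show ?thesis using s0 by linarith
    qed
    have "v (q - d') - v (q - d) = - integral {q - d..q - d'} (\<lambda>x. - (\<beta> * b x * k (u x)))"
      by (rule traj_v_diff[OF t]) (use d d' in auto)
    also have "\<dots> \<ge> \<beta> * \<kappa> * I"
    proof -
      have "integral {q - d..q - d'} (\<lambda>x. - (\<beta> * b x * k (u x))) \<le> integral {q - d..q - d'} (\<lambda>x. - (\<beta> * \<kappa>) * b x)"
      proof (rule integral_le)
        show "(\<lambda>x. - (\<beta> * b x * k (u x))) integrable_on {q - d..q - d'}"
          by (rule traj_integrable[OF t]) (use d d' in auto)
        show "(\<lambda>x. - (\<beta> * \<kappa>) * b x) integrable_on {q - d..q - d'}"
          using integrable_on_cmult_left[OF bi[of "q - d" "q - d'"], of "- (\<beta> * \<kappa>)"] d d' by simp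
        fix x assume x: "x \<in> {q - d..q - d'}"
        then have xq: "x \<in> {p..q}" using d d' by auto
        have "\<kappa> \<le> k (u x)" using \<kappa>(2)[OF us0[OF x] uR[OF xq]] k(2)[OF un[OF xq]] by linarith
        then have "(\<beta> * b x) * \<kappa> \<le> (\<beta> * b x) * k (u x)" using \<beta>0 bn[OF xq] by (intro mult_left_mono) auto
        then show "- (\<beta> * b x * k (u x)) \<le> - (\<beta> * \<kappa>) * b x" by (simp add: mult_ac)
      qed
      also have "\<dots> = - (\<beta> * \<kappa>) * I" unfolding I_def by (rule integral_mult_right)
      finally show ?thesis by simp
    qed
    finally have 1: "v (q - d) \<le> v (q - d') - \<beta> * \<kappa> * I" by simp
    have "B * (\<kappa> * I) \<le> \<beta> * (\<kappa> * I)" using \<beta> \<kappa> I by (intro mult_right_mono) auto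
    moreover have "B * (\<kappa> * I) = C + 2 * (R + 1) / (q - p)" using \<kappa> I by (simp add: B_def)
    moreover have "v (q - d') \<le> C" using vm[of "q - d'" q] ub d d' by auto
    ultimately have 2: "v (q - d) \<le> - (2 * (R + 1) / (q - p))" using 1 by (simp add: mult.assoc)
    have "u (q - d) - u p \<le> v (q - d) * (q - d - p)"
      by (rule traj_slope_le[OF t]) (use d vm in auto)
    also have "\<dots> \<le> - (2 * (R + 1) / (q - p)) * (q - d - p)" using 2 d by (intro mult_right_mono) auto
    also have "\<dots> \<le> - (2 * (R + 1) / (q - p)) * ((q - p) / 2)" using d pos pq by (intro mult_left_mono_neg) auto
    also have "\<dots> = - (R + 1)" using pq by (simp add: field_simps)
    finally have "u p \<ge> R + 1" using un[of "q - d"] d by auto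
    then show False using ub by simp
  qed
  then show ?thesis using that by blast
qed

text \<open>The linear lower bound keeps the absorption active in the first half of the gap. If
  \<open>u\<close> stayed below \<open>R\<close>, then for \<open>B \<le> \<beta>\<close> the slope
  at the midpoint would be at least \<open>(R + 1) / d\<close>, and the second half would carry
  \<open>u\<close> past \<open>R\<close>. Again \<open>B\<close> depends on the minorant
  \<open>kk\<close> only.\<close>

lemma gap_blowup:
  fixes b kk :: "real \<Rightarrow> real"
  assumes pq: "p < q" and b: "b absolutely_integrable_on {p..q}" and bn: "\<And>x. x \<in> {p..q} \<Longrightarrow> 0 \<le> b x"
    and nt: "\<And>e. 0 < e \<Longrightarrow> e \<le> q - p \<Longrightarrow> \<not> negligible {x \<in> {p..p + e}. b x \<noteq> 0}"
    and kk: "continuous_on {0..} kk" "\<And>s. 0 < s \<Longrightarrow> 0 < kk s"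
    and pos: "0 < c" "0 < C" "0 < R"
  obtains B where "\<And>\<beta> k u v. B \<le> \<beta> \<Longrightarrow> traj p q (\<lambda>x. - (\<beta> * b x * k (u x))) u v \<Longrightarrow>
    (\<And>x. x \<in> {p..q} \<Longrightarrow> c * (x - p) \<le> u x) \<Longrightarrow> (\<And>s. 0 \<le> s \<Longrightarrow> 0 \<le> k s) \<Longrightarrow> (\<And>s. 0 \<le> s \<Longrightarrow> kk s \<le> k s) \<Longrightarrow>
    u p \<le> R \<Longrightarrow> - C \<le> v p \<Longrightarrow> R < u q"
proof -
  define d where "d = (q - p) / 2"
  have d: "0 < d" "d < q - p" "q - (p + d) = d" using pq by (auto simp: d_def field_simps)
  have bi: "b integrable_on {x..y}" if "p \<le> x" "y \<le> q" for x y
    by (rule integrable_on_subinterval[OF abs_int_imp_int[OF b]]) (use that in auto)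
  obtain d' where d': "0 < d'" "d' < d" "0 < integral {p + d'..p + d} b"
    using mass_away_from_left_end[of p "p + d" b] d bi nt[of d] bn by auto
  obtain \<kappa> where \<kappa>: "0 < \<kappa>" "\<And>s. c * d' \<le> s \<Longrightarrow> s \<le> R \<Longrightarrow> \<kappa> \<le> kk s"
    using pos_lower_bound[OF kk, of "c * d'"] pos d' by auto
  define I where "I = integral {p + d'..p + d} b"
  have I: "0 < I" using d' by (simp add: I_def)
  define B where "B = (C + (R + 1) / d) / (\<kappa> * I)"
  have Bpos: "0 < B" using pos d \<kappa> I by (simp add: B_def add_pos_pos)
  have "R < u q"
    if \<beta>: "B \<le> \<beta>" and t: "traj p q (\<lambda>x. - (\<beta> * b x * k (u x))) u v"
      and uc: "\<And>x. x \<in> {p..q} \<Longrightarrow> c * (x - p) \<le> u x" and k: "\<And>s. 0 \<le> s \<Longrightarrow> 0 \<le> k s" "\<And>s. 0 \<le> s \<Longrightarrow> kk s \<le> k s"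
      and up: "u p \<le> R" and vp: "- C \<le> v p" for \<beta> k u v
  proof (rule ccontr)
    assume "\<not> R < u q"
    then have uq: "u q \<le> R" by simp
    have \<beta>0: "0 < \<beta>" using \<beta> Bpos by simp
    have un: "0 \<le> u x" if "x \<in> {p..q}" for x
    proof -
      have "0 \<le> c * (x - p)" using that pos by auto
      then show ?thesis using uc[OF that] by linarith
    qed
    have F: "- (\<beta> * b z * k (u z)) \<le> 0" if "p \<le> z" "z \<le> q" for z
      using that bn un k(1) \<beta>0 by auto
    have vm: "v x \<le> v y" if "p \<le> x" "x \<le> y" "y \<le> q" for x y
      by (rule traj_v_mono[OF t that]) (use F that in auto)
    have uR: "u x \<le> R" if "x \<in> {p..q}" for x
      by (rule traj_convex_le_max[OF t F]) (use that up uq in auto)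
    have "v (p + d) - v (p + d') = - integral {p + d'..p + d} (\<lambda>x. - (\<beta> * b x * k (u x)))"
      by (rule traj_v_diff[OF t]) (use d d' in auto)
    also have "\<dots> \<ge> \<beta> * \<kappa> * I"
    proof -
      have "integral {p + d'..p + d} (\<lambda>x. - (\<beta> * b x * k (u x))) \<le> integral {p + d'..p + d} (\<lambda>x. - (\<beta> * \<kappa>) * b x)"
      proof (rule integral_le)
        show "(\<lambda>x. - (\<beta> * b x * k (u x))) integrable_on {p + d'..p + d}"
          by (rule traj_integrable[OF t]) (use d d' in auto)
        show "(\<lambda>x. - (\<beta> * \<kappa>) * b x) integrable_on {p + d'..p + d}"
          using integrable_on_cmult_left[OF bi[of "p + d'" "p + d"], of "- (\<beta> * \<kappa>)"] d d' by simp
        fix x assume x: "x \<in> {p + d'..p + d}"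
        then have xq: "x \<in> {p..q}" using d d' by auto
        have "c * d' \<le> c * (x - p)" using x pos by (intro mult_left_mono) auto
        then have "c * d' \<le> u x" using uc[OF xq] by linarith
        then have "\<kappa> \<le> k (u x)" using \<kappa>(2)[OF _ uR[OF xq]] k(2)[OF un[OF xq]] by force
        then have "(\<beta> * b x) * \<kappa> \<le> (\<beta> * b x) * k (u x)" using \<beta>0 bn[OF xq] by (intro mult_left_mono) auto
        then show "- (\<beta> * b x * k (u x)) \<le> - (\<beta> * \<kappa>) * b x" by (simp add: mult_ac)
      qed
      also have "\<dots> = - (\<beta> * \<kappa>) * I" unfolding I_def by (rule integral_mult_right)
      finally show ?thesis by simp
    qed
    finally have 1: "v (p + d) \<ge> v (p + d') + \<beta> * \<kappa> * I" by simp
    have "B * (\<kappa> * I) \<le> \<beta> * (\<kappa> * I)" using \<beta> \<kappa> I by (intro mult_right_mono) auto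
    moreover have "B * (\<kappa> * I) = C + (R + 1) / d" using \<kappa> I by (simp add: B_def)
    moreover have "v (p + d') \<ge> - C" using vm[of p "p + d'"] vp d d' by auto
    ultimately have 2: "v (p + d) \<ge> (R + 1) / d" using 1 by (simp add: mult.assoc)
    have "u q - u (p + d) \<ge> (R + 1) / d * (q - (p + d))"
    proof (rule traj_slope_ge[OF t])
      fix z assume "p + d \<le> z" "z \<le> q"
      then show "(R + 1) / d \<le> v z" using vm[of "p + d" z] 2 d by auto
    qed (use d in auto)
    moreover have "0 \<le> u (p + d)" using un d by auto
    ultimately have "u q \<ge> R + 1" using d by simp
    then show False using uq by simp
  qed
  then show ?thesis using that by blast
qed

lemma wronskian_mono:
  assumes pq: "p \<le> q" and u: "traj p q F u v" and \<phi>: "traj p q G \<phi> \<psi>"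
    and N: "negligible N" and le: "\<And>x. x \<in> {p..q} \<Longrightarrow> x \<notin> N \<Longrightarrow> H x \<le> u x * G x - \<phi> x * F x"
    and H: "(H has_integral I) {p..q}"
  shows "v p * \<phi> p - u p * \<psi> p + I \<le> v q * \<phi> q - u q * \<psi> q"
proof -
  define H' where "H' x = (if x \<in> N then u x * G x - \<phi> x * F x else H x)" for x
  have "(H' has_integral I) {p..q}"
    by (rule has_integral_spike[OF N _ H]) (auto simp: H'_def)
  then have "I \<le> (v q * \<phi> q - u q * \<psi> q) - (v p * \<phi> p - u p * \<psi> p)"
    by (rule has_integral_le[OF _ traj_wronskian[OF pq u \<phi>]]) (use le in \<open>auto simp: H'_def\<close>)
  then show ?thesis by simp
qed

text \<open>The derivative of \<open>u / \<phi>\<close> is the Wronskian over \<open>\<phi>\<close>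
  squared, so Wronskian bounds become growth bounds by the mean value theorem.\<close>

lemma quotient_growth:
  assumes u: "traj p q F u v" and \<phi>: "traj p q G \<phi> \<psi>" and xy: "p \<le> x" "x \<le> y" "y \<le> q"
    and pos: "\<And>z. z \<in> {p..q} \<Longrightarrow> 0 < \<phi> z"
    and W: "\<And>z. x \<le> z \<Longrightarrow> z \<le> y \<Longrightarrow> c * (\<phi> z)\<^sup>2 \<le> v z * \<phi> z - u z * \<psi> z"
  shows "u x / \<phi> x + c * (y - x) \<le> u y / \<phi> y"
proof (cases "x = y")
  case False
  then have xy': "x < y" using xy by simp
  have c: "continuous_on {x..y} (\<lambda>z. u z / \<phi> z)"
  proof (intro continuous_on_divide ballI)
    show "continuous_on {x..y} u" "continuous_on {x..y} \<phi>"
      using traj_cont_u[OF u] traj_cont_u[OF \<phi>] xy by (auto intro: continuous_on_subset)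
    fix z assume "z \<in> {x..y}"
    then show "\<phi> z \<noteq> 0" using pos[of z] xy by auto
  qed
  have der: "((\<lambda>z. u z / \<phi> z) has_derivative (*) ((v z * \<phi> z - u z * \<psi> z) / (\<phi> z)\<^sup>2)) (at z)" if z: "x < z" "z < y" for z
  proof -
    have "(u has_real_derivative v z) (at z within {p..q})" "(\<phi> has_real_derivative \<psi> z) (at z within {p..q})"
      using u \<phi> xy z by (auto simp: traj_def)
    then have "(u has_real_derivative v z) (at z)" "(\<phi> has_real_derivative \<psi> z) (at z)"
      using at_within_Icc_at[of p z q] xy z by auto
    then have "((\<lambda>z. u z / \<phi> z) has_real_derivative (v z * \<phi> z - u z * \<psi> z) / (\<phi> z)\<^sup>2) (at z)"
      using pos[of z] xy z by (auto intro!: derivative_eq_intros simp: power2_eq_square)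
    then show ?thesis by (simp add: has_field_derivative_def)
  qed
  obtain z where z: "x < z" "z < y" "u y / \<phi> y - u x / \<phi> x = (v z * \<phi> z - u z * \<psi> z) / (\<phi> z)\<^sup>2 * (y - x)"
    using mvt[OF xy' c der] by auto
  have "0 < \<phi> z" using pos[of z] z xy by auto
  then have "c \<le> (v z * \<phi> z - u z * \<psi> z) / (\<phi> z)\<^sup>2"
    using W[of z] z by (simp add: pos_le_divide_eq)
  then have "c * (y - x) \<le> u y / \<phi> y - u x / \<phi> x"
    unfolding z(3) using xy' by (intro mult_right_mono) auto
  then show ?thesis by simp
qed auto

section \<open>Shooting for the Sturm-Liouville problem\<close>

text \<open>Only the weights, the boundary conditions and the geometry are fixed here.
  Nonlinearities and the coefficients \<open>bet\<close> remain parameters of the results, which are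
  applied to the given functions and to their Lipschitz approximations alike.\<close>

locale SL_structure =
  fixes L al be ga de :: real
    and m :: nat
    and alp :: "nat \<Rightarrow> real"
    and a b :: "nat \<Rightarrow> real \<Rightarrow> real"
    and \<sigma> \<tau> :: "nat \<Rightarrow> real"
  assumes L_pos: "L > 0"
    and bc_nonneg: "al \<ge> 0" "be \<ge> 0" "ga \<ge> 0" "de \<ge> 0"
    and bc_nondeg: "ga * be + al * ga + al * de > 0"
    and m_pos: "m \<ge> 1"
    and alp_pos: "\<forall>i\<in>{1..m}. alp i > 0"
    and a_nonneg: "\<forall>i\<in>{1..m}. \<forall>x\<in>{0..L}. a i x \<ge> 0"
    and a_int: "\<forall>i\<in>{1..m}. integrable (lebesgue_on {0..L}) (a i)"
    and b_nonneg: "\<forall>j\<in>{0..m+1}. \<forall>x\<in>{0..L}. b j x \<ge> 0"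
    and b_int: "\<forall>j\<in>{0..m+1}. integrable (lebesgue_on {0..L}) (b j)"
    and h1_tau0: "\<tau> 0 = 0"
    and h1_sigmaL: "\<sigma> (m+1) = L"
    and h1_first: "\<tau> 0 \<le> \<sigma> 1"
    and h1_I: "\<forall>i\<in>{1..m}. \<sigma> i < \<tau> i"
    and h1_J: "\<forall>i\<in>{1..m-1}. \<tau> i < \<sigma> (i+1)"
    and h1_last: "\<tau> m \<le> \<sigma> (m+1)"
    and h1_a_supp: "\<forall>i\<in>{1..m}. AE x in lebesgue. x \<in> {0..L} - {\<sigma> i..\<tau> i} \<longrightarrow> a i x = 0"
    and h1_a_nontriv: "\<forall>i\<in>{1..m}. \<not> (AE x in lebesgue. x \<in> {\<sigma> i..\<tau> i} \<longrightarrow> a i x = 0)"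
    and h1_b_supp: "\<forall>j\<in>{0..m}. AE x in lebesgue. x \<in> {0..L} - {\<tau> j..\<sigma> (j+1)} \<longrightarrow> b j x = 0"
    and h1_b_last: "AE x in lebesgue. x \<in> {0..L} \<longrightarrow> b (m+1) x = 0"
    and h1_b_nontriv: "\<forall>j\<in>{0..m}. \<tau> j < \<sigma> (j+1) \<longrightarrow> (\<forall>\<epsilon>>0.
          \<not> (AE x in lebesgue. x \<in> {\<tau> j..\<tau> j + \<epsilon>} \<longrightarrow> b j x = 0) \<and>
          \<not> (AE x in lebesgue. x \<in> {\<sigma> (j+1) - \<epsilon>..\<sigma> (j+1)} \<longrightarrow> b j x = 0))"
begin

lemma gap_le: "j \<le> m \<Longrightarrow> \<tau> j \<le> \<sigma> (Suc j)"
  using h1_first h1_last h1_J by (cases "j = 0"; cases "j = m") (auto simp: less_imp_le)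

lemma gap_less: "1 \<le> j \<Longrightarrow> j < m \<Longrightarrow> \<tau> j < \<sigma> (Suc j)"
  using h1_J by auto

lemma hump_less: "i \<in> {1..m} \<Longrightarrow> \<sigma> i < \<tau> i"
  using h1_I by auto

lemma tau_mono: "i \<le> j \<Longrightarrow> j \<le> m \<Longrightarrow> \<tau> i \<le> \<tau> j"
proof (induction j rule: dec_induct)
  case (step j)
  have "\<tau> j \<le> \<sigma> (Suc j)" "\<sigma> (Suc j) < \<tau> (Suc j)" using gap_le[of j] hump_less[of "Suc j"] step by auto
  then show ?case using step by simp
qed simp

lemma sigma_mono: "i \<le> j \<Longrightarrow> 1 \<le> i \<Longrightarrow> j \<le> Suc m \<Longrightarrow> \<sigma> i \<le> \<sigma> j"
proof (induction j rule: dec_induct)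
  case (step j)
  have "\<sigma> j < \<tau> j" "\<tau> j \<le> \<sigma> (Suc j)" using gap_le[of j] hump_less[of j] step by auto
  then show ?case using step by simp
qed simp

lemma tau_le_sigma: "l < i \<Longrightarrow> i \<le> Suc m \<Longrightarrow> \<tau> l \<le> \<sigma> i"
  using gap_le[of l] sigma_mono[of "Suc l" i] by simp

lemma hump_in: "i \<in> {1..m} \<Longrightarrow> 0 \<le> \<sigma> i" "i \<in> {1..m} \<Longrightarrow> \<tau> i \<le> L"
  using tau_le_sigma[of 0 i] h1_tau0 tau_mono[of i m] h1_last h1_sigmaL by auto

lemma gap_in: "j \<le> m \<Longrightarrow> 0 \<le> \<tau> j" "j \<le> m \<Longrightarrow> \<sigma> (Suc j) \<le> L"
  using tau_mono[of 0 j] h1_tau0 sigma_mono[of "Suc j" "Suc m"] h1_sigmaL by auto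

lemma a_abs: "i \<in> {1..m} \<Longrightarrow> a i absolutely_integrable_on {0..L}"
  using a_int by (auto simp: integrable_restrict_space set_integrable_def)

lemma b_abs: "j \<in> {0..m+1} \<Longrightarrow> b j absolutely_integrable_on {0..L}"
  using b_int by (auto simp: integrable_restrict_space set_integrable_def)

lemma a_nontriv:
  assumes "i \<in> {1..m}"
  shows "\<not> negligible {x \<in> {\<sigma> i..\<tau> i}. a i x \<noteq> 0}"
proof
  assume "negligible {x \<in> {\<sigma> i..\<tau> i}. a i x \<noteq> 0}"
  then have "AE x in lebesgue. x \<in> {\<sigma> i..\<tau> i} \<longrightarrow> a i x = 0" by (rule negligible_imp_AE) auto
  then show False using h1_a_nontriv assms by blast
qed

lemma b_nontriv_left:
  assumes "1 \<le> j" "j < m" "0 < e"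
  shows "\<not> negligible {x \<in> {\<tau> j..\<tau> j + e}. b j x \<noteq> 0}"
proof
  assume "negligible {x \<in> {\<tau> j..\<tau> j + e}. b j x \<noteq> 0}"
  then have "AE x in lebesgue. x \<in> {\<tau> j..\<tau> j + e} \<longrightarrow> b j x = 0" by (rule negligible_imp_AE) auto
  then show False using h1_b_nontriv assms gap_less[of j] by auto
qed

lemma b_nontriv_right:
  assumes "1 \<le> j" "j < m" "0 < e"
  shows "\<not> negligible {x \<in> {\<sigma> (Suc j) - e..\<sigma> (Suc j)}. b j x \<noteq> 0}"
proof
  assume "negligible {x \<in> {\<sigma> (Suc j) - e..\<sigma> (Suc j)}. b j x \<noteq> 0}"
  then have "AE x in lebesgue. x \<in> {\<sigma> (Suc j) - e..\<sigma> (Suc j)} \<longrightarrow> b j x = 0" by (rule negligible_imp_AE) auto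
  then show False using h1_b_nontriv assms gap_less[of j] by auto
qed

text \<open>All exceptional null sets are merged, together with the finitely many interval
  endpoints; adjacent humps and gaps then have genuinely disjoint supports.\<close>

lemma exceptional_null_set:
  obtains N where "negligible N" "\<And>i x. i \<in> {1..m} \<Longrightarrow> x \<in> {0..L} \<Longrightarrow> x \<notin> N \<Longrightarrow> x \<notin> {\<sigma> i<..<\<tau> i} \<Longrightarrow> a i x = 0"
    "\<And>j x. j \<in> {0..m} \<Longrightarrow> x \<in> {0..L} \<Longrightarrow> x \<notin> N \<Longrightarrow> x \<notin> {\<tau> j<..<\<sigma> (Suc j)} \<Longrightarrow> b j x = 0"
    "\<And>x. x \<in> {0..L} \<Longrightarrow> x \<notin> N \<Longrightarrow> b (Suc m) x = 0"
proof -
  define N where "N = (\<Union>i\<in>{1..m}. {x. \<not> (x \<in> {0..L} - {\<sigma> i..\<tau> i} \<longrightarrow> a i x = 0)}) \<union>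
     (\<Union>j\<in>{0..m}. {x. \<not> (x \<in> {0..L} - {\<tau> j..\<sigma> (j+1)} \<longrightarrow> b j x = 0)}) \<union>
     {x. \<not> (x \<in> {0..L} \<longrightarrow> b (m+1) x = 0)} \<union> \<sigma> ` {1..m+1} \<union> \<tau> ` {0..m}"
  have n1: "negligible {x. \<not> (x \<in> {0..L} - {\<sigma> i..\<tau> i} \<longrightarrow> a i x = 0)}" if "i \<in> {1..m}" for i
    by (rule AE_imp_negligible) (use h1_a_supp that in blast)
  have n2: "negligible {x. \<not> (x \<in> {0..L} - {\<tau> j..\<sigma> (j+1)} \<longrightarrow> b j x = 0)}" if "j \<in> {0..m}" for j
    by (rule AE_imp_negligible) (use h1_b_supp that in blast)
  have n3: "negligible {x. \<not> (x \<in> {0..L} \<longrightarrow> b (m+1) x = 0)}"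
    by (rule AE_imp_negligible) (rule h1_b_last)
  have n4: "negligible (\<sigma> ` {1..m+1})" "negligible (\<tau> ` {0..m})" by (intro negligible_finite finite_imageI; simp)+
  have "negligible (\<Union>i\<in>{1..m}. {x. \<not> (x \<in> {0..L} - {\<sigma> i..\<tau> i} \<longrightarrow> a i x = 0)})"
    by (rule negligible_Union) (use n1 in blast)+
  moreover have "negligible (\<Union>j\<in>{0..m}. {x. \<not> (x \<in> {0..L} - {\<tau> j..\<sigma> (j+1)} \<longrightarrow> b j x = 0)})"
    by (rule negligible_Union) (use n2 in blast)+
  ultimately have "negligible N" unfolding N_def by (intro negligible_Un n3 n4)
  moreover have "a i x = 0" if "i \<in> {1..m}" "x \<in> {0..L}" "x \<notin> N" "x \<notin> {\<sigma> i<..<\<tau> i}" for i x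
  proof -
    have "x \<noteq> \<sigma> i" "x \<noteq> \<tau> i" using that by (auto simp: N_def)
    then have "x \<in> {0..L} - {\<sigma> i..\<tau> i}" using that by auto
    then show ?thesis using that by (auto simp: N_def)
  qed
  moreover have "b j x = 0" if "j \<in> {0..m}" "x \<in> {0..L}" "x \<notin> N" "x \<notin> {\<tau> j<..<\<sigma> (Suc j)}" for j x
  proof -
    have "x \<noteq> \<tau> j" "x \<noteq> \<sigma> (Suc j)" using that by (auto simp: N_def)
    then have "x \<in> {0..L} - {\<tau> j..\<sigma> (j+1)}" using that by auto
    then show ?thesis using that by (auto simp: N_def)
  qed
  moreover have "b (Suc m) x = 0" if "x \<in> {0..L}" "x \<notin> N" for x using that by (auto simp: N_def)
  ultimately show ?thesis by (rule that)
qed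

lemma a_zero_off:
  assumes N: "\<And>i x. i \<in> {1..m} \<Longrightarrow> x \<in> {0..L} \<Longrightarrow> x \<notin> N \<Longrightarrow> x \<notin> {\<sigma> i<..<\<tau> i} \<Longrightarrow> a i x = 0" and x: "x \<notin> N"
  shows "i \<in> {1..m} \<Longrightarrow> l \<in> {1..m} \<Longrightarrow> l \<noteq> i \<Longrightarrow> x \<in> {\<sigma> i..\<tau> i} \<Longrightarrow> a l x = 0"
    and "j \<le> m \<Longrightarrow> l \<in> {1..m} \<Longrightarrow> x \<in> {\<tau> j..\<sigma> (Suc j)} \<Longrightarrow> a l x = 0"
proof -
  assume i: "i \<in> {1..m}" "l \<in> {1..m}" "l \<noteq> i" "x \<in> {\<sigma> i..\<tau> i}"
  show "a l x = 0"
  proof (rule N[OF i(2) _ x])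
    show "x \<in> {0..L}" using hump_in[OF i(1)] i(4) by auto
    show "x \<notin> {\<sigma> l<..<\<tau> l}"
    proof (cases "l < i")
      case True
      then have "\<tau> l \<le> \<sigma> i" using tau_le_sigma[of l i] i by auto
      then show ?thesis using i by auto
    next
      case False
      then have "\<tau> i \<le> \<sigma> l" using tau_le_sigma[of i l] i by auto
      then show ?thesis using i by auto
    qed
  qed
next
  assume j: "j \<le> m" "l \<in> {1..m}" "x \<in> {\<tau> j..\<sigma> (Suc j)}"
  show "a l x = 0"
  proof (rule N[OF j(2) _ x])
    show "x \<in> {0..L}" using gap_in[OF j(1)] j(3) by auto
    show "x \<notin> {\<sigma> l<..<\<tau> l}"
    proof (cases "l \<le> j")
      case True
      then have "\<tau> l \<le> \<tau> j" using tau_mono[of l j] j by auto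
      then show ?thesis using j by auto
    next
      case False
      then have "\<sigma> (Suc j) \<le> \<sigma> l" using sigma_mono[of "Suc j" l] j by auto
      then show ?thesis using j by auto
    qed
  qed
qed

lemma b_zero_off:
  assumes N: "\<And>j x. j \<in> {0..m} \<Longrightarrow> x \<in> {0..L} \<Longrightarrow> x \<notin> N \<Longrightarrow> x \<notin> {\<tau> j<..<\<sigma> (Suc j)} \<Longrightarrow> b j x = 0" and x: "x \<notin> N"
  shows "i \<in> {1..m} \<Longrightarrow> l \<in> {0..m} \<Longrightarrow> x \<in> {\<sigma> i..\<tau> i} \<Longrightarrow> b l x = 0"
    and "j \<le> m \<Longrightarrow> l \<in> {0..m} \<Longrightarrow> l \<noteq> j \<Longrightarrow> x \<in> {\<tau> j..\<sigma> (Suc j)} \<Longrightarrow> b l x = 0"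
proof -
  assume i: "i \<in> {1..m}" "l \<in> {0..m}" "x \<in> {\<sigma> i..\<tau> i}"
  show "b l x = 0"
  proof (rule N[OF i(2) _ x])
    show "x \<in> {0..L}" using hump_in[OF i(1)] i by auto
    show "x \<notin> {\<tau> l<..<\<sigma> (Suc l)}"
    proof (cases "l < i")
      case True
      then have "\<sigma> (Suc l) \<le> \<sigma> i" using sigma_mono[of "Suc l" i] i by auto
      then show ?thesis using i by auto
    next
      case False
      then have "\<tau> i \<le> \<tau> l" using tau_mono[of i l] i by auto
      then show ?thesis using i by auto
    qed
  qed
next
  assume j: "j \<le> m" "l \<in> {0..m}" "l \<noteq> j" "x \<in> {\<tau> j..\<sigma> (Suc j)}"
  show "b l x = 0"
  proof (rule N[OF j(2) _ x])
    show "x \<in> {0..L}" using gap_in[OF j(1)] j by auto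
    show "x \<notin> {\<tau> l<..<\<sigma> (Suc l)}"
    proof (cases "l < j")
      case True
      then have "\<sigma> (Suc l) \<le> \<sigma> j" "\<sigma> j < \<tau> j" using sigma_mono[of "Suc l" j] hump_less[of j] j by auto
      then show ?thesis using j by auto
    next
      case False
      then have "\<sigma> (Suc j) < \<tau> (Suc j)" "\<tau> (Suc j) \<le> \<tau> l" using tau_mono[of "Suc j" l] hump_less[of "Suc j"] j by auto
      then show ?thesis using j by auto
    qed
  qed
qed

text \<open>The positive part sits inside the arguments of \<open>g\<close> and \<open>k\<close>, so
  this is again an instance of \<open>f_SL\<close>, and it coincides with the original nonlinearity
  along nonnegative functions.\<close>

definition nl :: "(nat \<Rightarrow> real \<Rightarrow> real) \<Rightarrow> (nat \<Rightarrow> real \<Rightarrow> real) \<Rightarrow> (nat \<Rightarrow> real) \<Rightarrow> real \<Rightarrow> real \<Rightarrow> real" where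
  "nl g k bet = f_SL m alp a (\<lambda>i s. g i (max 0 s)) bet b (\<lambda>j s. k j (max 0 s))"

text \<open>The initial data with \<open>t \<ge> 0\<close> run through the half-line of solutions of
  the left boundary condition that start with nonnegative value and slope.\<close>

definition shot :: "(nat \<Rightarrow> real \<Rightarrow> real) \<Rightarrow> (nat \<Rightarrow> real \<Rightarrow> real) \<Rightarrow> (nat \<Rightarrow> real) \<Rightarrow> real \<Rightarrow> (real \<Rightarrow> real) \<Rightarrow> (real \<Rightarrow> real) \<Rightarrow> bool" where
  "shot g k bet t u v \<longleftrightarrow> 0 \<le> t \<and> traj 0 L (\<lambda>x. nl g k bet x (u x)) u v \<and> u 0 = be * t \<and> v 0 = al * t"

definition bvalue :: "(real \<Rightarrow> real) \<Rightarrow> (real \<Rightarrow> real) \<Rightarrow> real" where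
  "bvalue u v = ga * u L + de * v L"

definition nonlin :: "(nat \<Rightarrow> real \<Rightarrow> real) \<Rightarrow> (nat \<Rightarrow> real \<Rightarrow> real) \<Rightarrow> bool" where
  "nonlin g k \<longleftrightarrow> (\<forall>i\<in>{1..m}. continuous_on {0..} (g i) \<and> g i 0 = 0 \<and> (\<forall>s\<ge>0. 0 \<le> g i s)) \<and>
     (\<forall>j\<in>{0..m+1}. continuous_on {0..} (k j) \<and> k j 0 = 0 \<and> (\<forall>s\<ge>0. 0 \<le> k j s))"

lemma nl_nonpos: "nonlin g k \<Longrightarrow> s \<le> 0 \<Longrightarrow> nl g k bet x s = 0"
  by (auto simp: nl_def f_SL_def nonlin_def max_absorb1 intro!: sum.neutral)

lemma nl_integrable:
  assumes "nonlin g k" "continuous_on {0..L} u"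
  shows "(\<lambda>x. nl g k bet x (u x)) absolutely_integrable_on {0..L}"
proof -
  have c: "continuous_on {0..L} (\<lambda>x. h (max 0 (u x)))" if "continuous_on {0..} h" for h :: "real \<Rightarrow> real"
    by (rule continuous_on_compose2[OF that]) (use assms(2) in \<open>auto intro!: continuous_intros\<close>)
  have A: "(\<lambda>x. alp i * a i x * g i (max 0 (u x))) absolutely_integrable_on {0..L}" if "i \<in> {1..m}" for i
  proof (rule abs_int_mult_cont(1))
    show "(\<lambda>x. alp i * a i x) absolutely_integrable_on {0..L}"
      by (rule abs_int_mult_cont(2)[OF a_abs[OF that]]) auto
    show "continuous_on {0..L} (\<lambda>x. g i (max 0 (u x)))" by (rule c) (use assms that in \<open>auto simp: nonlin_def\<close>)
  qed
  have B: "(\<lambda>x. bet j * b j x * k j (max 0 (u x))) absolutely_integrable_on {0..L}" if "j \<in> {0..m+1}" for j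
  proof (rule abs_int_mult_cont(1))
    show "(\<lambda>x. bet j * b j x) absolutely_integrable_on {0..L}"
      by (rule abs_int_mult_cont(2)[OF b_abs[OF that]]) auto
    show "continuous_on {0..L} (\<lambda>x. k j (max 0 (u x)))" by (rule c) (use assms that in \<open>auto simp: nonlin_def\<close>)
  qed
  show ?thesis unfolding nl_def f_SL_def
    by (intro set_integral_diff(1) absolutely_integrable_sum A B) auto
qed

text \<open>A single term of the nonlinearity survives off a null set. Its sign makes shots concave
  on humps, while the analogous \<open>traj_gap\<close> makes them convex in gaps.\<close>

lemma traj_hump:
  assumes "traj 0 L (\<lambda>x. nl g k bet x (u x)) u v" and i: "i \<in> {1..m}"
  shows "traj (\<sigma> i) (\<tau> i) (\<lambda>x. a i x * (alp i * g i (max 0 (u x)))) u v"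
proof -
  obtain N where N: "negligible N" "\<And>i x. i \<in> {1..m} \<Longrightarrow> x \<in> {0..L} \<Longrightarrow> x \<notin> N \<Longrightarrow> x \<notin> {\<sigma> i<..<\<tau> i} \<Longrightarrow> a i x = 0"
    "\<And>j x. j \<in> {0..m} \<Longrightarrow> x \<in> {0..L} \<Longrightarrow> x \<notin> N \<Longrightarrow> x \<notin> {\<tau> j<..<\<sigma> (Suc j)} \<Longrightarrow> b j x = 0"
    "\<And>x. x \<in> {0..L} \<Longrightarrow> x \<notin> N \<Longrightarrow> b (Suc m) x = 0"
    by (rule exceptional_null_set) (rule that)
  show ?thesis
  proof (rule traj_cong[OF traj_sub[OF assms(1) hump_in(1)[OF i] hump_in(2)[OF i]] N(1)])
    fix x assume x: "x \<in> {\<sigma> i..\<tau> i}" "x \<notin> N"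
    then have xL: "x \<in> {0..L}" using hump_in[OF i] by auto
    have "(\<Sum>l=1..m. alp l * a l x * g l (max 0 (u x))) = (\<Sum>l\<in>{i}. alp l * a l x * g l (max 0 (u x)))"
      by (rule sum.mono_neutral_right) (use i a_zero_off(1)[OF N(2) x(2) i _ _ x(1)] in auto)
    moreover have "(\<Sum>j=0..m+1. bet j * b j x * k j (max 0 (u x))) = 0"
    proof (rule sum.neutral, intro ballI)
      fix j assume j: "j \<in> {0..m+1}"
      have "b j x = 0"
      proof (cases "j = m + 1")
        case True then show ?thesis using N(4)[OF xL x(2)] by simp
      next
        case False then show ?thesis using b_zero_off(1)[OF N(3) x(2) i _ x(1), of j] j by auto
      qed
      then show "bet j * b j x * k j (max 0 (u x)) = 0" by simp
    qed
    ultimately show "a i x * (alp i * g i (max 0 (u x))) = nl g k bet x (u x)"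
      by (simp add: nl_def f_SL_def)
  qed
qed

lemma traj_gap:
  assumes "traj 0 L (\<lambda>x. nl g k bet x (u x)) u v" and j: "j \<le> m"
  shows "traj (\<tau> j) (\<sigma> (Suc j)) (\<lambda>x. - (bet j * b j x * k j (max 0 (u x)))) u v"
proof -
  obtain N where N: "negligible N" "\<And>i x. i \<in> {1..m} \<Longrightarrow> x \<in> {0..L} \<Longrightarrow> x \<notin> N \<Longrightarrow> x \<notin> {\<sigma> i<..<\<tau> i} \<Longrightarrow> a i x = 0"
    "\<And>j x. j \<in> {0..m} \<Longrightarrow> x \<in> {0..L} \<Longrightarrow> x \<notin> N \<Longrightarrow> x \<notin> {\<tau> j<..<\<sigma> (Suc j)} \<Longrightarrow> b j x = 0"
    "\<And>x. x \<in> {0..L} \<Longrightarrow> x \<notin> N \<Longrightarrow> b (Suc m) x = 0"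
    by (rule exceptional_null_set) (rule that)
  show ?thesis
  proof (rule traj_cong[OF traj_sub[OF assms(1) gap_in(1)[OF j] gap_in(2)[OF j]] N(1)])
    fix x assume x: "x \<in> {\<tau> j..\<sigma> (Suc j)}" "x \<notin> N"
    then have xL: "x \<in> {0..L}" using gap_in[OF j] by auto
    have "(\<Sum>l=1..m. alp l * a l x * g l (max 0 (u x))) = 0"
      by (rule sum.neutral) (use a_zero_off(2)[OF N(2) x(2) j _ x(1)] in auto)
    moreover have "(\<Sum>l=0..m+1. bet l * b l x * k l (max 0 (u x))) = (\<Sum>l\<in>{j}. bet l * b l x * k l (max 0 (u x)))"
    proof (rule sum.mono_neutral_right)
      show "\<forall>l\<in>{0..m+1} - {j}. bet l * b l x * k l (max 0 (u x)) = 0"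
      proof
        fix l assume l: "l \<in> {0..m+1} - {j}"
        have "b l x = 0"
        proof (cases "l = m + 1")
          case True then show ?thesis using N(4)[OF xL x(2)] by simp
        next
          case False then show ?thesis using b_zero_off(2)[OF N(3) x(2) j _ _ x(1), of l] l by auto
        qed
        then show "bet l * b l x * k l (max 0 (u x)) = 0" by simp
      qed
    qed (use j in auto)
    ultimately show "- (bet j * b j x * k j (max 0 (u x))) = nl g k bet x (u x)"
      by (simp add: nl_def f_SL_def)
  qed
qed

lemma traj_weight_hump:
  assumes "traj 0 L (\<lambda>x. lam * (\<Sum>i=1..m. a i x) * \<phi> x) \<phi> \<psi>" and i: "i \<in> {1..m}"
  shows "traj (\<sigma> i) (\<tau> i) (\<lambda>x. lam * a i x * \<phi> x) \<phi> \<psi>"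
proof -
  obtain N where N: "negligible N" "\<And>i x. i \<in> {1..m} \<Longrightarrow> x \<in> {0..L} \<Longrightarrow> x \<notin> N \<Longrightarrow> x \<notin> {\<sigma> i<..<\<tau> i} \<Longrightarrow> a i x = 0"
    by (rule exceptional_null_set) (rule that)
  show ?thesis
  proof (rule traj_cong[OF traj_sub[OF assms(1) hump_in(1)[OF i] hump_in(2)[OF i]] N(1)])
    fix x assume x: "x \<in> {\<sigma> i..\<tau> i}" "x \<notin> N"
    have "(\<Sum>l=1..m. a l x) = (\<Sum>l\<in>{i}. a l x)"
      by (rule sum.mono_neutral_right) (use i a_zero_off(1)[OF N(2) x(2) i _ _ x(1)] in auto)
    then show "lam * a i x * \<phi> x = lam * (\<Sum>i=1..m. a i x) * \<phi> x" by simp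
  qed
qed

lemma traj_weight_gap:
  assumes "traj 0 L (\<lambda>x. lam * (\<Sum>i=1..m. a i x) * \<phi> x) \<phi> \<psi>" and j: "j \<le> m"
  shows "traj (\<tau> j) (\<sigma> (Suc j)) (\<lambda>x. 0) \<phi> \<psi>"
proof -
  obtain N where N: "negligible N" "\<And>i x. i \<in> {1..m} \<Longrightarrow> x \<in> {0..L} \<Longrightarrow> x \<notin> N \<Longrightarrow> x \<notin> {\<sigma> i<..<\<tau> i} \<Longrightarrow> a i x = 0"
    by (rule exceptional_null_set) (rule that)
  show ?thesis
  proof (rule traj_cong[OF traj_sub[OF assms(1) gap_in(1)[OF j] gap_in(2)[OF j]] N(1)])
    fix x assume x: "x \<in> {\<tau> j..\<sigma> (Suc j)}" "x \<notin> N"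
    have "(\<Sum>l=1..m. a l x) = 0"
      by (rule sum.neutral) (use a_zero_off(2)[OF N(2) x(2) j _ x(1)] in auto)
    then show "0 = lam * (\<Sum>i=1..m. a i x) * \<phi> x" by simp
  qed
qed

lemma shot_dead:
  assumes s: "shot g k bet t u v" and nl: "nonlin g k" and z: "0 \<le> z" "u z < 0" "z \<le> L"
  shows "z \<le> y \<Longrightarrow> y \<le> L \<Longrightarrow> u y < 0" "bvalue u v < 0"
proof -
  have t: "traj 0 L (\<lambda>x. nl g k bet x (u x)) u v" and u0: "0 \<le> u 0"
    using s bc_nonneg by (auto simp: shot_def)
  have F: "\<And>x. x \<in> {0..L} \<Longrightarrow> u x \<le> 0 \<Longrightarrow> nl g k bet x (u x) = 0" using nl_nonpos[OF nl] by auto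
  show "u y < 0" if "z \<le> y" "y \<le> L" for y
    by (rule traj_neg_future(1)[OF t F u0 z(1,2) that])
  have "u L < 0" "v L < 0" using traj_neg_future[OF t F u0 z(1,2), of L] z by auto
  then have "ga * u L \<le> 0" "de * v L \<le> 0" "ga > 0 \<Longrightarrow> ga * u L < 0" "de > 0 \<Longrightarrow> de * v L < 0"
    using bc_nonneg by (auto intro: mult_pos_neg mult_nonneg_nonpos)
  moreover have "ga > 0 \<or> de > 0" using bc_nonneg bc_nondeg by (auto simp: less_le)
  ultimately show "bvalue u v < 0" by (auto simp: bvalue_def)
qed

lemma shot_first_death:
  assumes s: "shot g k bet t u v" and nl: "nonlin g k" and z: "0 \<le> z" "z \<le> L" "u z < 0"
  obtains x0 where "0 \<le> x0" "x0 < z" "u x0 = 0" "v x0 < 0" "\<And>x. 0 \<le> x \<Longrightarrow> x \<le> x0 \<Longrightarrow> 0 \<le> u x"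
    "\<And>x. x0 < x \<Longrightarrow> x \<le> z \<Longrightarrow> u x < 0"
proof -
  have t: "traj 0 L (\<lambda>x. nl g k bet x (u x)) u v" and u0: "0 \<le> u 0"
    using s bc_nonneg by (auto simp: shot_def)
  have F: "\<And>x. x \<in> {0..L} \<Longrightarrow> u x \<le> 0 \<Longrightarrow> nl g k bet x (u x) = 0" using nl_nonpos[OF nl] by auto
  show ?thesis
    by (rule traj_first_death[OF t _ u0, of z]) (erule (1) F, use z in simp, use z in simp, rule that)
qed

lemma hump_nonlin: 
  assumes "nonlin g k" "i \<in> {1..m}"
  shows "0 \<le> s \<Longrightarrow> 0 \<le> alp i * g i s" "continuous_on {0..} (g i)"
proof -
  have "alp i > 0" using alp_pos assms(2) by blast
  then show "0 \<le> s \<Longrightarrow> 0 \<le> alp i * g i s" "continuous_on {0..} (g i)"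
    using assms unfolding nonlin_def by auto
qed

text \<open>Coefficients of the hump eigenvalue problem: Dirichlet conditions at interior ends, the
  given conditions where the hump touches an end of \<open>{0..L}\<close>.\<close>

definition c1_at where "c1_at i = (if i = 1 \<and> \<sigma> 1 = 0 then al else 1)"
definition c2_at where "c2_at i = (if i = 1 \<and> \<sigma> 1 = 0 then be else 0)"
definition c3_at where "c3_at i = (if i = m \<and> \<tau> m = L then ga else 1)"
definition c4_at where "c4_at i = (if i = m \<and> \<tau> m = L then de else 0)"

lemma c_at: "0 \<le> c1_at i" "0 \<le> c2_at i" "0 \<le> c3_at i" "0 \<le> c4_at i"
  "c3_at i * c2_at i + c1_at i * c3_at i + c1_at i * c4_at i > 0"
proof -
  have "al + be > 0" "ga + de > 0"
    using bc_nonneg bc_nondeg by (auto simp: add_nonneg_eq_0_iff less_le)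
  then show "c3_at i * c2_at i + c1_at i * c3_at i + c1_at i * c4_at i > 0"
    using bc_nondeg by (auto simp: c1_at_def c2_at_def c3_at_def c4_at_def algebra_simps)
qed (use bc_nonneg in \<open>auto simp: c1_at_def c2_at_def c3_at_def c4_at_def\<close>)

definition hump_eigenvalue where
  "hump_eigenvalue i = first_eigenvalue (\<sigma> i) (\<tau> i) (a i) (c1_at i) (c2_at i) (c3_at i) (c4_at i)"

text \<open>If the shot were nonnegative at \<open>\<tau> i\<close>, and for a hump reaching
  \<open>L\<close> also had a nonnegative boundary value, the boundary terms of its Wronskian with
  the principal eigenfunction would have the sign required by \<open>hump_bound\<close>, and
  \<open>u\<close> could not exceed \<open>R\<close>. The bound does not depend on \<open>k\<close>,
  \<open>bet\<close> or \<open>t\<close>, and on \<open>g\<close> only through the growth beyond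
  \<open>s1\<close>.\<close>

theorem hump_too_high:
  assumes i: "i \<in> {1..m}" and \<rho>: "hump_eigenvalue i < \<rho>" and s1: "0 < s1"
  obtains R where "\<And>g k bet t u v x. nonlin g k \<Longrightarrow> (\<And>s. s1 \<le> s \<Longrightarrow> \<rho> * s \<le> alp i * g i s) \<Longrightarrow>
    shot g k bet t u v \<Longrightarrow> x \<in> {\<sigma> i..\<tau> i} \<Longrightarrow> R < u x \<Longrightarrow> bvalue u v < 0 \<and> (i < m \<longrightarrow> u (\<tau> i) < 0)"
proof -
  define p where "p = \<sigma> i"
  define q where "q = \<tau> i"
  have pq: "p < q" "0 \<le> p" "q \<le> L" using hump_less[OF i] hump_in[OF i] by (auto simp: p_def q_def)
  have aa: "a i absolutely_integrable_on {p..q}"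
    by (rule absolutely_integrable_on_subinterval[OF a_abs[OF i]]) (use pq in auto)
  have an: "\<And>x. x \<in> {p..q} \<Longrightarrow> 0 \<le> a i x" using a_nonneg i pq by auto
  have nt: "\<not> negligible {x \<in> {p..q}. a i x \<noteq> 0}" using a_nontriv[OF i] by (simp add: p_def q_def)
  define \<mu> where "\<mu> = hump_eigenvalue i"
  note E = principal_eigenvalue[OF pq(1) aa an nt c_at[of i], folded p_def q_def]
  have \<mu>: "\<mu> = first_eigenvalue p q (a i) (c1_at i) (c2_at i) (c3_at i) (c4_at i)"
    by (simp add: \<mu>_def hump_eigenvalue_def p_def q_def)
  obtain \<phi> \<psi> where \<phi>: "traj p q (\<lambda>x. \<mu> * a i x * \<phi> x) \<phi> \<psi>" "\<phi> p = c2_at i" "\<psi> p = c1_at i"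
    "c3_at i * \<phi> q + c4_at i * \<psi> q = 0" "\<And>x. x\<in>{p..q} \<Longrightarrow> 0 \<le> \<phi> x" "\<And>x. p < x \<Longrightarrow> x < q \<Longrightarrow> 0 < \<phi> x"
    using E(1) unfolding \<mu>[symmetric] by auto
  have \<mu>0: "0 \<le> \<mu>" "\<mu> < \<rho>" using E(2) \<rho> unfolding \<mu>[symmetric] by (auto simp: \<mu>_def)
  obtain R where R: "\<And>h u v x. traj p q (\<lambda>x. a i x * h (u x)) u v \<Longrightarrow> (\<And>x. x \<in> {p..q} \<Longrightarrow> 0 \<le> u x) \<Longrightarrow>
    (\<And>s. 0 \<le> s \<Longrightarrow> 0 \<le> h s) \<Longrightarrow> (\<And>s. s1 \<le> s \<Longrightarrow> \<rho> * s \<le> h s) \<Longrightarrow>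
    u q * \<psi> q - v q * \<phi> q \<le> u p * \<psi> p - v p * \<phi> p \<Longrightarrow> x \<in> {p..q} \<Longrightarrow> u x \<le> R"
    using hump_bound[OF pq(1) aa an nt \<phi>(1,5,6) \<mu>0 s1] by blast
  have key: "bvalue u v < 0 \<and> (i < m \<longrightarrow> u (\<tau> i) < 0)"
    if n: "nonlin g k" and g: "\<And>s. s1 \<le> s \<Longrightarrow> \<rho> * s \<le> alp i * g i s" and s: "shot g k bet t u v"
      and x: "x \<in> {\<sigma> i..\<tau> i}" "R < u x" for g k bet t u v x
  proof -
    have t: "traj 0 L (\<lambda>x. nl g k bet x (u x)) u v" "0 \<le> t" "u 0 = be * t" "v 0 = al * t"
      using s by (auto simp: shot_def)
    have L: False if alive: "0 \<le> u q" and bcq: "i = m \<and> \<tau> m = L \<longrightarrow> 0 \<le> bvalue u v"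
    proof -
      have un: "0 \<le> u x" if "x \<in> {p..q}" for x
      proof (rule ccontr)
        assume "\<not> 0 \<le> u x"
        then have "u q < 0" using shot_dead(1)[OF s n, of x q] that pq by auto
        then show False using alive by simp
      qed
      have th: "traj p q (\<lambda>x. a i x * (alp i * g i (u x))) u v"
        by (rule traj_cong[OF traj_hump[OF t(1) i, folded p_def q_def] negligible_empty]) (use un in auto)
      \<comment> \<open>At an end shared with \<open>{0..L}\<close> the shot and the eigenfunction
        obey the same condition and the term vanishes; at an interior end \<open>\<phi>\<close> is 0
        and \<open>\<psi>\<close> is 1, leaving \<open>u p\<close>.\<close>
      have P: "0 \<le> u p * \<psi> p - v p * \<phi> p"
      proof (cases "i = 1 \<and> \<sigma> 1 = 0")
        case True
        then have "p = 0" by (simp add: p_def)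
        then show ?thesis using \<phi>(2,3) True t by (simp add: c1_at_def c2_at_def)
      next
        case False
        then have "\<phi> p = 0" "\<psi> p = 1" using \<phi>(2,3) by (auto simp: c1_at_def c2_at_def)
        then show ?thesis using un[of p] pq by simp
      qed
      have \<psi>q: "\<psi> q \<le> 0" if "\<phi> q = 0"
        by (rule traj_end_slope[OF \<phi>(1) pq(1) \<phi>(5) that])
      have Q: "u q * \<psi> q - v q * \<phi> q \<le> 0"
      proof (cases "\<phi> q = 0")
        case True
        then show ?thesis using \<psi>q un[of q] pq by (simp add: mult_nonneg_nonpos)
      next
        case False
        then have c: "i = m \<and> \<tau> m = L" using \<phi>(4) by (auto simp: c3_at_def c4_at_def split: if_splits)
        then have qL: "q = L" by (simp add: q_def)
        have e: "ga * \<phi> q + de * \<psi> q = 0" using \<phi>(4) c by (simp add: c3_at_def c4_at_def)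
        have de: "de > 0"
        proof (rule ccontr)
          assume "\<not> de > 0"
          then have "de = 0" using bc_nonneg by simp
          then show False using e False bc_nondeg by auto
        qed
        \<comment> \<open>After multiplication by \<open>de\<close> the condition on the
          eigenfunction eliminates \<open>\<psi> q\<close>, and what remains is minus the boundary
          value of the shot times \<open>\<phi> q\<close>.\<close>
        have "de * (u q * \<psi> q - v q * \<phi> q) = u q * (de * \<psi> q) - de * v q * \<phi> q" by (simp add: algebra_simps)
        also have "\<dots> = u q * (- (ga * \<phi> q)) - de * v q * \<phi> q" using e by (simp add: add_eq_0_iff)
        also have "\<dots> = - (bvalue u v * \<phi> q)" by (simp add: bvalue_def qL algebra_simps)
        also have "\<dots> \<le> 0" using bcq c \<phi>(5)[of q] pq by simp
        finally show ?thesis using de by (simp add: mult_le_0_iff)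
      qed
      have "u x \<le> R"
      proof (rule R[OF th un])
        show "0 \<le> s \<Longrightarrow> 0 \<le> alp i * g i s" for s by (rule hump_nonlin(1)[OF n i])
        show "s1 \<le> s \<Longrightarrow> \<rho> * s \<le> alp i * g i s" for s by (rule g)
        show "u q * \<psi> q - v q * \<phi> q \<le> u p * \<psi> p - v p * \<phi> p" using P Q by linarith
        show "x \<in> {p..q}" using x by (simp add: p_def q_def)
      qed
      then show False using x by simp
    qed
    show ?thesis
    proof (cases "0 \<le> u q")
      case True
      then have "\<not> (i = m \<and> \<tau> m = L \<longrightarrow> 0 \<le> bvalue u v)" using L by blast
      then show ?thesis by auto
    next
      case False
      then have "u q < 0" by simp
      then show ?thesis using shot_dead(2)[OF s n, of q] pq by (auto simp: q_def)
    qed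
  qed
  show ?thesis by (rule that[OF key])
qed

end

section \<open>Wronskian comparison of shots with a positive solution of the linear equation\<close>

context SL_structure
begin

text \<open>The comparison function solves the linear equation at level \<open>lam\<close>, is
  bounded below by \<open>d0\<close>, and its two boundary forms are nonnegative at 0 and positive
  at \<open>L\<close>. The constant \<open>c\<close> will bound the nonlinearity by
  \<open>alp i * g i s \<le> c * s\<close> up to the height \<open>r\<close>, so
  \<open>lam - c\<close> measures the strict advantage of the linear equation.\<close>

context
  fixes \<phi> \<psi> :: "real \<Rightarrow> real" and lam c d0 P r :: real
  assumes \<phi>: "traj 0 L (\<lambda>x. lam * (\<Sum>i=1..m. a i x) * \<phi> x) \<phi> \<psi>"
    and \<phi>0: "be * \<psi> 0 \<le> al * \<phi> 0" and \<phi>L: "0 < bvalue \<phi> \<psi>"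
    and d0: "0 < d0" "\<And>x. x \<in> {0..L} \<Longrightarrow> d0 \<le> \<phi> x"
    and P: "\<And>x. x \<in> {0..L} \<Longrightarrow> \<phi> x \<le> P" "\<And>x. x \<in> {0..L} \<Longrightarrow> \<bar>\<psi> x\<bar> \<le> P"
    and c: "0 \<le> c" "c < lam" and r: "0 < r"
begin

lemma P_pos: "0 < P"
  using P(1)[of 0] d0(2)[of 0] d0(1) L_pos by force

lemma phi_pos: "x \<in> {0..L} \<Longrightarrow> 0 < \<phi> x"
  using d0 by force

text \<open>In a gap the comparison function is affine, and absorption adds only a nonnegative term,
  whatever the height of the trajectory.\<close>

lemma wronskian_gap:
  assumes t: "traj 0 L (\<lambda>x. nl g k bet x (u x)) u v" and nl: "nonlin g k" and j: "j \<le> m" "0 \<le> bet j"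
    and xy: "\<tau> j \<le> x" "x \<le> y" "y \<le> \<sigma> (Suc j)" and un: "\<And>z. x \<le> z \<Longrightarrow> z \<le> y \<Longrightarrow> 0 \<le> u z"
  shows "v x * \<phi> x - u x * \<psi> x \<le> v y * \<phi> y - u y * \<psi> y"
proof -
  have "v x * \<phi> x - u x * \<psi> x + 0 \<le> v y * \<phi> y - u y * \<psi> y"
  proof (rule wronskian_mono[OF xy(2) traj_sub[OF traj_gap[OF t j(1)] xy(1,3)]
        traj_sub[OF traj_weight_gap[OF \<phi> j(1)] xy(1,3)] negligible_empty _ has_integral_0])
    fix z assume z: "z \<in> {x..y}"
    then have zL: "z \<in> {0..L}" using gap_in[OF j(1)] xy by auto
    have "0 \<le> b j z" using b_nonneg j zL by auto
    moreover have "0 \<le> k j (max 0 (u z))" using nl j by (auto simp: nonlin_def)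
    ultimately have "0 \<le> \<phi> z * (bet j * b j z * k j (max 0 (u z)))"
      using j(2) phi_pos[OF zL] by simp
    then show "0 \<le> u z * 0 - \<phi> z * - (bet j * b j z * k j (max 0 (u z)))" by simp
  qed
  then show ?thesis by simp
qed

text \<open>Used with \<open>l = 0\<close> for mere monotonicity of the Wronskian and with
  \<open>l\<close> a multiple of the tent for a definite gain.\<close>

lemma wronskian_hump_integrand:
  assumes i: "i \<in> {1..m}" and g: "\<And>s. 0 \<le> s \<Longrightarrow> s \<le> r \<Longrightarrow> alp i * g i s \<le> c * s"
    and z: "z \<in> {\<sigma> i..\<tau> i}" "0 \<le> u z" "u z \<le> r" "0 \<le> l" "l \<le> u z"
  shows "(lam - c) * d0 * (a i z * l) \<le> u z * (lam * a i z * \<phi> z) - \<phi> z * (a i z * (alp i * g i (max 0 (u z))))"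
proof -
  have zL: "z \<in> {0..L}" using hump_in[OF i] z by auto
  have an: "0 \<le> a i z" using a_nonneg i zL by auto
  have "((lam - c) * a i z) * (d0 * l) \<le> ((lam - c) * a i z) * (\<phi> z * u z)"
    using c an z d0(1) d0(2)[OF zL] by (intro mult_left_mono mult_mono) auto
  moreover have "(\<phi> z * a i z) * (alp i * g i (u z)) \<le> (\<phi> z * a i z) * (c * u z)"
    using g[of "u z"] z an phi_pos[OF zL] by (intro mult_left_mono) auto
  ultimately show ?thesis using z(2) by (simp add: max_absorb2 algebra_simps)
qed

lemma wronskian_hump:
  assumes t: "traj 0 L (\<lambda>x. nl g k bet x (u x)) u v" and i: "i \<in> {1..m}"
    and g: "\<And>s. 0 \<le> s \<Longrightarrow> s \<le> r \<Longrightarrow> alp i * g i s \<le> c * s"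
    and xy: "\<sigma> i \<le> x" "x \<le> y" "y \<le> \<tau> i" and un: "\<And>z. x \<le> z \<Longrightarrow> z \<le> y \<Longrightarrow> 0 \<le> u z \<and> u z \<le> r"
  shows "v x * \<phi> x - u x * \<psi> x \<le> v y * \<phi> y - u y * \<psi> y"
proof -
  have "v x * \<phi> x - u x * \<psi> x + 0 \<le> v y * \<phi> y - u y * \<psi> y"
  proof (rule wronskian_mono[OF xy(2) traj_sub[OF traj_hump[OF t i] xy(1,3)]
        traj_sub[OF traj_weight_hump[OF \<phi> i] xy(1,3)] negligible_empty _ has_integral_0])
    fix z assume z: "z \<in> {x..y}"
    show "0 \<le> u z * (lam * a i z * \<phi> z) - \<phi> z * (a i z * (alp i * g i (max 0 (u z))))"
      using wronskian_hump_integrand[where g=g and z=z and u=u and l=0, OF i g] z un[of z] xy by auto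
  qed
  then show ?thesis by simp
qed

definition hump_mass where "hump_mass i = integral {\<sigma> i..\<tau> i} (\<lambda>x. a i x * tent (\<sigma> i) (\<tau> i) x)"

lemma hump_mass:
  assumes i: "i \<in> {1..m}"
  shows "0 < hump_mass i" "((\<lambda>x. a i x * tent (\<sigma> i) (\<tau> i) x) has_integral hump_mass i) {\<sigma> i..\<tau> i}"
proof -
  have aa: "a i absolutely_integrable_on {\<sigma> i..\<tau> i}"
    by (rule absolutely_integrable_on_subinterval[OF a_abs[OF i]]) (use hump_in[OF i] in auto)
  have "0 < integral {\<sigma> i..\<tau> i} (\<lambda>x. a i x * (1 * tent (\<sigma> i) (\<tau> i) x))"
    by (rule integral_weighted_tent_pos[OF hump_less[OF i] aa _ a_nontriv[OF i]])
      (use a_nonneg i hump_in[OF i] in auto)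
  then show "0 < hump_mass i" by (simp add: hump_mass_def)
  show "((\<lambda>x. a i x * tent (\<sigma> i) (\<tau> i) x) has_integral hump_mass i) {\<sigma> i..\<tau> i}"
    unfolding hump_mass_def
    by (rule integrable_integral, rule abs_int_imp_int, rule abs_int_mult_cont(1)[OF aa tent_cont])
qed

text \<open>From \<open>\<xi>\<close> on, \<open>u / \<phi>\<close> decreases at rate at most
  \<open>e / d0\<close> squared. It starts at \<open>r / P\<close> or more, and \<open>e\<close> is
  too small for it to reach zero within length \<open>L\<close>.\<close>

lemma alive_through_hump:
  assumes s: "shot g k bet t u v" and nl: "nonlin g k" and i: "i \<in> {1..m}"
    and g: "\<And>s. 0 \<le> s \<Longrightarrow> s \<le> r \<Longrightarrow> alp i * g i s \<le> c * s"
    and ur: "\<And>x. x \<in> {\<sigma> i..\<tau> i} \<Longrightarrow> u x \<le> r" and \<xi>: "\<xi> \<in> {\<sigma> i..\<tau> i}" "u \<xi> = r"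
    and e: "0 \<le> e" "e * L / d0\<^sup>2 < r / P" "- e \<le> v (\<sigma> i) * \<phi> (\<sigma> i) - u (\<sigma> i) * \<psi> (\<sigma> i)"
    and x: "0 \<le> x" "x \<le> \<tau> i"
  shows "0 \<le> u x"
proof (rule ccontr)
  assume neg: "\<not> 0 \<le> u x"
  note hi = hump_in[OF i]
  have t: "traj 0 L (\<lambda>x. nl g k bet x (u x)) u v" using s by (simp add: shot_def)
  obtain x0 where x0: "0 \<le> x0" "x0 < x" "u x0 = 0" "v x0 < 0" "\<And>y. 0 \<le> y \<Longrightarrow> y \<le> x0 \<Longrightarrow> 0 \<le> u y"
    "\<And>y. x0 < y \<Longrightarrow> y \<le> x \<Longrightarrow> u y < 0"
    by (rule shot_first_death[OF s nl, of x]) (use x hi neg in simp, use x hi neg in simp, use neg in simp, rule that)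
  have "x > \<xi>"
  proof (rule ccontr)
    assume "\<not> x > \<xi>"
    then have "u \<xi> < 0" using shot_dead(1)[OF s nl, of x \<xi>] x hi neg \<xi> by auto
    then show False using \<xi> r by simp
  qed
  then have "\<xi> \<le> x0" using x0(6)[of \<xi>] \<xi> r by force
  have W: "- e \<le> v z * \<phi> z - u z * \<psi> z" if "\<xi> \<le> z" "z \<le> x0" for z
  proof -
    have "v (\<sigma> i) * \<phi> (\<sigma> i) - u (\<sigma> i) * \<psi> (\<sigma> i) \<le> v z * \<phi> z - u z * \<psi> z"
      by (rule wronskian_hump[OF t i g]) (use that \<xi> x0 x hi ur in auto)
    then show ?thesis using e(3) by simp
  qed
  have "u \<xi> / \<phi> \<xi> + (- e / d0\<^sup>2) * (x0 - \<xi>) \<le> u x0 / \<phi> x0"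
  proof (rule quotient_growth[OF t \<phi>])
    show "0 \<le> \<xi>" "\<xi> \<le> x0" "x0 \<le> L" using \<xi> hi \<open>\<xi> \<le> x0\<close> x0 x by auto
    show "0 < \<phi> z" if "z \<in> {0..L}" for z by (rule phi_pos[OF that])
    fix z assume z: "\<xi> \<le> z" "z \<le> x0"
    then have zL: "z \<in> {0..L}" using \<xi> hi x0 x by auto
    have "d0\<^sup>2 \<le> (\<phi> z)\<^sup>2" using d0(1) d0(2)[OF zL] by (intro power_mono) auto
    then have "e * 1 \<le> e * ((\<phi> z)\<^sup>2 / d0\<^sup>2)" using e(1) d0(1) by (intro mult_left_mono) auto
    then have "- e / d0\<^sup>2 * (\<phi> z)\<^sup>2 \<le> - e" by simp
    then show "- e / d0\<^sup>2 * (\<phi> z)\<^sup>2 \<le> v z * \<phi> z - u z * \<psi> z" using W[OF z] by simp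
  qed
  then have "r / \<phi> \<xi> \<le> e / d0\<^sup>2 * (x0 - \<xi>)" using \<xi> x0 by simp
  moreover have "r / P \<le> r / \<phi> \<xi>"
    using \<xi> hi r P(1)[of \<xi>] phi_pos[of \<xi>] by (intro divide_left_mono) (auto intro: mult_pos_pos P_pos)
  moreover have "e / d0\<^sup>2 * (x0 - \<xi>) \<le> e / d0\<^sup>2 * L"
    using e(1) x0 x \<xi> hi by (intro mult_left_mono) auto
  ultimately show False using e(2) by simp
qed

text \<open>On the hump \<open>u\<close> is concave with value \<open>r\<close> at
  \<open>\<xi>\<close>, hence at least \<open>r\<close> times the tent; the resulting gain is the
  same for all trajectories with maximum \<open>r\<close>.\<close>

lemma wronskian_after_hump:
  assumes s: "shot g k bet t u v" and nl: "nonlin g k" and i: "i \<in> {1..m}"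
    and g: "\<And>s. 0 \<le> s \<Longrightarrow> s \<le> r \<Longrightarrow> alp i * g i s \<le> c * s"
    and ur: "\<And>x. x \<in> {\<sigma> i..\<tau> i} \<Longrightarrow> u x \<le> r" and \<xi>: "\<xi> \<in> {\<sigma> i..\<tau> i}" "u \<xi> = r"
    and un: "\<And>x. x \<in> {\<sigma> i..\<tau> i} \<Longrightarrow> 0 \<le> u x"
  shows "v (\<sigma> i) * \<phi> (\<sigma> i) - u (\<sigma> i) * \<psi> (\<sigma> i) + (lam - c) * d0 * r * hump_mass i
    \<le> v (\<tau> i) * \<phi> (\<tau> i) - u (\<tau> i) * \<psi> (\<tau> i)"
proof -
  note hi = hump_in[OF i]
  have t: "traj 0 L (\<lambda>x. nl g k bet x (u x)) u v" using s by (simp add: shot_def)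
  have H: "((\<lambda>x. (lam - c) * d0 * r * (a i x * tent (\<sigma> i) (\<tau> i) x)) has_integral
      (lam - c) * d0 * r * hump_mass i) {\<sigma> i..\<tau> i}"
    by (intro has_integral_mult_right hump_mass(2)[OF i])
  show ?thesis
  proof (rule wronskian_mono[OF less_imp_le[OF hump_less[OF i]] traj_hump[OF t i] traj_weight_hump[OF \<phi> i] negligible_empty _ H])
    fix z assume z: "z \<in> {\<sigma> i..\<tau> i}"
    have F: "0 \<le> a i y * (alp i * g i (max 0 (u y)))" if "\<sigma> i \<le> y" "y \<le> \<tau> i" for y
      using a_nonneg i hi that hump_nonlin(1)[OF nl i, of "max 0 (u y)"] by auto
    have "u \<xi> * tent (\<sigma> i) (\<tau> i) z \<le> u z"
      by (rule traj_ge_tent[OF traj_hump[OF t i] F hump_less[OF i]]) (use un z \<xi> r hump_less[OF i] in auto)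
    then have "(lam - c) * d0 * (a i z * (r * tent (\<sigma> i) (\<tau> i) z)) \<le>
       u z * (lam * a i z * \<phi> z) - \<phi> z * (a i z * (alp i * g i (max 0 (u z))))"
      using \<xi> r z un ur tent_nonneg[of "\<sigma> i" z "\<tau> i"] by (intro wronskian_hump_integrand[where g=g, OF i g]) auto
    then show "(lam - c) * d0 * r * (a i z * tent (\<sigma> i) (\<tau> i) z) \<le>
       u z * (lam * a i z * \<phi> z) - \<phi> z * (a i z * (alp i * g i (max 0 (u z))))"
      by (simp add: mult_ac)
  qed
qed

text \<open>At a first death \<open>u\<close> is 0 and \<open>v\<close> negative, so the Wronskian
  would be negative; in the gap it cannot fall below its positive entry value.\<close>

lemma alive_through_gap:
  assumes s: "shot g k bet t u v" and nl: "nonlin g k" and i: "i \<in> {1..m}" and bet: "0 \<le> bet i"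
    and W: "0 < v (\<tau> i) * \<phi> (\<tau> i) - u (\<tau> i) * \<psi> (\<tau> i)"
    and un: "\<And>x. 0 \<le> x \<Longrightarrow> x \<le> \<tau> i \<Longrightarrow> 0 \<le> u x" and x: "0 \<le> x" "x \<le> \<sigma> (Suc i)"
  shows "0 \<le> u x"
proof (rule ccontr)
  assume neg: "\<not> 0 \<le> u x"
  have im: "i \<le> m" using i by simp
  have t: "traj 0 L (\<lambda>x. nl g k bet x (u x)) u v" using s by (simp add: shot_def)
  have xL: "x \<le> L" using x gap_in[OF im] by simp
  obtain x0 where x0: "0 \<le> x0" "x0 < x" "u x0 = 0" "v x0 < 0" "\<And>y. 0 \<le> y \<Longrightarrow> y \<le> x0 \<Longrightarrow> 0 \<le> u y"
    "\<And>y. x0 < y \<Longrightarrow> y \<le> x \<Longrightarrow> u y < 0"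
    by (rule shot_first_death[OF s nl, of x]) (use x neg in simp, use xL in simp, use neg in simp, rule that)
  have "\<tau> i < x" using un[of x] x neg by force
  then have "\<tau> i \<le> x0" using x0(6)[of "\<tau> i"] un[of "\<tau> i"] gap_in[OF im] by force
  have "v (\<tau> i) * \<phi> (\<tau> i) - u (\<tau> i) * \<psi> (\<tau> i) \<le> v x0 * \<phi> x0 - u x0 * \<psi> x0"
    by (rule wronskian_gap[where j=i, OF t nl im bet order_refl \<open>\<tau> i \<le> x0\<close>]) (use x0 x gap_in[OF im] in auto)
  moreover have "v x0 * \<phi> x0 < 0" using x0 xL phi_pos[of x0] by (intro mult_neg_pos) auto
  ultimately show False using W x0(3) by simp
qed

lemma last_hump_small:
  assumes s: "shot g k bet t u v" and nl: "nonlin g k" and bet: "0 \<le> bet m"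
    and W: "0 < v (\<tau> m) * \<phi> (\<tau> m) - u (\<tau> m) * \<psi> (\<tau> m)"
    and un: "\<And>x. 0 \<le> x \<Longrightarrow> x \<le> \<tau> m \<Longrightarrow> 0 \<le> u x"
  shows "0 < bvalue u v"
proof -
  have mm: "m \<in> {1..m}" using m_pos by simp
  have t: "traj 0 L (\<lambda>x. nl g k bet x (u x)) u v" using s by (simp add: shot_def)
  have sL: "\<sigma> (Suc m) = L" using h1_sigmaL by simp
  have uL: "0 \<le> u x" if "x \<in> {0..L}" for x
    by (rule alive_through_gap[where i=m, OF s nl mm bet W un]) (use that sL in auto)
  have "v (\<tau> m) * \<phi> (\<tau> m) - u (\<tau> m) * \<psi> (\<tau> m) \<le> v L * \<phi> L - u L * \<psi> L"
    by (rule wronskian_gap[where j=m, OF t nl order_refl bet order_refl]) (use sL gap_le[of m] gap_in(1)[of m] uL in auto)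
  then have WL: "0 < v L * \<phi> L - u L * \<psi> L" using W by simp
  have pL: "0 < \<phi> L" using phi_pos[of L] L_pos by simp
  have "0 < u L"
  proof (rule ccontr)
    assume "\<not> 0 < u L"
    then have z: "u L = 0" using uL[of L] L_pos by simp
    have "v L \<le> 0" by (rule traj_end_slope[OF t L_pos uL z])
    then have "v L * \<phi> L \<le> 0" using pL by (simp add: mult_nonpos_nonneg)
    then show False using WL z by simp
  qed
  \<comment> \<open>A positive Wronskian says that the logarithmic slope of \<open>u\<close> at
    \<open>L\<close> exceeds that of \<open>\<phi>\<close>; multiplying the boundary forms by
    \<open>u L\<close> and \<open>\<phi> L\<close> transfers positivity from \<open>\<phi>\<close>
    to \<open>u\<close> without dividing.\<close>
  then have "0 < u L * bvalue \<phi> \<psi>" using \<phi>L by simp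
  also have "\<dots> = ga * u L * \<phi> L + de * (u L * \<psi> L)" by (simp add: bvalue_def algebra_simps)
  also have "\<dots> \<le> ga * u L * \<phi> L + de * (v L * \<phi> L)" using WL bc_nonneg by (intro add_left_mono mult_left_mono) auto
  also have "\<dots> = bvalue u v * \<phi> L" by (simp add: bvalue_def algebra_simps)
  finally show ?thesis using pL by (simp add: zero_less_mult_iff)
qed

text \<open>The Wronskian is at least \<open>- e\<close> on entry, gains \<open>\<omega>\<close> on
  the hump and leaves with at least \<open>\<omega> / 2\<close>. The shot therefore survives the
  hump, grows linearly in the next gap and is driven above \<open>R\<close> there, or meets the
  right end with positive boundary value. The bound at \<open>\<tau> (i - 1)\<close> makes
  \<open>gap_exit\<close> applicable after an earlier, possibly large hump.\<close>

theorem small_hump_grows: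
  assumes i: "i \<in> {1..m}" and rR: "r \<le> R"
    and kk: "\<And>j. j \<in> {1..<m} \<Longrightarrow> continuous_on {0..} (kk j)" "\<And>j s. j \<in> {1..<m} \<Longrightarrow> 0 < s \<Longrightarrow> 0 < kk j s"
  obtains B where "\<And>g k bet t u v \<xi>. nonlin g k \<Longrightarrow> (\<And>s. 0 \<le> s \<Longrightarrow> s \<le> r \<Longrightarrow> alp i * g i s \<le> c * s) \<Longrightarrow>
    (\<And>j s. j \<in> {1..<m} \<Longrightarrow> 0 \<le> s \<Longrightarrow> kk j s \<le> k j s) \<Longrightarrow> (\<And>j. j \<le> m \<Longrightarrow> 0 \<le> bet j) \<Longrightarrow>
    (\<And>j. j \<in> {1..<m} \<Longrightarrow> B \<le> bet j) \<Longrightarrow> shot g k bet t u v \<Longrightarrow>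
    (\<And>x. x \<in> {\<sigma> i..\<tau> i} \<Longrightarrow> u x \<le> r) \<Longrightarrow> \<xi> \<in> {\<sigma> i..\<tau> i} \<Longrightarrow> u \<xi> = r \<Longrightarrow> (1 < i \<Longrightarrow> u (\<tau> (i - 1)) \<le> R) \<Longrightarrow>
    (i < m \<longrightarrow> R < u (\<sigma> (Suc i))) \<and> (i = m \<longrightarrow> 0 < bvalue u v)"
proof -
  note hi = hump_in[OF i]
  have R: "0 < R" using r rR by simp
  define \<omega> where "\<omega> = (lam - c) * d0 * r * hump_mass i"
  have \<omega>: "0 < \<omega>" using c d0 r hump_mass(1)[OF i] by (simp add: \<omega>_def)
  \<comment> \<open>The first entry lets the gain \<open>\<omega>\<close> outweigh the entry loss by
    half; the second is what survival on the hump in \<open>alive_through_hump\<close> asks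
    for.\<close>
  define e where "e = min (\<omega> / 2) (r / P * d0\<^sup>2 / (2 * L))"
  have e: "0 < e" "e \<le> \<omega> / 2" "e * L / d0\<^sup>2 < r / P"
  proof -
    have rP: "0 < r / P" using r P_pos by simp
    have "0 < r / P * d0\<^sup>2 / (2 * L)" using r P_pos d0(1) L_pos by simp
    then show "0 < e" unfolding e_def using \<omega> by (intro min_less_iff_conj[THEN iffD2] conjI) auto
    show "e \<le> \<omega> / 2" by (simp add: e_def)
    have "e \<le> r / P * d0\<^sup>2 / (2 * L)" unfolding e_def by (rule min.cobounded2)
    then have "e * L / d0\<^sup>2 \<le> (r / P * d0\<^sup>2 / (2 * L)) * L / d0\<^sup>2"
      using L_pos d0 by (intro divide_right_mono mult_right_mono) auto
    also have "\<dots> = r / P / 2" using L_pos d0 by simp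
    finally show "e * L / d0\<^sup>2 < r / P" using rP by simp
  qed
  define A where "A = integral {\<sigma> i..\<tau> i} (a i)"
  have ai: "a i integrable_on {\<sigma> i..\<tau> i}"
    by (rule integrable_on_subinterval[OF abs_int_imp_int[OF a_abs[OF i]]]) (use hi in auto)
  have A: "0 \<le> A" unfolding A_def by (rule integral_nonneg[OF ai]) (use a_nonneg i hi in auto)
  \<comment> \<open>Bounds the slope on entry: over the hump it can fall by at most
    \<open>c * r * A\<close>, and \<open>u\<close> rises from a nonnegative value to at most
    \<open>r\<close>.\<close>
  define C where "C = r / (\<tau> i - \<sigma> i) + c * r * A + 1"
  have C: "0 < C" using r hump_less[OF i] c A by (simp add: C_def add_nonneg_pos)
  obtain B1 where B1: "\<And>\<beta> k u v. 1 < i \<Longrightarrow> B1 \<le> \<beta> \<Longrightarrow> traj (\<tau> (i - 1)) (\<sigma> i) (\<lambda>x. - (\<beta> * b (i - 1) x * k (u x))) u v \<Longrightarrow>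
    (\<And>x. x \<in> {\<tau> (i - 1)..\<sigma> i} \<Longrightarrow> 0 \<le> u x) \<Longrightarrow> (\<And>s. 0 \<le> s \<Longrightarrow> 0 \<le> k s) \<Longrightarrow> (\<And>s. 0 \<le> s \<Longrightarrow> kk (i - 1) s \<le> k s) \<Longrightarrow>
    u (\<tau> (i - 1)) \<le> R \<Longrightarrow> u (\<sigma> i) \<le> R \<Longrightarrow> v (\<sigma> i) \<le> C \<Longrightarrow> u (\<sigma> i) \<le> e / (2 * P) \<and> - (e / (2 * P)) \<le> v (\<sigma> i)"
  proof (cases "1 < i")
    case True
    define j where "j = i - 1"
    have j: "j \<in> {1..<m}" "Suc j = i" "j \<le> m" using True i by (auto simp: j_def)
    have ba: "b j absolutely_integrable_on {\<tau> j..\<sigma> i}"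
      by (rule absolutely_integrable_on_subinterval[OF b_abs]) (use j gap_in[of j] in auto)
    have bn: "\<And>x. x \<in> {\<tau> j..\<sigma> i} \<Longrightarrow> 0 \<le> b j x" using b_nonneg j gap_in[of j] by auto
    have nt: "\<And>e. 0 < e \<Longrightarrow> e \<le> \<sigma> i - \<tau> j \<Longrightarrow> \<not> negligible {x \<in> {\<sigma> i - e..\<sigma> i}. b j x \<noteq> 0}"
      using b_nontriv_right[of j] j by auto
    have lt: "\<tau> j < \<sigma> i" using gap_less[of j] j by auto
    have eP: "0 < e / (2 * P)" using e P_pos by simp
    show ?thesis
      by (rule gap_exit[OF lt ba bn nt kk(1)[OF j(1)] kk(2)[OF j(1)] eP C R]) (assumption+, rule that, unfold j_def[symmetric], blast)
  qed (rule that[of 0], simp)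
  \<comment> \<open>In the gap \<open>u / \<phi>\<close> grows at rate at least
    \<open>\<omega> / 2\<close> over \<open>P\<close> squared; the factor \<open>d0\<close> converts
    this into a lower bound for \<open>u\<close>.\<close>
  define c1 where "c1 = d0 * (\<omega> / 2 / P\<^sup>2)"
  have c1: "0 < c1" using d0 \<omega> P_pos by (simp add: c1_def)
  \<comment> \<open>A slope below \<open>- C2\<close> at \<open>\<tau> i\<close> would make the
    Wronskian negative, because \<open>u\<close> is at most \<open>r\<close>, the absolute value of
    \<open>\<psi>\<close> at most \<open>P\<close>, and \<open>\<phi>\<close> at least
    \<open>d0\<close>.\<close>
  define C2 where "C2 = r * P / d0 + 1"
  have C2: "0 < C2" using r P_pos d0 by (simp add: C2_def add_pos_pos)
  obtain B2 where B2: "\<And>\<beta> k u v. i < m \<Longrightarrow> B2 \<le> \<beta> \<Longrightarrow> traj (\<tau> i) (\<sigma> (Suc i)) (\<lambda>x. - (\<beta> * b i x * k (u x))) u v \<Longrightarrow>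
    (\<And>x. x \<in> {\<tau> i..\<sigma> (Suc i)} \<Longrightarrow> c1 * (x - \<tau> i) \<le> u x) \<Longrightarrow> (\<And>s. 0 \<le> s \<Longrightarrow> 0 \<le> k s) \<Longrightarrow> (\<And>s. 0 \<le> s \<Longrightarrow> kk i s \<le> k s) \<Longrightarrow>
    u (\<tau> i) \<le> R \<Longrightarrow> - C2 \<le> v (\<tau> i) \<Longrightarrow> R < u (\<sigma> (Suc i))"
  proof (cases "i < m")
    case True
    have j: "i \<in> {1..<m}" using True i by auto
    have ba: "b i absolutely_integrable_on {\<tau> i..\<sigma> (Suc i)}"
      by (rule absolutely_integrable_on_subinterval[OF b_abs]) (use j gap_in[of i] in auto)
    have bn: "\<And>x. x \<in> {\<tau> i..\<sigma> (Suc i)} \<Longrightarrow> 0 \<le> b i x" using b_nonneg j gap_in[of i] by auto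
    have nt: "\<And>e. 0 < e \<Longrightarrow> e \<le> \<sigma> (Suc i) - \<tau> i \<Longrightarrow> \<not> negligible {x \<in> {\<tau> i..\<tau> i + e}. b i x \<noteq> 0}"
      using b_nontriv_left[of i] j by auto
    have lt: "\<tau> i < \<sigma> (Suc i)" using gap_less[of i] j by auto
    show ?thesis
      by (rule gap_blowup[OF lt ba bn nt kk(1)[OF j] kk(2)[OF j] c1 C2 R]) (assumption+, rule that, blast)
  qed (rule that[of 0], simp)
  show ?thesis
  proof (rule that[of "max B1 B2"])
    fix g k bet t u v \<xi>
    assume nl: "nonlin g k" and g: "\<And>s. 0 \<le> s \<Longrightarrow> s \<le> r \<Longrightarrow> alp i * g i s \<le> c * s"
      and kk': "\<And>j s. j \<in> {1..<m} \<Longrightarrow> 0 \<le> s \<Longrightarrow> kk j s \<le> k j s" and bet0: "\<And>j. j \<le> m \<Longrightarrow> 0 \<le> bet j"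
      and bet: "\<And>j. j \<in> {1..<m} \<Longrightarrow> max B1 B2 \<le> bet j" and s: "shot g k bet t u v"
      and ur: "\<And>x. x \<in> {\<sigma> i..\<tau> i} \<Longrightarrow> u x \<le> r" and \<xi>: "\<xi> \<in> {\<sigma> i..\<tau> i}" "u \<xi> = r"
      and prev: "1 < i \<Longrightarrow> u (\<tau> (i - 1)) \<le> R"
    have t: "traj 0 L (\<lambda>x. nl g k bet x (u x)) u v" and t0: "0 \<le> t" "u 0 = be * t" "v 0 = al * t"
      using s by (auto simp: shot_def)
    have before: "0 \<le> u x" if "0 \<le> x" "x \<le> \<sigma> i" for x
    proof (rule ccontr)
      assume "\<not> 0 \<le> u x"
      then have "u \<xi> < 0" using shot_dead(1)[OF s nl, of x \<xi>] that \<xi> hi by auto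
      then show False using \<xi> r by simp
    qed
    have Wl: "- e \<le> v (\<sigma> i) * \<phi> (\<sigma> i) - u (\<sigma> i) * \<psi> (\<sigma> i)"
    proof (cases "1 < i")
      case False
      then have i1: "i = 1" using i by simp
      have "v 0 * \<phi> 0 - u 0 * \<psi> 0 = t * (al * \<phi> 0 - be * \<psi> 0)" using t0 by (simp add: algebra_simps)
      then have "0 \<le> v 0 * \<phi> 0 - u 0 * \<psi> 0" using t0(1) \<phi>0 by simp
      also have "\<dots> \<le> v (\<sigma> 1) * \<phi> (\<sigma> 1) - u (\<sigma> 1) * \<psi> (\<sigma> 1)"
        by (rule wronskian_gap[where j=0, OF t nl]) (use bet0[of 0] h1_tau0 hi i1 before in auto)
      finally show ?thesis using i1 e by simp
    next
      case True
      define j where "j = i - 1"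
      have j: "j \<in> {1..<m}" "Suc j = i" "j \<le> m" using True i by (auto simp: j_def)
      have tj: "traj (\<tau> (i - 1)) (\<sigma> i) (\<lambda>x. - (bet (i - 1) * b (i - 1) x * k (i - 1) (u x))) u v"
        unfolding j_def[symmetric]
        by (rule traj_cong[OF traj_gap[OF t j(3), unfolded j(2)] negligible_empty])
          (use before gap_in[of j] j in auto)
      have vC: "v (\<sigma> i) \<le> C"
      proof -
        have low: "v (\<sigma> i) - c * r * A \<le> v z" if z: "\<sigma> i \<le> z" "z \<le> \<tau> i" for z
        proof -
          have "v z - v (\<sigma> i) = - integral {\<sigma> i..z} (\<lambda>x. a i x * (alp i * g i (max 0 (u x))))"
            by (rule traj_v_diff[OF traj_hump[OF t i]]) (use z in auto)
          moreover have "integral {\<sigma> i..z} (\<lambda>x. a i x * (alp i * g i (max 0 (u x)))) \<le> integral {\<sigma> i..z} (\<lambda>x. c * r * a i x)"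
          proof (rule integral_le)
            show "(\<lambda>x. a i x * (alp i * g i (max 0 (u x)))) integrable_on {\<sigma> i..z}"
              by (rule traj_integrable[OF traj_hump[OF t i]]) (use z in auto)
            have "a i integrable_on {\<sigma> i..z}" by (rule integrable_on_subinterval[OF ai]) (use z in auto)
            then show "(\<lambda>x. c * r * a i x) integrable_on {\<sigma> i..z}" using integrable_on_cmult_left by fastforce
            fix x assume x: "x \<in> {\<sigma> i..z}"
            then have "x \<in> {\<sigma> i..\<tau> i}" using z by auto
            then have "max 0 (u x) \<le> r" using ur r by auto
            then have "alp i * g i (max 0 (u x)) \<le> c * max 0 (u x)" by (intro g) auto
            also have "\<dots> \<le> c * r" using \<open>max 0 (u x) \<le> r\<close> c by (intro mult_left_mono) auto
            finally have "a i x * (alp i * g i (max 0 (u x))) \<le> a i x * (c * r)"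
              using a_nonneg i x z hi by (intro mult_left_mono) auto
            then show "a i x * (alp i * g i (max 0 (u x))) \<le> c * r * a i x" by (simp add: mult_ac)
          qed
          moreover have "integral {\<sigma> i..z} (\<lambda>x. c * r * a i x) \<le> c * r * A"
          proof -
            have "integral {\<sigma> i..z} (a i) \<le> A" unfolding A_def
              by (rule integral_subset_le[OF _ integrable_on_subinterval[OF ai] ai]) (use z a_nonneg i hi in auto)
            then have "c * r * integral {\<sigma> i..z} (a i) \<le> c * r * A" using c r by (intro mult_left_mono) auto
            then show ?thesis by simp
          qed
          ultimately show ?thesis by linarith
        qed
        have "u (\<tau> i) - u (\<sigma> i) \<ge> (v (\<sigma> i) - c * r * A) * (\<tau> i - \<sigma> i)"
          by (rule traj_slope_ge[OF traj_hump[OF t i]]) (use hump_less[OF i] low in auto)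
        moreover have "u (\<tau> i) \<le> r" "0 \<le> u (\<sigma> i)" using ur before hump_less[OF i] hi by auto
        ultimately have "(v (\<sigma> i) - c * r * A) * (\<tau> i - \<sigma> i) \<le> r" by linarith
        then have "v (\<sigma> i) - c * r * A \<le> r / (\<tau> i - \<sigma> i)" using hump_less[OF i] by (simp add: pos_le_divide_eq)
        then show ?thesis by (simp add: C_def)
      qed
      have "B1 \<le> bet (i - 1)" using bet[OF j(1)] by (simp add: j_def)
      moreover have "\<And>s. 0 \<le> s \<Longrightarrow> 0 \<le> k (i - 1) s" using nl j(1) unfolding nonlin_def j_def by auto
      moreover have "\<And>s. 0 \<le> s \<Longrightarrow> kk (i - 1) s \<le> k (i - 1) s" using kk'[OF j(1)] by (simp add: j_def)
      moreover have "u (\<sigma> i) \<le> R" using ur[of "\<sigma> i"] hump_less[OF i] rR by auto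
      moreover have "0 \<le> u x" if "x \<in> {\<tau> (i - 1)..\<sigma> i}" for x
        using before that gap_in(1)[of j] j by (auto simp: j_def)
      ultimately have ex: "u (\<sigma> i) \<le> e / (2 * P) \<and> - (e / (2 * P)) \<le> v (\<sigma> i)"
        using B1[OF True _ tj] prev[OF True] vC by blast
      have sL: "\<sigma> i \<in> {0..L}" using hi hump_less[OF i] by auto
      have "u (\<sigma> i) * \<psi> (\<sigma> i) \<le> u (\<sigma> i) * P"
        using P(2)[OF sL] before[of "\<sigma> i"] hi by (intro mult_left_mono) auto
      also have "\<dots> \<le> e / (2 * P) * P" using ex P_pos by (intro mult_right_mono) auto
      finally have 1: "u (\<sigma> i) * \<psi> (\<sigma> i) \<le> e / 2" using P_pos by simp
      have "- (e / (2 * P)) * P \<le> - (e / (2 * P)) * \<phi> (\<sigma> i)"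
        using P(1)[OF sL] e P_pos by (intro mult_left_mono_neg) auto
      also have "\<dots> \<le> v (\<sigma> i) * \<phi> (\<sigma> i)" using ex phi_pos[OF sL] by (intro mult_right_mono) auto
      finally have "- (e / 2) \<le> v (\<sigma> i) * \<phi> (\<sigma> i)" using P_pos by simp
      then show ?thesis using 1 by linarith
    qed
    have alive: "0 \<le> u x" if "0 \<le> x" "x \<le> \<tau> i" for x
      by (rule alive_through_hump[OF s nl i g ur \<xi> less_imp_le[OF e(1)] e(3) Wl that])
    have W\<tau>: "\<omega> / 2 \<le> v (\<tau> i) * \<phi> (\<tau> i) - u (\<tau> i) * \<psi> (\<tau> i)"
    proof -
      have "v (\<sigma> i) * \<phi> (\<sigma> i) - u (\<sigma> i) * \<psi> (\<sigma> i) + \<omega> \<le> v (\<tau> i) * \<phi> (\<tau> i) - u (\<tau> i) * \<psi> (\<tau> i)"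
        unfolding \<omega>_def by (rule wronskian_after_hump[OF s nl i g ur \<xi>]) (use alive hi in auto)
      then show ?thesis using Wl e(2) by linarith
    qed
    show "(i < m \<longrightarrow> R < u (\<sigma> (Suc i))) \<and> (i = m \<longrightarrow> 0 < bvalue u v)"
    proof (intro conjI impI)
      assume "i = m"
      then show "0 < bvalue u v"
        using last_hump_small[OF s nl] bet0[of m] W\<tau> \<omega> alive by auto
    next
      assume im: "i < m"
      have j: "i \<in> {1..<m}" "i \<le> m" using im i by auto
      have Wp: "0 < v (\<tau> i) * \<phi> (\<tau> i) - u (\<tau> i) * \<psi> (\<tau> i)" using W\<tau> \<omega> by simp
      have ug: "0 \<le> u x" if "0 \<le> x" "x \<le> \<sigma> (Suc i)" for x
        by (rule alive_through_gap[OF s nl i bet0[OF j(2)] Wp alive that])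
      have gi: "0 \<le> \<tau> i" "\<sigma> (Suc i) \<le> L" using gap_in[OF j(2)] by auto
      have ti: "traj (\<tau> i) (\<sigma> (Suc i)) (\<lambda>x. - (bet i * b i x * k i (u x))) u v"
        by (rule traj_cong[OF traj_gap[OF t j(2)] negligible_empty]) (use ug gi in auto)
      have low: "c1 * (x - \<tau> i) \<le> u x" if x: "x \<in> {\<tau> i..\<sigma> (Suc i)}" for x
      proof -
        have "u (\<tau> i) / \<phi> (\<tau> i) + (\<omega> / 2 / P\<^sup>2) * (x - \<tau> i) \<le> u x / \<phi> x"
        proof (rule quotient_growth[OF t \<phi> gi(1)])
          show "\<tau> i \<le> x" "x \<le> L" using x gi by auto
          show "0 < \<phi> z" if "z \<in> {0..L}" for z by (rule phi_pos[OF that])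
          fix z assume z: "\<tau> i \<le> z" "z \<le> x"
          then have zL: "z \<in> {0..L}" using gi x by auto
          have "(\<phi> z)\<^sup>2 \<le> P\<^sup>2" using P(1)[OF zL] phi_pos[OF zL] by (intro power_mono) auto
          then have "(\<omega> / 2) * ((\<phi> z)\<^sup>2 / P\<^sup>2) \<le> (\<omega> / 2) * 1" using \<omega> P_pos by (intro mult_left_mono) auto
          then have "\<omega> / 2 / P\<^sup>2 * (\<phi> z)\<^sup>2 \<le> \<omega> / 2" by simp
          also have "\<dots> \<le> v (\<tau> i) * \<phi> (\<tau> i) - u (\<tau> i) * \<psi> (\<tau> i)" by (rule W\<tau>)
          also have "\<dots> \<le> v z * \<phi> z - u z * \<psi> z"
            by (rule wronskian_gap[where j=i, OF t nl j(2) bet0[OF j(2)] order_refl z(1)]) (use z x ug gi in auto)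
          finally show "\<omega> / 2 / P\<^sup>2 * (\<phi> z)\<^sup>2 \<le> v z * \<phi> z - u z * \<psi> z" .
        qed
        moreover have "0 \<le> u (\<tau> i) / \<phi> (\<tau> i)"
          using alive[of "\<tau> i"] phi_pos[of "\<tau> i"] gi gap_le[OF j(2)] by auto
        ultimately have 1: "(\<omega> / 2 / P\<^sup>2) * (x - \<tau> i) \<le> u x / \<phi> x" by linarith
        have xL: "x \<in> {0..L}" using x gi by auto
        have "c1 * (x - \<tau> i) = d0 * ((\<omega> / 2 / P\<^sup>2) * (x - \<tau> i))" by (simp add: c1_def)
        also have "\<dots> \<le> \<phi> x * ((\<omega> / 2 / P\<^sup>2) * (x - \<tau> i))"
          using d0(2)[OF xL] x \<omega> by (intro mult_right_mono) auto
        also have "\<dots> \<le> \<phi> x * (u x / \<phi> x)" using 1 phi_pos[OF xL] by (intro mult_left_mono) auto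
        finally show ?thesis using phi_pos[OF xL] by simp
      qed
      have tL: "\<tau> i \<in> {0..L}" using gi gap_le[OF j(2)] by auto
      have vlow: "- C2 \<le> v (\<tau> i)"
      proof (rule ccontr)
        assume "\<not> - C2 \<le> v (\<tau> i)"
        then have v: "v (\<tau> i) < - C2" by simp
        have "v (\<tau> i) * \<phi> (\<tau> i) \<le> - C2 * \<phi> (\<tau> i)" using v phi_pos[OF tL] by (intro mult_right_mono) auto
        also have "\<dots> \<le> - C2 * d0" using d0(2)[OF tL] C2 by (intro mult_left_mono_neg) auto
        also have "\<dots> < - (r * P)" using d0(1) by (simp add: C2_def algebra_simps)
        finally have "v (\<tau> i) * \<phi> (\<tau> i) < - (r * P)" .
        moreover have "- (r * P) \<le> u (\<tau> i) * \<psi> (\<tau> i)"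
        proof -
          have "\<bar>u (\<tau> i) * \<psi> (\<tau> i)\<bar> \<le> r * P"
            unfolding abs_mult using ur[of "\<tau> i"] alive[of "\<tau> i"] P(2)[OF tL] gi hump_less[OF i] r by (intro mult_mono) auto
          then show ?thesis by linarith
        qed
        ultimately show False using Wp by linarith
      qed
      have "\<And>s. 0 \<le> s \<Longrightarrow> 0 \<le> k i s" using nl j by (auto simp: nonlin_def)
      moreover have "B2 \<le> bet i" using bet[OF j(1)] by simp
      moreover have "u (\<tau> i) \<le> R" using ur[of "\<tau> i"] hump_less[OF i] rR by auto
      ultimately show "R < u (\<sigma> (Suc i))"
        using B2[OF im _ ti low] kk'[OF j(1)] vlow by blast
    qed
  qed
qed

end

end

section \<open>Reflection, uniqueness for zero Cauchy data, and strict positivity\<close>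

lemma Sup_image_Icc:
  fixes u :: "real \<Rightarrow> real"
  assumes "continuous_on {p..q} u" "p \<le> q"
  obtains \<xi> where "\<xi> \<in> {p..q}" "Sup (u ` {p..q}) = u \<xi>" "\<And>x. x \<in> {p..q} \<Longrightarrow> u x \<le> u \<xi>"
proof -
  have "\<exists>\<xi>\<in>{p..q}. \<forall>x\<in>{p..q}. u x \<le> u \<xi>"
    using assms by (intro continuous_attains_sup) auto
  then obtain \<xi> where \<xi>: "\<xi> \<in> {p..q}" "\<forall>x\<in>{p..q}. u x \<le> u \<xi>" by blast
  have "Sup (u ` {p..q}) = u \<xi>" by (rule cSup_eq_maximum) (use \<xi> in auto)
  then show ?thesis using that \<xi> by blast
qed

text \<open>Allows the one-sided results, \<open>traj_end_slope\<close> at a right end and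
  \<open>traj_zero_forward\<close>, to be used in the opposite direction.\<close>

lemma traj_reflect:
  assumes t: "traj p q F u v" and pq: "p \<le> q"
  shows "traj (- q) (- p) (\<lambda>x. F (- x)) (\<lambda>x. u (- x)) (\<lambda>x. - v (- x))"
  unfolding traj_def
proof (intro conjI ballI)
  show "(\<lambda>x. F (- x)) absolutely_integrable_on {- q..- p}" using t by (simp add: traj_def)
  fix x assume x: "x \<in> {- q..- p}"
  have "integral {- q..x} (\<lambda>x. F (- x)) = integral {- x..q} F"
    using Henstock_Kurzweil_Integration.integral_reflect_real[of q "- x" F] by simp
  also have "\<dots> = v (- x) - v q" using traj_v_diff[OF t, of "- x" q] x by auto
  finally show "integral {- q..x} (\<lambda>x. F (- x)) = - v (- (- q)) - - v (- x)" by simp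
  have "((\<lambda>x. u (- x)) has_real_derivative v (- x) * (- 1)) (at x within {- q..- p})"
  proof (rule DERIV_image_chain[of u "v (- x)" uminus x "{- q..- p}" "- 1", unfolded o_def])
    have "uminus ` {- q..- p} = {p..q}" by simp
    then show "(u has_real_derivative v (- x)) (at (- x) within uminus ` {- q..- p})"
      using t x by (auto simp: traj_def)
  qed (auto intro!: derivative_eq_intros)
  then show "((\<lambda>x. u (- x)) has_real_derivative - v (- x)) (at x within {- q..- p})" by simp
qed

text \<open>The Gronwall bound with \<open>E = 0\<close>. It requires only a linear bound on the
  force along this trajectory, so the field itself may fail to be Lipschitz.\<close>

lemma traj_zero_forward:
  assumes pq: "p \<le> q" and t: "traj p q F u v" and z: "u p = 0" "v p = 0"
    and w: "w absolutely_integrable_on {p..q}" "\<And>x. x \<in> {p..q} \<Longrightarrow> 0 \<le> w x"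
    and F: "\<And>x. x \<in> {p..q} \<Longrightarrow> \<bar>F x\<bar> \<le> w x * \<bar>u x\<bar>" and x: "x \<in> {p..q}"
  shows "u x = 0"
proof -
  define K where "K = q - p"
  have Kw: "(\<lambda>x. K * w x) absolutely_integrable_on {p..q}"
    by (rule abs_int_mult_cont(2)[OF w(1)]) auto
  have Kwn: "\<And>x. x \<in> {p..q} \<Longrightarrow> 0 \<le> K * w x" using w(2) pq by (simp add: K_def)
  obtain C where C: "C \<ge> 1" "\<And>y E x. continuous_on {p..q} y \<Longrightarrow>
    (\<And>x. x \<in> {p..q} \<Longrightarrow> 0 \<le> y x) \<Longrightarrow>
    (\<And>x. x \<in> {p..q} \<Longrightarrow> y x \<le> E + integral {p..x} (\<lambda>\<xi>. (K * w \<xi>) * y \<xi>)) \<Longrightarrow> x \<in> {p..q} \<Longrightarrow> y x \<le> C * E"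
    using gronwall_L1[OF pq Kw Kwn] by blast
  have cu: "continuous_on {p..q} (\<lambda>x. \<bar>u x\<bar>)" by (intro continuous_intros traj_cont_u[OF t])
  have wu: "(\<lambda>x. w x * \<bar>u x\<bar>) integrable_on {p..q}"
    by (rule abs_int_imp_int, rule abs_int_mult_cont(1)[OF w(1) cu])
  have "\<bar>u x\<bar> \<le> C * 0"
  proof (rule C(2)[OF cu _ _ x])
    fix x assume x: "x \<in> {p..q}"
    have wi: "(\<lambda>x. w x * \<bar>u x\<bar>) integrable_on {p..y}" if "y \<in> {p..q}" for y
      by (rule integrable_on_subinterval[OF wu]) (use that in auto)
    have v: "\<bar>v y\<bar> \<le> integral {p..x} (\<lambda>x. w x * \<bar>u x\<bar>)" if y: "y \<in> {p..x}" for y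
    proof -
      have yq: "y \<in> {p..q}" using y x by auto
      have "\<bar>v y\<bar> = norm (integral {p..y} F)" using traj_v_diff[OF t, of p y] yq z by simp
      also have "\<dots> \<le> integral {p..y} (\<lambda>x. w x * \<bar>u x\<bar>)"
        by (rule integral_norm_bound_integral[OF traj_integrable[OF t] wi[OF yq]]) (use yq F in auto)
      also have "\<dots> \<le> integral {p..x} (\<lambda>x. w x * \<bar>u x\<bar>)"
        by (rule integral_subset_le[OF _ wi[OF yq] wi[OF x]]) (use y x w in auto)
      finally show ?thesis .
    qed
    have "\<bar>u x\<bar> = norm (integral {p..x} v)" using traj_u_integral[OF t x] z by simp
    also have "\<dots> \<le> integral {p..x} (\<lambda>_. integral {p..x} (\<lambda>x. w x * \<bar>u x\<bar>))"
    proof (rule integral_norm_bound_integral)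
      show "v integrable_on {p..x}"
        by (rule integrable_continuous_real, rule continuous_on_subset[OF traj_cont_v[OF t]]) (use x in auto)
    qed (use v in auto)
    also have "\<dots> = (x - p) * integral {p..x} (\<lambda>x. w x * \<bar>u x\<bar>)" using x by simp
    also have "\<dots> \<le> K * integral {p..x} (\<lambda>x. w x * \<bar>u x\<bar>)"
      using x w by (intro mult_right_mono integral_nonneg wi) (auto simp: K_def)
    finally show "\<bar>u x\<bar> \<le> 0 + integral {p..x} (\<lambda>\<xi>. (K * w \<xi>) * \<bar>u \<xi>\<bar>)" by (simp add: mult.assoc)
  qed simp
  then show ?thesis by simp
qed

text \<open>A nonnegative function has slope zero at an interior zero: \<open>traj_end_slope\<close>
  gives one sign from each side. Uniqueness to the right, and after reflection to the left, then
  makes it vanish identically.\<close>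

lemma traj_positive:
  assumes t: "traj p q F u v"
    and w: "w absolutely_integrable_on {p..q}" "\<And>x. x \<in> {p..q} \<Longrightarrow> 0 \<le> w x"
    and F: "\<And>x. x \<in> {p..q} \<Longrightarrow> \<bar>F x\<bar> \<le> w x * \<bar>u x\<bar>"
    and un: "\<And>x. x \<in> {p..q} \<Longrightarrow> 0 \<le> u x" and \<xi>: "\<xi> \<in> {p..q}" "u \<xi> \<noteq> 0" and x: "p < x" "x < q"
  shows "0 < u x"
proof (rule ccontr)
  assume "\<not> 0 < u x"
  then have z: "u x = 0" using un[of x] x by auto
  have tl: "traj p x F u v" and tr: "traj x q F u v" by (rule traj_sub[OF t]; use x in simp)+
  have tlr: "traj (- x) (- p) (\<lambda>x. F (- x)) (\<lambda>x. u (- x)) (\<lambda>x. - v (- x))"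
    by (rule traj_reflect[OF tl]) (use x in simp)
  have trr: "traj (- q) (- x) (\<lambda>x. F (- x)) (\<lambda>x. u (- x)) (\<lambda>x. - v (- x))"
    by (rule traj_reflect[OF tr]) (use x in simp)
  have "v x \<le> 0" by (rule traj_end_slope[OF tl]) (use x un z in auto)
  moreover have "- v (- (- x)) \<le> 0" by (rule traj_end_slope[OF trr]) (use x un z in auto)
  ultimately have vz: "v x = 0" by simp
  have "u \<xi> = 0"
  proof (cases "x \<le> \<xi>")
    case True
    show ?thesis
      by (rule traj_zero_forward[OF _ tr z vz, of w])
        (use x True \<xi> w F in \<open>auto intro: absolutely_integrable_on_subinterval[OF w(1)]\<close>)
  next
    case False
    have "u (- (- \<xi>)) = 0"
    proof (rule traj_zero_forward[OF _ tlr, of "\<lambda>x. w (- x)"])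
      have "w absolutely_integrable_on {p..x}" by (rule absolutely_integrable_on_subinterval[OF w(1)]) (use x in auto)
      then show "(\<lambda>x. w (- x)) absolutely_integrable_on {- x..- p}" by simp
    qed (use x False \<xi> w(2) F z vz in auto)
    then show ?thesis by simp
  qed
  then show False using \<xi> by simp
qed

section \<open>Solutions for every pattern when the nonlinearities are Lipschitz\<close>

context SL_structure
begin

lemma nl_lip_field:
  assumes nl: "nonlin g k" and K: "0 \<le> K"
    and g: "\<And>i s s'. i \<in> {1..m} \<Longrightarrow> \<bar>g i s - g i s'\<bar> \<le> K * \<bar>s - s'\<bar>"
    and k: "\<And>j s s'. j \<in> {0..m+1} \<Longrightarrow> \<bar>k j s - k j s'\<bar> \<le> K * \<bar>s - s'\<bar>"
  shows "lip_field 0 L (\<lambda>x. (\<Sum>i=1..m. alp i * K * a i x) + (\<Sum>j=0..m+1. \<bar>bet j\<bar> * K * b j x)) (nl g k bet)"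
  unfolding lip_field_def
proof (intro conjI ballI allI impI)
  have "(\<lambda>x. alp i * K * a i x) absolutely_integrable_on {0..L}" if "i \<in> {1..m}" for i
    by (rule abs_int_mult_cont(2)[OF a_abs[OF that]]) auto
  moreover have "(\<lambda>x. \<bar>bet j\<bar> * K * b j x) absolutely_integrable_on {0..L}" if "j \<in> {0..m+1}" for j
    by (rule abs_int_mult_cont(2)[OF b_abs[OF that]]) auto
  ultimately show "(\<lambda>x. (\<Sum>i=1..m. alp i * K * a i x) + (\<Sum>j=0..m+1. \<bar>bet j\<bar> * K * b j x)) absolutely_integrable_on {0..L}"
    by (intro set_integral_add(1) absolutely_integrable_sum) auto
  show "(\<lambda>x. nl g k bet x (u x)) absolutely_integrable_on {0..L}" if "continuous_on {0..L} u" for u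
    by (rule nl_integrable[OF nl that])
  fix x assume x: "x \<in> {0..L}"
  have alpn: "0 \<le> alp i" if "i \<in> {1..m}" for i using alp_pos that by (simp add: less_imp_le)
  show "0 \<le> (\<Sum>i=1..m. alp i * K * a i x) + (\<Sum>j=0..m+1. \<bar>bet j\<bar> * K * b j x)"
    using K a_nonneg b_nonneg x alpn by (intro add_nonneg_nonneg sum_nonneg mult_nonneg_nonneg) auto
  fix s s' :: real
  have A: "\<bar>alp i * a i x * g i (max 0 s) - alp i * a i x * g i (max 0 s')\<bar> \<le> alp i * K * a i x * \<bar>s - s'\<bar>"
    if i: "i \<in> {1..m}" for i
  proof -
    have an: "0 \<le> alp i * a i x" using alpn[OF i] a_nonneg i x by simp
    have "\<bar>g i (max 0 s) - g i (max 0 s')\<bar> \<le> K * \<bar>max 0 s - max 0 s'\<bar>" by (rule g[OF i])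
    also have "\<dots> \<le> K * \<bar>s - s'\<bar>" by (intro mult_left_mono max0_lip K)
    finally have "(alp i * a i x) * \<bar>g i (max 0 s) - g i (max 0 s')\<bar> \<le> (alp i * a i x) * (K * \<bar>s - s'\<bar>)"
      by (intro mult_left_mono an)
    moreover have "(alp i * a i x) * \<bar>g i (max 0 s) - g i (max 0 s')\<bar> = \<bar>alp i * a i x * g i (max 0 s) - alp i * a i x * g i (max 0 s')\<bar>"
      using abs_of_nonneg[OF an] by (metis abs_mult right_diff_distrib)
    ultimately show ?thesis by (simp only: mult.assoc mult.left_commute[of K])
  qed
  have B: "\<bar>bet j * b j x * k j (max 0 s) - bet j * b j x * k j (max 0 s')\<bar> \<le> \<bar>bet j\<bar> * K * b j x * \<bar>s - s'\<bar>"
    if j: "j \<in> {0..m+1}" for j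
  proof -
    have bn: "0 \<le> b j x" using b_nonneg j x by simp
    have "\<bar>k j (max 0 s) - k j (max 0 s')\<bar> \<le> K * \<bar>max 0 s - max 0 s'\<bar>" by (rule k[OF j])
    also have "\<dots> \<le> K * \<bar>s - s'\<bar>" by (intro mult_left_mono max0_lip K)
    finally have "(\<bar>bet j\<bar> * b j x) * \<bar>k j (max 0 s) - k j (max 0 s')\<bar> \<le> (\<bar>bet j\<bar> * b j x) * (K * \<bar>s - s'\<bar>)"
      by (intro mult_left_mono) (use bn in auto)
    moreover have "(\<bar>bet j\<bar> * b j x) * \<bar>k j (max 0 s) - k j (max 0 s')\<bar> = \<bar>bet j * b j x * k j (max 0 s) - bet j * b j x * k j (max 0 s')\<bar>"
      using abs_of_nonneg[OF bn] by (metis abs_mult right_diff_distrib)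
    ultimately show ?thesis by (simp add: mult_ac)
  qed
  define X where "X = (\<Sum>i=1..m. alp i * a i x * g i (max 0 s) - alp i * a i x * g i (max 0 s'))"
  define Y where "Y = (\<Sum>j=0..m+1. bet j * b j x * k j (max 0 s) - bet j * b j x * k j (max 0 s'))"
  have e: "nl g k bet x s - nl g k bet x s' = X - Y"
    by (simp only: nl_def f_SL_def sum_subtractf X_def Y_def)
  have "\<bar>X\<bar> \<le> (\<Sum>i=1..m. alp i * K * a i x * \<bar>s - s'\<bar>)"
    unfolding X_def by (rule order_trans[OF sum_abs]) (rule sum_mono, rule A)
  moreover have "\<bar>Y\<bar> \<le> (\<Sum>j=0..m+1. \<bar>bet j\<bar> * K * b j x * \<bar>s - s'\<bar>)"
    unfolding Y_def by (rule order_trans[OF sum_abs]) (rule sum_mono, rule B)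
  moreover have "\<bar>X - Y\<bar> \<le> \<bar>X\<bar> + \<bar>Y\<bar>" by (rule abs_triangle_ineq4)
  ultimately have "\<bar>X - Y\<bar> \<le> (\<Sum>i=1..m. alp i * K * a i x * \<bar>s - s'\<bar>) + (\<Sum>j=0..m+1. \<bar>bet j\<bar> * K * b j x * \<bar>s - s'\<bar>)"
    by linarith
  then show "\<bar>nl g k bet x s - nl g k bet x s'\<bar> \<le>
     ((\<Sum>i=1..m. alp i * K * a i x) + (\<Sum>j=0..m+1. \<bar>bet j\<bar> * K * b j x)) * \<bar>s - s'\<bar>"
    unfolding e by (simp only: sum_distrib_right distrib_right)
qed

text \<open>As long as \<open>u\<close> stays below \<open>R\<close> on the first hump, the force
  there is bounded and the slope loses at most \<open>G' * A\<close>, whereas position and slope on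
  entry grow linearly in the shooting parameter.\<close>

lemma shots_leave_first_hump:
  assumes nl: "nonlin g k" and bet: "0 \<le> bet 0"
  obtains t1 where "0 \<le> t1" "\<And>u v. shot g k bet t1 u v \<Longrightarrow> \<exists>x\<in>{\<sigma> 1..\<tau> 1}. R < u x"
proof -
  have i: "1 \<in> {1..m}" using m_pos by simp
  note hi = hump_in[OF i] and hl = hump_less[OF i]
  define G where "G = (SOME G. \<forall>s\<in>{0..R}. alp 1 * g 1 s \<le> G)"
  have "\<exists>G. \<forall>s\<in>{0..R}. alp 1 * g 1 s \<le> G"
  proof -
    have "continuous_on {0..R} (\<lambda>s. alp 1 * g 1 s)"
      by (intro continuous_intros continuous_on_subset[OF hump_nonlin(2)[OF nl i]]) auto
    then have "bounded ((\<lambda>s. alp 1 * g 1 s) ` {0..R})"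
      by (intro compact_imp_bounded compact_continuous_image) auto
    then obtain B where "\<forall>s\<in>{0..R}. norm (alp 1 * g 1 s) \<le> B" unfolding bounded_iff by auto
    then have "\<forall>s\<in>{0..R}. alp 1 * g 1 s \<le> B" by auto
    then show ?thesis by blast
  qed
  then have G: "\<forall>s\<in>{0..R}. alp 1 * g 1 s \<le> G" unfolding G_def by (rule someI_ex)
  define A where "A = integral {\<sigma> 1..\<tau> 1} (a 1)"
  have ai: "a 1 integrable_on {\<sigma> 1..\<tau> 1}"
    by (rule integrable_on_subinterval[OF abs_int_imp_int[OF a_abs[OF i]]]) (use hi in auto)
  have an: "0 \<le> a 1 x" if "x \<in> {\<sigma> 1..\<tau> 1}" for x using that a_nonneg i hi by auto
  define G' where "G' = max G 0"
  have G': "0 \<le> G'" "G \<le> G'" by (auto simp: G'_def)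
  define l where "l = \<tau> 1 - \<sigma> 1"
  have l: "0 < l" using hl by (simp add: l_def)
  define s where "s = be + al * l"
  have "al > 0 \<or> be > 0" using bc_nonneg bc_nondeg by (auto simp: less_le)
  then have s: "0 < s" using bc_nonneg l by (auto simp: s_def intro: add_pos_nonneg add_nonneg_pos mult_pos_pos)
  have Ann: "0 \<le> A" unfolding A_def by (rule integral_nonneg[OF ai an])
  \<comment> \<open>Under the contrary assumption \<open>u (\<tau> 1)\<close> is at least
    \<open>s * t1 - G' * A * l\<close>, which for this value is \<open>max R 0 + 1\<close>. The
    factor \<open>s\<close> is positive because \<open>al\<close> and \<open>be\<close> are not both
    zero.\<close>
  define t1 where "t1 = (max R 0 + G' * A * l + 1) / s"
  have t1: "0 \<le> t1" using s G' Ann l by (simp add: t1_def)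
  have "\<exists>x\<in>{\<sigma> 1..\<tau> 1}. R < u x" if sh: "shot g k bet t1 u v" for u v
  proof (rule ccontr)
    assume "\<not> ?thesis"
    then have uR: "\<And>x. x \<in> {\<sigma> 1..\<tau> 1} \<Longrightarrow> u x \<le> R" by force
    have t: "traj 0 L (\<lambda>x. nl g k bet x (u x)) u v" and t0: "u 0 = be * t1" "v 0 = al * t1"
      using sh by (auto simp: shot_def)
    have tg: "traj 0 (\<sigma> 1) (\<lambda>x. - (bet 0 * b 0 x * k 0 (max 0 (u x)))) u v"
      using traj_gap[OF t, of 0] h1_tau0 by simp
    have F: "- (bet 0 * b 0 z * k 0 (max 0 (u z))) \<le> 0" if "0 \<le> z" "z \<le> \<sigma> 1" for z
    proof -
      have "0 \<le> b 0 z" using b_nonneg that hi hl by auto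
      moreover have "0 \<le> k 0 (max 0 (u z))" using nl by (auto simp: nonlin_def)
      ultimately show ?thesis using bet by simp
    qed
    have v0: "al * t1 \<le> v z" if "0 \<le> z" "z \<le> \<sigma> 1" for z
      using traj_v_mono[OF tg, of 0 z] F that t0 by auto
    have "u (\<sigma> 1) - u 0 \<ge> 0 * (\<sigma> 1 - 0)"
    proof (rule traj_slope_ge[OF tg])
      fix z assume "0 \<le> z" "z \<le> \<sigma> 1"
      moreover have "0 \<le> al * t1" using bc_nonneg t1 by simp
      ultimately show "0 \<le> v z" using v0[of z] by linarith
    qed (use hi in auto)
    then have u1: "be * t1 \<le> u (\<sigma> 1)" using t0 by simp
    note th = traj_hump[OF t i]
    have low: "al * t1 - G' * A \<le> v z" if z: "\<sigma> 1 \<le> z" "z \<le> \<tau> 1" for z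
    proof -
      have "v z - v (\<sigma> 1) = - integral {\<sigma> 1..z} (\<lambda>x. a 1 x * (alp 1 * g 1 (max 0 (u x))))"
        by (rule traj_v_diff[OF th]) (use z in auto)
      moreover have "integral {\<sigma> 1..z} (\<lambda>x. a 1 x * (alp 1 * g 1 (max 0 (u x)))) \<le> integral {\<sigma> 1..z} (\<lambda>x. G' * a 1 x)"
      proof (rule integral_le)
        show "(\<lambda>x. a 1 x * (alp 1 * g 1 (max 0 (u x)))) integrable_on {\<sigma> 1..z}"
          by (rule traj_integrable[OF th]) (use z in auto)
        have "a 1 integrable_on {\<sigma> 1..z}" by (rule integrable_on_subinterval[OF ai]) (use z in auto)
        then show "(\<lambda>x. G' * a 1 x) integrable_on {\<sigma> 1..z}" using integrable_on_cmult_left by fastforce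
        fix x assume "x \<in> {\<sigma> 1..z}"
        then have x: "x \<in> {\<sigma> 1..\<tau> 1}" using z by auto
        have "alp 1 * g 1 (max 0 (u x)) \<le> G'"
        proof (cases "0 \<le> u x")
          case True
          then have "u x \<in> {0..R}" using uR[OF x] by simp
          then have "alp 1 * g 1 (u x) \<le> G" using G by blast
          then show ?thesis using True G' by (simp add: max_absorb2)
        next
          case False
          then have "g 1 (max 0 (u x)) = 0" using nl i by (auto simp: nonlin_def max_def)
          then show ?thesis using G' by simp
        qed
        then have "a 1 x * (alp 1 * g 1 (max 0 (u x))) \<le> a 1 x * G'" by (intro mult_left_mono an x)
        then show "a 1 x * (alp 1 * g 1 (max 0 (u x))) \<le> G' * a 1 x" by (simp add: mult_ac)
      qed
      moreover have "integral {\<sigma> 1..z} (\<lambda>x. G' * a 1 x) \<le> G' * A"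
      proof -
        have "integral {\<sigma> 1..z} (a 1) \<le> A" unfolding A_def
          by (rule integral_subset_le[OF _ integrable_on_subinterval[OF ai] ai]) (use z an in auto)
        then show ?thesis using G' by (simp add: mult_left_mono)
      qed
      moreover have "al * t1 \<le> v (\<sigma> 1)" using v0[of "\<sigma> 1"] hi by simp
      ultimately show ?thesis by linarith
    qed
    have "u (\<tau> 1) - u (\<sigma> 1) \<ge> (al * t1 - G' * A) * (\<tau> 1 - \<sigma> 1)"
      by (rule traj_slope_ge[OF th]) (use hl low in auto)
    then have "u (\<tau> 1) \<ge> s * t1 - G' * A * l" using u1 by (simp add: l_def s_def algebra_simps)
    moreover have "s * t1 = max R 0 + G' * A * l + 1" using s by (simp add: t1_def)
    moreover have "u (\<tau> 1) \<le> R" using uR hl by auto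
    ultimately show False by simp
  qed
  then show ?thesis using that t1 by blast
qed

text \<open>Feeds \<open>shooting_patterns\<close> with the maxima over the humps and the right
  boundary value, all Lipschitz in the parameter by \<open>ode_stable\<close>. The hypotheses
  \<open>high\<close> and \<open>low\<close> state the two driving facts in abstract form, so that
  only this theorem sees the Lipschitz constant \<open>K\<close>.\<close>

theorem shooting_solutions:
  assumes nl: "nonlin g k" and K: "0 \<le> K"
    and gl: "\<And>i s s'. i \<in> {1..m} \<Longrightarrow> \<bar>g i s - g i s'\<bar> \<le> K * \<bar>s - s'\<bar>"
    and kl: "\<And>j s s'. j \<in> {0..m+1} \<Longrightarrow> \<bar>k j s - k j s'\<bar> \<le> K * \<bar>s - s'\<bar>"
    and r: "0 < r" "r < R" and bet: "0 \<le> bet 0"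
    and high: "\<And>t u v i x. i \<in> {1..m} \<Longrightarrow> shot g k bet t u v \<Longrightarrow> x \<in> {\<sigma> i..\<tau> i} \<Longrightarrow> R < u x \<Longrightarrow>
       bvalue u v < 0 \<and> (i < m \<longrightarrow> u (\<tau> i) < 0)"
    and low: "\<And>t u v i \<xi>. i \<in> {1..m} \<Longrightarrow> shot g k bet t u v \<Longrightarrow> (\<And>x. x \<in> {\<sigma> i..\<tau> i} \<Longrightarrow> u x \<le> r) \<Longrightarrow>
       \<xi> \<in> {\<sigma> i..\<tau> i} \<Longrightarrow> u \<xi> = r \<Longrightarrow> (1 < i \<Longrightarrow> u (\<tau> (i - 1)) \<le> R) \<Longrightarrow>
       (i < m \<longrightarrow> R < u (\<sigma> (Suc i))) \<and> (i = m \<longrightarrow> 0 < bvalue u v)"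
    and S: "S \<subseteq> {1..m}" "S \<noteq> {}"
  obtains t u v where "shot g k bet t u v" "bvalue u v = 0"
    "\<And>i. i \<in> {1..m} \<Longrightarrow> i \<in> S \<Longrightarrow> \<exists>x\<in>{\<sigma> i..\<tau> i}. r \<le> u x"
    "\<And>i x. i \<in> {1..m} \<Longrightarrow> i \<notin> S \<Longrightarrow> x \<in> {\<sigma> i..\<tau> i} \<Longrightarrow> u x \<le> r"
    "\<And>i x. i \<in> {1..m} \<Longrightarrow> x \<in> {\<sigma> i..\<tau> i} \<Longrightarrow> u x \<le> R"
proof -
  define w where "w x = (\<Sum>i=1..m. alp i * K * a i x) + (\<Sum>j=0..m+1. \<bar>bet j\<bar> * K * b j x)" for x
  have LF: "lip_field 0 L w (nl g k bet)"
    unfolding w_def by (rule nl_lip_field[OF nl K gl kl])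
  have L0: "0 \<le> L" using L_pos by simp
  have "\<exists>u v. traj 0 L (\<lambda>x. nl g k bet x (u x)) u v \<and> u 0 = be * t \<and> v 0 = al * t" for t
    using ode_exists[OF L0 LF, of "be * t" "al * t"] by metis
  then obtain U V where UV: "\<And>t. traj 0 L (\<lambda>x. nl g k bet x (U t x)) (U t) (V t)" "\<And>t. U t 0 = be * t" "\<And>t. V t 0 = al * t"
    by metis
  have sh: "shot g k bet t (U t) (V t)" if "0 \<le> t" for t using UV that by (simp add: shot_def)
  obtain C where C: "C \<ge> 0" "\<And>F1 F2 u1 v1 u2 v2 x. lip_field 0 L w F1 \<Longrightarrow>
    traj 0 L (\<lambda>x. F1 x (u1 x)) u1 v1 \<Longrightarrow> traj 0 L (\<lambda>x. F2 x (u2 x)) u2 v2 \<Longrightarrow> x \<in> {0..L} \<Longrightarrow>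
    \<bar>u1 x - u2 x\<bar> \<le> C * (\<bar>u1 0 - u2 0\<bar> + \<bar>v1 0 - v2 0\<bar> + integral {0..L} (\<lambda>s. \<bar>F1 s (u2 s) - F2 s (u2 s)\<bar>)) \<and>
    \<bar>v1 x - v2 x\<bar> \<le> C * (\<bar>u1 0 - u2 0\<bar> + \<bar>v1 0 - v2 0\<bar> + integral {0..L} (\<lambda>s. \<bar>F1 s (u2 s) - F2 s (u2 s)\<bar>))"
    using ode_stable[of 0 L w] L0 LF unfolding lip_field_def by blast
  define D where "D = C * (be + al)"
  have D: "0 \<le> D" using C bc_nonneg by (simp add: D_def)
  have diff: "\<bar>U t x - U t' x\<bar> \<le> D * \<bar>t - t'\<bar> \<and> \<bar>V t x - V t' x\<bar> \<le> D * \<bar>t - t'\<bar>" if x: "x \<in> {0..L}" for t t' x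
  proof -
    have e: "\<bar>be * t - be * t'\<bar> + \<bar>al * t - al * t'\<bar> = (be + al) * \<bar>t - t'\<bar>"
      using bc_nonneg by (simp add: right_diff_distrib[symmetric] abs_mult distrib_right)
    show ?thesis
      using C(2)[of "nl g k bet" "U t" "V t" "nl g k bet" "U t'" "V t'" x, OF LF UV(1) UV(1) x] UV(2,3) e
      by (simp add: D_def mult.assoc)
  qed
  define M where "M i t = Sup (U t ` {\<sigma> i..\<tau> i})" for i t
  have cU: "continuous_on {\<sigma> i..\<tau> i} (U t)" if "i \<in> {1..m}" for i t
    by (rule continuous_on_subset[OF traj_cont_u[OF UV(1)]]) (use hump_in[OF that] in auto)
  have Mat: "\<exists>\<xi>\<in>{\<sigma> i..\<tau> i}. M i t = U t \<xi> \<and> (\<forall>x\<in>{\<sigma> i..\<tau> i}. U t x \<le> U t \<xi>)" if "i \<in> {1..m}" for i t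
    using Sup_image_Icc[OF cU[OF that] less_imp_le[OF hump_less[OF that]]] unfolding M_def by metis
  have Mge: "U t x \<le> M i t" if "i \<in> {1..m}" "x \<in> {\<sigma> i..\<tau> i}" for i t x
    using Mat[OF that(1), of t] that(2) by auto
  have Mle: "M i t \<le> M i t' + D * \<bar>t - t'\<bar>" if i: "i \<in> {1..m}" for i t t'
  proof -
    obtain \<xi> where \<xi>: "\<xi> \<in> {\<sigma> i..\<tau> i}" "M i t = U t \<xi>" using Mat[OF i] by blast
    have "U t \<xi> \<le> U t' \<xi> + D * \<bar>t - t'\<bar>" using diff[of \<xi> t t'] \<xi> hump_in[OF i] by auto
    then show ?thesis using Mge[OF i \<xi>(1), of t'] \<xi> by simp
  qed
  have Mc: "continuous_on {0..} (M i)" if i: "i \<in> {1..m}" for i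
  proof -
    have "D-lipschitz_on {0..} (M i)"
    proof (rule lipschitz_onI)
      fix t t' :: real
      show "dist (M i t) (M i t') \<le> D * dist t t'"
        using Mle[OF i, of t t'] Mle[OF i, of t' t] by (simp add: dist_real_def abs_le_iff abs_minus_commute)
    qed (rule D)
    then show ?thesis by (rule lipschitz_on_continuous_on)
  qed
  define \<Phi> where "\<Phi> t = bvalue (U t) (V t)" for t
  have \<Phi>c: "continuous_on {0..} \<Phi>"
  proof -
    have "((ga + de) * D)-lipschitz_on {0..} \<Phi>"
    proof (rule lipschitz_onI)
      fix t t' :: real
      have "\<Phi> t - \<Phi> t' = ga * (U t L - U t' L) + de * (V t L - V t' L)" by (simp add: \<Phi>_def bvalue_def algebra_simps)
      also have "\<bar>\<dots>\<bar> \<le> ga * \<bar>U t L - U t' L\<bar> + de * \<bar>V t L - V t' L\<bar>"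
        using bc_nonneg abs_triangle_ineq[of "ga * (U t L - U t' L)" "de * (V t L - V t' L)"] by (simp add: abs_mult)
      also have "\<dots> \<le> ga * (D * \<bar>t - t'\<bar>) + de * (D * \<bar>t - t'\<bar>)"
        using bc_nonneg diff[of L t t'] L0 by (intro add_mono mult_left_mono) auto
      finally show "dist (\<Phi> t) (\<Phi> t') \<le> (ga + de) * D * dist t t'" by (simp add: dist_real_def algebra_simps)
    qed (use D bc_nonneg in auto)
    then show ?thesis by (rule lipschitz_on_continuous_on)
  qed
  have U0: "U 0 x = 0" if "x \<in> {0..L}" for x
  proof -
    have "traj 0 L (\<lambda>x. nl g k bet x 0) (\<lambda>_. 0) (\<lambda>_. 0)"
      by (simp add: traj_def nl_nonpos[OF nl])
    then show ?thesis
      using C(2)[of "nl g k bet" "U 0" "V 0" "nl g k bet" "\<lambda>_. 0" "\<lambda>_. 0" x, OF LF UV(1) _ that] UV(2,3)[of 0] by simp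
  qed
  obtain t1 where t1: "0 \<le> t1" "\<And>u v. shot g k bet t1 u v \<Longrightarrow> \<exists>x\<in>{\<sigma> 1..\<tau> 1}. R < u x"
    using shots_leave_first_hump[where g=g and k=k and bet=bet and R=R, OF nl bet] by blast
  have m1: "1 \<in> {1..m}" "m \<in> {1..m}" using m_pos by auto
  have high': "\<Phi> t < 0 \<and> (i < m \<longrightarrow> U t (\<tau> i) < 0)" if i: "i \<in> {1..m}" "0 \<le> t" "R < M i t" for i t
  proof -
    obtain \<xi> where "\<xi> \<in> {\<sigma> i..\<tau> i}" "M i t = U t \<xi>" using Mat[OF i(1)] by blast
    then show ?thesis using high[OF i(1) sh[OF i(2)]] i(3) by (auto simp: \<Phi>_def)
  qed
  have low': "(i < m \<longrightarrow> R < U t (\<sigma> (Suc i))) \<and> (i = m \<longrightarrow> 0 < \<Phi> t)" if i: "i \<in> {1..m}" "0 \<le> t" "M i t = r" for i t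
  proof -
    obtain \<xi> where \<xi>: "\<xi> \<in> {\<sigma> i..\<tau> i}" "M i t = U t \<xi>" using Mat[OF i(1)] by blast
    \<comment> \<open>The side condition of \<open>low\<close> holds automatically: a value above
      \<open>R\<close> on hump \<open>i - 1\<close> would force a negative value at its right
      end.\<close>
    have "U t (\<tau> (i - 1)) \<le> R" if "1 < i"
    proof (rule ccontr)
      assume "\<not> U t (\<tau> (i - 1)) \<le> R"
      then have c: "R < U t (\<tau> (i - 1))" by simp
      have i': "i - 1 \<in> {1..m}" "i - 1 < m" using that i by auto
      have "\<tau> (i - 1) \<in> {\<sigma> (i - 1)..\<tau> (i - 1)}" using hump_less[OF i'(1)] by auto
      then have "U t (\<tau> (i - 1)) < 0" using high[OF i'(1) sh[OF i(2)] _ c] i'(2) by blast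
      then show False using c r by simp
    qed
    then show ?thesis
      using low[OF i(1) sh[OF i(2)] _ \<xi>(1)] Mge[OF i(1), of _ t] i(3) \<xi>(2) unfolding \<Phi>_def by auto
  qed
  obtain t where t: "0 \<le> t" "\<Phi> t = 0" "\<And>i. i \<in> {1..m} \<Longrightarrow> if i \<in> S then r \<le> M i t else M i t \<le> r"
  proof (rule shooting_patterns[OF m_pos r _ \<Phi>c _ _ _ _ _ t1(1) _ S])
    show "continuous_on {0..} (M i)" if "i \<in> {1..m}" for i by (rule Mc[OF that])
    show "M i 0 \<le> 0" if i: "i \<in> {1..m}" for i
    proof -
      obtain \<xi> where "\<xi> \<in> {\<sigma> i..\<tau> i}" "M i 0 = U 0 \<xi>" using Mat[OF i] by blast
      then show ?thesis using U0[of \<xi>] hump_in[OF i] by auto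
    qed
    show "R < M (Suc i) t" if "i \<in> {1..m}" "0 \<le> t" "M i t = r" "i < m" for i t
    proof -
      have si: "Suc i \<in> {1..m}" using that by auto
      have "U t (\<sigma> (Suc i)) \<le> M (Suc i) t" by (rule Mge[OF si]) (use hump_less[OF si] in auto)
      then show ?thesis using low'[OF that(1-3)] that(4) by auto
    qed
    show "0 < \<Phi> t" if "0 \<le> t" "M m t = r" for t using low'[OF m1(2) that] by simp
    show "M l t \<le> 0" if i: "i \<in> {1..m}" "0 \<le> t" "R < M i t" "l \<in> {Suc i..m}" for i l t
    proof -
      have l: "l \<in> {1..m}" "i < m" using i by auto
      obtain \<xi> where \<xi>: "\<xi> \<in> {\<sigma> l..\<tau> l}" "M l t = U t \<xi>" using Mat[OF l(1)] by blast
      have "U t (\<tau> i) < 0" using high'[OF i(1-3)] l by simp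
      moreover have "\<tau> i \<le> \<xi>" "\<xi> \<le> L" using tau_le_sigma[of i l] i \<xi> hump_in[OF l(1)] by auto
      ultimately have "U t \<xi> < 0"
        using shot_dead(1)[OF sh[OF i(2)] nl, of "\<tau> i" \<xi>] hump_in[OF i(1)] hump_less[OF i(1)] by auto
      then show ?thesis using \<xi> by simp
    qed
    show "\<Phi> t < 0" if "i \<in> {1..m}" "0 \<le> t" "R < M i t" for i t using high'[OF that] by simp
    show "R < M 1 t1"
    proof -
      obtain x where "x \<in> {\<sigma> 1..\<tau> 1}" "R < U t1 x" using t1(2)[OF sh[OF t1(1)]] by blast
      then show ?thesis using Mge[OF m1(1), of x t1] by simp
    qed
  qed (rule that)
  show ?thesis
  proof (rule that[OF sh[OF t(1)]])
    show b0: "bvalue (U t) (V t) = 0" using t(2) by (simp add: \<Phi>_def)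
    show "\<exists>x\<in>{\<sigma> i..\<tau> i}. r \<le> U t x" if "i \<in> {1..m}" "i \<in> S" for i
      using Mat[OF that(1), of t] t(3)[OF that(1)] that(2) by auto
    show "U t x \<le> r" if "i \<in> {1..m}" "i \<notin> S" "x \<in> {\<sigma> i..\<tau> i}" for i x
      using Mge[OF that(1,3), of t] t(3)[OF that(1)] that(2) by auto
    show "U t x \<le> R" if "i \<in> {1..m}" "x \<in> {\<sigma> i..\<tau> i}" for i x
      using high[OF that(1) sh[OF t(1)] that(2)] b0 by force
  qed
qed

end

section \<open>Passage to continuous nonlinearities\<close>

lemma tendsto_moving:
  fixes hn :: "nat \<Rightarrow> real \<Rightarrow> real"
  assumes u: "\<And>e. 0 < e \<Longrightarrow> \<exists>n0. \<forall>n\<ge>n0. \<forall>s\<in>{0..R}. \<bar>hn n s - h s\<bar> \<le> e"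
    and h: "continuous_on {0..R} h" and x: "\<And>n. xn n \<in> {0..R}" "xn \<longlonglongrightarrow> x"
  shows "(\<lambda>n. hn n (xn n)) \<longlonglongrightarrow> h x"
proof -
  have xR: "x \<in> {0..R}"
    by (rule closed_sequentially[OF closed_atLeastAtMost, of xn]) (use x in auto)
  have 1: "(\<lambda>n. h (xn n)) \<longlonglongrightarrow> h x"
    by (rule continuous_on_tendsto_compose[OF h x(2) xR]) (use x in auto)
  have 2: "(\<lambda>n. hn n (xn n) - h (xn n)) \<longlonglongrightarrow> 0"
  proof (rule LIMSEQ_I)
    fix e :: real assume "0 < e"
    then obtain n0 where "\<forall>n\<ge>n0. \<forall>s\<in>{0..R}. \<bar>hn n s - h s\<bar> \<le> e/2" using u[of "e/2"] by auto
    then have "\<bar>hn n (xn n) - h (xn n)\<bar> \<le> e/2" if "n0 \<le> n" for n using x(1)[of n] that by blast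
    then have "\<forall>n\<ge>n0. norm (hn n (xn n) - h (xn n) - 0) < e" using \<open>0 < e\<close> by force
    then show "\<exists>n0. \<forall>n\<ge>n0. norm (hn n (xn n) - h (xn n) - 0) < e" by blast
  qed
  show ?thesis using tendsto_add[OF 2 1] by simp
qed

context SL_structure
begin

lemma humps_and_gaps_cover:
  assumes "x \<in> {0..L}"
  shows "(\<exists>i\<in>{1..m}. x \<in> {\<sigma> i..\<tau> i}) \<or> (\<exists>j\<le>m. x \<in> {\<tau> j..\<sigma> (Suc j)})"
proof -
  define j where "j = Max {j \<in> {0..m}. \<tau> j \<le> x}"
  have fin: "finite {j \<in> {0..m}. \<tau> j \<le> x}" "0 \<in> {j \<in> {0..m}. \<tau> j \<le> x}" using assms h1_tau0 by auto
  then have "j \<in> {j \<in> {0..m}. \<tau> j \<le> x}" unfolding j_def by (intro Max_in) blast+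
  then have j: "j \<le> m" "\<tau> j \<le> x" by auto
  show ?thesis
  proof (cases "x \<le> \<sigma> (Suc j)")
    case True then show ?thesis using j by auto
  next
    case False
    then have "j \<noteq> m" using assms h1_sigmaL by auto
    then have jm: "Suc j \<le> m" using j by simp
    have "x < \<tau> (Suc j)"
    proof (rule ccontr)
      assume "\<not> x < \<tau> (Suc j)"
      then have "Suc j \<le> j" unfolding j_def using fin(1) jm by (intro Max_ge) (auto simp: j_def)
      then show False by simp
    qed
    then show ?thesis using False jm by force
  qed
qed

text \<open>Integrable majorant of the nonlinearity when \<open>g\<close> and \<open>k\<close> are
  bounded by \<open>K\<close>; it serves as dominating function in the limit and as linear growth
  weight for positivity.\<close>

definition wt :: "(nat \<Rightarrow> real) \<Rightarrow> real \<Rightarrow> real \<Rightarrow> real" where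
  "wt bet K x = (\<Sum>i=1..m. alp i * K * a i x) + (\<Sum>j=0..m+1. \<bar>bet j\<bar> * K * b j x)"

lemma wt:
  assumes "0 \<le> K"
  shows "wt bet K absolutely_integrable_on {0..L}" "x \<in> {0..L} \<Longrightarrow> 0 \<le> wt bet K x"
proof -
  have "lip_field 0 L (wt bet K) (nl (\<lambda>_ _. 0) (\<lambda>_ _. 0) bet)"
    unfolding wt_def[abs_def] by (rule nl_lip_field) (use assms in \<open>auto simp: nonlin_def\<close>)
  then show "wt bet K absolutely_integrable_on {0..L}" "x \<in> {0..L} \<Longrightarrow> 0 \<le> wt bet K x"
    by (auto simp: lip_field_def)
qed

lemma nl_bound:
  assumes K: "\<And>i. i \<in> {1..m} \<Longrightarrow> 0 \<le> g i (max 0 s) \<and> g i (max 0 s) \<le> K * z"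
    "\<And>j. j \<in> {0..m+1} \<Longrightarrow> 0 \<le> k j (max 0 s) \<and> k j (max 0 s) \<le> K * z" and x: "x \<in> {0..L}"
  shows "\<bar>nl g k bet x s\<bar> \<le> wt bet K x * z"
proof -
  define X where "X = (\<Sum>i=1..m. alp i * a i x * g i (max 0 s))"
  define Y where "Y = (\<Sum>j=0..m+1. bet j * b j x * k j (max 0 s))"
  have e: "nl g k bet x s = X - Y" by (simp only: nl_def f_SL_def X_def Y_def)
  have "\<bar>X\<bar> \<le> (\<Sum>i=1..m. alp i * K * a i x * z)"
    unfolding X_def
  proof (rule order_trans[OF sum_abs], rule sum_mono)
    fix i assume i: "i \<in> {1..m}"
    have n: "0 \<le> alp i * a i x" using alp_pos a_nonneg i x by (simp add: less_imp_le)
    then have "(alp i * a i x) * g i (max 0 s) \<le> (alp i * a i x) * (K * z)" using K(1)[OF i] by (intro mult_left_mono) auto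
    moreover have "0 \<le> (alp i * a i x) * g i (max 0 s)" using n K(1)[OF i] mult_nonneg_nonneg by blast
    ultimately show "\<bar>alp i * a i x * g i (max 0 s)\<bar> \<le> alp i * K * a i x * z"
      by (simp only: abs_of_nonneg) (simp only: mult.assoc mult.left_commute[of K])
  qed
  moreover have "\<bar>Y\<bar> \<le> (\<Sum>j=0..m+1. \<bar>bet j\<bar> * K * b j x * z)"
    unfolding Y_def
  proof (rule order_trans[OF sum_abs], rule sum_mono)
    fix j assume j: "j \<in> {0..m+1}"
    have bn: "0 \<le> b j x" using b_nonneg j x by simp
    have "\<bar>bet j * b j x * k j (max 0 s)\<bar> = (\<bar>bet j\<bar> * b j x) * k j (max 0 s)"
      using bn K(2)[OF j] by (simp add: abs_mult)
    also have "\<dots> \<le> (\<bar>bet j\<bar> * b j x) * (K * z)" using K(2)[OF j] bn by (intro mult_left_mono) auto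
    finally show "\<bar>bet j * b j x * k j (max 0 s)\<bar> \<le> \<bar>bet j\<bar> * K * b j x * z"
      by (simp only: mult.assoc mult.left_commute[of K])
  qed
  moreover have "\<bar>X - Y\<bar> \<le> \<bar>X\<bar> + \<bar>Y\<bar>" by (rule abs_triangle_ineq4)
  ultimately have "\<bar>X - Y\<bar> \<le> (\<Sum>i=1..m. alp i * K * a i x * z) + (\<Sum>j=0..m+1. \<bar>bet j\<bar> * K * b j x * z)"
    by linarith
  then show ?thesis unfolding e wt_def by (simp only: sum_distrib_right distrib_right)
qed

lemma solution_nonneg:
  assumes "shot g k bet t u v" "nonlin g k" "bvalue u v = 0" "x \<in> {0..L}"
  shows "0 \<le> u x"
proof (rule ccontr)
  assume "\<not> 0 \<le> u x"
  then have "bvalue u v < 0" using shot_dead(2)[OF assms(1,2), of x] assms(4) by auto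
  then show False using assms(3) by simp
qed

text \<open>Convexity in a gap puts the maximum at its ends, which belong to humps. In the first and
  last gap the boundary condition gives the slope a sign, so the solution is monotone towards the
  neighbouring hump.\<close>

lemma solution_le:
  assumes s: "shot g k bet t u v" and nl: "nonlin g k" and b0: "bvalue u v = 0"
    and bet: "\<And>j. j \<le> m \<Longrightarrow> 0 \<le> bet j"
    and uR: "\<And>i x. i \<in> {1..m} \<Longrightarrow> x \<in> {\<sigma> i..\<tau> i} \<Longrightarrow> u x \<le> R" and x: "x \<in> {0..L}"
  shows "u x \<le> R"
proof (cases "\<exists>i\<in>{1..m}. x \<in> {\<sigma> i..\<tau> i}")
  case True then show ?thesis using uR by blast
next
  case False
  then obtain j where j: "j \<le> m" "x \<in> {\<tau> j..\<sigma> (Suc j)}" using humps_and_gaps_cover[OF x] by blast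
  have t: "traj 0 L (\<lambda>x. nl g k bet x (u x)) u v" and t0: "0 \<le> t" "v 0 = al * t"
    using s by (auto simp: shot_def)
  note tg = traj_gap[OF t j(1)]
  have F: "- (bet j * b j z * k j (max 0 (u z))) \<le> 0" if "\<tau> j \<le> z" "z \<le> \<sigma> (Suc j)" for z
  proof -
    have "0 \<le> b j z" using b_nonneg j that gap_in[OF j(1)] by auto
    moreover have "0 \<le> k j (max 0 (u z))" using nl j by (auto simp: nonlin_def)
    ultimately show ?thesis using bet[OF j(1)] by simp
  qed
  have lt: "j \<noteq> 0 \<Longrightarrow> u (\<tau> j) \<le> R" using uR[of j "\<tau> j"] hump_less[of j] j by auto
  have rt: "j \<noteq> m \<Longrightarrow> u (\<sigma> (Suc j)) \<le> R" using uR[of "Suc j" "\<sigma> (Suc j)"] hump_less[of "Suc j"] j by auto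
  show ?thesis
  proof (cases "j = 0")
    case True
    have "0 \<le> v z" if "x \<le> z" "z \<le> \<sigma> (Suc j)" for z
    proof -
      have "v (\<tau> j) \<le> v z" by (rule traj_v_mono[OF tg]) (use that j F in auto)
      moreover have "0 \<le> v (\<tau> j)" using True h1_tau0 t0 bc_nonneg by simp
      ultimately show ?thesis by simp
    qed
    then have "u (\<sigma> (Suc j)) - u x \<ge> 0 * (\<sigma> (Suc j) - x)" using j by (intro traj_slope_ge[OF tg]) auto
    then show ?thesis using rt True m_pos by simp
  next
    case j0: False
    show ?thesis
    proof (cases "j = m")
      case True
      then have sL: "\<sigma> (Suc j) = L" using h1_sigmaL by simp
      have vL: "v L \<le> 0"
      proof (cases "de = 0")
        case True
        then have "ga > 0" using bc_nonneg bc_nondeg by (auto simp: less_le)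
        moreover have "ga * u L = 0" using b0 True unfolding bvalue_def by simp
        ultimately have "u L = 0" by simp
        then show ?thesis using traj_end_slope[OF t L_pos solution_nonneg[OF s nl b0]] by simp
      next
        case False
        then have "0 < de" using bc_nonneg by simp
        moreover have "0 \<le> ga * u L" using bc_nonneg solution_nonneg[OF s nl b0, of L] L_pos by simp
        ultimately show ?thesis using b0 by (simp add: bvalue_def) (smt (verit) mult_pos_pos)
      qed
      have "v z \<le> 0" if "\<tau> j \<le> z" "z \<le> x" for z
      proof -
        have "v z \<le> v (\<sigma> (Suc j))" by (rule traj_v_mono[OF tg]) (use that j F in auto)
        then show ?thesis using vL sL by simp
      qed
      then have "u x - u (\<tau> j) \<le> 0 * (x - \<tau> j)" using j by (intro traj_slope_le[OF tg]) auto
      then show ?thesis using lt j0 by simp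
    next
      case False
      show ?thesis by (rule traj_convex_le_max[OF tg F]) (use j j0 False lt rt in auto)
    qed
  qed
qed

text \<open>The common bound \<open>R\<close> bounds the forces by one integrable function, hence
  the slopes uniformly and the solutions equi-Lipschitz. After Arzela-Ascoli a second subsequence
  makes the shooting parameters converge, and dominated convergence passes to the limit in both
  integral equations.\<close>

theorem shots_limit:
  assumes nl: "nonlin g k" and nln: "\<And>n. nonlin (gn n) (kn n)"
    and le: "\<And>n i s. i \<in> {1..m} \<Longrightarrow> 0 \<le> s \<Longrightarrow> gn n i s \<le> g i s" "\<And>n j s. j \<in> {0..m+1} \<Longrightarrow> 0 \<le> s \<Longrightarrow> kn n j s \<le> k j s"
    and conv: "\<And>i e. i \<in> {1..m} \<Longrightarrow> 0 < e \<Longrightarrow> \<exists>n0. \<forall>n\<ge>n0. \<forall>s\<in>{0..R}. \<bar>gn n i s - g i s\<bar> \<le> e"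
      "\<And>j e. j \<in> {0..m+1} \<Longrightarrow> 0 < e \<Longrightarrow> \<exists>n0. \<forall>n\<ge>n0. \<forall>s\<in>{0..R}. \<bar>kn n j s - k j s\<bar> \<le> e"
    and bet: "\<And>j. j \<le> m \<Longrightarrow> 0 \<le> bet j" and R: "0 \<le> R"
    and sh: "\<And>n. shot (gn n) (kn n) bet (tn n) (un n) (vn n)" and b0: "\<And>n. bvalue (un n) (vn n) = 0"
    and uR: "\<And>n i x. i \<in> {1..m} \<Longrightarrow> x \<in> {\<sigma> i..\<tau> i} \<Longrightarrow> un n x \<le> R"
  obtains ks t u v where "strict_mono (ks :: nat \<Rightarrow> nat)" "shot g k bet t u v" "bvalue u v = 0"
    "\<And>e. 0 < e \<Longrightarrow> \<exists>N. \<forall>n\<ge>N. \<forall>x\<in>{0..L}. \<bar>un (ks n) x - u x\<bar> < e"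
proof -
  have tr: "traj 0 L (\<lambda>x. nl (gn n) (kn n) bet x (un n x)) (un n) (vn n)" and tn: "0 \<le> tn n" "un n 0 = be * tn n" "vn n 0 = al * tn n" for n
    using sh[of n] by (auto simp: shot_def)
  have ub: "un n x \<in> {0..R}" if "x \<in> {0..L}" for n x
    using solution_nonneg[OF sh nln b0 that] solution_le[OF sh nln b0 bet uR that] by auto
  have "\<exists>G. \<forall>s\<in>{0..R}. h s \<le> G" if "continuous_on {0..} h" for h :: "real \<Rightarrow> real"
  proof -
    have "continuous_on {0..R} h" by (rule continuous_on_subset[OF that]) auto
    then have "bounded (h ` {0..R})" by (intro compact_imp_bounded compact_continuous_image) auto
    then obtain B where "\<forall>s\<in>{0..R}. norm (h s) \<le> B" unfolding bounded_iff by auto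
    then have "\<forall>s\<in>{0..R}. h s \<le> B" by auto
    then show ?thesis by blast
  qed
  then have "\<forall>i\<in>{1..m}. \<exists>G. \<forall>s\<in>{0..R}. g i s \<le> G" "\<forall>j\<in>{0..m+1}. \<exists>G. \<forall>s\<in>{0..R}. k j s \<le> G"
    using nl unfolding nonlin_def by blast+
  then obtain G1 G2 where G12: "\<And>i s. i \<in> {1..m} \<Longrightarrow> s \<in> {0..R} \<Longrightarrow> g i s \<le> G1 i"
    "\<And>j s. j \<in> {0..m+1} \<Longrightarrow> s \<in> {0..R} \<Longrightarrow> k j s \<le> G2 j" by metis
  define G where "G = (\<Sum>i=1..m. \<bar>G1 i\<bar>) + (\<Sum>j=0..m+1. \<bar>G2 j\<bar>)"
  have G0: "0 \<le> G" by (simp add: G_def add_nonneg_nonneg sum_nonneg)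
  have G1: "g i s \<le> G" if "i \<in> {1..m}" "s \<in> {0..R}" for i s
  proof -
    have "\<bar>G1 i\<bar> \<le> (\<Sum>i=1..m. \<bar>G1 i\<bar>)" by (rule member_le_sum) (use that in auto)
    moreover have "0 \<le> (\<Sum>j=0..m+1. \<bar>G2 j\<bar>)" by (simp add: sum_nonneg)
    ultimately show ?thesis using G12(1)[OF that] unfolding G_def by linarith
  qed
  have G2: "k j s \<le> G" if "j \<in> {0..m+1}" "s \<in> {0..R}" for j s
  proof -
    have "\<bar>G2 j\<bar> \<le> (\<Sum>j=0..m+1. \<bar>G2 j\<bar>)" by (rule member_le_sum) (use that in auto)
    moreover have "0 \<le> (\<Sum>i=1..m. \<bar>G1 i\<bar>)" by (simp add: sum_nonneg)
    ultimately show ?thesis using G12(2)[OF that] unfolding G_def by linarith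
  qed
  have Fb: "\<bar>nl (gn n) (kn n) bet x (un n x)\<bar> \<le> wt bet G x" if x: "x \<in> {0..L}" for n x
  proof -
    have m0: "max 0 (un n x) = un n x" "un n x \<in> {0..R}" "0 \<le> un n x" using ub[OF x, of n] by auto
    have "\<bar>nl (gn n) (kn n) bet x (un n x)\<bar> \<le> wt bet G x * 1"
    proof (rule nl_bound[OF _ _ x])
      show "0 \<le> gn n i (max 0 (un n x)) \<and> gn n i (max 0 (un n x)) \<le> G * 1" if i: "i \<in> {1..m}" for i
        using nln[of n] i le(1)[OF i m0(3), of n] G1[OF i m0(2)] m0(3) unfolding m0(1) nonlin_def by auto
      show "0 \<le> kn n j (max 0 (un n x)) \<and> kn n j (max 0 (un n x)) \<le> G * 1" if j: "j \<in> {0..m+1}" for j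
        using nln[of n] j le(2)[OF j m0(3), of n] G2[OF j m0(2)] m0(3) unfolding m0(1) nonlin_def by auto
    qed
    then show ?thesis by simp
  qed
  define H where "H = integral {0..L} (wt bet G)"
  have wi: "wt bet G integrable_on {x..y}" if "0 \<le> x" "y \<le> L" for x y
    by (rule integrable_on_subinterval[OF abs_int_imp_int[OF wt(1)[OF G0]]]) (use that in auto)
  have vdiff: "\<bar>vn n y - vn n x\<bar> \<le> H" if "0 \<le> x" "x \<le> y" "y \<le> L" for n x y
  proof -
    have "\<bar>vn n y - vn n x\<bar> = norm (integral {x..y} (\<lambda>x. nl (gn n) (kn n) bet x (un n x)))"
      using traj_v_diff[OF tr that] by simp
    also have "\<dots> \<le> integral {x..y} (wt bet G)"
      by (rule integral_norm_bound_integral[OF traj_integrable[OF tr] wi]) (use that Fb in auto)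
    also have "\<dots> \<le> H" unfolding H_def
      by (rule integral_subset_le) (use that wi wt(2)[OF G0] in auto)
    finally show ?thesis .
  qed
  \<comment> \<open>At some point the slope equals the mean slope, at most \<open>R / L\<close> in
    absolute value; from there it changes by at most \<open>H\<close>.\<close>
  define C where "C = R / L + H"
  have vC: "\<bar>vn n x\<bar> \<le> C" if x: "x \<in> {0..L}" for n x
  proof -
    obtain z where z: "0 < z" "z < L" "un n L - un n 0 = vn n z * (L - 0)"
      using traj_mvt[OF tr order_refl L_pos order_refl] by blast
    have "\<bar>vn n z\<bar> = \<bar>un n L - un n 0\<bar> / L" using z(3) L_pos by (simp add: abs_mult)
    also have "\<dots> \<le> R / L" using ub[of L n] ub[of 0 n] L_pos by (intro divide_right_mono) auto
    finally have "\<bar>vn n z\<bar> \<le> R / L" .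
    moreover have "\<bar>vn n x - vn n z\<bar> \<le> H"
      using vdiff[of x z n] vdiff[of z x n] x z by (cases "x \<le> z") (auto simp: abs_minus_commute)
    ultimately show ?thesis by (simp add: C_def)
  qed
  have C0: "0 \<le> C" using vC[of 0 0] L_pos by force
  have lip: "\<bar>un n x - un n y\<bar> \<le> C * \<bar>x - y\<bar>" if "x \<in> {0..L}" "y \<in> {0..L}" for n x y
  proof -
    have *: "\<bar>un n y - un n x\<bar> \<le> C * (y - x)" if "0 \<le> x" "x \<le> y" "y \<le> L" for x y
    proof -
      have vz: "vn n z \<le> C \<and> - C \<le> vn n z" if "x \<le> z" "z \<le> y" for z
      proof -
        have "z \<in> {0..L}" using that \<open>0 \<le> x\<close> \<open>y \<le> L\<close> by simp
        then show ?thesis using vC[of z n] by (simp add: abs_le_iff)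
      qed
      have "un n y - un n x \<le> C * (y - x)"
        by (rule traj_slope_le[OF tr that]) (use vz in blast)
      moreover have "un n y - un n x \<ge> - C * (y - x)"
        by (rule traj_slope_ge[OF tr that]) (use vz in blast)
      ultimately show ?thesis by (simp add: abs_le_iff)
    qed
    show ?thesis using *[of x y] *[of y x] that by (cases "x \<le> y") (auto simp: abs_minus_commute)
  qed
  obtain u k1 where k1: "continuous_on {0..L} u" "strict_mono (k1 :: nat \<Rightarrow> nat)"
    "\<And>e. 0 < e \<Longrightarrow> \<exists>N. \<forall>n x. n \<ge> N \<and> x \<in> {0..L} \<longrightarrow> norm (un (k1 n) x - u x) < e"
  proof (rule Arzela_Ascoli[of "{0..L}" un R])
    show "norm (un n x) \<le> R" if "x \<in> {0..L}" for n x using ub[OF that, of n] by auto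
    show "\<exists>d. 0 < d \<and> (\<forall>n y. y \<in> {0..L} \<and> norm (x - y) < d \<longrightarrow> norm (un n x - un n y) < e)"
      if x: "x \<in> {0..L}" "0 < e" for x e
    proof (intro exI conjI allI impI)
      show "0 < e / (C + 1)" using x C0 by simp
      fix n y assume y: "y \<in> {0..L} \<and> norm (x - y) < e / (C + 1)"
      have "\<bar>un n x - un n y\<bar> \<le> C * \<bar>x - y\<bar>" using lip x y by blast
      also have "\<dots> \<le> (C + 1) * \<bar>x - y\<bar>" by (intro mult_right_mono) auto
      also have "\<dots> < e" using y C0 by (simp add: pos_less_divide_eq mult.commute)
      finally show "norm (un n x - un n y) < e" by simp
    qed
  qed (auto intro: that)
  have L0: "0 \<in> {0..L}" "L \<in> {0..L}" using L_pos by auto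
  \<comment> \<open>The parameter is read off the initial data: \<open>be * tn n\<close> is a value,
    \<open>al * tn n\<close> a slope, both are bounded, and \<open>be + al\<close> is
    positive.\<close>
  have tb: "tn n \<in> {0..(R + C) / (be + al)}" for n
  proof -
    have s: "be + al > 0" using bc_nonneg bc_nondeg by (auto simp: add_nonneg_eq_0_iff less_le)
    have "be * tn n \<le> R" "al * tn n \<le> C" using ub[OF L0(1), of n] vC[OF L0(1), of n] tn by auto
    then have "(be + al) * tn n \<le> R + C" by (simp add: distrib_right)
    then show ?thesis using tn(1) s by (simp add: pos_le_divide_eq mult.commute)
  qed
  have "bounded (range (\<lambda>n. tn (k1 n)))"
    by (rule bounded_subset[OF bounded_closed_interval[of 0 "(R + C) / (be + al)"]]) (use tb in auto)
  then obtain t k2 where k2: "strict_mono (k2 :: nat \<Rightarrow> nat)" "((\<lambda>n. tn (k1 n)) \<circ> k2) \<longlonglongrightarrow> t"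
    using bounded_imp_convergent_subsequence by blast
  define ks where "ks n = k1 (k2 n)" for n
  have ks: "strict_mono ks" using k1(2) k2(1) by (auto simp: strict_mono_def ks_def)
  have ksn: "n \<le> ks n" for n by (rule seq_suble[OF ks])
  have tlim: "(\<lambda>n. tn (ks n)) \<longlonglongrightarrow> t" using k2(2) by (simp add: ks_def o_def)
  have unif: "\<exists>N. \<forall>n\<ge>N. \<forall>x\<in>{0..L}. \<bar>un (ks n) x - u x\<bar> < e" if "0 < e" for e
  proof -
    obtain N where "\<forall>n x. n \<ge> N \<and> x \<in> {0..L} \<longrightarrow> norm (un (k1 n) x - u x) < e" using k1(3)[OF \<open>0 < e\<close>] by blast
    moreover have "N \<le> k2 n" if "N \<le> n" for n using seq_suble[OF k2(1), of n] that by simp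
    ultimately show ?thesis unfolding ks_def real_norm_def by blast
  qed
  have ulim: "(\<lambda>n. un (ks n) x) \<longlonglongrightarrow> u x" if "x \<in> {0..L}" for x
    using unif that unfolding LIMSEQ_iff real_norm_def by blast
  have Flim: "(\<lambda>n. nl (gn (ks n)) (kn (ks n)) bet x (un (ks n) x)) \<longlonglongrightarrow> nl g k bet x (u x)" if x: "x \<in> {0..L}" for x
  proof -
    have xn: "max 0 (un (ks n) x) \<in> {0..R}" for n using ub[OF x, of "ks n"] by auto
    have xl: "(\<lambda>n. max 0 (un (ks n) x)) \<longlonglongrightarrow> max 0 (u x)" by (intro tendsto_intros ulim x)
    have A: "(\<lambda>n. gn (ks n) i (max 0 (un (ks n) x))) \<longlonglongrightarrow> g i (max 0 (u x))" if i: "i \<in> {1..m}" for i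
    proof (rule tendsto_moving[where hn="\<lambda>n. gn (ks n) i", OF _ _ xn xl])
      show "\<exists>n0. \<forall>n\<ge>n0. \<forall>s\<in>{0..R}. \<bar>gn (ks n) i s - g i s\<bar> \<le> e" if "0 < e" for e
        using conv(1)[OF i that] ksn by (meson order_trans)
      show "continuous_on {0..R} (g i)" by (rule continuous_on_subset[OF hump_nonlin(2)[OF nl i]]) auto
    qed
    have B: "(\<lambda>n. kn (ks n) j (max 0 (un (ks n) x))) \<longlonglongrightarrow> k j (max 0 (u x))" if j: "j \<in> {0..m+1}" for j
    proof (rule tendsto_moving[where hn="\<lambda>n. kn (ks n) j", OF _ _ xn xl])
      show "\<exists>n0. \<forall>n\<ge>n0. \<forall>s\<in>{0..R}. \<bar>kn (ks n) j s - k j s\<bar> \<le> e" if "0 < e" for e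
        using conv(2)[OF j that] ksn by (meson order_trans)
      have "continuous_on {0..} (k j)" using nl j unfolding nonlin_def by blast
      then show "continuous_on {0..R} (k j)" by (rule continuous_on_subset) auto
    qed
    show ?thesis unfolding nl_def f_SL_def
      by (intro tendsto_diff tendsto_sum tendsto_mult tendsto_const A B)
  qed
  define F where "F x = nl g k bet x (u x)" for x
  define v where "v x = al * t - integral {0..x} F" for x
  have Fa: "F absolutely_integrable_on {0..L}" unfolding F_def by (rule nl_integrable[OF nl k1(1)])
  have vlim: "(\<lambda>n. vn (ks n) x) \<longlonglongrightarrow> v x" if x: "x \<in> {0..L}" for x
  proof -
    have "(\<lambda>n. integral {0..x} (\<lambda>x. nl (gn (ks n)) (kn (ks n)) bet x (un (ks n) x))) \<longlonglongrightarrow> integral {0..x} F"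
    proof (rule dominated_convergence(2))
      show "(\<lambda>x. nl (gn (ks n)) (kn (ks n)) bet x (un (ks n) x)) integrable_on {0..x}" for n
        by (rule traj_integrable[OF tr]) (use x in auto)
      show "wt bet G integrable_on {0..x}" by (rule wi) (use x in auto)
    qed (use x Fb Flim in \<open>auto simp: F_def\<close>)
    then have "(\<lambda>n. al * tn (ks n) - integral {0..x} (\<lambda>x. nl (gn (ks n)) (kn (ks n)) bet x (un (ks n) x))) \<longlonglongrightarrow> v x"
      unfolding v_def by (intro tendsto_intros tlim)
    moreover have "al * tn (ks n) - integral {0..x} (\<lambda>x. nl (gn (ks n)) (kn (ks n)) bet x (un (ks n) x)) = vn (ks n) x" for n
      using traj_v_diff[OF tr, of 0 x "ks n"] x tn(3)[of "ks n"] by simp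
    ultimately show ?thesis by simp
  qed
  have ui: "u x = be * t + integral {0..x} v" if x: "x \<in> {0..L}" for x
  proof -
    have "(\<lambda>n. integral {0..x} (vn (ks n))) \<longlonglongrightarrow> integral {0..x} v"
    proof (rule dominated_convergence(2))
      show "vn (ks n) integrable_on {0..x}" for n
        by (rule integrable_continuous_real, rule continuous_on_subset[OF traj_cont_v[OF tr]]) (use x in auto)
      show "(\<lambda>_. C) integrable_on {0..x}" by (rule integrable_const_ivl)
      show "norm (vn (ks n) y) \<le> C" if "y \<in> {0..x}" for n y using vC[of y "ks n"] that x by auto
      show "(\<lambda>n. vn (ks n) y) \<longlonglongrightarrow> v y" if "y \<in> {0..x}" for y using vlim[of y] that x by auto
    qed
    then have "(\<lambda>n. be * tn (ks n) + integral {0..x} (vn (ks n))) \<longlonglongrightarrow> be * t + integral {0..x} v"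
      by (intro tendsto_intros tlim)
    moreover have "be * tn (ks n) + integral {0..x} (vn (ks n)) = un (ks n) x" for n
      using traj_u_integral[OF tr x, of "ks n"] tn(2)[of "ks n"] by simp
    ultimately have "(\<lambda>n. un (ks n) x) \<longlonglongrightarrow> be * t + integral {0..x} v" by simp
    then show ?thesis using LIMSEQ_unique ulim[OF x] by blast
  qed
  have "traj 0 L F u v"
    by (rule trajI_integral[OF Fa, of v "al * t" u "be * t"]) (use ui v_def in auto)
  moreover have "u 0 = be * t" using ui[OF L0(1)] by simp
  moreover have "v 0 = al * t" by (simp add: v_def)
  moreover have "0 \<le> t" by (rule LIMSEQ_le_const[OF tlim]) (use tn in auto)
  ultimately have "shot g k bet t u v" by (simp add: shot_def F_def[abs_def])
  moreover have "bvalue u v = 0"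
  proof -
    have "(\<lambda>n. bvalue (un (ks n)) (vn (ks n))) \<longlonglongrightarrow> bvalue u v"
      unfolding bvalue_def by (intro tendsto_intros ulim vlim L0)
    then show ?thesis unfolding b0 by (simp add: LIMSEQ_const_iff)
  qed
  ultimately show ?thesis using that[OF ks _ _ unif] by blast
qed

text \<open>The solution never exceeds \<open>R\<close>, so the linear bounds on
  \<open>{0..R}\<close> dominate the force by \<open>wt bet K x\<close> times the solution, which is
  what \<open>traj_positive\<close> requires.\<close>

lemma solution_positive:
  assumes s: "shot g k bet t u v" and nl: "nonlin g k" and b0: "bvalue u v = 0"
    and bet: "\<And>j. j \<le> m \<Longrightarrow> 0 \<le> bet j"
    and uR: "\<And>i x. i \<in> {1..m} \<Longrightarrow> x \<in> {\<sigma> i..\<tau> i} \<Longrightarrow> u x \<le> R"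
    and K: "0 \<le> K" "\<And>i s. i \<in> {1..m} \<Longrightarrow> 0 \<le> s \<Longrightarrow> s \<le> R \<Longrightarrow> g i s \<le> K * s"
      "\<And>j s. j \<in> {0..m+1} \<Longrightarrow> 0 \<le> s \<Longrightarrow> s \<le> R \<Longrightarrow> k j s \<le> K * s"
    and \<xi>: "\<xi> \<in> {0..L}" "u \<xi> \<noteq> 0" and x: "0 < x" "x < L"
  shows "0 < u x"
proof (rule traj_positive[where w="wt bet K" and u=u and \<xi>=\<xi> and p=0 and q=L, OF _ wt[OF K(1)] _ _ \<xi> x])
  show "traj 0 L (\<lambda>x. nl g k bet x (u x)) u v" using s by (simp add: shot_def)
  show nn: "0 \<le> u x" if "x \<in> {0..L}" for x by (rule solution_nonneg[OF s nl b0 that])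
  show "\<bar>nl g k bet x (u x)\<bar> \<le> wt bet K x * \<bar>u x\<bar>" if x: "x \<in> {0..L}" for x
  proof (rule nl_bound[OF _ _ x])
    have m0: "max 0 (u x) = u x" "\<bar>u x\<bar> = u x" "0 \<le> u x" using nn[OF x] by auto
    have ur: "u x \<le> R" by (rule solution_le[OF s nl b0 bet uR x])
    show "0 \<le> g i (max 0 (u x)) \<and> g i (max 0 (u x)) \<le> K * \<bar>u x\<bar>" if "i \<in> {1..m}" for i
      unfolding m0 using K(2)[OF that m0(3) ur] nl that m0(3) by (auto simp: nonlin_def)
    show "0 \<le> k j (max 0 (u x)) \<and> k j (max 0 (u x)) \<le> K * \<bar>u x\<bar>" if "j \<in> {0..m+1}" for j
      unfolding m0 using K(3)[OF that m0(3) ur] nl that m0(3) by (auto simp: nonlin_def)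
  qed
qed

lemma shot_SL_solution:
  assumes s: "shot g k bet t u v" and nl: "nonlin g k" and b0: "bvalue u v = 0"
  shows "SL_solution L al be ga de (f_SL m alp a g bet b k) u"
  unfolding SL_solution_def
proof (intro conjI exI)
  have t: "traj 0 L (\<lambda>x. nl g k bet x (u x)) u v" and t0: "u 0 = be * t" "v 0 = al * t"
    using s by (auto simp: shot_def)
  have nn: "0 \<le> u x" if "x \<in> {0..L}" for x by (rule solution_nonneg[OF s nl b0 that])
  then show "\<forall>x\<in>{0..L}. 0 \<le> u x" by blast
  show "abs_cont_on 0 L u" by (rule traj_ac_u[OF t])
  show "abs_cont_on 0 L v" by (rule traj_ac_v[OF t])
  show "\<forall>x\<in>{0..L}. (u has_real_derivative v x) (at x within {0..L})" using t by (simp add: traj_def)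
  have "nl g k bet x (u x) = f_SL m alp a g bet b k x (u x)" if "x \<in> {0..L}" for x
    using nn[OF that] by (simp add: nl_def f_SL_def max_absorb2)
  then show "AE x in lebesgue. x \<in> {0..L} \<longrightarrow> (v has_real_derivative - f_SL m alp a g bet b k x (u x)) (at x within {0..L})"
    using traj_AE[OF t] by (auto elim!: eventually_mono)
  show "al * u 0 - be * v 0 = 0" using t0 by simp
  show "ga * u L + de * v L = 0" using b0 by (simp add: bvalue_def)
qed

end

section \<open>Uniform bounds over finitely many indices, and growth of the nonlinearities at zero
  and infinity\<close>

lemma finite_upper_bound:
  fixes f :: "'i \<Rightarrow> real"
  assumes "finite A"
  obtains B where "0 < B" "\<And>i. i \<in> A \<Longrightarrow> f i \<le> B"
proof -
  have "f i \<le> 1 + (\<Sum>i\<in>A. \<bar>f i\<bar>)" if "i \<in> A" for i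
    using member_le_sum[OF that, of "\<lambda>i. \<bar>f i\<bar>"] assms by force
  then show ?thesis using that[of "1 + (\<Sum>i\<in>A. \<bar>f i\<bar>)"] by (simp add: sum_nonneg add_pos_nonneg)
qed

lemma finite_pos_lower_bound:
  fixes f :: "'i \<Rightarrow> real"
  assumes "finite A" "\<And>i. i \<in> A \<Longrightarrow> 0 < f i"
  obtains d where "0 < d" "\<And>i. i \<in> A \<Longrightarrow> d \<le> f i"
proof -
  have "0 < Min (insert 1 (f ` A))" using assms by (subst Min_gr_iff) auto
  moreover have "Min (insert 1 (f ` A)) \<le> f i" if "i \<in> A" for i using assms that by (intro Min_le) auto
  ultimately show ?thesis using that by blast
qed

lemma Limsup_ratio_less:
  fixes h :: "real \<Rightarrow> real"
  assumes "Limsup (at_right 0) (\<lambda>s. ereal (h s / s)) < ereal K"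
  obtains d where "0 < d" "\<And>s. 0 < s \<Longrightarrow> s < d \<Longrightarrow> h s \<le> K * s"
proof -
  have "eventually (\<lambda>s. ereal (h s / s) < ereal K) (at_right 0)" by (rule Limsup_lessD[OF assms])
  then obtain d where d: "0 < d" "\<forall>s>0. s < d \<longrightarrow> ereal (h s / s) < ereal K"
    unfolding eventually_at_right_field by blast
  have "h s \<le> K * s" if "0 < s" "s < d" for s
    using d(2)[rule_format, OF that] that by (simp add: pos_divide_less_eq less_imp_le)
  then show ?thesis using that d(1) by blast
qed

lemma less_Liminf_ratio:
  fixes h :: "real \<Rightarrow> real"
  assumes "ereal K < Liminf at_top (\<lambda>s. ereal (h s / s))"
  obtains s0 where "0 < s0" "\<And>s. s0 \<le> s \<Longrightarrow> K * s \<le> h s"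
proof -
  have "eventually (\<lambda>s. ereal K < ereal (h s / s)) at_top" by (rule less_LiminfD[OF assms])
  then obtain N where N: "\<forall>s\<ge>N. ereal K < ereal (h s / s)" unfolding eventually_at_top_linorder by blast
  have "K * s \<le> h s" if "max N 1 \<le> s" for s
    using N[rule_format, of s] that by (simp add: pos_less_divide_eq less_imp_le)
  then show ?thesis using that[of "max N 1"] by simp
qed

text \<open>Near zero the upper limit gives the slope; from \<open>d\<close> on, \<open>h\<close> is
  at most \<open>\<bar>B\<bar>\<close>, hence at most \<open>\<bar>B\<bar> / d\<close> times
  \<open>s\<close>.\<close>

lemma linear_growth_on_bounded:
  fixes h :: "real \<Rightarrow> real"
  assumes h: "continuous_on {0..} h" "h 0 = 0"
    and lim: "Limsup (at_right 0) (\<lambda>s. ereal (h s / s)) < \<infinity>"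
  obtains K where "\<And>s. 0 \<le> s \<Longrightarrow> s \<le> R \<Longrightarrow> h s \<le> K * s"
proof -
  obtain K where "Limsup (at_right 0) (\<lambda>s. ereal (h s / s)) < ereal K"
    using ereal_dense2[OF lim] by blast
  then obtain d where d: "0 < d" "\<And>s. 0 < s \<Longrightarrow> s < d \<Longrightarrow> h s \<le> K * s"
    using Limsup_ratio_less by blast
  have "continuous_on {0..R} h" by (rule continuous_on_subset[OF h(1)]) auto
  then have "bounded (h ` {0..R})" by (intro compact_imp_bounded compact_continuous_image) auto
  then obtain B where B: "\<forall>s\<in>{0..R}. norm (h s) \<le> B" unfolding bounded_iff by auto
  define K' where "K' = max K (\<bar>B\<bar> / d)"
  have "h s \<le> K' * s" if s: "0 \<le> s" "s \<le> R" for s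
  proof (cases "s = 0 \<or> s < d")
    case True
    have "K * s \<le> K' * s" using s by (intro mult_right_mono) (auto simp: K'_def)
    moreover have "h s \<le> K * s"
    proof (cases "s = 0")
      case False
      then show ?thesis using d(2)[of s] True s by simp
    qed (simp add: h(2))
    ultimately show ?thesis by linarith
  next
    case False
    have "h s \<le> \<bar>B\<bar>" using B s by force
    also have "\<dots> = \<bar>B\<bar> / d * d" using d by simp
    also have "\<dots> \<le> K' * s" using False d s by (intro mult_mono) (auto simp: K'_def le_max_iff_disj)
    finally show ?thesis .
  qed
  then show ?thesis using that by blast
qed

section \<open>Choice of the constants, solutions for each pattern, and their distinctness\<close>

theorem theorem4p1:
  fixes L al be ga de :: real
    and m :: nat
    and alp :: "nat \<Rightarrow> real"
    and a g b k :: "nat \<Rightarrow> real \<Rightarrow> real"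
    and \<sigma> \<tau> :: "nat \<Rightarrow> real"
  assumes L_pos: "L > 0"
    and bc_nonneg: "al \<ge> 0" "be \<ge> 0" "ga \<ge> 0" "de \<ge> 0"
    and bc_nondeg: "ga * be + al * ga + al * de > 0"
    and m_pos: "m \<ge> 1"
    and alp_pos: "\<forall>i\<in>{1..m}. alp i > 0"
    and a_nonneg: "\<forall>i\<in>{1..m}. \<forall>x\<in>{0..L}. a i x \<ge> 0"
    and a_int: "\<forall>i\<in>{1..m}. integrable (lebesgue_on {0..L}) (a i)"
    and b_nonneg: "\<forall>j\<in>{0..m+1}. \<forall>x\<in>{0..L}. b j x \<ge> 0"
    and b_int: "\<forall>j\<in>{0..m+1}. integrable (lebesgue_on {0..L}) (b j)"
    and g_cont: "\<forall>i\<in>{1..m}. continuous_on {0..} (g i)"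
    and g_nonneg: "\<forall>i\<in>{1..m}. \<forall>s\<ge>0. g i s \<ge> 0"
    and k_cont: "\<forall>j\<in>{0..m+1}. continuous_on {0..} (k j)"
    and k_nonneg: "\<forall>j\<in>{0..m+1}. \<forall>s\<ge>0. k j s \<ge> 0"
    \<comment> \<open>(h1)\<close>
    and h1_tau0: "\<tau> 0 = 0"
    and h1_sigmaL: "\<sigma> (m+1) = L"
    and h1_first: "\<tau> 0 \<le> \<sigma> 1"
    and h1_I: "\<forall>i\<in>{1..m}. \<sigma> i < \<tau> i"
    and h1_J: "\<forall>i\<in>{1..m-1}. \<tau> i < \<sigma> (i+1)"
    and h1_last: "\<tau> m \<le> \<sigma> (m+1)"
    and h1_a_supp: "\<forall>i\<in>{1..m}. AE x in lebesgue. x \<in> {0..L} - {\<sigma> i..\<tau> i} \<longrightarrow> a i x = 0"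
    and h1_a_nontriv: "\<forall>i\<in>{1..m}. \<not> (AE x in lebesgue. x \<in> {\<sigma> i..\<tau> i} \<longrightarrow> a i x = 0)"
    and h1_b_supp: "\<forall>j\<in>{0..m}. AE x in lebesgue. x \<in> {0..L} - {\<tau> j..\<sigma> (j+1)} \<longrightarrow> b j x = 0"
    and h1_b_last: "AE x in lebesgue. x \<in> {0..L} \<longrightarrow> b (m+1) x = 0"
    and h1_b_nontriv: "\<forall>j\<in>{0..m}. \<tau> j < \<sigma> (j+1) \<longrightarrow> (\<forall>\<epsilon>>0.
          \<not> (AE x in lebesgue. x \<in> {\<tau> j..\<tau> j + \<epsilon>} \<longrightarrow> b j x = 0) \<and>
          \<not> (AE x in lebesgue. x \<in> {\<sigma> (j+1) - \<epsilon>..\<sigma> (j+1)} \<longrightarrow> b j x = 0))"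
    \<comment> \<open>(h2)\<close>
    and h2_g: "\<forall>i\<in>{1..m}. g i 0 = 0 \<and> (\<forall>s>0. g i s > 0)"
    and h2_k: "\<forall>j\<in>{0..m+1}. k j 0 = 0 \<and> (\<forall>s>0. k j s > 0)"
    \<comment> \<open>(h3)\<close>
    and h3_g0: "\<forall>i\<in>{1..m}. Limsup (at_right 0) (\<lambda>s. ereal (g i s / s)) < \<infinity>"
    and h3_ginf: "\<forall>i\<in>{1..m}. Liminf at_top (\<lambda>s. ereal (g i s / s)) > 0"
    and h3_k0: "\<forall>j\<in>{0..m+1}. Limsup (at_right 0) (\<lambda>s. ereal (k j s / s)) < \<infinity>"
    \<comment> \<open>eigenvalue conditions\<close>
    and cond0: "\<forall>i\<in>{1..m}. ereal (alp i) * Limsup (at_right 0) (\<lambda>s. ereal (g i s / s))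
          < ereal (first_eigenvalue 0 L (\<lambda>x. \<Sum>i'=1..m. a i' x) al be ga de)"
    and condinf: "\<forall>i\<in>{1..m}. ereal (alp i) * Liminf at_top (\<lambda>s. ereal (g i s / s))
          > ereal (first_eigenvalue (\<sigma> i) (\<tau> i) (a i)
                     (if i = 1 \<and> \<sigma> 1 = 0 then al else 1) (if i = 1 \<and> \<sigma> 1 = 0 then be else 0)
                     (if i = m \<and> \<tau> m = L then ga else 1) (if i = m \<and> \<tau> m = L then de else 0))"
  shows "\<exists>\<beta>star>0. \<forall>bet :: nat \<Rightarrow> real. (\<forall>j\<in>{0..m+1}. bet j > \<beta>star) \<longrightarrow>
           (\<exists>us :: nat \<Rightarrow> real \<Rightarrow> real.
              (\<forall>n<2^m - 1. SL_positive_solution L al be ga de (f_SL m alp a g bet b k) (us n)) \<and>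
              (\<forall>n<2^m - 1. \<forall>n'<2^m - 1. n \<noteq> n' \<longrightarrow> (\<exists>x\<in>{0..L}. us n x \<noteq> us n' x)))"
proof -
  interpret SL_structure L al be ga de m alp a b \<sigma> \<tau>
    by (unfold_locales; fact)
  have nl: "nonlin g k" using g_cont g_nonneg k_cont k_nonneg h2_g h2_k by (auto simp: nonlin_def)
  define w where "w x = (\<Sum>i'=1..m. a i' x)" for x
  have wa: "w absolutely_integrable_on {0..L}"
    unfolding w_def by (intro absolutely_integrable_sum a_abs) auto
  have wn: "0 \<le> w x" if "x \<in> {0..L}" for x unfolding w_def by (rule sum_nonneg) (use a_nonneg that in auto)
  have m1: "1 \<in> {1..m}" using m_pos by simp
  have wnt: "\<not> negligible {x \<in> {0..L}. w x \<noteq> 0}"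
  proof
    assume "negligible {x \<in> {0..L}. w x \<noteq> 0}"
    moreover have "{x \<in> {\<sigma> 1..\<tau> 1}. a 1 x \<noteq> 0} \<subseteq> {x \<in> {0..L}. w x \<noteq> 0}"
    proof
      fix x assume x: "x \<in> {x \<in> {\<sigma> 1..\<tau> 1}. a 1 x \<noteq> 0}"
      then have xL: "x \<in> {0..L}" using hump_in[OF m1] by auto
      have "a 1 x \<le> w x" unfolding w_def by (rule member_le_sum[OF m1]) (use a_nonneg xL in auto)
      moreover have "0 \<le> a 1 x" using a_nonneg m1 xL by blast
      ultimately show "x \<in> {x \<in> {0..L}. w x \<noteq> 0}" using x xL by auto
    qed
    ultimately show False using a_nontriv[OF m1] negligible_subset by blast
  qed
  define lam0 where "lam0 = first_eigenvalue 0 L w al be ga de"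
  have lam0: "lam0 > 0" unfolding lam0_def
    by (rule principal_eigenvalue_pos[OF L_pos wa wn wnt bc_nonneg bc_nondeg])
  have "\<exists>c d. c < lam0 \<and> 0 < d \<and> (\<forall>s. 0 < s \<and> s < d \<longrightarrow> alp i * g i s \<le> c * s)" if i: "i \<in> {1..m}" for i
  proof -
    have ap: "0 < alp i" using alp_pos i by blast
    have "ereal (alp i) * Limsup (at_right 0) (\<lambda>s. ereal (g i s / s)) < ereal lam0"
      using cond0 i unfolding lam0_def w_def[abs_def] by blast
    then have "Limsup (at_right 0) (\<lambda>s. ereal (g i s / s)) < ereal (lam0 / alp i)"
      using ap by (cases "Limsup (at_right 0) (\<lambda>s. ereal (g i s / s))") (auto simp: field_simps)
    then obtain y where y: "Limsup (at_right 0) (\<lambda>s. ereal (g i s / s)) < ereal y" "ereal y < ereal (lam0 / alp i)"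
      using ereal_dense2 by blast
    obtain d where d: "0 < d" "\<And>s. 0 < s \<Longrightarrow> s < d \<Longrightarrow> g i s \<le> y * s"
      using Limsup_ratio_less[OF y(1)] by blast
    have "alp i * g i s \<le> (alp i * y) * s" if "0 < s" "s < d" for s
      using mult_left_mono[OF d(2)[OF that], of "alp i"] ap by (simp add: mult.assoc)
    moreover have "alp i * y < lam0" using y(2) ap by (simp add: field_simps)
    ultimately show ?thesis using d(1) by blast
  qed
  then obtain cc dd where cd: "\<And>i. i \<in> {1..m} \<Longrightarrow> cc i < lam0" "\<And>i. i \<in> {1..m} \<Longrightarrow> 0 < dd i"
    "\<And>i s. i \<in> {1..m} \<Longrightarrow> 0 < s \<Longrightarrow> s < dd i \<Longrightarrow> alp i * g i s \<le> cc i * s"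
    by metis
  obtain gap where gap: "0 < gap" "\<And>i. i \<in> {1..m} \<Longrightarrow> gap \<le> lam0 - cc i"
    using finite_pos_lower_bound[of "{1..m}" "\<lambda>i. lam0 - cc i"] cd(1) by auto
  obtain dmin where dmin: "0 < dmin" "\<And>i. i \<in> {1..m} \<Longrightarrow> dmin \<le> dd i"
    using finite_pos_lower_bound[of "{1..m}" dd] cd(2) by auto
  \<comment> \<open>One growth bound for all humps, still strictly below \<open>lam0\<close> because
    \<open>gap\<close> is the smallest of finitely many positive distances.\<close>
  define c where "c = max 0 (lam0 - gap)"
  have c: "0 \<le> c" "c < lam0" "\<And>i. i \<in> {1..m} \<Longrightarrow> cc i \<le> c" using lam0 gap by (force simp: c_def)+
  define r where "r = dmin / 2"
  have r: "0 < r" using dmin by (simp add: r_def)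
  have gsmall: "alp i * g i s \<le> c * s" if i: "i \<in> {1..m}" and s: "0 \<le> s" "s \<le> r" for i s
  proof (cases "s = 0")
    case True then show ?thesis using h2_g i by simp
  next
    case False
    then have "alp i * g i s \<le> cc i * s" using cd(3)[OF i, of s] dmin(2)[OF i] s dmin(1) by (simp add: r_def)
    also have "\<dots> \<le> c * s" using c(3)[OF i] s by (intro mult_right_mono) auto
    finally show ?thesis .
  qed
  \<comment> \<open>Above \<open>c\<close>, so that the Wronskian gains on humps, and below
    \<open>lam0\<close>, so that a solution bounded away from zero exists.\<close>
  define lam where "lam = (c + lam0) / 2"
  have lam: "c < lam" "0 \<le> lam" "lam < lam0" using c by (auto simp: lam_def)
  obtain \<phi> \<psi> \<eta> d0 where \<phi>: "\<eta> > 0" "d0 > 0" "traj 0 L (\<lambda>x. lam * w x * \<phi> x) \<phi> \<psi>" "\<phi> 0 = be + \<eta>" "\<psi> 0 = al"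
    "ga * \<phi> L + de * \<psi> L > 0" "\<And>x. x \<in> {0..L} \<Longrightarrow> d0 \<le> \<phi> x"
    using positive_below_principal[OF L_pos wa wn wnt bc_nonneg bc_nondeg lam(2), folded lam0_def] lam(3) by blast
  obtain P where P: "\<And>x. x \<in> {0..L} \<Longrightarrow> \<phi> x \<le> P" "\<And>x. x \<in> {0..L} \<Longrightarrow> \<bar>\<psi> x\<bar> \<le> P"
  proof -
    have "bounded (\<phi> ` {0..L})" "bounded (\<psi> ` {0..L})"
      using traj_cont_u[OF \<phi>(3)] traj_cont_v[OF \<phi>(3)] by (auto intro!: compact_imp_bounded compact_continuous_image)
    then obtain B1 B2 where "\<forall>x\<in>{0..L}. norm (\<phi> x) \<le> B1" "\<forall>x\<in>{0..L}. norm (\<psi> x) \<le> B2"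
      unfolding bounded_iff by auto
    then show ?thesis by (intro that[of "max B1 B2"]) (auto simp: abs_le_iff le_max_iff_disj)
  qed
  have \<phi>': "traj 0 L (\<lambda>x. lam * (\<Sum>i=1..m. a i x) * \<phi> x) \<phi> \<psi>" using \<phi>(3) by (simp add: w_def)
  have \<phi>0: "be * \<psi> 0 \<le> al * \<phi> 0" using \<phi>(1,4,5) bc_nonneg by (simp add: algebra_simps)
  have \<phi>L: "0 < bvalue \<phi> \<psi>" using \<phi>(6) by (simp add: bvalue_def)
  have "\<exists>\<rho> s0. hump_eigenvalue i < \<rho> \<and> 0 \<le> \<rho> \<and> 0 < s0 \<and> (\<forall>s\<ge>s0. \<rho> * s \<le> alp i * g i s)" if i: "i \<in> {1..m}" for i
  proof -
    have ap: "0 < alp i" using alp_pos i by blast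
    have "ereal (hump_eigenvalue i) < ereal (alp i) * Liminf at_top (\<lambda>s. ereal (g i s / s))"
      using condinf i unfolding hump_eigenvalue_def c1_at_def c2_at_def c3_at_def c4_at_def by blast
    then have "ereal (hump_eigenvalue i / alp i) < Liminf at_top (\<lambda>s. ereal (g i s / s))"
      using ap by (cases "Liminf at_top (\<lambda>s. ereal (g i s / s))") (auto simp: field_simps)
    then obtain y where y: "ereal (hump_eigenvalue i / alp i) < ereal y" "ereal y < Liminf at_top (\<lambda>s. ereal (g i s / s))"
      using ereal_dense2 by blast
    obtain s0 where s0: "0 < s0" "\<And>s. s0 \<le> s \<Longrightarrow> y * s \<le> g i s"
      using less_Liminf_ratio[OF y(2)] by blast
    have "max (alp i * y) 0 * s \<le> alp i * g i s" if "s0 \<le> s" for s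
    proof -
      have "(alp i * y) * s \<le> alp i * g i s" using mult_left_mono[OF s0(2)[OF that], of "alp i"] ap by (simp add: mult.assoc)
      moreover have "0 \<le> alp i * g i s" by (rule hump_nonlin(1)[OF nl i]) (use s0 that in auto)
      ultimately show ?thesis by (simp add: max_def)
    qed
    moreover have "hump_eigenvalue i < alp i * y" using y(1) ap by (simp add: field_simps)
    ultimately show ?thesis using s0(1) by (intro exI[of _ "max (alp i * y) 0"] exI[of _ s0]) auto
  qed
  then obtain \<rho> ss where \<rho>: "\<And>i. i \<in> {1..m} \<Longrightarrow> hump_eigenvalue i < \<rho> i" "\<And>i. i \<in> {1..m} \<Longrightarrow> 0 \<le> \<rho> i"
    "\<And>i. i \<in> {1..m} \<Longrightarrow> 0 < ss i" "\<And>i s. i \<in> {1..m} \<Longrightarrow> ss i \<le> s \<Longrightarrow> \<rho> i * s \<le> alp i * g i s"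
    by metis
  obtain s1 where s1: "0 < s1" "\<And>i. i \<in> {1..m} \<Longrightarrow> ss i \<le> s1"
    using finite_upper_bound[of "{1..m}" ss] by auto
  \<comment> \<open>Inf-convolutions keep the superlinear bound only from twice the original
    threshold on; the too-high level is computed for this weaker bound and so holds for them as well
    as for \<open>g\<close>.\<close>
  have s1': "0 < 2 * s1" using s1 by simp
  have "\<exists>R. \<forall>g k bet t u v x. nonlin g k \<longrightarrow> (\<forall>s\<ge>2 * s1. \<rho> i * s \<le> alp i * g i s) \<longrightarrow>
    shot g k bet t u v \<longrightarrow> x \<in> {\<sigma> i..\<tau> i} \<longrightarrow> R < u x \<longrightarrow> bvalue u v < 0 \<and> (i < m \<longrightarrow> u (\<tau> i) < 0)" if i: "i \<in> {1..m}" for i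
  proof -
    obtain R where "\<And>g k bet t u v x. nonlin g k \<Longrightarrow> (\<And>s. 2 * s1 \<le> s \<Longrightarrow> \<rho> i * s \<le> alp i * g i s) \<Longrightarrow>
      shot g k bet t u v \<Longrightarrow> x \<in> {\<sigma> i..\<tau> i} \<Longrightarrow> R < u x \<Longrightarrow> bvalue u v < 0 \<and> (i < m \<longrightarrow> u (\<tau> i) < 0)"
      using hump_too_high[OF i \<rho>(1)[OF i] s1'] by blast
    then show ?thesis by (intro exI[of _ R]) blast
  qed
  then obtain RR where RR: "\<And>i. i \<in> {1..m} \<Longrightarrow> \<forall>g k bet t u v x. nonlin g k \<longrightarrow> (\<forall>s\<ge>2 * s1. \<rho> i * s \<le> alp i * g i s) \<longrightarrow>
    shot g k bet t u v \<longrightarrow> x \<in> {\<sigma> i..\<tau> i} \<longrightarrow> RR i < u x \<longrightarrow> bvalue u v < 0 \<and> (i < m \<longrightarrow> u (\<tau> i) < 0)"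
    by metis
  obtain R0 where R0: "0 < R0" "\<And>i. i \<in> {1..m} \<Longrightarrow> RR i \<le> R0"
    using finite_upper_bound[of "{1..m}" RR] by auto
  define R where "R = max R0 (r + 1)"
  have R: "r < R" "0 < R" "\<And>i. i \<in> {1..m} \<Longrightarrow> RR i \<le> R" using R0 r by (force simp: R_def)+
  have high: "bvalue u v < 0 \<and> (i < m \<longrightarrow> u (\<tau> i) < 0)"
    if "i \<in> {1..m}" "nonlin g k" "\<And>s. 2 * s1 \<le> s \<Longrightarrow> \<rho> i * s \<le> alp i * g i s" "shot g k bet t u v" "x \<in> {\<sigma> i..\<tau> i}" "R < u x"
    for i g k bet t u v x
  proof -
    have "RR i < u x" using that(6) R(3)[OF that(1)] by simp
    then show ?thesis using RR[OF that(1)] that(2-5) by blast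
  qed
  have knn: "\<And>s. 0 \<le> s \<Longrightarrow> 0 \<le> k j s" and kc: "continuous_on {0..} (k j)" and kp: "\<And>s. 0 < s \<Longrightarrow> 0 < k j s"
    and k0: "k j 0 = 0" if "j \<in> {0..m+1}" for j
    using that k_nonneg k_cont h2_k by auto
  have gnn: "\<And>s. 0 \<le> s \<Longrightarrow> 0 \<le> g i s" and gc: "continuous_on {0..} (g i)"
    and g0: "g i 0 = 0" if "i \<in> {1..m}" for i
    using that g_nonneg g_cont h2_g by auto
  \<comment> \<open>Lies below \<open>k\<close> and below every approximation of index at least 1,
    yet is positive for positive arguments. The gap thresholds depend on this minorant alone, so the
    final threshold can be chosen before the approximation index.\<close>
  define kk where "kk j = inf_conv (k j) 1" for j
  have lipc: "continuous_on S h" if "\<And>s s'. \<bar>h s - h s'\<bar> \<le> real n * \<bar>s - s'\<bar>" for h :: "real \<Rightarrow> real" and n :: nat and S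
  proof -
    have "(real n)-lipschitz_on S h" by (rule lipschitz_onI) (use that in \<open>auto simp: dist_real_def\<close>)
    then show ?thesis by (rule lipschitz_on_continuous_on)
  qed
  have kkc: "continuous_on {0..} (kk j)" if "j \<in> {1..<m}" for j
    unfolding kk_def by (rule lipc[of _ 1], rule inf_conv_lip) (use knn[of j] that in auto)
  have kkp: "0 < kk j s" if "j \<in> {1..<m}" "0 < s" for j s
    unfolding kk_def by (rule inf_conv_pos) (use knn[of j] kc[of j] kp[of j] that in auto)
  define lowB where "lowB i B \<longleftrightarrow> (\<forall>g k bet t u v \<xi>. nonlin g k \<longrightarrow> (\<forall>s. 0 \<le> s \<longrightarrow> s \<le> r \<longrightarrow> alp i * g i s \<le> c * s) \<longrightarrow>
    (\<forall>j\<in>{1..<m}. \<forall>s\<ge>0. kk j s \<le> k j s) \<longrightarrow> (\<forall>j\<le>m. 0 \<le> bet j) \<longrightarrow>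
    (\<forall>j\<in>{1..<m}. B \<le> bet j) \<longrightarrow> shot g k bet t u v \<longrightarrow>
    (\<forall>x\<in>{\<sigma> i..\<tau> i}. u x \<le> r) \<longrightarrow> \<xi> \<in> {\<sigma> i..\<tau> i} \<longrightarrow> u \<xi> = r \<longrightarrow> (1 < i \<longrightarrow> u (\<tau> (i - 1)) \<le> R) \<longrightarrow>
    (i < m \<longrightarrow> R < u (\<sigma> (Suc i))) \<and> (i = m \<longrightarrow> 0 < bvalue u v))" for i B
  have "\<exists>B. lowB i B" if i: "i \<in> {1..m}" for i
  proof -
    obtain B where "\<And>g k bet t u v \<xi>. nonlin g k \<Longrightarrow> (\<And>s. 0 \<le> s \<Longrightarrow> s \<le> r \<Longrightarrow> alp i * g i s \<le> c * s) \<Longrightarrow>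
      (\<And>j s. j \<in> {1..<m} \<Longrightarrow> 0 \<le> s \<Longrightarrow> kk j s \<le> k j s) \<Longrightarrow> (\<And>j. j \<le> m \<Longrightarrow> 0 \<le> bet j) \<Longrightarrow>
      (\<And>j. j \<in> {1..<m} \<Longrightarrow> B \<le> bet j) \<Longrightarrow> shot g k bet t u v \<Longrightarrow>
      (\<And>x. x \<in> {\<sigma> i..\<tau> i} \<Longrightarrow> u x \<le> r) \<Longrightarrow> \<xi> \<in> {\<sigma> i..\<tau> i} \<Longrightarrow> u \<xi> = r \<Longrightarrow> (1 < i \<Longrightarrow> u (\<tau> (i - 1)) \<le> R) \<Longrightarrow>
      (i < m \<longrightarrow> R < u (\<sigma> (Suc i))) \<and> (i = m \<longrightarrow> 0 < bvalue u v)"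
      by (rule small_hump_grows[OF \<phi>' \<phi>0 \<phi>L \<phi>(2,7) P c(1) lam(1) r i less_imp_le[OF R(1)] kkc kkp]) (assumption+, rule that, blast)
    then have "lowB i B" unfolding lowB_def by (intro allI impI) blast
    then show ?thesis by blast
  qed
  then obtain BB where BB: "\<And>i. i \<in> {1..m} \<Longrightarrow> lowB i (BB i)" by metis
  obtain \<beta>star where \<beta>star: "0 < \<beta>star" "\<And>i. i \<in> {1..m} \<Longrightarrow> BB i \<le> \<beta>star"
    using finite_upper_bound[of "{1..m}" BB] by auto
  show ?thesis
  proof (intro exI[of _ \<beta>star] conjI \<beta>star(1) allI impI)
    fix bet :: "nat \<Rightarrow> real" assume bet: "\<forall>j\<in>{0..m+1}. bet j > \<beta>star"
    have bet0: "0 \<le> bet j" if "j \<le> m" for j using bet[rule_format, of j] \<beta>star(1) that by simp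
    have low: "(i < m \<longrightarrow> R < u (\<sigma> (Suc i))) \<and> (i = m \<longrightarrow> 0 < bvalue u v)"
      if i: "i \<in> {1..m}" and h: "nonlin g k" "\<And>s. 0 \<le> s \<Longrightarrow> s \<le> r \<Longrightarrow> alp i * g i s \<le> c * s"
        "\<And>j s. j \<in> {1..<m} \<Longrightarrow> 0 \<le> s \<Longrightarrow> kk j s \<le> k j s" "shot g k bet t u v"
        "\<And>x. x \<in> {\<sigma> i..\<tau> i} \<Longrightarrow> u x \<le> r" "\<xi> \<in> {\<sigma> i..\<tau> i}" "u \<xi> = r" "1 < i \<Longrightarrow> u (\<tau> (i - 1)) \<le> R"
      for i g k t u v \<xi>
    proof -
      have B: "\<forall>j\<in>{1..<m}. BB i \<le> bet j"
      proof
        fix j assume "j \<in> {1..<m}"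
        then have "\<beta>star < bet j" using bet by auto
        then show "BB i \<le> bet j" using \<beta>star(2)[OF i] by simp
      qed
      have q: "\<forall>s. 0 \<le> s \<longrightarrow> s \<le> r \<longrightarrow> alp i * g i s \<le> c * s" "\<forall>j\<in>{1..<m}. \<forall>s\<ge>0. kk j s \<le> k j s"
        "\<forall>j\<le>m. 0 \<le> bet j" "\<forall>x\<in>{\<sigma> i..\<tau> i}. u x \<le> r" "1 < i \<longrightarrow> u (\<tau> (i - 1)) \<le> R"
        using h(2,3,5,8) bet0 by blast+
      show ?thesis
        using BB[OF i, unfolded lowB_def, THEN spec, of g, THEN spec, of k, THEN spec, of bet, THEN spec, of t,
            THEN spec, of u, THEN spec, of v, THEN spec, of \<xi>, THEN mp, OF h(1), THEN mp, OF q(1), THEN mp, OF q(2),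
            THEN mp, OF q(3), THEN mp, OF B, THEN mp, OF h(4), THEN mp, OF q(4), THEN mp, OF h(6), THEN mp, OF h(7),
            THEN mp, OF q(5)] .
    qed
    \<comment> \<open>Only weak inequalities, since these survive the uniform limit. Distinctness of
      the patterns is recovered afterwards from the impossibility of a maximum exactly
      \<open>r\<close>.\<close>
    define good where "good S t u v \<longleftrightarrow> shot g k bet t u v \<and> bvalue u v = 0 \<and>
      (\<forall>i\<in>{1..m}. i \<in> S \<longrightarrow> (\<exists>x\<in>{\<sigma> i..\<tau> i}. r \<le> u x)) \<and> (\<forall>i\<in>{1..m}. i \<notin> S \<longrightarrow> (\<forall>x\<in>{\<sigma> i..\<tau> i}. u x \<le> r)) \<and>
      (\<forall>i\<in>{1..m}. \<forall>x\<in>{\<sigma> i..\<tau> i}. u x \<le> R)" for S t u v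
    \<comment> \<open>The index shift makes all approximations lie above \<open>kk\<close> and
      inherit the superlinear bounds from the first one on.\<close>
    obtain n0 :: nat where n0: "1 \<le> n0" "\<And>i. i \<in> {1..m} \<Longrightarrow> 2 * (\<rho> i / alp i) \<le> real n0"
    proof -
      obtain B where B: "0 < B" "\<And>i. i \<in> {1..m} \<Longrightarrow> 2 * (\<rho> i / alp i) \<le> B"
        using finite_upper_bound[of "{1..m}" "\<lambda>i. 2 * (\<rho> i / alp i)"] by auto
      obtain n :: nat where n: "B \<le> real n" using real_arch_simple by blast
      then have "1 \<le> n" using B(1) by (cases n) auto
      then show ?thesis using that[of n] B(2) n by force
    qed
    define gn where "gn n i = inf_conv (g i) (n + n0)" for n i
    define kn where "kn n j = inf_conv (k j) (n + n0)" for n j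
    have nln: "nonlin (gn n) (kn n)" for n
      unfolding nonlin_def
    proof (intro conjI ballI allI impI)
      fix i assume i: "i \<in> {1..m}"
      show "continuous_on {0..} (gn n i)" unfolding gn_def by (rule lipc, rule inf_conv_lip[OF gnn[OF i]])
      show nn: "0 \<le> gn n i s" for s unfolding gn_def by (rule inf_conv_nonneg[OF gnn[OF i]])
      show "gn n i 0 = 0"
        using nn[of 0] inf_conv_le_self[where g = "g i" and s = 0 and n = "n + n0", OF gnn[OF i]] g0[OF i] by (simp add: gn_def)
    next
      fix j assume j: "j \<in> {0..m+1}"
      show "continuous_on {0..} (kn n j)" unfolding kn_def by (rule lipc, rule inf_conv_lip[OF knn[OF j]])
      show nn: "0 \<le> kn n j s" for s unfolding kn_def by (rule inf_conv_nonneg[OF knn[OF j]])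
      show "kn n j 0 = 0"
        using nn[of 0] inf_conv_le_self[where g = "k j" and s = 0 and n = "n + n0", OF knn[OF j]] k0[OF j] by (simp add: kn_def)
    qed
    have gle: "gn n i s \<le> g i s" if "i \<in> {1..m}" "0 \<le> s" for n i s
      unfolding gn_def by (rule inf_conv_le_self[OF gnn[OF that(1)] that(2)])
    have kle: "kn n j s \<le> k j s" if "j \<in> {0..m+1}" "0 \<le> s" for n j s
      unfolding kn_def by (rule inf_conv_le_self[OF knn[OF that(1)] that(2)])
    have kkn: "kk j s \<le> kn n j s" if "j \<in> {1..<m}" for n j s
      unfolding kk_def kn_def by (rule inf_conv_mono) (use knn[of j] that n0 in auto)
    have kk1: "kk j s \<le> k j s" if "j \<in> {1..<m}" "0 \<le> s" for j s
      unfolding kk_def by (rule inf_conv_le_self) (use knn[of j] that in auto)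
    have gsn: "alp i * gn n i s \<le> c * s" if "i \<in> {1..m}" "0 \<le> s" "s \<le> r" for n i s
    proof -
      have "alp i * gn n i s \<le> alp i * g i s" using gle[OF that(1,2)] alp_pos that(1) by (intro mult_left_mono) (auto intro: less_imp_le)
      then show ?thesis using gsmall[OF that] by simp
    qed
    have gln: "\<rho> i * s \<le> alp i * gn n i s" if i: "i \<in> {1..m}" and s: "2 * s1 \<le> s" for n i s
    proof -
      have ap: "0 < alp i" using alp_pos i by blast
      have "\<rho> i / alp i * s \<le> gn n i s" unfolding gn_def
      proof (rule inf_conv_superlinear[OF gnn[OF i] _ s s1(1)])
        show "\<rho> i / alp i * s \<le> g i s" if "s1 \<le> s" for s
          using \<rho>(4)[OF i, of s] s1(2)[OF i] that ap by (simp add: field_simps)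
        show "2 * (\<rho> i / alp i) \<le> real (n + n0)" using n0(2)[OF i] by simp
        show "0 \<le> \<rho> i / alp i" using \<rho>(2)[OF i] ap by simp
      qed
      then show ?thesis using ap by (simp add: field_simps)
    qed
    have gl: "\<rho> i * s \<le> alp i * g i s" if "i \<in> {1..m}" "2 * s1 \<le> s" for i s
      by (rule \<rho>(4)[OF that(1)]) (use s1 that in force)
    have ex: "\<exists>t u v. good S t u v" if S: "S \<subseteq> {1..m}" "S \<noteq> {}" for S
    proof -
      have "\<exists>t u v. shot (gn n) (kn n) bet t u v \<and> bvalue u v = 0 \<and>
        (\<forall>i\<in>{1..m}. i \<in> S \<longrightarrow> (\<exists>x\<in>{\<sigma> i..\<tau> i}. r \<le> u x)) \<and> (\<forall>i\<in>{1..m}. i \<notin> S \<longrightarrow> (\<forall>x\<in>{\<sigma> i..\<tau> i}. u x \<le> r)) \<and>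
        (\<forall>i\<in>{1..m}. \<forall>x\<in>{\<sigma> i..\<tau> i}. u x \<le> R)" for n
      proof -
        have K0: "0 \<le> real (n + n0)" by simp
        have lg: "\<bar>gn n i s - gn n i s'\<bar> \<le> real (n + n0) * \<bar>s - s'\<bar>" if "i \<in> {1..m}" for i s s'
          unfolding gn_def by (rule inf_conv_lip[OF gnn[OF that]])
        have lk: "\<bar>kn n j s - kn n j s'\<bar> \<le> real (n + n0) * \<bar>s - s'\<bar>" if "j \<in> {0..m+1}" for j s s'
          unfolding kn_def by (rule inf_conv_lip[OF knn[OF that]])
        have hi: "bvalue u v < 0 \<and> (i < m \<longrightarrow> u (\<tau> i) < 0)"
          if "i \<in> {1..m}" "shot (gn n) (kn n) bet t u v" "x \<in> {\<sigma> i..\<tau> i}" "R < u x" for t u v i x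
          by (rule high[OF that(1) nln gln[OF that(1)] that(2-4)])
        have lo: "(i < m \<longrightarrow> R < u (\<sigma> (Suc i))) \<and> (i = m \<longrightarrow> 0 < bvalue u v)"
          if "i \<in> {1..m}" "shot (gn n) (kn n) bet t u v" "\<And>x. x \<in> {\<sigma> i..\<tau> i} \<Longrightarrow> u x \<le> r" "\<xi> \<in> {\<sigma> i..\<tau> i}" "u \<xi> = r"
            "1 < i \<Longrightarrow> u (\<tau> (i - 1)) \<le> R" for t u v i \<xi>
          by (rule low[OF that(1) nln gsn[OF that(1)] kkn that(2-6)])
        obtain t u v where "shot (gn n) (kn n) bet t u v" "bvalue u v = 0"
          "\<And>i. i \<in> {1..m} \<Longrightarrow> i \<in> S \<Longrightarrow> \<exists>x\<in>{\<sigma> i..\<tau> i}. r \<le> u x"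
          "\<And>i x. i \<in> {1..m} \<Longrightarrow> i \<notin> S \<Longrightarrow> x \<in> {\<sigma> i..\<tau> i} \<Longrightarrow> u x \<le> r"
          "\<And>i x. i \<in> {1..m} \<Longrightarrow> x \<in> {\<sigma> i..\<tau> i} \<Longrightarrow> u x \<le> R"
        proof -
          show ?thesis
            by (rule shooting_solutions[where g = "gn n" and k = "kn n" and bet = bet and r = r and R = R and S = S,
                  OF nln[of n] K0]) (fact lg lk r R(1) bet0[OF le0] hi lo S that)+
        qed
        then show ?thesis by (intro exI[of _ t] exI[of _ u] exI[of _ v]) blast
      qed
      then obtain tn un vn where A: "\<And>n. shot (gn n) (kn n) bet (tn n) (un n) (vn n)" "\<And>n. bvalue (un n) (vn n) = 0"
        "\<And>n. \<forall>i\<in>{1..m}. i \<in> S \<longrightarrow> (\<exists>x\<in>{\<sigma> i..\<tau> i}. r \<le> un n x)"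
        "\<And>n. \<forall>i\<in>{1..m}. i \<notin> S \<longrightarrow> (\<forall>x\<in>{\<sigma> i..\<tau> i}. un n x \<le> r)"
        "\<And>n. \<forall>i\<in>{1..m}. \<forall>x\<in>{\<sigma> i..\<tau> i}. un n x \<le> R"
        by metis
      have cg: "\<exists>N. \<forall>n\<ge>N. \<forall>s\<in>{0..R}. \<bar>gn n i s - g i s\<bar> \<le> e" if i: "i \<in> {1..m}" and e: "0 < e" for i e
      proof -
        obtain N where "\<And>n s. N \<le> n \<Longrightarrow> s \<in> {0..R} \<Longrightarrow> \<bar>inf_conv (g i) n s - g i s\<bar> \<le> e"
          using inf_conv_converges[OF gnn[OF i] gc[OF i] e less_imp_le[OF R(2)]] by blast
        then show ?thesis unfolding gn_def by (intro exI[of _ N]) auto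
      qed
      have ck: "\<exists>N. \<forall>n\<ge>N. \<forall>s\<in>{0..R}. \<bar>kn n j s - k j s\<bar> \<le> e" if j: "j \<in> {0..m+1}" and e: "0 < e" for j e
      proof -
        obtain N where "\<And>n s. N \<le> n \<Longrightarrow> s \<in> {0..R} \<Longrightarrow> \<bar>inf_conv (k j) n s - k j s\<bar> \<le> e"
          using inf_conv_converges[OF knn[OF j] kc[OF j] e less_imp_le[OF R(2)]] by blast
        then show ?thesis unfolding kn_def by (intro exI[of _ N]) auto
      qed
      have uR: "un n x \<le> R" if "i \<in> {1..m}" "x \<in> {\<sigma> i..\<tau> i}" for n i x using A(5) that by blast
      obtain ks t u v where lim: "strict_mono (ks :: nat \<Rightarrow> nat)" "shot g k bet t u v" "bvalue u v = 0"
        "\<And>e. 0 < e \<Longrightarrow> \<exists>N. \<forall>n\<ge>N. \<forall>x\<in>{0..L}. \<bar>un (ks n) x - u x\<bar> < e"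
        by (rule shots_limit[OF nl nln gle kle cg ck bet0 less_imp_le[OF R(2)] A(1,2) uR]) (assumption+, rule that, blast+)
      have le: "u x \<le> B" if x: "x \<in> {0..L}" and B: "\<And>n. un n x \<le> B" for x B
      proof (rule field_le_epsilon)
        fix e :: real assume "0 < e"
        then obtain N where "\<forall>n\<ge>N. \<forall>x\<in>{0..L}. \<bar>un (ks n) x - u x\<bar> < e" using lim(4) by blast
        then have "\<bar>un (ks N) x - u x\<bar> < e" using x by blast
        then show "u x \<le> B + e" using B[of "ks N"] by linarith
      qed
      have "good S t u v"
        unfolding good_def
      proof (intro conjI lim(2,3) ballI impI)
        fix i assume i: "i \<in> {1..m}" "i \<in> S"
        have IL: "{\<sigma> i..\<tau> i} \<subseteq> {0..L}" using hump_in[OF i(1)] by auto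
        have "traj 0 L (\<lambda>x. nl g k bet x (u x)) u v" using lim(2) by (simp add: shot_def)
        then have "continuous_on {\<sigma> i..\<tau> i} u" by (rule continuous_on_subset[OF traj_cont_u IL])
        then obtain \<xi> where \<xi>: "\<xi> \<in> {\<sigma> i..\<tau> i}" "\<And>x. x \<in> {\<sigma> i..\<tau> i} \<Longrightarrow> u x \<le> u \<xi>"
          using Sup_image_Icc[OF _ less_imp_le[OF hump_less[OF i(1)]]] by metis
        \<comment> \<open>The points where the approximations reach \<open>r\<close> may move with
          the index; comparing with the maximum of the limit avoids extracting a convergent
          subsequence of them.\<close>
        have "r \<le> u \<xi>"
        proof (rule ccontr)
          assume "\<not> r \<le> u \<xi>"
          then have "0 < r - u \<xi>" by simp
          then obtain N where "\<forall>n\<ge>N. \<forall>x\<in>{0..L}. \<bar>un (ks n) x - u x\<bar> < r - u \<xi>" using lim(4) by blast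
          moreover obtain x where x: "x \<in> {\<sigma> i..\<tau> i}" "r \<le> un (ks N) x" using A(3) i by blast
          ultimately have "\<bar>un (ks N) x - u x\<bar> < r - u \<xi>" using IL by blast
          then show False using x(2) \<xi>(2)[OF x(1)] by linarith
        qed
        then show "\<exists>x\<in>{\<sigma> i..\<tau> i}. r \<le> u x" using \<xi>(1) by blast
      next
        fix i x assume i: "i \<in> {1..m}" "i \<notin> S" "x \<in> {\<sigma> i..\<tau> i}"
        show "u x \<le> r" by (rule le) (use i hump_in[OF i(1)] A(4) in auto)
      next
        fix i x assume i: "i \<in> {1..m}" "x \<in> {\<sigma> i..\<tau> i}"
        show "u x \<le> R" by (rule le) (use i hump_in[OF i(1)] A(5) in auto)
      qed
      then show ?thesis by blast
    qed
    obtain Kg where Kg: "\<And>i s. i \<in> {1..m} \<Longrightarrow> 0 \<le> s \<Longrightarrow> s \<le> R \<Longrightarrow> g i s \<le> Kg i * s"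
    proof -
      have "\<forall>i\<in>{1..m}. \<exists>K. \<forall>s. 0 \<le> s \<longrightarrow> s \<le> R \<longrightarrow> g i s \<le> K * s"
      proof
        fix i assume i: "i \<in> {1..m}"
        obtain K where "\<And>s. 0 \<le> s \<Longrightarrow> s \<le> R \<Longrightarrow> g i s \<le> K * s"
          using linear_growth_on_bounded[OF gc[OF i] g0[OF i]] h3_g0 i by blast
        then show "\<exists>K. \<forall>s. 0 \<le> s \<longrightarrow> s \<le> R \<longrightarrow> g i s \<le> K * s" by blast
      qed
      then show ?thesis using that by metis
    qed
    obtain Kk where Kk: "\<And>j s. j \<in> {0..m+1} \<Longrightarrow> 0 \<le> s \<Longrightarrow> s \<le> R \<Longrightarrow> k j s \<le> Kk j * s"
    proof -
      have "\<forall>j\<in>{0..m+1}. \<exists>K. \<forall>s. 0 \<le> s \<longrightarrow> s \<le> R \<longrightarrow> k j s \<le> K * s"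
      proof
        fix j assume j: "j \<in> {0..m+1}"
        obtain K where "\<And>s. 0 \<le> s \<Longrightarrow> s \<le> R \<Longrightarrow> k j s \<le> K * s"
          using linear_growth_on_bounded[OF kc[OF j] k0[OF j]] h3_k0 j by blast
        then show "\<exists>K. \<forall>s. 0 \<le> s \<longrightarrow> s \<le> R \<longrightarrow> k j s \<le> K * s" by blast
      qed
      then show ?thesis using that by metis
    qed
    obtain K1 where K1: "0 < K1" "\<And>i. i \<in> {1..m} \<Longrightarrow> Kg i \<le> K1" using finite_upper_bound[of "{1..m}" Kg] by auto
    obtain K2 where K2: "0 < K2" "\<And>j. j \<in> {0..m+1} \<Longrightarrow> Kk j \<le> K2" using finite_upper_bound[of "{0..m+1}" Kk] by auto
    define K where "K = max K1 K2"
    have K: "0 \<le> K" "\<And>i s. i \<in> {1..m} \<Longrightarrow> 0 \<le> s \<Longrightarrow> s \<le> R \<Longrightarrow> g i s \<le> K * s"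
      "\<And>j s. j \<in> {0..m+1} \<Longrightarrow> 0 \<le> s \<Longrightarrow> s \<le> R \<Longrightarrow> k j s \<le> K * s"
    proof -
      show "0 \<le> K" using K1 by (simp add: K_def)
      show "g i s \<le> K * s" if "i \<in> {1..m}" "0 \<le> s" "s \<le> R" for i s
      proof -
        have "Kg i * s \<le> K * s" using K1(2)[OF that(1)] that(2) by (intro mult_right_mono) (auto simp: K_def)
        then show ?thesis using Kg[OF that] by simp
      qed
      show "k j s \<le> K * s" if "j \<in> {0..m+1}" "0 \<le> s" "s \<le> R" for j s
      proof -
        have "Kk j * s \<le> K * s" using K2(2)[OF that(1)] that(2) by (intro mult_right_mono) (auto simp: K_def)
        then show ?thesis using Kk[OF that] by simp
      qed
    qed
    have sol: "SL_positive_solution L al be ga de (f_SL m alp a g bet b k) u"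
      if gd: "good S t u v" and S: "S \<subseteq> {1..m}" "S \<noteq> {}" for S t u v
    proof -
      have s: "shot g k bet t u v" "bvalue u v = 0" using gd by (auto simp: good_def)
      obtain i where i: "i \<in> S" "i \<in> {1..m}" using S by blast
      then obtain \<xi> where \<xi>: "\<xi> \<in> {\<sigma> i..\<tau> i}" "r \<le> u \<xi>" using gd unfolding good_def by blast
      have \<xi>': "\<xi> \<in> {0..L}" "u \<xi> \<noteq> 0" using \<xi> hump_in[OF i(2)] r by auto
      have uR: "u x \<le> R" if "i \<in> {1..m}" "x \<in> {\<sigma> i..\<tau> i}" for i x using gd that by (auto simp: good_def)
      have "0 < u x" if "0 < x" "x < L" for x
        by (rule solution_positive[OF s(1) nl s(2) bet0 uR K \<xi>' that])
      then show ?thesis using shot_SL_solution[OF s(1) nl s(2)] by (auto simp: SL_positive_solution_def)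
    qed
    \<comment> \<open>A function good for both patterns would have maximum exactly \<open>r\<close>
      on hump \<open>i\<close>. Then \<open>low\<close>, applied to the limit problem itself, gives
      a value above \<open>R\<close> on the next hump or a positive boundary value, and both are
      excluded for good functions.\<close>
    have distinct: "\<exists>x\<in>{0..L}. u x \<noteq> u' x"
      if gd: "good S t u v" "good S' t' u' v'" and i: "i \<in> {1..m}" "i \<in> S" "i \<notin> S'" for S S' t t' u u' v v' i
    proof (rule ccontr)
      assume "\<not> ?thesis"
      then have eq: "\<And>x. x \<in> {0..L} \<Longrightarrow> u x = u' x" by blast
      have s: "shot g k bet t' u' v'" "bvalue u' v' = 0" using gd by (auto simp: good_def)
      obtain \<xi> where \<xi>: "\<xi> \<in> {\<sigma> i..\<tau> i}" "r \<le> u \<xi>" using gd(1) i unfolding good_def by blast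
      have ur: "u' x \<le> r" if "x \<in> {\<sigma> i..\<tau> i}" for x using gd(2) i that unfolding good_def by blast
      have "u' \<xi> = r" using eq[of \<xi>] \<xi> ur[OF \<xi>(1)] hump_in[OF i(1)] by auto
      have uR: "u' x \<le> R" if "l \<in> {1..m}" "x \<in> {\<sigma> l..\<tau> l}" for l x using gd(2) that unfolding good_def by blast
      have "u' (\<tau> (i - 1)) \<le> R" if "1 < i"
      proof (rule uR)
        show "i - 1 \<in> {1..m}" using that i by auto
        then show "\<tau> (i - 1) \<in> {\<sigma> (i - 1)..\<tau> (i - 1)}" using hump_less by fastforce
      qed
      then have *: "(i < m \<longrightarrow> R < u' (\<sigma> (Suc i))) \<and> (i = m \<longrightarrow> 0 < bvalue u' v')"
        by (intro low[OF i(1) nl gsmall[OF i(1)] kk1 s(1) ur \<xi>(1) \<open>u' \<xi> = r\<close>])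
      show False
      proof (cases "i < m")
        case True
        have "u' (\<sigma> (Suc i)) \<le> R" by (rule uR[of "Suc i"]) (use True hump_less[of "Suc i"] in auto)
        then show False using * True by simp
      next
        case False
        then show False using * s(2) i by simp
      qed
    qed
    define FS where "FS = {S. S \<subseteq> {1..m} \<and> S \<noteq> {}}"
    have FS: "finite FS" "card FS = 2 ^ m - 1"
    proof -
      have e: "FS = Pow {1..m} - {{}}" by (auto simp: FS_def)
      show "finite FS" unfolding e by simp
      show "card FS = 2 ^ m - 1" unfolding e by (subst card_Diff_singleton) (auto simp: card_Pow)
    qed
    obtain h :: "nat \<Rightarrow> nat set" where h: "bij_betw h {0..<2 ^ m - 1} FS"
      using ex_bij_betw_nat_finite[OF FS(1)] unfolding FS(2) by blast
    have "\<forall>S\<in>FS. \<exists>u. \<exists>t v. good S t u v"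
    proof
      fix S assume "S \<in> FS"
      then have "S \<subseteq> {1..m}" "S \<noteq> {}" by (auto simp: FS_def)
      then show "\<exists>u. \<exists>t v. good S t u v" using ex by blast
    qed
    then obtain sel where sel: "\<And>S. S \<in> FS \<Longrightarrow> \<exists>t v. good S t (sel S) v" by metis
    have hF: "h n \<in> FS" if "n < 2 ^ m - 1" for n using bij_betwE[OF h] that by auto
    show "\<exists>us :: nat \<Rightarrow> real \<Rightarrow> real. (\<forall>n<2 ^ m - 1. SL_positive_solution L al be ga de (f_SL m alp a g bet b k) (us n)) \<and>
       (\<forall>n<2 ^ m - 1. \<forall>n'<2 ^ m - 1. n \<noteq> n' \<longrightarrow> (\<exists>x\<in>{0..L}. us n x \<noteq> us n' x))"
    proof (intro exI[of _ "\<lambda>n. sel (h n)"] conjI allI impI)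
      fix n :: nat assume n: "n < 2 ^ m - 1"
      obtain t v where "good (h n) t (sel (h n)) v" using sel[OF hF[OF n]] by blast
      then show "SL_positive_solution L al be ga de (f_SL m alp a g bet b k) (sel (h n))"
        by (rule sol) (use hF[OF n] in \<open>auto simp: FS_def\<close>)
    next
      fix n n' :: nat assume n: "n < 2 ^ m - 1" "n' < 2 ^ m - 1" "n \<noteq> n'"
      have "h n \<noteq> h n'" using h n by (auto simp: bij_betw_def inj_on_def)
      moreover obtain t v where g1: "good (h n) t (sel (h n)) v" using sel[OF hF[OF n(1)]] by blast
      moreover obtain t' v' where g2: "good (h n') t' (sel (h n')) v'" using sel[OF hF[OF n(2)]] by blast
      moreover have "h n \<subseteq> {1..m}" "h n' \<subseteq> {1..m}" using hF n by (auto simp: FS_def)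
      ultimately consider i where "i \<in> {1..m}" "i \<in> h n" "i \<notin> h n'" | i where "i \<in> {1..m}" "i \<in> h n'" "i \<notin> h n"
        by blast
      then show "\<exists>x\<in>{0..L}. sel (h n) x \<noteq> sel (h n') x"
      proof cases
        case 1 then show ?thesis using distinct[OF g1 g2] by blast
      next
        case 2 then show ?thesis using distinct[OF g2 g1] by metis
      qed
    qed
  qed
qed

end
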